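(* Suppose $s>5/2$. Then for any $(u_0,\rho_0)\in H^s(S^1)\times H^{s-1}(S^1)$ there exists an open interval $J$ centered at $0$ and a unique solution $$(u,\rho)\in C\bigl(J,H^s(S^1)\times H^{s-1}(S^1)\bigr)\cap C^1\bigl(J,H^{s-1}(S^1)\times H^{s-2}(S^1)\bigr)$$ of the Cauchy problem $$u_t+uu_x=-A^{-1}\Bigl(\bigl(\tfrac32u^2-\rho^2\bigr)_x+\rho u_x\Bigr),\qquad \rho_t+u\rho_x=-2\rho u_x,\qquad (u(0),\rho(0))=(u_0,\rho_0),$$ which depends continuously on the initial data $(u_0,\rho_0)$.
   Context: $S^1\simeq\mathbb{R}/\mathbb{Z}$; $H^r(S^1)$ is the $L^2$-based Sobolev space of real-valued functions on $S^1$; $A=1-\partial_x^2$, an isomorphism $H^r(S^1)\to H^{r-2}(S^1)$. The Cauchy problem is the weak form of the two-component Degasperis--Procesi equation $m_t=-3mu_x-m_xu-\rho u_x+2\rho\rho_x$, $\rho_t=-2\rho u_x-\rho_xu$, $m=u-u_{xx}$. *)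

theory Defs
  imports "HOL-Analysis.Analysis"
begin

section \<open>Functions on the circle\<close>

definition periodic1 :: "(real \<Rightarrow> 'a) \<Rightarrow> bool" where
  "periodic1 f \<longleftrightarrow> (\<forall>x. f (x + 1) = f x)"

definition circle_eq :: "(real \<Rightarrow> real) \<Rightarrow> (real \<Rightarrow> real) \<Rightarrow> bool" where
  "circle_eq f g \<longleftrightarrow> f \<in> borel_measurable borel \<and> g \<in> borel_measurable borel \<and>
     periodic1 f \<and> periodic1 g \<and> (AE x in lborel. f x = g x)"

text \<open>Real-valued measurable functions on \<open>S\<^sup>1 = \<real>/\<int>\<close> modulo equality almost everywhere,
  represented by 1-periodic functions on the line.\<close>

quotient_type circle_fun = "real \<Rightarrow> real" / partial: circle_eq
proof (rule part_equivpI)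
  show "\<exists>f. circle_eq f f"
    by (rule exI[of _ "\<lambda>_. 0"]) (simp add: circle_eq_def periodic1_def)
  show "symp circle_eq"
    by (auto intro!: sympI simp: circle_eq_def)
  show "transp circle_eq"
    by (auto intro!: transpI simp: circle_eq_def)
qed

instantiation circle_fun :: comm_ring_1
begin

lift_definition zero_circle_fun :: circle_fun is "\<lambda>_. 0"
  by (simp add: circle_eq_def periodic1_def)
lift_definition one_circle_fun :: circle_fun is "\<lambda>_. 1"
  by (simp add: circle_eq_def periodic1_def)
lift_definition uminus_circle_fun :: "circle_fun \<Rightarrow> circle_fun" is "\<lambda>f x. - f x"
  by (auto simp: circle_eq_def periodic1_def)
lift_definition plus_circle_fun :: "circle_fun \<Rightarrow> circle_fun \<Rightarrow> circle_fun"
  is "\<lambda>f g x. f x + g x"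
  by (auto simp: circle_eq_def periodic1_def)
lift_definition minus_circle_fun :: "circle_fun \<Rightarrow> circle_fun \<Rightarrow> circle_fun"
  is "\<lambda>f g x. f x - g x"
  by (auto simp: circle_eq_def periodic1_def)
lift_definition times_circle_fun :: "circle_fun \<Rightarrow> circle_fun \<Rightarrow> circle_fun"
  is "\<lambda>f g x. f x * g x"
  by (auto simp: circle_eq_def periodic1_def)

instance
proof
  show "(0::circle_fun) \<noteq> 1"
  proof (transfer, rule notI)
    assume "circle_eq (\<lambda>_. 0) (\<lambda>_. 1)"
    then have "emeasure lborel (UNIV :: real set) = 0"
      by (simp add: circle_eq_def AE_iff_measurable[OF _ refl])
    then show False by simp
  qed
qed (transfer; auto simp: circle_eq_def periodic1_def algebra_simps)+

end

instantiation circle_fun :: real_algebra_1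
begin

lift_definition scaleR_circle_fun :: "real \<Rightarrow> circle_fun \<Rightarrow> circle_fun" is "\<lambda>c f x. c * f x"
  by (auto simp: circle_eq_def periodic1_def)

instance
  by standard (transfer; auto simp: circle_eq_def periodic1_def algebra_simps)+

end

lift_definition square_integrable :: "circle_fun \<Rightarrow> bool"
  is "\<lambda>f. set_integrable lborel {0..1} (\<lambda>x. (f x)\<^sup>2)"
  unfolding set_integrable_def
  by (intro integrable_cong_AE) (auto simp: circle_eq_def)

lift_definition fourier_coeff :: "circle_fun \<Rightarrow> int \<Rightarrow> complex"
  is "\<lambda>f n. LBINT x:{0..1}. of_real (f x) * cis (- (2 * pi * of_int n * x))"
  unfolding set_lebesgue_integral_def
proof (intro ext integral_cong_AE)
  have [measurable]: "(\<lambda>x. cis (- (2 * pi * of_int n * x))) \<in> borel_measurable borel" for n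
    by (intro borel_measurable_continuous_onI continuous_intros)
  fix f g :: "real \<Rightarrow> real" and n
  assume fg: "circle_eq f g"
  then have [measurable]: "f \<in> borel_measurable borel" "g \<in> borel_measurable borel"
    by (auto simp: circle_eq_def)
  show "(\<lambda>x. indicat_real {0..1} x *\<^sub>R (complex_of_real (f x) * cis (- (2 * pi * of_int n * x))))
    \<in> borel_measurable lborel" by measurable
  show "(\<lambda>x. indicat_real {0..1} x *\<^sub>R (complex_of_real (g x) * cis (- (2 * pi * of_int n * x))))
    \<in> borel_measurable lborel" by measurable
  show "AE x in lborel.
    indicat_real {0..1} x *\<^sub>R (complex_of_real (f x) * cis (- (2 * pi * of_int n * x))) =
    indicat_real {0..1} x *\<^sub>R (complex_of_real (g x) * cis (- (2 * pi * of_int n * x)))"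
    using fg by (auto simp: circle_eq_def)
qed


section \<open>Sobolev spaces\<close>

text \<open>\<open>H\<^sup>r(S\<^sup>1)\<close> for \<open>r \<ge> 0\<close>; for negative \<open>r\<close>, which are not needed, the space would have to
  contain distributions that are not functions. The weight is the Fourier symbol of
  \<open>A\<^sup>r = (1 - \<partial>\<^sub>x\<^sup>2)\<^sup>r\<close>.\<close>

definition sobolev_weight :: "real \<Rightarrow> int \<Rightarrow> real" where
  "sobolev_weight r n = (1 + (2 * pi * of_int n)\<^sup>2) powr r"

definition sobolev :: "real \<Rightarrow> circle_fun set" where
  "sobolev r = {f. square_integrable f \<and>
     (\<lambda>n. sobolev_weight r n * (cmod (fourier_coeff f n))\<^sup>2) summable_on UNIV}"

definition sobolev_norm :: "real \<Rightarrow> circle_fun \<Rightarrow> real" where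
  "sobolev_norm r f =
     sqrt (infsum (\<lambda>n. sobolev_weight r n * (cmod (fourier_coeff f n))\<^sup>2) UNIV)"

text \<open>The Sobolev norm induces a metric; the point is definiteness, that is, that a function on
  the circle is determined by its Fourier coefficients.\<close>

lemma set_integrable_times_continuous:
  fixes g :: "real \<Rightarrow> complex"
  assumes f: "set_integrable lborel {0..1} f" and [measurable]: "f \<in> borel_measurable borel"
    and g: "continuous_on UNIV g"
  shows "set_integrable lborel {0..1} (\<lambda>x. complex_of_real (f x) * g x)"
proof -
  have [measurable]: "g \<in> borel_measurable borel"
    using g by (rule borel_measurable_continuous_onI)
  have "compact (g ` {0..1})"
    by (intro compact_continuous_image) (auto intro: continuous_on_subset[OF g])
  then obtain B where B: "\<And>x. x \<in> {0..1} \<Longrightarrow> norm (g x) \<le> B"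
    using compact_imp_bounded bounded_iff by (metis imageI)
  have "integrable lborel (\<lambda>x. B * (indicat_real {0..1} x *\<^sub>R f x))"
    using f unfolding set_integrable_def by (rule integrable_mult_right)
  then show ?thesis
    unfolding set_integrable_def
  proof (rule Bochner_Integration.integrable_bound)
    show "AE x in lborel. norm (indicat_real {0..1} x *\<^sub>R (complex_of_real (f x) * g x))
      \<le> norm (B * (indicat_real {0..1} x *\<^sub>R f x))"
    proof (rule AE_I2)
      fix x :: real
      show "norm (indicat_real {0..1} x *\<^sub>R (complex_of_real (f x) * g x))
        \<le> norm (B * (indicat_real {0..1} x *\<^sub>R f x))"
        using B[of x] norm_ge_zero[of "g x"]
        by (auto simp: indicator_def norm_mult abs_mult mult.commute[of "\<bar>f x\<bar>"] intro!: mult_right_mono)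
    qed
  qed measurable
qed

lemma fourier_coeffs_eq_0_imp_AE_eq_0:
  fixes f :: "real \<Rightarrow> real"
  assumes f: "set_integrable lborel {0..1} f" and [measurable]: "f \<in> borel_measurable borel"
    and 0: "\<And>n::int. (LBINT x:{0..1}. of_real (f x) * cis (- (2 * pi * of_int n * x))) = 0"
  shows "AE x in lborel. x \<in> {0..1} \<longrightarrow> f x = 0"
proof -
  define e :: "real \<Rightarrow> complex" where "e x = cis (2 * pi * x)" for x
  define E :: "int \<Rightarrow> real \<Rightarrow> complex" where "E n x = cis (2 * pi * of_int n * x)" for n x
  define ok where "ok h \<longleftrightarrow> continuous_on UNIV h \<and>
     (\<forall>n. (LBINT x:{0..1}. of_real (f x) * (h x * E n x)) = 0)" for h :: "real \<Rightarrow> complex"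
  have E_cont [continuous_intros]: "continuous_on UNIV (E n)" for n
    unfolding E_def by (intro continuous_intros)
  have e_cont [continuous_intros]: "continuous_on UNIV e"
    unfolding e_def by (intro continuous_intros)
  have int: "set_integrable lborel {0..1} (\<lambda>x. of_real (f x) * (h x * E n x))"
    if "continuous_on UNIV h" for h n
    by (intro set_integrable_times_continuous f continuous_intros that) measurable
  have ok_add: "ok (\<lambda>x. h x + k x)" if "ok h" "ok k" for h k
    using that set_integral_add(2)[OF int[of h] int[of k]]
    by (auto simp: ok_def algebra_simps intro!: continuous_intros)
  have ok_mult: "ok (\<lambda>x. c * h x)" if "ok h" for h c
  proof -
    have "(LBINT x:{0..1}. of_real (f x) * (c * h x * E n x)) =
       c * (LBINT x:{0..1}. of_real (f x) * (h x * E n x))" for n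
      by (subst set_integral_mult_right[symmetric]) (simp add: ac_simps)
    with that show ?thesis by (auto simp: ok_def intro!: continuous_intros)
  qed
  have ok_E: "ok (\<lambda>x. E m x * h x)" if "ok h" for h m
  proof -
    have *: "E m x * h x * E n x = h x * E (m + n) x" for n x
    proof -
      have "E m x * E n x = E (m + n) x"
        by (simp add: E_def cis_mult algebra_simps)
      then show ?thesis by (metis mult.assoc mult.commute)
    qed
    show ?thesis using that unfolding ok_def * by (auto intro!: continuous_intros)
  qed
  have ok_poly: "ok (\<lambda>x. of_real (p (e x)) * h x)"
    if "real_polynomial_function p" "ok h" for p :: "complex \<Rightarrow> real" and h
    using that
  proof (induction p arbitrary: h rule: real_polynomial_function.induct)
    case (linear p)
    note okh = \<open>ok h\<close>
    interpret bounded_linear p by fact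
    have *: "of_real (p (e x)) * h x =
      Complex (p 1 / 2) (- p \<i> / 2) * (E 1 x * h x) + Complex (p 1 / 2) (p \<i> / 2) * (E (-1) x * h x)" for x
    proof -
      have "e x = cos (2*pi*x) *\<^sub>R 1 + sin (2*pi*x) *\<^sub>R \<i>"
        by (simp add: e_def complex_eq_iff)
      then have "p (e x) = cos (2*pi*x) * p 1 + sin (2*pi*x) * p \<i>"
        by (simp add: add scaleR)
      then have "of_real (p (e x)) =
        Complex (p 1 / 2) (- p \<i> / 2) * E 1 x + Complex (p 1 / 2) (p \<i> / 2) * E (-1) x"
        by (simp add: E_def complex_eq_iff field_simps)
      then show ?thesis by (simp add: algebra_simps)
    qed
    show ?case unfolding * by (intro ok_add ok_mult ok_E okh)
  next
    case (const c)
    then show ?case by (rule ok_mult)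
  next
    case (add p q)
    then show ?case by (simp add: distrib_right ok_add)
  next
    case (mult p q)
    then show ?case by (simp add: mult.assoc)
  qed
  have "ok (\<lambda>_. 1)"
    unfolding ok_def
  proof (intro conjI allI)
    show "(LBINT x:{0..1}. of_real (f x) * (1 * E n x)) = 0" for n
      using 0[of "-n"] by (simp add: E_def)
  qed simp
  from ok_poly[OF _ this]
  have poly0: "(LBINT x:{0..1}. of_real (f x) * complex_of_real (p (e x))) = 0"
    if "real_polynomial_function p" for p
    using that by (force simp: ok_def E_def dest!: spec[of _ 0])
  have intR: "set_integrable lborel {0..1} (\<lambda>x. f x * g (e x))"
    if "continuous_on UNIV g" for g :: "complex \<Rightarrow> real"
  proof -
    have "set_integrable lborel {0..1} (\<lambda>x. complex_of_real (f x) * of_real (g (e x)))"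
      by (intro set_integrable_times_continuous f continuous_intros
            continuous_on_compose2[OF that]) (auto intro!: continuous_intros)
    then have "set_integrable lborel {0..1} (\<lambda>x. Re (complex_of_real (f x) * of_real (g (e x))))"
      unfolding set_integrable_def by (drule_tac integrable_Re) simp
    then show ?thesis by simp
  qed
  have poly_cont: "continuous_on UNIV p" if "real_polynomial_function p" for p :: "complex \<Rightarrow> real"
    using that by (simp add: continuous_real_polymonial_function continuous_at_imp_continuous_on)
  have polyR: "(LBINT x:{0..1}. f x * p (e x)) = 0" if "real_polynomial_function p" for p
  proof -
    have "complex_of_real (LBINT x:{0..1}. f x * p (e x)) = (LBINT x:{0..1}. of_real (f x * p (e x)))"
      by (rule set_integral_complex_of_real[symmetric])
    then show ?thesis using poly0[OF that] by simp
  qed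
  define N where "N = (LBINT x:{0..1}. \<bar>f x\<bar>)"
  have fabs: "set_integrable lborel {0..1} (\<lambda>x. \<bar>f x\<bar>)"
    using f by (rule set_integrable_abs)
  have cont0: "(LBINT x:{0..1}. f x * g (e x)) = 0" if g: "continuous_on UNIV g" for g :: "complex \<Rightarrow> real"
  proof -
    have "\<bar>LBINT x:{0..1}. f x * g (e x)\<bar> \<le> 0 + \<epsilon>" if \<epsilon>: "\<epsilon> > 0" for \<epsilon>
    proof -
      have N0: "N \<ge> 0" unfolding N_def set_lebesgue_integral_def by (rule integral_nonneg_AE) auto
      have "\<epsilon> / (N + 1) > 0" using N0 \<epsilon> by simp
      then obtain p where p: "real_polynomial_function p"
        and pg: "\<And>z. z \<in> sphere 0 1 \<Longrightarrow> \<bar>g z - p z\<bar> < \<epsilon> / (N + 1)"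
        using Stone_Weierstrass_real_polynomial_function[of "sphere 0 1" g "\<epsilon> / (N + 1)"]
          continuous_on_subset[OF g] by (metis compact_sphere subset_UNIV)
      have i: "set_integrable lborel {0..1} (\<lambda>x. f x * g (e x))"
              "set_integrable lborel {0..1} (\<lambda>x. f x * p (e x))"
        by (intro intR g poly_cont p)+
      have "(LBINT x:{0..1}. f x * g (e x)) = (LBINT x:{0..1}. f x * g (e x) - f x * p (e x))"
        using set_integral_diff(2)[OF i] polyR[OF p] by simp
      also have "\<bar>\<dots>\<bar> \<le> (LBINT x:{0..1}. \<bar>f x * g (e x) - f x * p (e x)\<bar>)"
        using set_integral_norm_bound[OF set_integral_diff(1)[OF i]] by simp
      also have "\<dots> \<le> (LBINT x:{0..1}. \<bar>f x\<bar> * (\<epsilon> / (N + 1)))"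
      proof (rule set_integral_mono)
        show "set_integrable lborel {0..1} (\<lambda>x. \<bar>f x * g (e x) - f x * p (e x)\<bar>)"
          by (intro set_integrable_abs set_integral_diff(1) i)
        show "set_integrable lborel {0..1} (\<lambda>x. \<bar>f x\<bar> * (\<epsilon> / (N + 1)))"
          using fabs by (intro set_integrable_mult_left) simp
        show "\<bar>f x * g (e x) - f x * p (e x)\<bar> \<le> \<bar>f x\<bar> * (\<epsilon> / (N + 1))" for x
        proof -
          have "\<bar>g (e x) - p (e x)\<bar> \<le> \<epsilon> / (N + 1)"
            by (intro less_imp_le pg) (simp add: e_def)
          then show ?thesis
            unfolding right_diff_distrib[symmetric] abs_mult by (rule mult_left_mono) simp
        qed
      qed
      also have "\<dots> = N * (\<epsilon> / (N + 1))"
        by (simp add: N_def)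
      also have "\<dots> \<le> \<epsilon>" using N0 \<epsilon> by (simp add: field_simps)
      finally show ?thesis by simp
    qed
    then have "\<bar>LBINT x:{0..1}. f x * g (e x)\<bar> \<le> 0" by (rule field_le_epsilon)
    then show ?thesis by simp
  qed
  have compact0: "(LBINT x:K. f x) = 0" if K: "compact K" "K \<subseteq> {0<..<1}" "K \<noteq> {}" for K
  proof -
    define C where "C = e ` K"
    have "compact C" unfolding C_def
      by (intro compact_continuous_image K continuous_on_subset[OF e_cont]) auto
    then have C: "closed C" "C \<noteq> {}" using K by (auto simp: compact_imp_closed C_def)
    have e_inj: "x = y" if "e x = e y" "x \<in> {0..1}" "y \<in> {0<..<1}" for x y
    proof -
      have "cis (2 * pi * x - 2 * pi * y) = 1"
        using that by (simp add: e_def cis_divide[symmetric])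
      then have "cos (2 * pi * x - 2 * pi * y) = 1" by (simp add: complex_eq_iff)
      then obtain k :: int where "2 * pi * x - 2 * pi * y = of_int k * (2 * pi)"
        by (auto simp: cos_one_2pi_int)
      then have "2 * pi * (x - y) = 2 * pi * of_int k" by (simp add: algebra_simps)
      then have xy: "x - y = of_int k" by simp
      then have "real_of_int k < 1" "real_of_int k > -1" using that by auto
      then have "k = 0" by linarith
      with xy show ?thesis by simp
    qed
    define g where "g k z = max 0 (1 - real k * infdist z C)" for k z
    have g_cont: "continuous_on UNIV (g k)" for k
      unfolding g_def by (intro continuous_intros)
    have [measurable]: "(\<lambda>x. g k (e x)) \<in> borel_measurable borel" for k
      by (intro borel_measurable_continuous_onI continuous_on_compose2[OF g_cont]) 
        (auto intro!: continuous_intros)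
    have [measurable]: "K \<in> sets borel" using K(1) by (simp add: borel_compact)
    have "(\<lambda>k. LBINT x. indicat_real {0..1} x *\<^sub>R (f x * g k (e x))) \<longlonglongrightarrow> (LBINT x. indicat_real K x *\<^sub>R f x)"
    proof (rule integral_dominated_convergence)
      show "integrable lborel (\<lambda>x. indicat_real {0..1} x *\<^sub>R \<bar>f x\<bar>)"
        using fabs by (simp add: set_integrable_def)
      show "AE x in lborel. norm (indicat_real {0..1} x *\<^sub>R (f x * g k (e x)))
         \<le> indicat_real {0..1} x *\<^sub>R \<bar>f x\<bar>" for k
      proof (rule AE_I2)
        fix x
        have "\<bar>g k (e x)\<bar> \<le> 1" unfolding g_def by (simp add: infdist_nonneg)
        then show "norm (indicat_real {0..1} x *\<^sub>R (f x * g k (e x))) \<le> indicat_real {0..1} x *\<^sub>R \<bar>f x\<bar>"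
          by (simp add: abs_mult indicator_def mult_left_le)
      qed
      show "AE x in lborel. (\<lambda>k. indicat_real {0..1} x *\<^sub>R (f x * g k (e x))) \<longlonglongrightarrow> indicat_real K x *\<^sub>R f x"
      proof (rule AE_I2)
        fix x :: real
        show "(\<lambda>k. indicat_real {0..1} x *\<^sub>R (f x * g k (e x))) \<longlonglongrightarrow> indicat_real K x *\<^sub>R f x"
        proof (cases "x \<in> {0..1}")
          case False
          then have "x \<notin> K" using K by auto
          then show ?thesis using False by simp
        next
          case x: True
          show ?thesis
          proof (cases "x \<in> K")
            case True
            then have "e x \<in> C" by (simp add: C_def)
            then have "g k (e x) = 1" for k by (simp add: g_def)
            then show ?thesis using True x by simp
          next
            case False
            have "e x \<notin> C" using e_inj x False K unfolding C_def by blast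
            then have d: "infdist (e x) C > 0"
              using C in_closed_iff_infdist_zero infdist_nonneg by (metis less_eq_real_def)
            obtain k0 :: nat where k0: "real k0 * infdist (e x) C > 1"
              using reals_Archimedean3[OF d] by blast
            have "\<forall>\<^sub>F k in sequentially. g k (e x) = 0"
              using eventually_ge_at_top[of k0]
            proof eventually_elim
              case (elim k)
              then have "real k0 * infdist (e x) C \<le> real k * infdist (e x) C"
                using d by (intro mult_right_mono) auto
              with k0 show ?case by (simp add: g_def)
            qed
            then have "(\<lambda>k. indicat_real {0..1} x *\<^sub>R (f x * g k (e x))) \<longlonglongrightarrow> 0"
              by (rule tendsto_eventually[OF eventually_mono]) simp
            then show ?thesis using False by simp
          qed
        qed
      qed
    qed measurable
    moreover have "(LBINT x. indicat_real {0..1} x *\<^sub>R (f x * g k (e x))) = 0" for k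
      using cont0[OF g_cont] by (simp add: set_lebesgue_integral_def)
    ultimately show ?thesis by (simp add: LIMSEQ_const_iff set_lebesgue_integral_def)
  qed
  have null: "{x \<in> {0<..<1}. \<sigma> * f x > 0} \<in> null_sets lborel" if \<sigma>: "\<sigma> \<in> {1, -1}" for \<sigma> :: real
  proof -
    define P where "P = {x \<in> {0<..<1}. \<sigma> * f x > 0}"
    have [measurable]: "P \<in> sets borel" unfolding P_def by measurable
    then have "P \<in> sets lebesgue" by simp
    then obtain N0 C where N0: "negligible N0" and C: "\<And>n::nat. compact (C n)"
      and P: "P = (\<Union>n. C n) \<union> N0"
      by (rule lebesgue_regular_inner) blast
    have "negligible (C n)" for n
    proof (cases "C n = {}")
      case False
      have CP: "C n \<subseteq> P" using P by blast
      have [measurable]: "C n \<in> sets borel" using C by (simp add: borel_compact)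
      have "set_integrable lborel (C n) f"
        by (rule set_integrable_subset[OF f]) (use CP in \<open>auto simp: P_def\<close>)
      then have i: "integrable lborel (\<lambda>x. \<sigma> * (indicat_real (C n) x *\<^sub>R f x))"
        unfolding set_integrable_def by (rule integrable_mult_right)
      have "(LBINT x. \<sigma> * (indicat_real (C n) x *\<^sub>R f x)) = 0"
      proof -
        have "C n \<subseteq> {0<..<1}" using CP by (auto simp: P_def)
        from compact0[OF C this False] show ?thesis by (simp add: set_lebesgue_integral_def)
      qed
      moreover have "AE x in lborel. 0 \<le> \<sigma> * (indicat_real (C n) x *\<^sub>R f x)"
        by (rule AE_I2) (use CP in \<open>force simp: P_def indicator_def\<close>)
      ultimately have "AE x in lborel. \<sigma> * (indicat_real (C n) x *\<^sub>R f x) = 0"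
        using integral_nonneg_eq_0_iff_AE[OF i] by simp
      then have "AE x in lborel. x \<notin> C n"
        by (rule AE_mp) (rule AE_I2, use CP in \<open>force simp: P_def indicator_def\<close>)
      then have "C n \<in> null_sets lborel" by (simp add: AE_iff_null_sets)
      then show ?thesis by (simp add: negligible_iff_null_sets null_sets_completionI)
    qed simp
    then have "negligible P" unfolding P using N0 by (auto intro: negligible_Union_nat)
    then have "P \<in> null_sets lebesgue" by (simp add: negligible_iff_null_sets)
    then have "P \<in> null_sets lborel" by (auto simp: null_sets_def)
    then show ?thesis by (simp add: P_def)
  qed
  have "AE x in lborel. x \<noteq> (0::real)" "AE x in lborel. x \<noteq> (1::real)"
    by (auto intro: AE_lborel_singleton)
  moreover have "AE x in lborel. x \<notin> {x \<in> {0<..<1}. 1 * f x > 0}"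
    "AE x in lborel. x \<notin> {x \<in> {0<..<1}. -1 * f x > 0}"
    by (intro AE_not_in null; simp)+
  ultimately show ?thesis
    by eventually_elim (auto simp: not_less le_less)
qed


lemma square_integrable_imp_integrable:
  fixes f :: "real \<Rightarrow> real"
  assumes f: "set_integrable lborel {0..1} (\<lambda>x. (f x)\<^sup>2)" and [measurable]: "f \<in> borel_measurable borel"
  shows "set_integrable lborel {0..1} f"
proof -
  have "set_integrable lborel {0..1} (\<lambda>x. 1 + (f x)\<^sup>2)"
    using f by (intro set_integral_add) (simp_all add: set_integrable_def)
  then show ?thesis
    unfolding set_integrable_def
  proof (rule Bochner_Integration.integrable_bound)
    have "\<bar>f x\<bar> \<le> 1 + (f x)\<^sup>2" for x
    proof -
      have "0 \<le> (\<bar>f x\<bar> - 1)\<^sup>2 + \<bar>f x\<bar>" by simp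
      also have "\<dots> = 1 + (f x)\<^sup>2 - \<bar>f x\<bar>" by (simp add: power2_diff)
      finally show ?thesis by simp
    qed
    then show "AE x in lborel. norm (indicat_real {0..1} x *\<^sub>R f x)
      \<le> norm (indicat_real {0..1} x *\<^sub>R (1 + (f x)\<^sup>2))"
      by (intro AE_I2) (auto simp: indicator_def)
  qed measurable
qed

lemma fourier_coeff_diff:
  assumes "square_integrable f" "square_integrable g"
  shows "fourier_coeff (f - g) n = fourier_coeff f n - fourier_coeff g n"
  using assms
proof (transfer fixing: n)
  fix f g :: "real \<Rightarrow> real"
  assume "circle_eq f f" "circle_eq g g"
    and sq: "set_integrable lborel {0..1} (\<lambda>x. (f x)\<^sup>2)" "set_integrable lborel {0..1} (\<lambda>x. (g x)\<^sup>2)"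
  then have m: "f \<in> borel_measurable borel" "g \<in> borel_measurable borel"
    by (auto simp: circle_eq_def)
  have *: "set_integrable lborel {0..1} (\<lambda>x. of_real (h x) * cis (- (2 * pi * of_int n * x)))"
    if "h \<in> borel_measurable borel" "set_integrable lborel {0..1} (\<lambda>x. (h x)\<^sup>2)" for h
    by (rule set_integrable_times_continuous[OF square_integrable_imp_integrable[OF that(2,1)] that(1)])
      (intro continuous_intros)
  show "(LBINT x:{0..1}. of_real (f x - g x) * cis (- (2 * pi * of_int n * x))) =
    (LBINT x:{0..1}. of_real (f x) * cis (- (2 * pi * of_int n * x))) -
    (LBINT x:{0..1}. of_real (g x) * cis (- (2 * pi * of_int n * x)))"
    using set_integral_diff(2)[OF *[OF m(1) sq(1)] *[OF m(2) sq(2)]]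
    by (simp add: left_diff_distrib)
qed

lemma fourier_coeff_uminus: "fourier_coeff (- f) n = - fourier_coeff f n"
proof (transfer fixing: n)
  fix f :: "real \<Rightarrow> real"
  show "(LBINT x:{0..1}. of_real (- f x) * cis (- (2 * pi * of_int n * x))) =
    - (LBINT x:{0..1}. of_real (f x) * cis (- (2 * pi * of_int n * x)))"
    unfolding set_lebesgue_integral_def Bochner_Integration.integral_minus[symmetric] by simp
qed

lemma square_integrable_diff:
  assumes "square_integrable f" "square_integrable g"
  shows "square_integrable (f - g)"
  using assms
proof transfer
  fix f g :: "real \<Rightarrow> real"
  assume "circle_eq f f" "circle_eq g g"
    and sq: "set_integrable lborel {0..1} (\<lambda>x. (f x)\<^sup>2)" "set_integrable lborel {0..1} (\<lambda>x. (g x)\<^sup>2)"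
  then have [measurable]: "f \<in> borel_measurable borel" "g \<in> borel_measurable borel"
    by (auto simp: circle_eq_def)
  have "set_integrable lborel {0..1} (\<lambda>x. 2 * (f x)\<^sup>2 + 2 * (g x)\<^sup>2)"
    using sq by (intro set_integral_add set_integrable_mult_right) auto
  then show "set_integrable lborel {0..1} (\<lambda>x. (f x - g x)\<^sup>2)"
    unfolding set_integrable_def
  proof (rule Bochner_Integration.integrable_bound)
    have "(f x - g x)\<^sup>2 \<le> 2 * (f x)\<^sup>2 + 2 * (g x)\<^sup>2" for x
      using zero_le_power2[of "f x + g x"] by (simp add: power2_eq_square algebra_simps)
    then show "AE x in lborel. norm (indicat_real {0..1} x *\<^sub>R (f x - g x)\<^sup>2)
      \<le> norm (indicat_real {0..1} x *\<^sub>R (2 * (f x)\<^sup>2 + 2 * (g x)\<^sup>2))"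
      by (intro AE_I2) (auto simp: indicator_def)
  qed measurable
qed

lemma fourier_coeff_eq_0_imp_eq_0:
  assumes "square_integrable f" and "\<forall>n. fourier_coeff f n = 0"
  shows "f = 0"
  using assms
proof transfer
  fix f :: "real \<Rightarrow> real"
  assume f: "circle_eq f f" "set_integrable lborel {0..1} (\<lambda>x. (f x)\<^sup>2)"
    and 0: "\<forall>n. (LBINT x:{0..1}. of_real (f x) * cis (- (2 * pi * of_int n * x))) = 0"
  have [measurable]: "f \<in> borel_measurable borel" and p: "periodic1 f"
    using f by (auto simp: circle_eq_def)
  have unit: "AE x in lborel. x \<in> {0..1} \<longrightarrow> f x = 0"
    using 0 by (intro fourier_coeffs_eq_0_imp_AE_eq_0[OF square_integrable_imp_integrable[OF f(2)]]) auto
  have per: "f (x + of_int k) = f x" for x k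
  proof (induction k rule: int_induct[where k = 0])
    case (step1 i)
    then show ?case using p[unfolded periodic1_def, rule_format, of "x + of_int i"]
      by (simp add: add.assoc)
  next
    case (step2 i)
    then show ?case using p[unfolded periodic1_def, rule_format, of "x + of_int (i - 1)"]
      by (simp add: step2)
  qed simp
  have "AE x in lborel. x - of_int k \<in> {0..1} \<longrightarrow> f (x - of_int k) = 0" for k :: int
  proof -
    have "AE x in distr lborel borel (\<lambda>x. - of_int k + x). x \<in> {0..1} \<longrightarrow> f x = 0"
      using unit lborel_distr_plus[of "- real_of_int k"] by metis
    then show ?thesis by (subst (asm) AE_distr_iff) auto
  qed
  then have "AE x in lborel. \<forall>k::int. x - of_int k \<in> {0..1} \<longrightarrow> f (x - of_int k) = 0"
    by (simp add: AE_all_countable)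
  then have "AE x in lborel. f x = 0"
  proof eventually_elim
    case (elim x)
    then have "f (x - of_int \<lfloor>x\<rfloor>) = 0"
      by (metis add_diff_cancel_left' atLeastAtMost_iff frac_def frac_ge_0 frac_lt_1 less_imp_le)
    then show ?case using per[of "x - of_int \<lfloor>x\<rfloor>" "\<lfloor>x\<rfloor>"] by simp
  qed
  then show "circle_eq f (\<lambda>_. 0)" using p by (auto simp: circle_eq_def periodic1_def)
qed

lemma weighted_l2_diff:
  fixes a b :: "int \<Rightarrow> complex"
  assumes w: "\<And>n. w n \<ge> (0::real)"
    and a: "(\<lambda>n. w n * (cmod (a n))\<^sup>2) summable_on UNIV"
    and b: "(\<lambda>n. w n * (cmod (b n))\<^sup>2) summable_on UNIV"
  shows weighted_l2_diff_summable: "(\<lambda>n. w n * (cmod (a n - b n))\<^sup>2) summable_on UNIV"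
    and weighted_l2_diff_le: "sqrt (infsum (\<lambda>n. w n * (cmod (a n - b n))\<^sup>2) UNIV)
      \<le> sqrt (infsum (\<lambda>n. w n * (cmod (a n))\<^sup>2) UNIV) + sqrt (infsum (\<lambda>n. w n * (cmod (b n))\<^sup>2) UNIV)"
proof -
  let ?N = "\<lambda>c. infsum (\<lambda>n. w n * (cmod (c n))\<^sup>2) UNIV"
  have L2: "L2_set (\<lambda>n. sqrt (w n) * cmod (c n)) F = sqrt (\<Sum>n\<in>F. w n * (cmod (c n))\<^sup>2)" for c F
    using w by (simp add: L2_set_def power_mult_distrib)
  have fin: "(\<Sum>n\<in>F. w n * (cmod (a n - b n))\<^sup>2) \<le> (sqrt (?N a) + sqrt (?N b))\<^sup>2" if "finite F" for F
  proof -
    have "sqrt (\<Sum>n\<in>F. w n * (cmod (a n - b n))\<^sup>2) = L2_set (\<lambda>n. sqrt (w n) * cmod (a n - b n)) F"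
      by (simp add: L2[symmetric])
    also have "\<dots> \<le> L2_set (\<lambda>n. sqrt (w n) * cmod (a n) + sqrt (w n) * cmod (b n)) F"
      using w by (intro L2_set_mono)
        (auto simp: distrib_left[symmetric] intro!: mult_left_mono norm_triangle_ineq4)
    also have "\<dots> \<le> L2_set (\<lambda>n. sqrt (w n) * cmod (a n)) F + L2_set (\<lambda>n. sqrt (w n) * cmod (b n)) F"
      by (rule L2_set_triangle_ineq)
    also have "\<dots> \<le> sqrt (?N a) + sqrt (?N b)"
      unfolding L2 using w a b that
      by (intro add_mono real_sqrt_le_mono finite_sum_le_infsum) auto
    finally show ?thesis by (rule sqrt_le_D)
  qed
  show s: "(\<lambda>n. w n * (cmod (a n - b n))\<^sup>2) summable_on UNIV"
    using w fin by (intro nonneg_bdd_above_summable_on bdd_aboveI2) auto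
  show "sqrt (?N (\<lambda>n. a n - b n)) \<le> sqrt (?N a) + sqrt (?N b)"
    using w by (intro real_le_lsqrt infsum_le_finite_sums[OF s] fin add_nonneg_nonneg) 
      (auto intro!: infsum_nonneg)
qed

lemma sobolev_weight_pos: "sobolev_weight r n > 0"
  unfolding sobolev_weight_def by (smt (verit) powr_gt_zero zero_le_power2)

lemma Metric_space_sobolev: "Metric_space (sobolev r) (\<lambda>f g. sobolev_norm r (f - g))"
proof
  note w = less_imp_le[OF sobolev_weight_pos]
  show "0 \<le> sobolev_norm r (f - g)" for f g
    unfolding sobolev_norm_def using w by (auto intro!: infsum_nonneg)
  have diff: "f - g \<in> sobolev r" if "f \<in> sobolev r" "g \<in> sobolev r" for f g
    using that weighted_l2_diff(1)[OF w]
    by (auto simp: sobolev_def square_integrable_diff fourier_coeff_diff)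
  have tri: "sobolev_norm r (f - g) \<le> sobolev_norm r f + sobolev_norm r g"
    if "f \<in> sobolev r" "g \<in> sobolev r" for f g
    using that weighted_l2_diff(2)[OF w]
    by (auto simp: sobolev_def sobolev_norm_def fourier_coeff_diff)
  fix f g assume f: "f \<in> sobolev r" and g: "g \<in> sobolev r"
  show "(sobolev_norm r (f - g) = 0) = (f = g)"
  proof
    assume "sobolev_norm r (f - g) = 0"
    then have 0: "infsum (\<lambda>n. sobolev_weight r n * (cmod (fourier_coeff (f - g) n))\<^sup>2) UNIV = 0"
      by (simp add: sobolev_norm_def)
    have s: "(\<lambda>n. sobolev_weight r n * (cmod (fourier_coeff (f - g) n))\<^sup>2) summable_on UNIV"
      and sq: "square_integrable (f - g)"
      using diff[OF f g] by (auto simp: sobolev_def)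
    have "sobolev_weight r n * (cmod (fourier_coeff (f - g) n))\<^sup>2 = 0" for n
      using s w 0 by (intro nonneg_infsum_le_0D[of _ UNIV]) auto
    then have "\<forall>n. fourier_coeff (f - g) n = 0"
      using sobolev_weight_pos[of r] by (simp add: order_less_le)
    then have "f - g = 0" by (rule fourier_coeff_eq_0_imp_eq_0[OF sq])
    then show "f = g" by simp
  next
    assume "f = g"
    then show "sobolev_norm r (f - g) = 0"
      using f fourier_coeff_diff[of f f] by (simp add: sobolev_norm_def sobolev_def)
  qed
  show "sobolev_norm r (f - h) \<le> sobolev_norm r (f - g) + sobolev_norm r (g - h)"
    if h: "h \<in> sobolev r" for h
  proof -
    have "sobolev_norm r ((f - g) - (h - g)) \<le> sobolev_norm r (f - g) + sobolev_norm r (h - g)"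
      by (intro tri diff f g h)
    moreover have "sobolev_norm r (h - g) = sobolev_norm r (g - h)"
      using g h by (simp add: sobolev_norm_def fourier_coeff_diff sobolev_def norm_minus_commute)
    ultimately show ?thesis by simp
  qed
next
  fix f g
  have "fourier_coeff (f - g) n = - fourier_coeff (g - f) n" for n
    using fourier_coeff_uminus[of "g - f" n] by simp
  then show "sobolev_norm r (f - g) = sobolev_norm r (g - f)"
    by (simp add: sobolev_norm_def)
qed

definition sobolev_metric :: "real \<Rightarrow> circle_fun metric" where
  "sobolev_metric r = metric (sobolev r, \<lambda>f g. sobolev_norm r (f - g))"

lemma mspace_sobolev_metric [simp]: "mspace (sobolev_metric r) = sobolev r"
  by (simp add: sobolev_metric_def Metric_space.mspace_metric[OF Metric_space_sobolev])

lemma mdist_sobolev_metric [simp]: "mdist (sobolev_metric r) f g = sobolev_norm r (f - g)"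
  by (simp add: sobolev_metric_def Metric_space.mdist_metric[OF Metric_space_sobolev])

text \<open>\<open>H\<^sup>s(S\<^sup>1) \<times> H\<^sup>s\<^sup>-\<^sup>1(S\<^sup>1)\<close>\<close>

definition state_space :: "real \<Rightarrow> (circle_fun \<times> circle_fun) metric" where
  "state_space s = prod_metric (sobolev_metric s) (sobolev_metric (s - 1))"


section \<open>Spatial derivative and the operator \<open>A\<close>\<close>

definition test_function :: "(real \<Rightarrow> real) \<Rightarrow> bool" where
  "test_function \<phi> \<longleftrightarrow> periodic1 \<phi> \<and> (\<forall>k x. (deriv ^^ k) \<phi> differentiable (at x))"

lemma test_function_measurable:
  assumes "test_function \<phi>"
  shows "\<phi> \<in> borel_measurable borel" "deriv \<phi> \<in> borel_measurable borel"
proof -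
  have *: "(deriv ^^ k) \<phi> \<in> borel_measurable borel" for k
    using assms
    by (intro borel_measurable_continuous_onI continuous_at_imp_continuous_on)
      (auto simp: test_function_def intro!: differentiable_imp_continuous_within)
  show "\<phi> \<in> borel_measurable borel" "deriv \<phi> \<in> borel_measurable borel"
    using *[of 0] *[of 1] by simp_all
qed

lift_definition has_weak_derivative :: "circle_fun \<Rightarrow> circle_fun \<Rightarrow> bool"
  is "\<lambda>f g. set_integrable lborel {0..1} f \<and> set_integrable lborel {0..1} g \<and>
        (\<forall>\<phi>. test_function \<phi> \<longrightarrow>
          (LBINT x:{0..1}. f x * deriv \<phi> x) = - (LBINT x:{0..1}. g x * \<phi> x))"
proof -
  fix f1 f2 g1 g2 assume f: "circle_eq f1 f2" and g: "circle_eq g1 g2"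
  have int: "set_integrable lborel {0..1} h1 = set_integrable lborel {0..1} h2"
    if "circle_eq h1 h2" for h1 h2
    unfolding set_integrable_def
    using that by (intro integrable_cong_AE) (auto simp: circle_eq_def)
  have eq: "(LBINT x:{0..1}. h1 x * \<psi> x) = (LBINT x:{0..1}. h2 x * \<psi> x)"
    if "circle_eq h1 h2" "\<psi> \<in> borel_measurable borel" for h1 h2 \<psi> :: "real \<Rightarrow> real"
    unfolding set_lebesgue_integral_def
    using that by (intro integral_cong_AE) (auto simp: circle_eq_def)
  show "(set_integrable lborel {0..1} f1 \<and> set_integrable lborel {0..1} g1 \<and>
        (\<forall>\<phi>. test_function \<phi> \<longrightarrow>
          (LBINT x:{0..1}. f1 x * deriv \<phi> x) = - (LBINT x:{0..1}. g1 x * \<phi> x))) =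
     (set_integrable lborel {0..1} f2 \<and> set_integrable lborel {0..1} g2 \<and>
        (\<forall>\<phi>. test_function \<phi> \<longrightarrow>
          (LBINT x:{0..1}. f2 x * deriv \<phi> x) = - (LBINT x:{0..1}. g2 x * \<phi> x)))"
    using int[OF f] int[OF g] eq[OF f] eq[OF g] test_function_measurable by simp
qed

definition Dx :: "circle_fun \<Rightarrow> circle_fun" where
  "Dx f = (THE g. has_weak_derivative f g)"

definition A_op :: "circle_fun \<Rightarrow> circle_fun" where
  "A_op f = f - Dx (Dx f)"

text \<open>Inverse of the isomorphism \<open>A : H\<^sup>r(S\<^sup>1) \<rightarrow> H\<^sup>r\<^sup>-\<^sup>2(S\<^sup>1)\<close>, for \<open>r \<ge> 2\<close>.\<close>

definition A_inv :: "real \<Rightarrow> circle_fun \<Rightarrow> circle_fun" where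
  "A_inv r = the_inv_into (sobolev r) A_op"


section \<open>Curves in a normed space of functions\<close>

text \<open>The spaces \<open>H\<^sup>r(S\<^sup>1)\<close> depend on a real parameter, so they are not types and time derivatives
  are taken as limits of difference quotients in the topology of a metric on a subspace.\<close>

definition has_time_deriv :: "'a::real_vector metric \<Rightarrow> (real \<Rightarrow> 'a) \<Rightarrow> 'a \<Rightarrow> real \<Rightarrow> bool" where
  "has_time_deriv m z d t \<longleftrightarrow>
     limitin (mtopology_of m) (\<lambda>h. (z (t + h) - z t) /\<^sub>R h) d (at 0)"

definition time_deriv :: "'a::real_vector metric \<Rightarrow> (real \<Rightarrow> 'a) \<Rightarrow> real \<Rightarrow> 'a" where
  "time_deriv m z t = (THE d. has_time_deriv m z d t)"

definition C0_curve :: "real set \<Rightarrow> 'a metric \<Rightarrow> (real \<Rightarrow> 'a) \<Rightarrow> bool" where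
  "C0_curve J m z \<longleftrightarrow> continuous_map (top_of_set J) (mtopology_of m) z"

definition C1_curve :: "real set \<Rightarrow> 'a::real_vector metric \<Rightarrow> (real \<Rightarrow> 'a) \<Rightarrow> bool" where
  "C1_curve J m z \<longleftrightarrow> C0_curve J m z \<and> (\<forall>t\<in>J. \<exists>d. has_time_deriv m z d t) \<and>
     C0_curve J m (time_deriv m z)"


section \<open>The Cauchy problem\<close>

text \<open>Curves on \<open>J\<close> are normalised to be \<^term>\<open>undefined\<close> off \<open>J\<close>, so that equality of
  solutions means equality on \<open>J\<close>.\<close>

definition dp2_solution ::
  "real \<Rightarrow> real set \<Rightarrow> circle_fun \<times> circle_fun \<Rightarrow> (real \<Rightarrow> circle_fun \<times> circle_fun) \<Rightarrow> bool"
where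
  "dp2_solution s J z0 z \<longleftrightarrow>
     z \<in> extensional J \<and>
     C0_curve J (state_space s) z \<and> C1_curve J (state_space (s - 1)) z \<and>
     (\<forall>t\<in>J. let (u, \<rho>) = z t; (u_t, \<rho>_t) = time_deriv (state_space (s - 1)) z t in
        u_t + u * Dx u = - A_inv s (Dx ((3/2) *\<^sub>R u\<^sup>2 - \<rho>\<^sup>2) + \<rho> * Dx u) \<and>
        \<rho>_t + u * Dx \<rho> = - 2 * \<rho> * Dx u) \<and>
     z 0 = z0"

text \<open>Continuity of a map \<open>\<Phi> : U \<rightarrow> C(J, H\<^sup>s \<times> H\<^sup>s\<^sup>-\<^sup>1) \<inter> C\<^sup>1(J, H\<^sup>s\<^sup>-\<^sup>1 \<times> H\<^sup>s\<^sup>-\<^sup>2)\<close>, where \<open>U\<close>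
  carries the topology of \<open>H\<^sup>s \<times> H\<^sup>s\<^sup>-\<^sup>1\<close> and the target that of uniform convergence, on compact
  subsets of \<open>J\<close>, of the curves in \<open>H\<^sup>s \<times> H\<^sup>s\<^sup>-\<^sup>1\<close> and of their time derivatives in
  \<open>H\<^sup>s\<^sup>-\<^sup>1 \<times> H\<^sup>s\<^sup>-\<^sup>2\<close>.\<close>

definition continuous_data_to_solution ::
  "real \<Rightarrow> real set \<Rightarrow> (circle_fun \<times> circle_fun) set \<Rightarrow>
     (circle_fun \<times> circle_fun \<Rightarrow> real \<Rightarrow> circle_fun \<times> circle_fun) \<Rightarrow> bool"
where
  "continuous_data_to_solution s J U \<Phi> \<longleftrightarrow>
     (\<forall>K. compact K \<and> K \<subseteq> J \<longrightarrow>
        continuous_map (subtopology (mtopology_of (state_space s)) U)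
          (mtopology_of (cfunspace (top_of_set K) (state_space s)))
          (\<lambda>z0. restrict (\<Phi> z0) K) \<and>
        continuous_map (subtopology (mtopology_of (state_space s)) U)
          (mtopology_of (cfunspace (top_of_set K) (state_space (s - 1))))
          (\<lambda>z0. restrict (time_deriv (state_space (s - 1)) (\<Phi> z0)) K))"

end

theory Submission imports Defs "HOL-Real_Asymp.Real_Asymp" begin

text \<open>On the Fourier side the problem is a quadratic system of ordinary differential equations for the
  coefficients of \<open>(u, \<rho>)\<close>, whose vector field loses one derivative. For a weight \<open>V\<close> on the frequencies
  consider the energy \<open>\<Sum>n. (jb n * V n * \<bar>u n\<bar>)\<^sup>2 + (V n * \<bar>\<rho> n\<bar>)\<^sup>2\<close>, where \<open>jb n\<close> is the
  square root of the symbol of \<open>A\<close>. By Hermitian symmetry the transport terms enter its derivative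
  only through commutators, so the energy grows at most exponentially, at a rate that depends only on
  the norm of the state. With \<open>V n = jb n powr (s - 1)\<close> this
  gives a common time of existence for the Galerkin truncations. For differences of two solutions the
  same estimate holds only with the low weight \<open>V n = 1\<close>; it gives convergence of the truncations and
  uniqueness.

  What remains is continuity in the top norm, in time and in the data. The weights
  \<open>jb n powr (s - 1) * min 1 (jb n / K)\<close> obey the energy estimate uniformly in \<open>K\<close> and see only the
  frequencies beyond \<open>K\<close> at full strength. A tail that is small initially therefore stays small, and
  stays so for nearby data, while below \<open>K\<close> the low norm controls the top norm.\<close>

section \<open>Weights on the frequencies\<close>

text \<open>The field maps the weight \<open>jb n powr (s - 1)\<close> only into
  \<open>jb n powr (s - 2)\<close>, so it is not a vector field on the state space and no
  contraction argument applies there; energy estimates on finite truncations take its place. The u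
  component carries one more factor \<open>jb n\<close> than \<rho>, because the inverse of
  \<open>A\<close> regains a derivative in the u equation while \<open>\<rho> * Dx u\<close> costs
  one in the \<rho> equation; with this shift every term except transport is bounded on the energy
  space. The hypothesis s > 5/2 enters as s - 2 > 1/2: two derivatives of u and one of \<rho> then
  have absolutely summable coefficients. The second derivative of u is also what confines the
  comparison of two solutions to a low norm. If w is the difference and b one of the solutions, the
  product of w with the derivative of b puts on b all derivatives that the weight of the u component
  demands, and one more. At the top weight b would need a derivative that it does not have; at V = 1
  it needs two.\<close>

definition freq :: "int \<Rightarrow> real" where "freq n = 2 * pi * of_int n"

definition jb :: "int \<Rightarrow> real" where "jb n = sqrt (1 + (freq n)\<^sup>2)"

lemma freq_0 [simp]: "freq 0 = 0" by (simp add: freq_def)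

lemma freq_minus [simp]: "freq (- n) = - freq n" by (simp add: freq_def)

lemma freq_diff: "freq (n - k) = freq n - freq k" by (simp add: freq_def algebra_simps)

lemma jb_minus [simp]: "jb (- n) = jb n" by (simp add: jb_def)

lemma jb_commute: "jb (n - k) = jb (k - n)"
  using jb_minus[of "n - k"] by simp

lemma jb_ge_1 [simp]: "1 \<le> jb n" by (simp add: jb_def)

lemma jb_pos [simp]: "0 < jb n" using jb_ge_1[of n] by linarith

lemma jb_nonneg [simp]: "0 \<le> jb n" using jb_pos[of n] by linarith

lemma jb_neq_0 [simp]: "jb n \<noteq> 0" using jb_pos[of n] by linarith

lemma jb_square: "(jb n)\<^sup>2 = 1 + (freq n)\<^sup>2" by (simp add: jb_def)

lemma freq_le_jb: "\<bar>freq n\<bar> \<le> jb n"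
  unfolding jb_def by (rule real_le_rsqrt) simp

text \<open>Minkowski's inequality in the plane for the vectors (1, \<open>freq k\<close>) and (0,
  \<open>freq (n - k)\<close>); \<open>L2_set\<close> over \<open>bool\<close> plays the Euclidean
  norm.\<close>

lemma jb_triangle_freq: "jb n \<le> jb k + \<bar>freq (n - k)\<bar>"
proof -
  have "jb n = sqrt (1\<^sup>2 + (freq k + freq (n - k))\<^sup>2)" by (simp add: jb_def freq_diff)
  also have "\<dots> = L2_set (\<lambda>b. (if b then 1 else freq k) + (if b then 0 else freq (n - k))) (UNIV :: bool set)"
    by (simp add: L2_set_def UNIV_bool add.commute)
  also have "\<dots> \<le> L2_set (\<lambda>b. if b then 1 else freq k) (UNIV :: bool set)
      + L2_set (\<lambda>b. if b then 0 else freq (n - k)) (UNIV :: bool set)"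
    by (rule L2_set_triangle_ineq)
  also have "\<dots> = jb k + \<bar>freq (n - k)\<bar>"
    by (simp add: L2_set_def UNIV_bool jb_def add.commute)
  finally show ?thesis .
qed

lemma jb_triangle: "jb n \<le> jb k + jb (n - k)"
  using jb_triangle_freq[of n k] freq_le_jb[of "n - k"] by linarith

lemma jb_submult: "jb n \<le> 2 * jb (n - k) * jb k"
proof -
  have "jb k \<le> jb (n - k) * jb k" "jb (n - k) \<le> jb (n - k) * jb k"
    using mult_right_mono[OF jb_ge_1[of "n - k"] jb_nonneg[of k]]
      mult_left_mono[OF jb_ge_1[of k] jb_nonneg[of "n - k"]] by simp_all
  with jb_triangle[of n k] show ?thesis by linarith
qed

lemma jb_int_ge: "\<bar>of_int n\<bar> \<le> jb n"
proof -
  have "\<bar>of_int n\<bar> * 1 \<le> \<bar>of_int n\<bar> * (2 * pi)"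
    using pi_gt3 by (intro mult_left_mono) auto
  then show ?thesis using freq_le_jb[of n] by (simp add: freq_def abs_mult mult.commute)
qed

lemma sobolev_weight_jb: "sobolev_weight r n = (jb n powr r)\<^sup>2"
proof -
  have "sobolev_weight r n = ((jb n)\<^sup>2) powr r"
    by (simp add: sobolev_weight_def jb_square freq_def)
  also have "\<dots> = (jb n powr r)\<^sup>2"
    by (simp add: power2_eq_square powr_mult)
  finally show ?thesis .
qed

section \<open>Admissible weights\<close>

text \<open>Monotone in the frequency and of polynomial growth of order at most p. The constants
  below depend on the weight through p alone, hence are uniform over a whole family such as the tail
  weights.\<close>

definition admissible :: "nat \<Rightarrow> (int \<Rightarrow> real) \<Rightarrow> bool" where
  "admissible p V \<longleftrightarrow> (\<forall>n. 0 < V n) \<and>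
     (\<forall>n k. jb n \<le> jb k \<longrightarrow> V n \<le> V k \<and> V k \<le> (jb k / jb n) ^ p * V n)"

lemma admissible_pos: "admissible p V \<Longrightarrow> 0 < V n"
  and admissible_mono: "admissible p V \<Longrightarrow> jb n \<le> jb k \<Longrightarrow> V n \<le> V k"
  and admissible_growth: "admissible p V \<Longrightarrow> jb n \<le> jb k \<Longrightarrow> V k \<le> (jb k / jb n) ^ p * V n"
  by (auto simp: admissible_def)

lemma admissible_minus: "admissible p V \<Longrightarrow> V (- n) = V n"
  by (intro antisym; rule admissible_mono) auto

text \<open>The u component of the energy has the weight \<open>jb n * V n\<close>, to which the
  commutator bound has to apply as well.\<close>

lemma admissible_mult_jb:
  assumes "admissible p V" shows "admissible (Suc p) (\<lambda>n. jb n * V n)"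
  unfolding admissible_def
proof (intro conjI allI impI)
  show "0 < jb n * V n" for n using admissible_pos[OF assms] by simp
  fix n k assume le: "jb n \<le> jb k"
  show "jb n * V n \<le> jb k * V k"
    by (intro mult_mono le admissible_mono[OF assms le] jb_nonneg less_imp_le[OF admissible_pos[OF assms]])
  have "jb k * V k \<le> jb k * ((jb k / jb n) ^ p * V n)"
    by (intro mult_left_mono admissible_growth[OF assms le] jb_nonneg)
  also have "\<dots> = (jb k / jb n) ^ Suc p * (jb n * V n)"
    by (simp add: field_simps)
  finally show "jb k * V k \<le> (jb k / jb n) ^ Suc p * (jb n * V n)" .
qed

lemma admissible_scaled:
  assumes V: "admissible p V" and c: "1 \<le> c" and le: "jb n \<le> c * jb k"
  shows "V n \<le> c ^ p * V k"
proof (cases "jb n \<le> jb k")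
  case True
  have "V n \<le> 1 * V k" using admissible_mono[OF V True] by simp
  also have "\<dots> \<le> c ^ p * V k"
    using c by (intro mult_right_mono less_imp_le[OF admissible_pos[OF V]]) auto
  finally show ?thesis .
next
  case False
  then have "V n \<le> (jb n / jb k) ^ p * V k" by (intro admissible_growth[OF V]) auto
  also have "\<dots> \<le> c ^ p * V k"
    using le by (intro mult_right_mono power_mono less_imp_le[OF admissible_pos[OF V]])
      (auto simp: divide_le_eq)
  finally show ?thesis .
qed

text \<open>Of two frequencies with sum n, one has a bracket at least half that of n; between n and
  that frequency a weight of order p drops by a factor of at most \<open>2 ^ p\<close>.\<close>

lemma admissible_quasi_subadditive:
  assumes V: "admissible p V"
  shows "V n \<le> 2 ^ p * (V (n - k) + V k)"
proof -
  have pos: "0 < V m" for m by (rule admissible_pos[OF V])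
  consider "jb n \<le> 2 * jb (n - k)" | "jb n \<le> 2 * jb k"
    using jb_triangle[of n k] by linarith
  then show ?thesis
  proof cases
    case 1
    then have "V n \<le> 2 ^ p * V (n - k)" by (intro admissible_scaled[OF V]) auto
    then show ?thesis using pos[of k] by (smt (verit) mult_left_mono zero_le_power)
  next
    case 2
    then have "V n \<le> 2 ^ p * V k" by (intro admissible_scaled[OF V]) auto
    then show ?thesis using pos[of "n-k"] by (smt (verit) mult_left_mono zero_le_power)
  qed
qed

section \<open>The commutator of a weight with transport\<close>

text \<open>Turns polynomial growth into a bound for increments of the weight: x will be the ratio
  of two comparable brackets, and x - 1 their relative distance, which is where one derivative is
  gained.\<close>

lemma power_minus_one_le:
  fixes x :: real assumes "1 \<le> x" "x \<le> 2"
  shows "x ^ p - 1 \<le> real p * 2 ^ p * (x - 1)"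
proof (induction p)
  case (Suc p)
  have "x ^ Suc p - 1 = x * (x ^ p - 1) + (x - 1)" by (simp add: algebra_simps)
  also have "\<dots> \<le> 2 * (real p * 2 ^ p * (x - 1)) + 2 * 2 ^ p * (x - 1)"
  proof (rule add_mono)
    have "x * (x ^ p - 1) \<le> 2 * (x ^ p - 1)" using assms by (intro mult_right_mono) auto
    also have "\<dots> \<le> 2 * (real p * 2 ^ p * (x - 1))" using Suc by (rule mult_left_mono) simp
    finally show "x * (x ^ p - 1) \<le> 2 * (real p * 2 ^ p * (x - 1))" .
    have "1 * (x - 1) \<le> (2 * 2 ^ p) * (x - 1)" using assms
      by (intro mult_right_mono) (auto simp flip: power_Suc)
    then show "x - 1 \<le> 2 * 2 ^ p * (x - 1)" by simp
  qed
  also have "\<dots> = real (Suc p) * 2 ^ Suc p * (x - 1)" by (simp add: algebra_simps)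
  finally show ?case .
qed simp

text \<open>In the next lemma \<open>1 + 3 * (real p * 2 ^ p)\<close> is the cost of the
  near-diagonal case and \<open>2 ^ p\<close> that of the far case.\<close>

definition comm_const :: "nat \<Rightarrow> real" where "comm_const p = 1 + 3 * (real p * 2 ^ p) + 2 ^ p"

text \<open>If the brackets of n and k are comparable, \<open>W n - W k\<close> is of size
  \<open>W k * jb (n - k) / jb k\<close>, so the derivative moves to the coefficient of frequency n
  - k. Otherwise n - k carries the top frequency, \<open>W n\<close> is at most
  \<open>2 ^ p * W (n - k)\<close>, and no cancellation is required.\<close>

lemma commutator_symbol_aux:
  assumes W: "admissible p W" and le: "jb k \<le> jb n"
  shows "\<bar>(W n)\<^sup>2 * freq k - (W k)\<^sup>2 * freq n\<bar> \<le> comm_const p *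
     (jb (n - k) * W k * W n + W (n - k) * jb k * W n + W (n - k) * W k * jb n)"
proof -
  define a b h where "a = W n" and "b = W k" and "h = W (n - k)"
  define c where "c = real p * 2 ^ p"
  have pos: "0 < a" "0 < b" "0 < h" using admissible_pos[OF W] by (auto simp: a_def b_def h_def)
  have ba: "b \<le> a" unfolding a_def b_def by (rule admissible_mono[OF W le])
  have c0: "0 \<le> c" by (simp add: c_def)
  have fk: "\<bar>freq k\<bar> \<le> jb k" and fn: "\<bar>freq n\<bar> \<le> jb n" and fh: "\<bar>freq (n - k)\<bar> \<le> jb (n - k)"
    by (rule freq_le_jb)+
  have P: "0 \<le> jb (n - k) * b * a" "0 \<le> h * jb k * a" "0 \<le> h * b * jb n"
    using pos by auto
  show ?thesis
  proof (cases "jb n \<le> 2 * jb k")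
    case True
    define x where "x = jb n / jb k"
    have x: "1 \<le> x" "x \<le> 2" using le True by (auto simp: x_def field_simps)
    have x1: "jb k * (x - 1) \<le> \<bar>freq (n - k)\<bar>"
    proof -
      have "jb k * (x - 1) = jb n - jb k" by (simp add: x_def field_simps)
      then show ?thesis using jb_triangle_freq[of n k] by linarith
    qed
    have "a \<le> x ^ p * b" unfolding a_def b_def x_def by (rule admissible_growth[OF W le])
    then have "a - b \<le> (x ^ p - 1) * b" by (simp add: algebra_simps)
    also have "\<dots> \<le> (c * (x - 1)) * b"
      using power_minus_one_le[OF x, of p] pos by (intro mult_right_mono) (auto simp: c_def)
    finally have "(a - b) * jb k \<le> (c * (x - 1)) * b * jb k" by (intro mult_right_mono) auto
    also have "\<dots> = c * b * (jb k * (x - 1))" by simp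
    also have "\<dots> \<le> c * b * jb (n - k)"
      using x1 fh c0 pos by (intro mult_left_mono) auto
    finally have ab: "(a - b) * jb k \<le> c * b * jb (n - k)" .
    \<comment> \<open>A splitting in which each term has a factor that is small near the diagonal:
      \<open>a - b\<close> in one, \<open>freq (n - k)\<close> in the other.\<close>
    have "a\<^sup>2 * freq k - b\<^sup>2 * freq n = (a - b) * (a * freq k + b * freq n) - a * b * freq (n - k)"
      by (simp add: freq_diff power2_eq_square algebra_simps)
    also have "\<bar>\<dots>\<bar> \<le> (a - b) * (a * jb k + b * jb n) + a * b * jb (n - k)"
    proof -
      have "\<bar>(a - b) * (a * freq k + b * freq n)\<bar> \<le> (a - b) * (a * jb k + b * jb n)"
        unfolding abs_mult using ba pos fk fn
        by (intro mult_mono) (auto intro!: order_trans[OF abs_triangle_ineq] add_mono mult_left_mono simp: abs_mult)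
      moreover have "\<bar>a * b * freq (n - k)\<bar> \<le> a * b * jb (n - k)"
        using fh pos by (simp add: abs_mult)
      ultimately show ?thesis by linarith
    qed
    also have "(a - b) * (a * jb k + b * jb n) \<le> (a - b) * (a * jb k + a * (2 * jb k))"
      using ba pos True by (intro mult_left_mono add_mono mult_mono) auto
    also have "\<dots> = 3 * a * ((a - b) * jb k)" by (simp add: algebra_simps)
    also have "\<dots> \<le> 3 * a * (c * b * jb (n - k))"
      using ab pos by (intro mult_left_mono) auto
    finally have "\<bar>a\<^sup>2 * freq k - b\<^sup>2 * freq n\<bar> \<le> (1 + 3 * c) * (jb (n - k) * b * a)"
      by (simp add: algebra_simps)
    also have "\<dots> \<le> comm_const p * (jb (n - k) * b * a)"
      using P by (intro mult_right_mono) (auto simp: comm_const_def c_def)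
    also have "\<dots> \<le> comm_const p * (jb (n - k) * b * a + h * jb k * a + h * b * jb n)"
      using P by (intro mult_left_mono) (auto simp: comm_const_def)
    finally show ?thesis by (simp add: a_def b_def h_def)
  next
    case False
    then have "jb n \<le> 2 * jb (n - k)" using jb_triangle[of n k] by linarith
    then have ah: "a \<le> 2 ^ p * h" unfolding a_def h_def by (intro admissible_scaled[OF W]) auto
    have "\<bar>a\<^sup>2 * freq k\<bar> \<le> a * a * jb k"
      using fk pos by (simp add: abs_mult power2_eq_square)
    also have "\<dots> \<le> (2 ^ p * h) * a * jb k" using ah pos by (intro mult_right_mono) auto
    finally have 1: "\<bar>a\<^sup>2 * freq k\<bar> \<le> 2 ^ p * (h * jb k * a)" by (simp add: mult_ac)
    have "\<bar>b\<^sup>2 * freq n\<bar> \<le> b * b * jb n"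
      using fn pos by (simp add: abs_mult power2_eq_square)
    also have "\<dots> \<le> (2 ^ p * h) * b * jb n" using ah ba pos by (intro mult_right_mono) auto
    finally have 2: "\<bar>b\<^sup>2 * freq n\<bar> \<le> 2 ^ p * (h * b * jb n)" by (simp add: mult_ac)
    have "\<bar>a\<^sup>2 * freq k - b\<^sup>2 * freq n\<bar> \<le> 2 ^ p * (h * jb k * a + h * b * jb n)"
      using 1 2 by (simp add: distrib_left)
    also have "\<dots> \<le> comm_const p * (h * jb k * a + h * b * jb n)"
      using P by (intro mult_right_mono) (auto simp: comm_const_def)
    also have "\<dots> \<le> comm_const p * (jb (n - k) * b * a + h * jb k * a + h * b * jb n)"
      using P by (intro mult_left_mono) (auto simp: comm_const_def)
    finally show ?thesis by (simp add: a_def b_def h_def)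
  qed
qed

text \<open>Exchanging n and k changes the sign of the symbol and permutes the terms of the
  bound.\<close>

lemma commutator_symbol:
  assumes W: "admissible p W"
  shows "\<bar>(W n)\<^sup>2 * freq k - (W k)\<^sup>2 * freq n\<bar> \<le> comm_const p *
     (jb (n - k) * W k * W n + W (n - k) * jb k * W n + W (n - k) * W k * jb n)"
proof (cases "jb k \<le> jb n")
  case False
  then have "\<bar>(W k)\<^sup>2 * freq n - (W n)\<^sup>2 * freq k\<bar> \<le> comm_const p *
     (jb (k - n) * W n * W k + W (k - n) * jb n * W k + W (k - n) * W n * jb k)"
    by (intro commutator_symbol_aux[OF W]) auto
  moreover have "W (k - n) = W (n - k)" using admissible_minus[OF W, of "n - k"] by simp
  ultimately show ?thesis by (simp add: abs_minus_commute jb_commute[of k n] mult_ac add_ac)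
qed (rule commutator_symbol_aux[OF W])

section \<open>Trilinear estimates\<close>

text \<open>Norm bounds are expressed, here and for l2, by bounds on all finite partial sums: no
  separate summability statement has to be carried along, and the bounds pass to limits taken
  coefficient by coefficient.\<close>

definition l1_le :: "(int \<Rightarrow> real) \<Rightarrow> real \<Rightarrow> bool" where
  "l1_le f A \<longleftrightarrow> (\<forall>F. finite F \<longrightarrow> sum f F \<le> A)"

definition l2_le :: "(int \<Rightarrow> real) \<Rightarrow> real \<Rightarrow> bool" where
  "l2_le f A \<longleftrightarrow> (\<forall>F. finite F \<longrightarrow> L2_set f F \<le> A)"

lemma l1_leD: "l1_le f A \<Longrightarrow> finite F \<Longrightarrow> sum f F \<le> A"
  unfolding l1_le_def by blast

lemma l2_leD: "l2_le g A \<Longrightarrow> finite F \<Longrightarrow> L2_set g F \<le> A"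
  unfolding l2_le_def by blast

lemma l1_le_nonneg: "l1_le f A \<Longrightarrow> 0 \<le> A"
  using l1_leD[of f A "{}"] by simp

lemma l2_le_nonneg: "l2_le f A \<Longrightarrow> 0 \<le> A"
  using l2_leD[of f A "{}"] by simp

lemma l1_le_mono: "l1_le g A \<Longrightarrow> (\<And>n. f n \<le> g n) \<Longrightarrow> A \<le> B \<Longrightarrow> l1_le f B"
  unfolding l1_le_def by (meson order_trans sum_mono)

lemma l2_le_mono:
  assumes "l2_le g A" "\<And>n. 0 \<le> f n" "\<And>n. f n \<le> g n" "A \<le> B" shows "l2_le f B"
  unfolding l2_le_def
proof (intro allI impI)
  fix F :: "int set" assume "finite F"
  have "L2_set f F \<le> L2_set g F" by (rule L2_set_mono) (use assms in auto)
  also have "\<dots> \<le> A" using assms(1) \<open>finite F\<close> by (rule l2_leD)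
  finally show "L2_set f F \<le> B" using assms(4) by simp
qed

lemma l2_le_add:
  assumes "l2_le f A" "l2_le g B" shows "l2_le (\<lambda>n. f n + g n) (A + B)"
  unfolding l2_le_def
  by (intro allI impI order_trans[OF L2_set_triangle_ineq] add_mono l2_leD assms)

lemma l2_le_mult:
  assumes "l2_le f A" "0 \<le> c" shows "l2_le (\<lambda>n. c * f n) (c * A)"
  unfolding l2_le_def
  by (intro allI impI) (simp add: L2_set_right_distrib[symmetric] assms mult_left_mono l2_leD)

lemma l2_le_point: "l2_le f A \<Longrightarrow> f n \<le> A"
  using l2_leD[of f A "{n}"] by (simp add: L2_set_def)

lemma l1_l2_product:
  assumes "l2_le f A" "l2_le g B" "\<And>n. 0 \<le> f n" "\<And>n. 0 \<le> g n"
  shows "l1_le (\<lambda>n. f n * g n) (A * B)"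
  unfolding l1_le_def
proof (intro allI impI)
  fix F :: "int set" assume F: "finite F"
  have "(\<Sum>n\<in>F. f n * g n) = (\<Sum>n\<in>F. \<bar>f n\<bar> * \<bar>g n\<bar>)" using assms by simp
  also have "\<dots> \<le> L2_set f F * L2_set g F" by (rule L2_set_mult_ineq)
  also have "\<dots> \<le> A * B" using F assms
    by (intro mult_mono l2_leD l2_le_nonneg[OF assms(1)]) (auto intro: L2_set_nonneg)
  finally show "(\<Sum>n\<in>F. f n * g n) \<le> A * B" .
qed

lemma L2_set_image: "inj_on p F \<Longrightarrow> L2_set (\<lambda>n. g (p n)) F = L2_set g (p ` F)"
  by (simp add: L2_set_def sum.reindex o_def)

lemma l2_le_comp_inj:
  assumes "l2_le g A" "inj p" shows "l2_le (\<lambda>n. g (p n)) A"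
  unfolding l2_le_def
  using assms by (auto simp: L2_set_image[OF inj_on_subset[OF assms(2)]] intro!: l2_leD)

context
  fixes f g h :: "int \<Rightarrow> real" and F G :: "int set" and A B C :: real
  assumes nn: "\<And>n. 0 \<le> f n" "\<And>n. 0 \<le> g n" "\<And>n. 0 \<le> h n" and fin: "finite F" "finite G"
begin

text \<open>Young's inequality. For a fixed difference m = n - k the Cauchy-Schwarz inequality
  bounds the sum over n, and the absolutely summable factor is summed over m at the end. The two
  lemmas after it place that factor at k and at n; the three terms of the commutator bound need one
  version each.\<close>

lemma trilinear_1:
  assumes f: "l1_le f A" and g: "l2_le g B" and h: "l2_le h C"
  shows "(\<Sum>n\<in>F. \<Sum>k\<in>G. f (n - k) * g k * h n) \<le> A * B * C"
proof -
  \<comment> \<open>All differences that occur, so that the inner sums over m share one finite range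
    and can be interchanged with the sum over n.\<close>
  define M where "M = (\<lambda>(n, k). n - k) ` (F \<times> G)"
  have M: "finite M" using fin by (simp add: M_def)
  have "(\<Sum>k\<in>G. f (n - k) * g k * h n) \<le> (\<Sum>m\<in>M. f m * (g (n - m) * h n))" if "n \<in> F" for n
  proof -
    have "(\<Sum>k\<in>G. f (n - k) * g k * h n) = (\<Sum>m\<in>(\<lambda>k. n - k) ` G. f m * (g (n - m) * h n))"
      by (subst sum.reindex) (auto simp: inj_on_def mult_ac)
    also have "\<dots> \<le> (\<Sum>m\<in>M. f m * (g (n - m) * h n))"
      using that nn M by (intro sum_mono2) (auto simp: M_def)
    finally show ?thesis .
  qed
  then have "(\<Sum>n\<in>F. \<Sum>k\<in>G. f (n - k) * g k * h n) \<le> (\<Sum>n\<in>F. \<Sum>m\<in>M. f m * (g (n - m) * h n))"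
    by (rule sum_mono)
  also have "\<dots> = (\<Sum>m\<in>M. f m * (\<Sum>n\<in>F. g (n - m) * h n))"
    by (subst sum.swap) (simp add: sum_distrib_left)
  also have "\<dots> \<le> (\<Sum>m\<in>M. f m * (B * C))"
  proof (intro sum_mono mult_left_mono nn)
    fix m
    have "l1_le (\<lambda>n. g (n - m) * h n) (B * C)"
      by (intro l1_l2_product l2_le_comp_inj[OF g] h nn) (auto simp: inj_def)
    then show "(\<Sum>n\<in>F. g (n - m) * h n) \<le> B * C" using fin by (intro l1_leD)
  qed
  also have "\<dots> \<le> A * (B * C)"
    unfolding sum_distrib_right[symmetric]
    by (intro mult_right_mono l1_leD[OF f] M mult_nonneg_nonneg l2_le_nonneg[OF g] l2_le_nonneg[OF h])
  finally show ?thesis by (simp add: mult.assoc)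
qed

lemma trilinear_2:
  assumes f: "l2_le f A" and g: "l1_le g B" and h: "l2_le h C"
  shows "(\<Sum>n\<in>F. \<Sum>k\<in>G. f (n - k) * g k * h n) \<le> A * B * C"
proof -
  have "(\<Sum>n\<in>F. \<Sum>k\<in>G. f (n - k) * g k * h n) = (\<Sum>k\<in>G. g k * (\<Sum>n\<in>F. f (n - k) * h n))"
    by (subst sum.swap) (simp add: sum_distrib_left mult_ac)
  also have "\<dots> \<le> (\<Sum>k\<in>G. g k * (A * C))"
  proof (intro sum_mono mult_left_mono nn)
    fix k
    have "l1_le (\<lambda>n. f (n - k) * h n) (A * C)"
      by (intro l1_l2_product l2_le_comp_inj[OF f] h nn) (auto simp: inj_def)
    then show "(\<Sum>n\<in>F. f (n - k) * h n) \<le> A * C" using fin by (intro l1_leD)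
  qed
  also have "\<dots> \<le> B * (A * C)"
    unfolding sum_distrib_right[symmetric]
    by (intro mult_right_mono l1_leD[OF g] fin mult_nonneg_nonneg l2_le_nonneg[OF f] l2_le_nonneg[OF h])
  finally show ?thesis by (simp add: mult_ac)
qed

lemma trilinear_3:
  assumes f: "l2_le f A" and g: "l2_le g B" and h: "l1_le h C"
  shows "(\<Sum>n\<in>F. \<Sum>k\<in>G. f (n - k) * g k * h n) \<le> A * B * C"
proof -
  have "(\<Sum>n\<in>F. \<Sum>k\<in>G. f (n - k) * g k * h n) = (\<Sum>n\<in>F. h n * (\<Sum>k\<in>G. f (n - k) * g k))"
    by (simp add: sum_distrib_left mult_ac)
  also have "\<dots> \<le> (\<Sum>n\<in>F. h n * (A * B))"
  proof (intro sum_mono mult_left_mono nn)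
    fix n
    have "l1_le (\<lambda>k. f (n - k) * g k) (A * B)"
      by (intro l1_l2_product l2_le_comp_inj[OF f] g nn) (auto simp: inj_def)
    then show "(\<Sum>k\<in>G. f (n - k) * g k) \<le> A * B" using fin by (intro l1_leD)
  qed
  also have "\<dots> \<le> C * (A * B)"
    unfolding sum_distrib_right[symmetric]
    by (intro mult_right_mono l1_leD[OF h] fin mult_nonneg_nonneg l2_le_nonneg[OF f] l2_le_nonneg[OF g])
  finally show ?thesis by (simp add: mult_ac)
qed

end

section \<open>The quadratic vector field in Fourier coefficients\<close>

definition conv :: "(int \<Rightarrow> complex) \<Rightarrow> (int \<Rightarrow> complex) \<Rightarrow> int \<Rightarrow> complex" where
  "conv f g n = (\<Sum>\<^sub>\<infinity>k. f (n - k) * g k)"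

definition dx :: "(int \<Rightarrow> complex) \<Rightarrow> int \<Rightarrow> complex" where
  "dx f n = \<i> * of_real (freq n) * f n"

text \<open>The right-hand side in polarised form: the nonlinearity is its value at equal arguments.
  In the transport and coupling terms the derivative falls on the second pair. Division by
  \<open>(jb n)\<^sup>2\<close> is the inverse of \<open>A\<close>.\<close>

definition Bu :: "(int \<Rightarrow> complex) \<Rightarrow> (int \<Rightarrow> complex) \<Rightarrow> (int \<Rightarrow> complex) \<Rightarrow> (int \<Rightarrow> complex) \<Rightarrow> int \<Rightarrow> complex" where
  "Bu u \<rho> v \<eta> n = - conv u (dx v) n
     - \<i> * of_real (freq n / (jb n)\<^sup>2) * (3/2 * conv u v n - conv \<rho> \<eta> n)
     - of_real (1 / (jb n)\<^sup>2) * conv \<rho> (dx v) n"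

definition Br :: "(int \<Rightarrow> complex) \<Rightarrow> (int \<Rightarrow> complex) \<Rightarrow> (int \<Rightarrow> complex) \<Rightarrow> (int \<Rightarrow> complex) \<Rightarrow> int \<Rightarrow> complex" where
  "Br u \<rho> v \<eta> n = - conv u (dx \<eta>) n - 2 * conv \<rho> (dx v) n"

definition hermitian :: "(int \<Rightarrow> complex) \<Rightarrow> bool" where
  "hermitian f \<longleftrightarrow> (\<forall>n. f (- n) = cnj (f n))"

definition supp_in :: "int set \<Rightarrow> (int \<Rightarrow> complex) \<Rightarrow> bool" where
  "supp_in F f \<longleftrightarrow> (\<forall>n. n \<notin> F \<longrightarrow> f n = 0)"

definition energy :: "int set \<Rightarrow> (int \<Rightarrow> real) \<Rightarrow> (int \<Rightarrow> complex) \<Rightarrow> (int \<Rightarrow> complex) \<Rightarrow> real" where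
  "energy F V u \<rho> = (\<Sum>n\<in>F. (jb n * V n * cmod (u n))\<^sup>2 + (V n * cmod (\<rho> n))\<^sup>2)"

lemma energy_nonneg: "0 \<le> energy F V u \<rho>"
  unfolding energy_def by (intro sum_nonneg) simp

lemma conv_finite:
  assumes "finite F" "supp_in F g" shows "conv f g n = (\<Sum>k\<in>F. f (n - k) * g k)"
proof -
  have "conv f g n = (\<Sum>\<^sub>\<infinity>k\<in>F. f (n - k) * g k)"
    unfolding conv_def by (rule infsum_cong_neutral) (use assms in \<open>auto simp: supp_in_def\<close>)
  then show ?thesis using assms by (simp add: infsum_finite)
qed

lemma supp_in_dx: "supp_in F f \<Longrightarrow> supp_in F (dx f)"
  by (simp add: supp_in_def dx_def)

lemma supp_in_diff: "supp_in F f \<Longrightarrow> supp_in F g \<Longrightarrow> supp_in F (\<lambda>n. f n - g n)"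
  by (simp add: supp_in_def)

lemma cmod_dx: "cmod (dx f n) \<le> jb n * cmod (f n)"
  using freq_le_jb[of n] by (simp add: dx_def norm_mult mult_right_mono)

lemma conv_finite_norm:
  assumes "finite F" "supp_in F g"
  shows "cmod (conv f g n) \<le> (\<Sum>k\<in>F. cmod (f (n - k)) * cmod (g k))"
  unfolding conv_finite[OF assms] by (rule order_trans[OF norm_sum]) (simp add: norm_mult)

section \<open>Energy estimates for finitely supported coefficients\<close>

text \<open>The real part of S is half of S plus its conjugate. Exchanging the two summation indices
  in the conjugate, where Hermitian symmetry turns \<open>cnj (u (k - n))\<close> into
  \<open>u (n - k)\<close>, leaves only the antisymmetrised multiplier.\<close>

lemma transport_symmetrized:
  fixes w :: "int \<Rightarrow> real"
  assumes u: "hermitian u" and F: "finite F" and v: "supp_in F v"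
  shows "\<bar>\<Sum>n\<in>F. w n * Re (cnj (v n) * conv u (dx v) n)\<bar> \<le>
    (\<Sum>n\<in>F. \<Sum>k\<in>F. \<bar>w n * freq k - w k * freq n\<bar> * cmod (u (n - k)) * cmod (v k) * cmod (v n))"
proof -
  define T where "T n k = of_real (w n) * (cnj (v n) * (u (n - k) * dx v k))" for n k
  define S where "S = (\<Sum>n\<in>F. \<Sum>k\<in>F. T n k)"
  have S: "(\<Sum>n\<in>F. w n * Re (cnj (v n) * conv u (dx v) n)) = Re S"
    unfolding S_def T_def conv_finite[OF F supp_in_dx[OF v]]
    by (simp add: sum_distrib_left Re_sum)
  have "cnj S = (\<Sum>n\<in>F. \<Sum>k\<in>F. cnj (T k n))"
    unfolding S_def by (subst sum.swap) simp
  then have "S + cnj S = (\<Sum>n\<in>F. \<Sum>k\<in>F. T n k + cnj (T k n))"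
    by (simp add: S_def sum.distrib)
  moreover have "T n k + cnj (T k n) =
      \<i> * of_real (w n * freq k - w k * freq n) * u (n - k) * v k * cnj (v n)" for n k
  proof -
    have "cnj (u (k - n)) = u (n - k)"
      using u[unfolded hermitian_def, rule_format, of "k - n"] by simp
    then show ?thesis by (simp add: T_def dx_def algebra_simps)
  qed
  ultimately have "S + cnj S =
      (\<Sum>n\<in>F. \<Sum>k\<in>F. \<i> * of_real (w n * freq k - w k * freq n) * u (n - k) * v k * cnj (v n))"
    by simp
  then have "cmod (S + cnj S) \<le>
      (\<Sum>n\<in>F. \<Sum>k\<in>F. cmod (\<i> * of_real (w n * freq k - w k * freq n) * u (n - k) * v k * cnj (v n)))"
    by (simp only:) (intro order_trans[OF norm_sum sum_mono] norm_sum)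
  moreover have "\<bar>Re S\<bar> \<le> cmod (S + cnj S)"
    by (simp add: complex_add_cnj norm_mult)
  ultimately show ?thesis unfolding S by (simp add: norm_mult del: of_real_diff of_real_mult)
qed

text \<open>In each term of the commutator bound \<open>jb\<close> falls on one factor, which is
  taken in l1, and W on the other two, which are taken in l2. The estimate is therefore linear in
  the l1 norms, whatever the order of the weight.\<close>

lemma transport_tame:
  assumes u: "hermitian u" and F: "finite F" and v: "supp_in F v" and W: "admissible p W"
    and "l1_le (\<lambda>n. jb n * cmod (u n)) A1" "l2_le (\<lambda>n. W n * cmod (u n)) A2"
    and "l1_le (\<lambda>n. jb n * cmod (v n)) B1" "l2_le (\<lambda>n. W n * cmod (v n)) B2"
  shows "\<bar>\<Sum>n\<in>F. (W n)\<^sup>2 * Re (cnj (v n) * conv u (dx v) n)\<bar> \<le> comm_const p * (A1 * B2 * B2 + 2 * (A2 * B1 * B2))"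
proof -
  have nn: "0 \<le> W n * c" "0 \<le> jb n * c" if "0 \<le> c" for n c
    using that less_imp_le[OF admissible_pos[OF W]] by auto
  have "(\<Sum>n\<in>F. \<Sum>k\<in>F. \<bar>(W n)\<^sup>2 * freq k - (W k)\<^sup>2 * freq n\<bar> * cmod (u (n - k)) * cmod (v k) * cmod (v n))
    \<le> (\<Sum>n\<in>F. \<Sum>k\<in>F. comm_const p *
     ((jb (n - k) * cmod (u (n - k))) * (W k * cmod (v k)) * (W n * cmod (v n))
    + (W (n - k) * cmod (u (n - k))) * (jb k * cmod (v k)) * (W n * cmod (v n))
    + (W (n - k) * cmod (u (n - k))) * (W k * cmod (v k)) * (jb n * cmod (v n))))"
  proof (intro sum_mono)
    fix n k
    have "\<bar>(W n)\<^sup>2 * freq k - (W k)\<^sup>2 * freq n\<bar> * (cmod (u (n - k)) * cmod (v k) * cmod (v n)) \<le>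
      (comm_const p * (jb (n - k) * W k * W n + W (n - k) * jb k * W n + W (n - k) * W k * jb n)) *
      (cmod (u (n - k)) * cmod (v k) * cmod (v n))"
      by (intro mult_right_mono commutator_symbol[OF W]) simp
    then show "\<bar>(W n)\<^sup>2 * freq k - (W k)\<^sup>2 * freq n\<bar> * cmod (u (n - k)) * cmod (v k) * cmod (v n) \<le>
     comm_const p *
     ((jb (n - k) * cmod (u (n - k))) * (W k * cmod (v k)) * (W n * cmod (v n))
    + (W (n - k) * cmod (u (n - k))) * (jb k * cmod (v k)) * (W n * cmod (v n))
    + (W (n - k) * cmod (u (n - k))) * (W k * cmod (v k)) * (jb n * cmod (v n)))"
      by (simp add: algebra_simps)
  qed
  also have "\<dots> = comm_const p *
      ((\<Sum>n\<in>F. \<Sum>k\<in>F. (jb (n - k) * cmod (u (n - k))) * (W k * cmod (v k)) * (W n * cmod (v n)))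
     + (\<Sum>n\<in>F. \<Sum>k\<in>F. (W (n - k) * cmod (u (n - k))) * (jb k * cmod (v k)) * (W n * cmod (v n)))
     + (\<Sum>n\<in>F. \<Sum>k\<in>F. (W (n - k) * cmod (u (n - k))) * (W k * cmod (v k)) * (jb n * cmod (v n))))"
    by (simp only: sum_distrib_left[symmetric] sum.distrib)
  also have "\<dots> \<le> comm_const p * (A1 * B2 * B2 + A2 * B1 * B2 + A2 * B2 * B1)"
    using assms(5-8) F nn
    by (intro mult_left_mono add_mono trilinear_1[where f="\<lambda>n. jb n * cmod (u n)"]
        trilinear_2[where f="\<lambda>n. W n * cmod (u n)"] trilinear_3[where f="\<lambda>n. W n * cmod (u n)"])
      (auto simp: comm_const_def)
  also have "\<dots> = comm_const p * (A1 * B2 * B2 + 2 * (A2 * B1 * B2))"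
    by (simp add: algebra_simps)
  finally show ?thesis by (rule order_trans[OF transport_symmetrized[OF u F v]])
qed

text \<open>A product estimate of Moser type, tested against e: quasi-subadditivity moves the weight
  onto one of the two factors while the other stays in l1.\<close>

lemma weighted_product:
  assumes V: "admissible p V" and F: "finite F"
    and "l1_le (\<lambda>n. cmod (a n)) A1" "l2_le (\<lambda>n. V n * cmod (a n)) A2"
    and "l1_le (\<lambda>n. cmod (b n)) B1" "l2_le (\<lambda>n. V n * cmod (b n)) B2"
    and e: "l2_le e E" "\<And>n. 0 \<le> e n"
  shows "(\<Sum>n\<in>F. V n * (\<Sum>k\<in>F. cmod (a (n - k)) * cmod (b k)) * e n) \<le> 2 ^ p * (A1 * B2 + A2 * B1) * E"
proof -
  have nn: "0 \<le> V n * c" if "0 \<le> c" for n c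
    using that less_imp_le[OF admissible_pos[OF V]] by auto
  have "(\<Sum>n\<in>F. V n * (\<Sum>k\<in>F. cmod (a (n - k)) * cmod (b k)) * e n) =
     (\<Sum>n\<in>F. \<Sum>k\<in>F. V n * (cmod (a (n - k)) * cmod (b k) * e n))"
    by (simp add: sum_distrib_left sum_distrib_right mult_ac)
  also have "\<dots> \<le> (\<Sum>n\<in>F. \<Sum>k\<in>F. 2 ^ p * (V (n - k) + V k) * (cmod (a (n - k)) * cmod (b k) * e n))"
    using e by (intro sum_mono mult_right_mono admissible_quasi_subadditive[OF V]) auto
  also have "\<dots> = (\<Sum>n\<in>F. \<Sum>k\<in>F. 2 ^ p * (cmod (a (n - k)) * (V k * cmod (b k)) * e n
       + (V (n - k) * cmod (a (n - k))) * cmod (b k) * e n))"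
    by (simp add: algebra_simps)
  also have "\<dots> = 2 ^ p * ((\<Sum>n\<in>F. \<Sum>k\<in>F. cmod (a (n - k)) * (V k * cmod (b k)) * e n)
       + (\<Sum>n\<in>F. \<Sum>k\<in>F. (V (n - k) * cmod (a (n - k))) * cmod (b k) * e n))"
    by (simp only: sum_distrib_left[symmetric] sum.distrib)
  also have "\<dots> \<le> 2 ^ p * (A1 * B2 * E + A2 * B1 * E)"
    using assms nn by (intro mult_left_mono add_mono trilinear_1[where f="\<lambda>n. cmod (a n)"]
        trilinear_2[where f="\<lambda>n. V n * cmod (a n)"]) auto
  finally show ?thesis by (simp add: algebra_simps)
qed

lemma abs_weighted_Re_le:
  assumes "\<And>n. n \<in> F \<Longrightarrow> cmod (z' n) \<le> m' n" "\<And>n. n \<in> F \<Longrightarrow> \<bar>c' n\<bar> \<le> c n"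
  shows "\<bar>\<Sum>n\<in>F. c' n * Re (cnj (x n) * z' n)\<bar> \<le> (\<Sum>n\<in>F. c n * (cmod (x n) * m' n))"
proof (rule order_trans[OF sum_abs], rule sum_mono)
  fix n assume n: "n \<in> F"
  have "\<bar>Re (cnj (x n) * z' n)\<bar> \<le> cmod (cnj (x n) * z' n)" by (rule abs_Re_le_cmod)
  also have "\<dots> \<le> cmod (x n) * m' n" using assms(1)[OF n] by (simp add: norm_mult mult_left_mono)
  finally show "\<bar>c' n * Re (cnj (x n) * z' n)\<bar> \<le> c n * (cmod (x n) * m' n)"
    unfolding abs_mult using assms(2)[OF n] by (intro mult_mono) auto
qed

lemma l2_le_supp:
  assumes "finite F" "\<And>n. n \<notin> F \<Longrightarrow> f n = 0" "(\<Sum>n\<in>F. (f n)\<^sup>2) \<le> E"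
  shows "l2_le f (sqrt E)"
  unfolding l2_le_def L2_set_def
proof (intro allI impI real_sqrt_le_mono)
  fix G :: "int set" assume G: "finite G"
  have "(\<Sum>n\<in>G. (f n)\<^sup>2) = (\<Sum>n\<in>G \<inter> F. (f n)\<^sup>2)"
    using assms(2) G by (intro sum.mono_neutral_right) auto
  also have "\<dots> \<le> (\<Sum>n\<in>F. (f n)\<^sup>2)" using assms(1) by (intro sum_mono2) auto
  finally show "(\<Sum>n\<in>G. (f n)\<^sup>2) \<le> E" using assms(3) by simp
qed

lemma energy_l2:
  assumes F: "finite F" and u: "supp_in F u" "supp_in F \<rho>"
  shows "l2_le (\<lambda>n. jb n * V n * cmod (u n)) (sqrt (energy F V u \<rho>))"
    and "l2_le (\<lambda>n. V n * cmod (\<rho> n)) (sqrt (energy F V u \<rho>))"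
proof -
  show "l2_le (\<lambda>n. jb n * V n * cmod (u n)) (sqrt (energy F V u \<rho>))"
    using F u by (intro l2_le_supp) (auto simp: supp_in_def energy_def intro!: sum_mono)
  show "l2_le (\<lambda>n. V n * cmod (\<rho> n)) (sqrt (energy F V u \<rho>))"
    using F u by (intro l2_le_supp) (auto simp: supp_in_def energy_def intro!: sum_mono)
qed

text \<open>The derivative of \<open>energy\<close> when the state moves with velocity (du,
  d\<rho>). Being twice a real inner product, it is also used as a bilinear form apart from any
  flow.\<close>

definition energy_rate :: "int set \<Rightarrow> (int \<Rightarrow> real) \<Rightarrow> (int \<Rightarrow> complex) \<Rightarrow> (int \<Rightarrow> complex) \<Rightarrow>
    (int \<Rightarrow> complex) \<Rightarrow> (int \<Rightarrow> complex) \<Rightarrow> real" where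
  "energy_rate F V u \<rho> du d\<rho> = 2 * (\<Sum>n\<in>F. (jb n * V n)\<^sup>2 * Re (cnj (u n) * du n))
     + 2 * (\<Sum>n\<in>F. (V n)\<^sup>2 * Re (cnj (\<rho> n) * d\<rho> n))"

text \<open>Each of the two transport sums costs three commutator constants, and the product sums
  cost 11 * 2^p together. The chain rule doubles everything; the resulting 22 is rounded up to
  24.\<close>

definition tame_const :: "nat \<Rightarrow> real" where
  "tame_const p = 6 * comm_const (Suc p) + 6 * comm_const p + 24 * 2 ^ p"

text \<open>The factor \<open>(jb n)\<^sup>2\<close> in the u energy cancels the symbol of the
  inverse of \<open>A\<close>, so the nonlocal terms keep the weight \<open>(V n)\<^sup>2\<close>
  with at most one factor \<open>freq n\<close>.\<close>

lemma energy_rate_Bu_Br: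
  "energy_rate F V w r (Bu u \<rho> v \<eta>) (Br u \<rho> v \<eta>) =
    2 * (- (\<Sum>n\<in>F. (jb n * V n)\<^sup>2 * Re (cnj (w n) * conv u (dx v) n))
      + 3/2 * (\<Sum>n\<in>F. freq n * (V n)\<^sup>2 * Re (cnj (w n) * (- \<i> * conv u v n)))
      - (\<Sum>n\<in>F. freq n * (V n)\<^sup>2 * Re (cnj (w n) * (- \<i> * conv \<rho> \<eta> n)))
      - (\<Sum>n\<in>F. (V n)\<^sup>2 * Re (cnj (w n) * conv \<rho> (dx v) n))
      - (\<Sum>n\<in>F. (V n)\<^sup>2 * Re (cnj (r n) * conv u (dx \<eta>) n))
      - 2 * (\<Sum>n\<in>F. (V n)\<^sup>2 * Re (cnj (r n) * conv \<rho> (dx v) n)))"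
proof -
  have aux: "Re (c * (- C1 - \<i> * of_real a * (3/2 * C2 - C3) - of_real b * C4)) =
      - Re (c * C1) + a * (3/2 * Re (c * (- \<i> * C2)) - Re (c * (- \<i> * C3))) - b * Re (c * C4)"
    for c C1 C2 C3 C4 :: complex and a b by (simp add: field_simps)
  have 0: "(jb n * V n)\<^sup>2 * (freq n / (jb n)\<^sup>2 * (3/2 * x - y)) = 3/2 * (freq n * (V n)\<^sup>2 * x) - freq n * (V n)\<^sup>2 * y" for n x y
  proof -
    have "(jb n * V n)\<^sup>2 * (freq n / (jb n)\<^sup>2 * (3/2 * x - y)) = freq n * (V n)\<^sup>2 * (3/2 * x - y)"
      by (simp add: power_mult_distrib)
    then show ?thesis by (simp add: algebra_simps)
  qed
  have 1: "(jb n * V n)\<^sup>2 * Re (cnj (w n) * Bu u \<rho> v \<eta> n) =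
      - ((jb n * V n)\<^sup>2 * Re (cnj (w n) * conv u (dx v) n))
      + 3/2 * (freq n * (V n)\<^sup>2 * Re (cnj (w n) * (- \<i> * conv u v n)))
      - (freq n * (V n)\<^sup>2 * Re (cnj (w n) * (- \<i> * conv \<rho> \<eta> n)))
      - ((V n)\<^sup>2 * Re (cnj (w n) * conv \<rho> (dx v) n))" for n
    unfolding Bu_def aux distrib_left right_diff_distrib[of "(jb n * V n)\<^sup>2"] 0
    by (simp add: power_mult_distrib algebra_simps)
  have 2: "(V n)\<^sup>2 * Re (cnj (r n) * Br u \<rho> v \<eta> n) =
      - ((V n)\<^sup>2 * Re (cnj (r n) * conv u (dx \<eta>) n))
      - 2 * ((V n)\<^sup>2 * Re (cnj (r n) * conv \<rho> (dx v) n))" for n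
    unfolding Br_def by (simp add: algebra_simps)
  show ?thesis unfolding energy_rate_def 1 2
    by (simp only: sum.distrib sum_subtractf sum_negf sum_distrib_left[symmetric]) (simp add: algebra_simps)
qed

lemma l1_le_jbD:
  assumes "l1_le (\<lambda>n. jb n * cmod (f n)) A"
  shows "l1_le (\<lambda>n. cmod (f n)) A" "l1_le (\<lambda>n. cmod (dx f n)) A"
proof -
  have "cmod (f n) \<le> jb n * cmod (f n)" for n
    using mult_right_mono[OF jb_ge_1, of "cmod (f n)" n] by simp
  then show "l1_le (\<lambda>n. cmod (f n)) A" by (intro l1_le_mono[OF assms]) auto
  show "l1_le (\<lambda>n. cmod (dx f n)) A" by (intro l1_le_mono[OF assms] cmod_dx) auto
qed

lemma abs_combination_le:
  fixes x1 x2 x3 x4 x5 x6 :: real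
  assumes "\<bar>x1\<bar> \<le> y1" "\<bar>x2\<bar> \<le> y2" "\<bar>x3\<bar> \<le> y3" "\<bar>x4\<bar> \<le> y4" "\<bar>x5\<bar> \<le> y5" "\<bar>x6\<bar> \<le> y6"
  shows "\<bar>2 * (- x1 + 3/2 * x2 - x3 - x4 - x5 - 2 * x6)\<bar> \<le> 2 * (y1 + 3/2 * y2 + y3 + y4 + y5 + 2 * y6)"
  using assms unfolding abs_le_iff by argo

text \<open>The transport sums are commutators. In the other sums one factor \<open>V n\<close> goes
  to the test component and one to the product. A factor \<open>freq n\<close> is absorbed by the
  extra \<open>jb n\<close> of the u energy, and \<open>dx u\<close> is bounded by the energy in the
  same weight as \<rho>, so the coupling terms lose nothing.\<close>

lemma tame_energy_estimate:
  assumes F: "finite F" and V: "admissible p V" and u: "hermitian u" "supp_in F u" and r: "supp_in F \<rho>"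
    and A: "l1_le (\<lambda>n. jb n * cmod (u n)) A" "l1_le (\<lambda>n. jb n * cmod (\<rho> n)) A"
  shows "\<bar>energy_rate F V u \<rho> (Bu u \<rho> u \<rho>) (Br u \<rho> u \<rho>)\<bar> \<le> tame_const p * A * energy F V u \<rho>"
proof -
  define X where "X = sqrt (energy F V u \<rho>)"
  have X2: "X * X = energy F V u \<rho>" by (simp add: X_def energy_nonneg)
  have Vn: "0 \<le> V n" for n using admissible_pos[OF V, of n] by simp
  have le_jb: "x \<le> jb n * x" if "0 \<le> x" for x n
    using mult_right_mono[OF jb_ge_1 that] by simp
  note W = admissible_mult_jb[OF V]
  have WuX: "l2_le (\<lambda>n. jb n * V n * cmod (u n)) X" and VrX: "l2_le (\<lambda>n. V n * cmod (\<rho> n)) X"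
    using energy_l2[OF F u(2) r] by (auto simp: X_def)
  have VuX: "l2_le (\<lambda>n. V n * cmod (u n)) X"
    by (rule l2_le_mono[OF WuX]) (auto simp: Vn mult.assoc intro!: le_jb mult_nonneg_nonneg)
  have VdX: "l2_le (\<lambda>n. V n * cmod (dx u n)) X"
  proof (rule l2_le_mono[OF WuX])
    fix n show "V n * cmod (dx u n) \<le> jb n * V n * cmod (u n)"
      using mult_left_mono[OF cmod_dx[of u n] Vn[of n]] by (simp add: mult_ac)
  qed (auto simp: Vn)
  have uA: "l1_le (\<lambda>n. cmod (u n)) A" and rA: "l1_le (\<lambda>n. cmod (\<rho> n)) A" and dA: "l1_le (\<lambda>n. cmod (dx u n)) A"
    by (intro l1_le_jbD A)+
  define T where "T = A * (X * X)"
  have T0: "0 \<le> T" unfolding T_def X2 using l1_le_nonneg[OF uA] by (simp add: energy_nonneg)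
  have t1: "\<bar>\<Sum>n\<in>F. (jb n * V n)\<^sup>2 * Re (cnj (u n) * conv u (dx u) n)\<bar> \<le> 3 * comm_const (Suc p) * T"
    using transport_tame[OF u(1) F u(2) W A(1) WuX A(1) WuX] by (simp add: T_def algebra_simps)
  have t4: "\<bar>\<Sum>n\<in>F. (V n)\<^sup>2 * Re (cnj (\<rho> n) * conv u (dx \<rho>) n)\<bar> \<le> 3 * comm_const p * T"
    using transport_tame[OF u(1) F r V A(1) VuX A(2) VrX] by (simp add: T_def algebra_simps)
  have prod: "\<bar>\<Sum>n\<in>F. (V n)\<^sup>2 * Re (cnj (e n) * conv a b n)\<bar> \<le> 2 * 2 ^ p * T"
    if "l1_le (\<lambda>n. cmod (a n)) A" "l2_le (\<lambda>n. V n * cmod (a n)) X"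
      "l1_le (\<lambda>n. cmod (b n)) A" "l2_le (\<lambda>n. V n * cmod (b n)) X"
      "l2_le (\<lambda>n. V n * cmod (e n)) X" "supp_in F b" for a b e
  proof -
    have "\<bar>\<Sum>n\<in>F. (V n)\<^sup>2 * Re (cnj (e n) * conv a b n)\<bar> \<le>
      (\<Sum>n\<in>F. (V n)\<^sup>2 * (cmod (e n) * (\<Sum>k\<in>F. cmod (a (n - k)) * cmod (b k))))"
      by (intro abs_weighted_Re_le conv_finite_norm F that) simp
    also have "\<dots> = (\<Sum>n\<in>F. V n * (\<Sum>k\<in>F. cmod (a (n - k)) * cmod (b k)) * (V n * cmod (e n)))"
      by (simp add: power2_eq_square mult_ac)
    also have "\<dots> \<le> 2 ^ p * (A * X + X * A) * X"
      by (intro weighted_product[OF V F] that) (simp add: Vn)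
    also have "\<dots> = 2 * 2 ^ p * T" by (simp add: T_def algebra_simps)
    finally show ?thesis .
  qed
  have prod': "\<bar>\<Sum>n\<in>F. freq n * (V n)\<^sup>2 * Re (cnj (u n) * (- \<i> * conv a b n))\<bar> \<le> 2 * 2 ^ p * T"
    if "l1_le (\<lambda>n. cmod (a n)) A" "l2_le (\<lambda>n. V n * cmod (a n)) X"
      "l1_le (\<lambda>n. cmod (b n)) A" "l2_le (\<lambda>n. V n * cmod (b n)) X" "supp_in F b" for a b
  proof -
    have "\<bar>\<Sum>n\<in>F. freq n * (V n)\<^sup>2 * Re (cnj (u n) * (- \<i> * conv a b n))\<bar> \<le>
      (\<Sum>n\<in>F. jb n * (V n)\<^sup>2 * (cmod (u n) * (\<Sum>k\<in>F. cmod (a (n - k)) * cmod (b k))))"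
    proof (rule abs_weighted_Re_le)
      show "cmod (- \<i> * conv a b n) \<le> (\<Sum>k\<in>F. cmod (a (n - k)) * cmod (b k))" for n
        using conv_finite_norm[OF F that(5), of a n] by (simp add: norm_mult)
      show "\<bar>freq n * (V n)\<^sup>2\<bar> \<le> jb n * (V n)\<^sup>2" for n
        using freq_le_jb[of n] by (simp add: abs_mult mult_right_mono)
    qed
    also have "\<dots> = (\<Sum>n\<in>F. V n * (\<Sum>k\<in>F. cmod (a (n - k)) * cmod (b k)) * (jb n * V n * cmod (u n)))"
      by (simp add: power2_eq_square mult_ac)
    also have "\<dots> \<le> 2 ^ p * (A * X + X * A) * X"
      by (intro weighted_product[OF V F] that WuX) (simp add: Vn)
    also have "\<dots> = 2 * 2 ^ p * T" by (simp add: T_def algebra_simps)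
    finally show ?thesis .
  qed
  have "\<bar>energy_rate F V u \<rho> (Bu u \<rho> u \<rho>) (Br u \<rho> u \<rho>)\<bar> \<le>
     2 * (3 * comm_const (Suc p) * T + 3/2 * (2 * 2 ^ p * T) + 2 * 2 ^ p * T + 2 * 2 ^ p * T
       + 3 * comm_const p * T + 2 * (2 * 2 ^ p * T))"
    unfolding energy_rate_Bu_Br
    by (rule abs_combination_le[OF t1 prod'[OF uA VuX uA VuX u(2)] prod'[OF rA VrX rA VrX r]
        prod[OF rA VrX dA VdX VuX supp_in_dx[OF u(2)]] t4 prod[OF rA VrX dA VdX VrX supp_in_dx[OF u(2)]]])
  also have "\<dots> \<le> tame_const p * T"
  proof -
    have "0 \<le> T * 2 ^ p" using T0 by simp
    moreover have "tame_const p * T = 6 * (comm_const (Suc p) * T) + 6 * (comm_const p * T) + 24 * (T * 2 ^ p)"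
      by (simp add: tame_const_def distrib_right)
    ultimately show ?thesis by simp
  qed
  finally show ?thesis by (simp only: T_def X2 mult.assoc)
qed

section \<open>Polarisation and the low estimate for differences\<close>

definition square_summable :: "(int \<Rightarrow> complex) \<Rightarrow> bool" where
  "square_summable f \<longleftrightarrow> (\<exists>A. l2_le (\<lambda>n. cmod (f n)) A)"

lemma square_summable_supp: "finite F \<Longrightarrow> supp_in F f \<Longrightarrow> square_summable f"
  unfolding square_summable_def by (rule exI, rule l2_le_supp[OF _ _ order_refl]) (auto simp: supp_in_def)

lemma square_summable_diff:
  assumes "square_summable f" "square_summable g" shows "square_summable (\<lambda>n. f n - g n)"
proof -
  obtain A B where "l2_le (\<lambda>n. cmod (f n)) A" "l2_le (\<lambda>n. cmod (g n)) B"
    using assms by (auto simp: square_summable_def)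
  then have "l2_le (\<lambda>n. cmod (f n) + cmod (g n)) (A + B)" by (rule l2_le_add)
  then have "l2_le (\<lambda>n. cmod (f n - g n)) (A + B)"
    by (rule l2_le_mono) (auto intro: norm_triangle_ineq4)
  then show ?thesis by (auto simp: square_summable_def)
qed

lemma conv_abs_summable:
  assumes "l2_le (\<lambda>n. cmod (f n)) A" "l2_le (\<lambda>n. cmod (g n)) B"
  shows "(\<lambda>k. cmod (f (n - k) * g k)) summable_on UNIV"
    and "(\<Sum>\<^sub>\<infinity>k. cmod (f (n - k) * g k)) \<le> A * B"
proof -
  have 1: "l1_le (\<lambda>k. cmod (f (n - k)) * cmod (g k)) (A * B)"
    by (intro l1_l2_product l2_le_comp_inj[OF assms(1)] assms) (auto simp: inj_def)
  then show 2: "(\<lambda>k. cmod (f (n - k) * g k)) summable_on UNIV"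
    by (intro nonneg_bdd_above_summable_on bdd_aboveI2[where M = "A * B"]) (auto simp: norm_mult l1_le_def)
  show "(\<Sum>\<^sub>\<infinity>k. cmod (f (n - k) * g k)) \<le> A * B"
    using 1 by (intro infsum_le_finite_sums 2) (auto simp: norm_mult l1_le_def)
qed

lemma conv_summable:
  assumes "square_summable f" "square_summable g"
  shows "(\<lambda>k. f (n - k) * g k) summable_on UNIV"
proof -
  obtain A B where "l2_le (\<lambda>n. cmod (f n)) A" "l2_le (\<lambda>n. cmod (g n)) B"
    using assms by (auto simp: square_summable_def)
  from conv_abs_summable(1)[OF this] show ?thesis by (rule abs_summable_summable)
qed

lemma conv_diff:
  assumes "square_summable a" "square_summable b" "square_summable c" "square_summable d"
  shows "conv a b n - conv c d n = conv a (\<lambda>n. b n - d n) n + conv (\<lambda>n. a n - c n) d n"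
proof -
  have "(\<Sum>\<^sub>\<infinity>k. a (n - k) * (b k - d k) + a (n - k) * d k)
      = conv a (\<lambda>n. b n - d n) n + conv a d n"
    unfolding conv_def by (intro infsum_add conv_summable[of a "\<lambda>n. b n - d n"] conv_summable assms square_summable_diff)
  then have "conv a b n = conv a (\<lambda>n. b n - d n) n + conv a d n"
    by (simp add: conv_def right_diff_distrib)
  moreover
  have "(\<Sum>\<^sub>\<infinity>k. (a (n - k) - c (n - k)) * d k + c (n - k) * d k)
      = conv (\<lambda>n. a n - c n) d n + conv c d n"
    unfolding conv_def by (intro infsum_add conv_summable[of "\<lambda>n. a n - c n"] conv_summable assms square_summable_diff)
  then have "conv a d n = conv (\<lambda>n. a n - c n) d n + conv c d n"
    by (simp add: conv_def left_diff_distrib)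
  ultimately show ?thesis by simp
qed

lemma dx_diff: "dx (\<lambda>n. a n - b n) = (\<lambda>n. dx a n - dx b n)"
  by (simp add: dx_def fun_eq_iff algebra_simps)

text \<open>The identity B(z,z) - B(y,y) = B(z,z-y) + B(z-y,y). In the first summand the difference
  is transported by a solution, which a commutator handles; in the second the derivative falls on
  the other solution and not on the difference.\<close>

lemma Bu_Br_diff:
  assumes s: "square_summable a" "square_summable \<alpha>" "square_summable b" "square_summable \<beta>"
    "square_summable (dx a)" "square_summable (dx \<alpha>)" "square_summable (dx b)" "square_summable (dx \<beta>)"
  defines "w \<equiv> \<lambda>n. a n - b n" and "r \<equiv> \<lambda>n. \<alpha> n - \<beta> n"
  shows "Bu a \<alpha> a \<alpha> n - Bu b \<beta> b \<beta> n = Bu a \<alpha> w r n + Bu w r b \<beta> n"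
    and "Br a \<alpha> a \<alpha> n - Br b \<beta> b \<beta> n = Br a \<alpha> w r n + Br w r b \<beta> n"
proof -
  note [simp] = s
  have c: "conv x y n = conv x (\<lambda>n. y n - y' n) n + conv (\<lambda>n. x n - x' n) y' n + conv x' y' n"
    if "square_summable x" "square_summable y" "square_summable x'" "square_summable y'" for x y x' y'
    using conv_diff[OF that(1,2,3,4), of n] by (simp add: algebra_simps)
  have 1: "conv a (dx a) n = conv a (dx w) n + conv w (dx b) n + conv b (dx b) n"
    using c[of a "dx a" b "dx b"] by (simp add: w_def dx_diff)
  have 2: "conv a a n = conv a w n + conv w b n + conv b b n"
    using c[of a a b b] by (simp add: w_def)
  have 3: "conv \<alpha> \<alpha> n = conv \<alpha> r n + conv r \<beta> n + conv \<beta> \<beta> n"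
    using c[of \<alpha> \<alpha> \<beta> \<beta>] by (simp add: r_def)
  have 4: "conv \<alpha> (dx a) n = conv \<alpha> (dx w) n + conv r (dx b) n + conv \<beta> (dx b) n"
    using c[of \<alpha> "dx a" \<beta> "dx b"] by (simp add: w_def r_def dx_diff)
  have 5: "conv a (dx \<alpha>) n = conv a (dx r) n + conv w (dx \<beta>) n + conv b (dx \<beta>) n"
    using c[of a "dx \<alpha>" b "dx \<beta>"] by (simp add: w_def r_def dx_diff)
  show "Bu a \<alpha> a \<alpha> n - Bu b \<beta> b \<beta> n = Bu a \<alpha> w r n + Bu w r b \<beta> n"
    unfolding Bu_def 1 2 3 4 by (simp add: algebra_simps add_divide_distrib)
  show "Br a \<alpha> a \<alpha> n - Br b \<beta> b \<beta> n = Br a \<alpha> w r n + Br w r b \<beta> n"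
    unfolding Br_def 4 5 by (simp add: algebra_simps)
qed

lemma energy_rate_add:
  "energy_rate F V w r (\<lambda>n. x n + y n) (\<lambda>n. x' n + y' n) = energy_rate F V w r x x' + energy_rate F V w r y y'"
  unfolding energy_rate_def by (simp add: algebra_simps sum.distrib)

text \<open>No l1 bound is available for the differences w and r, so \<open>transport_tame\<close>
  is of no use: every term has to put l1 on a solution and l2 on the differences. The hypotheses on
  a and b are asymmetric because a only transports while b is differentiated.\<close>

lemma low_energy_estimate:
  assumes F: "finite F" and s: "supp_in F a" "supp_in F \<alpha>" "supp_in F b" "supp_in F \<beta>" and a: "hermitian a"
    and A: "l1_le (\<lambda>n. jb n * cmod (a n)) A" "l1_le (\<lambda>n. cmod (\<alpha> n)) A"
      "l1_le (\<lambda>n. (jb n)\<^sup>2 * cmod (b n)) A" "l1_le (\<lambda>n. jb n * cmod (\<beta> n)) A"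
  defines "w \<equiv> \<lambda>n. a n - b n" and "r \<equiv> \<lambda>n. \<alpha> n - \<beta> n"
  shows "\<bar>energy_rate F (\<lambda>_. 1) w r (\<lambda>n. Bu a \<alpha> a \<alpha> n - Bu b \<beta> b \<beta> n) (\<lambda>n. Br a \<alpha> a \<alpha> n - Br b \<beta> b \<beta> n)\<bar>
     \<le> 40 * A * energy F (\<lambda>_. 1) w r"
proof -
  have sw: "supp_in F w" "supp_in F r" using s by (simp_all add: w_def r_def supp_in_diff)
  define X where "X = sqrt (energy F (\<lambda>_. 1) w r)"
  have X2: "X * X = energy F (\<lambda>_. 1) w r" by (simp add: X_def energy_nonneg)
  have le_jb: "x \<le> jb n * x" if "0 \<le> x" for x n
    using mult_right_mono[OF jb_ge_1 that] by simp
  have JwX: "l2_le (\<lambda>n. jb n * cmod (w n)) X" and rX: "l2_le (\<lambda>n. cmod (r n)) X"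
    using energy_l2[OF F sw, of "\<lambda>_. 1"] by (auto simp: X_def)
  have wX: "l2_le (\<lambda>n. cmod (w n)) X"
    by (rule l2_le_mono[OF JwX]) (auto intro: le_jb)
  have dwX: "l2_le (\<lambda>n. cmod (dx w n)) X"
    by (rule l2_le_mono[OF JwX]) (auto intro: cmod_dx)
  have JbA: "l1_le (\<lambda>n. jb n * cmod (b n)) A"
    by (rule l1_le_mono[OF A(3)]) (auto simp: power2_eq_square mult.assoc intro: le_jb)
  have aA: "l1_le (\<lambda>n. cmod (a n)) A" and bA: "l1_le (\<lambda>n. cmod (b n)) A" and \<beta>A: "l1_le (\<lambda>n. cmod (\<beta> n)) A"
    and dbA: "l1_le (\<lambda>n. cmod (dx b n)) A" and d\<beta>A: "l1_le (\<lambda>n. cmod (dx \<beta> n)) A"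
    by (intro l1_le_jbD A JbA)+
  define T where "T = A * (X * X)"
  have T0: "0 \<le> T" unfolding T_def X2 using l1_le_nonneg[OF aA] by (simp add: energy_nonneg)
  have t1: "\<bar>\<Sum>n\<in>F. (jb n)\<^sup>2 * Re (cnj (w n) * conv a (dx w) n)\<bar> \<le> 2 * T"
  proof -
    \<comment> \<open>For the weight \<open>jb\<close> the commutator factors exactly, with
      \<open>freq (n - k)\<close> in front, so that the difference frequency falls on the
      transporting coefficient alone.\<close>
    have b: "\<bar>(jb n)\<^sup>2 * freq k - (jb k)\<^sup>2 * freq n\<bar> \<le> 2 * jb (n - k) * jb k * jb n" for n k
    proof -
      have "(jb n)\<^sup>2 * freq k - (jb k)\<^sup>2 * freq n = - freq (n - k) * (1 - freq n * freq k)"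
        unfolding jb_square by (simp add: freq_diff power2_eq_square algebra_simps)
      also have "\<bar>\<dots>\<bar> \<le> jb (n - k) * (2 * (jb k * jb n))"
        unfolding abs_mult
      proof (intro mult_mono)
        have "\<bar>freq n\<bar> * \<bar>freq k\<bar> \<le> jb n * jb k" by (intro mult_mono freq_le_jb) auto
        moreover have "1 \<le> jb n * jb k" using mult_mono[OF jb_ge_1[of n] jb_ge_1[of k]] by simp
        ultimately show "\<bar>1 - freq n * freq k\<bar> \<le> 2 * (jb k * jb n)"
          unfolding abs_mult[symmetric] by (simp add: mult.commute)
      qed (auto simp: freq_le_jb)
      finally show ?thesis by (simp add: mult_ac)
    qed
    have *: "\<bar>(jb n)\<^sup>2 * freq k - (jb k)\<^sup>2 * freq n\<bar> * cmod (a (n - k)) * cmod (w k) * cmod (w n) \<le>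
       2 * ((jb (n - k) * cmod (a (n - k))) * (jb k * cmod (w k)) * (jb n * cmod (w n)))" for n k
      using mult_right_mono[OF b[of n k], of "cmod (a (n - k)) * cmod (w k) * cmod (w n)"]
      by (simp add: mult_ac)
    have "\<bar>\<Sum>n\<in>F. (jb n)\<^sup>2 * Re (cnj (w n) * conv a (dx w) n)\<bar> \<le>
        (\<Sum>n\<in>F. \<Sum>k\<in>F. 2 * ((jb (n - k) * cmod (a (n - k))) * (jb k * cmod (w k)) * (jb n * cmod (w n))))"
      by (intro order_trans[OF transport_symmetrized[OF a F sw(1)]] sum_mono *)
    also have "\<dots> \<le> 2 * (A * X * X)"
      unfolding sum_distrib_left[symmetric]
      by (intro mult_left_mono trilinear_1[where f="\<lambda>n. jb n * cmod (a n)"] A JwX F) auto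
    finally show ?thesis by (simp add: T_def)
  qed
  have t4: "\<bar>\<Sum>n\<in>F. Re (cnj (r n) * conv a (dx r) n)\<bar> \<le> T"
  proof -
    have *: "\<bar>1 * freq k - 1 * freq n\<bar> * cmod (a (n - k)) * cmod (r k) * cmod (r n) \<le>
       (jb (n - k) * cmod (a (n - k))) * cmod (r k) * cmod (r n)" for n k
      using freq_le_jb[of "n - k"] by (intro mult_right_mono) (auto simp: freq_diff)
    have "\<bar>\<Sum>n\<in>F. 1 * Re (cnj (r n) * conv a (dx r) n)\<bar> \<le>
        (\<Sum>n\<in>F. \<Sum>k\<in>F. (jb (n - k) * cmod (a (n - k))) * cmod (r k) * cmod (r n))"
      by (intro order_trans[OF transport_symmetrized[OF a F sw(2)]] sum_mono *)
    also have "\<dots> \<le> A * X * X"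
      by (intro trilinear_1[where f="\<lambda>n. jb n * cmod (a n)"] A rX F) auto
    finally show ?thesis by (simp add: T_def)
  qed
  have bnd: "\<bar>\<Sum>n\<in>F. c n * Re (cnj (e n) * (z * conv x y n))\<bar> \<le> T"
    if "l1_le (\<lambda>n. cmod (x n)) A \<and> l2_le (\<lambda>n. cmod (y n)) X \<or> l2_le (\<lambda>n. cmod (x n)) X \<and> l1_le (\<lambda>n. cmod (y n)) A"
      and e: "l2_le (\<lambda>n. \<bar>c n\<bar> * cmod (e n)) X" and y: "supp_in F y" and z: "cmod z = 1" for x y e c z
  proof -
    have "\<bar>\<Sum>n\<in>F. c n * Re (cnj (e n) * (z * conv x y n))\<bar> \<le>
        (\<Sum>n\<in>F. \<bar>c n\<bar> * (cmod (e n) * (\<Sum>k\<in>F. cmod (x (n - k)) * cmod (y k))))"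
      using z by (intro abs_weighted_Re_le) (auto simp: norm_mult intro: conv_finite_norm F y)
    also have "\<dots> = (\<Sum>n\<in>F. \<Sum>k\<in>F. cmod (x (n - k)) * cmod (y k) * (\<bar>c n\<bar> * cmod (e n)))"
      by (simp add: sum_distrib_left mult_ac)
    also have "\<dots> \<le> A * X * X"
      using that(1)
    proof
      assume "l1_le (\<lambda>n. cmod (x n)) A \<and> l2_le (\<lambda>n. cmod (y n)) X"
      then show ?thesis by (intro trilinear_1[where f="\<lambda>n. cmod (x n)"] e F) auto
    next
      assume "l2_le (\<lambda>n. cmod (x n)) X \<and> l1_le (\<lambda>n. cmod (y n)) A"
      then have "(\<Sum>n\<in>F. \<Sum>k\<in>F. cmod (x (n - k)) * cmod (y k) * (\<bar>c n\<bar> * cmod (e n))) \<le> X * A * X"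
        by (intro trilinear_2[where f="\<lambda>n. cmod (x n)"] e F) auto
      then show ?thesis by (simp add: mult_ac)
    qed
    finally show ?thesis by (simp add: T_def mult.assoc)
  qed
  have fX: "l2_le (\<lambda>n. \<bar>freq n\<bar> * cmod (w n)) X"
    by (rule l2_le_mono[OF JwX]) (auto intro: mult_right_mono freq_le_jb)
  \<comment> \<open>Nothing cancels here. Submultiplicativity distributes \<open>jb n\<close> over
    both factors, and together with the derivative this puts \<open>(jb k)\<^sup>2\<close> on
    b.\<close>
  have m1: "\<bar>\<Sum>n\<in>F. (jb n)\<^sup>2 * Re (cnj (w n) * conv w (dx b) n)\<bar> \<le> 2 * T"
  proof -
    have "\<bar>\<Sum>n\<in>F. (jb n)\<^sup>2 * Re (cnj (w n) * conv w (dx b) n)\<bar> \<le>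
        (\<Sum>n\<in>F. (jb n)\<^sup>2 * (cmod (w n) * (\<Sum>k\<in>F. cmod (w (n - k)) * cmod (dx b k))))"
      by (intro abs_weighted_Re_le conv_finite_norm F supp_in_dx s) auto
    also have "\<dots> = (\<Sum>n\<in>F. \<Sum>k\<in>F. jb n * (cmod (w (n - k)) * cmod (dx b k) * (jb n * cmod (w n))))"
      by (simp add: sum_distrib_left power2_eq_square mult_ac)
    also have "\<dots> \<le> (\<Sum>n\<in>F. \<Sum>k\<in>F. 2 * jb (n - k) * jb k * (cmod (w (n - k)) * (jb k * cmod (b k)) * (jb n * cmod (w n))))"
      by (intro sum_mono mult_mono jb_submult mult_nonneg_nonneg cmod_dx) auto
    also have "\<dots> = (\<Sum>n\<in>F. \<Sum>k\<in>F. 2 * ((jb (n - k) * cmod (w (n - k))) * ((jb k)\<^sup>2 * cmod (b k)) * (jb n * cmod (w n))))"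
      by (simp add: power2_eq_square mult_ac)
    also have "\<dots> \<le> 2 * (X * A * X)"
      unfolding sum_distrib_left[symmetric]
      by (intro mult_left_mono trilinear_2[where f="\<lambda>n. jb n * cmod (w n)"] A JwX F) auto
    finally show ?thesis by (simp add: T_def mult_ac)
  qed
  have b1: "\<bar>\<Sum>n\<in>F. 1\<^sup>2 * Re (cnj (e n) * conv x y n)\<bar> \<le> T"
    if "l1_le (\<lambda>n. cmod (x n)) A \<and> l2_le (\<lambda>n. cmod (y n)) X \<or> l2_le (\<lambda>n. cmod (x n)) X \<and> l1_le (\<lambda>n. cmod (y n)) A"
      "l2_le (\<lambda>n. cmod (e n)) X" "supp_in F y" for x y e
    using bnd[of x y "\<lambda>_. 1" e 1] that by (simp only: power_one mult_1 abs_one norm_one simp_thms)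
  have bf: "\<bar>\<Sum>n\<in>F. freq n * 1\<^sup>2 * Re (cnj (w n) * (- \<i> * conv x y n))\<bar> \<le> T"
    if "l1_le (\<lambda>n. cmod (x n)) A \<and> l2_le (\<lambda>n. cmod (y n)) X \<or> l2_le (\<lambda>n. cmod (x n)) X \<and> l1_le (\<lambda>n. cmod (y n)) A"
      "supp_in F y" for x y
    using bnd[of x y freq w "- \<i>"] that fX
    by (simp only: power_one mult_1_right norm_minus_cancel norm_ii simp_thms)
  have 1: "\<bar>energy_rate F (\<lambda>_. 1) w r (Bu a \<alpha> w r) (Br a \<alpha> w r)\<bar> \<le> 2 * (2 * T + 3/2 * T + T + T + T + 2 * T)"
    unfolding energy_rate_Bu_Br
  proof (rule abs_combination_le[OF _ bf bf b1 _ b1])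
    show "\<bar>\<Sum>n\<in>F. (jb n * 1)\<^sup>2 * Re (cnj (w n) * conv a (dx w) n)\<bar> \<le> 2 * T"
      unfolding mult_1_right by (rule t1)
    show "\<bar>\<Sum>n\<in>F. 1\<^sup>2 * Re (cnj (r n) * conv a (dx r) n)\<bar> \<le> T"
      unfolding power_one mult_1 by (rule t4)
  qed (simp_all only: aA wX A rX dwX sw supp_in_dx simp_thms)
  have 2: "\<bar>energy_rate F (\<lambda>_. 1) w r (Bu w r b \<beta>) (Br w r b \<beta>)\<bar> \<le> 2 * (2 * T + 3/2 * T + T + T + T + 2 * T)"
    unfolding energy_rate_Bu_Br
  proof (rule abs_combination_le[OF _ bf bf b1 b1 b1])
    show "\<bar>\<Sum>n\<in>F. (jb n * 1)\<^sup>2 * Re (cnj (w n) * conv w (dx b) n)\<bar> \<le> 2 * T"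
      unfolding mult_1_right by (rule m1)
  qed (simp_all only: bA \<beta>A wX A rX dbA d\<beta>A s supp_in_dx simp_thms)
  \<comment> \<open>Each of the two halves is at most 17 T; their sum 34 T is rounded up to 40
    T.\<close>
  have "\<bar>energy_rate F (\<lambda>_. 1) w r (\<lambda>n. Bu a \<alpha> a \<alpha> n - Bu b \<beta> b \<beta> n) (\<lambda>n. Br a \<alpha> a \<alpha> n - Br b \<beta> b \<beta> n)\<bar> \<le> 40 * T"
    unfolding Bu_Br_diff[OF s[THEN square_summable_supp[OF F]] s[THEN supp_in_dx, THEN square_summable_supp[OF F]]] w_def[symmetric] r_def[symmetric] energy_rate_add
    using 1 2 T0 by argo
  then show ?thesis by (simp only: T_def X2 mult.assoc)
qed

section \<open>Weighted norms of states\<close>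

text \<open>The Euclidean norm of both components at one frequency. With it the energy is the square
  of a single l2 norm, and Minkowski's inequality applies to pairs.\<close>

definition pnorm :: "(int \<Rightarrow> real) \<Rightarrow> (int \<Rightarrow> complex) \<Rightarrow> (int \<Rightarrow> complex) \<Rightarrow> int \<Rightarrow> real" where
  "pnorm V u \<rho> n = sqrt ((jb n * V n * cmod (u n))\<^sup>2 + (V n * cmod (\<rho> n))\<^sup>2)"

definition state_le :: "(int \<Rightarrow> real) \<Rightarrow> (int \<Rightarrow> complex) \<Rightarrow> (int \<Rightarrow> complex) \<Rightarrow> real \<Rightarrow> bool" where
  "state_le V u \<rho> R \<longleftrightarrow> l2_le (pnorm V u \<rho>) R"

lemma pnorm_nonneg [simp]: "0 \<le> pnorm V u \<rho> n"
  by (simp add: pnorm_def)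

lemma energy_pnorm: "energy F V u \<rho> = (L2_set (pnorm V u \<rho>) F)\<^sup>2"
  by (simp add: energy_def pnorm_def L2_set_def sum_nonneg)

lemma state_le_nonneg: "state_le V u \<rho> R \<Longrightarrow> 0 \<le> R"
  unfolding state_le_def by (rule l2_le_nonneg)

lemma state_le_energy: "state_le V u \<rho> R \<Longrightarrow> finite F \<Longrightarrow> energy F V u \<rho> \<le> R\<^sup>2"
  unfolding state_le_def energy_pnorm by (intro power_mono l2_leD L2_set_nonneg)

lemma state_leI_energy:
  assumes "0 \<le> R" "\<And>F. finite F \<Longrightarrow> energy F V u \<rho> \<le> R\<^sup>2" shows "state_le V u \<rho> R"
  unfolding state_le_def l2_le_def
  using assms power2_le_imp_le unfolding energy_pnorm by blast

lemma state_leI_energy_supp: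
  assumes "0 \<le> R" "finite F" "supp_in F u" "supp_in F \<rho>" "energy F V u \<rho> \<le> R\<^sup>2"
  shows "state_le V u \<rho> R"
proof -
  have "(\<Sum>n\<in>F. (pnorm V u \<rho> n)\<^sup>2) \<le> R\<^sup>2" using assms(5) by (simp add: energy_def pnorm_def)
  then have "l2_le (pnorm V u \<rho>) (sqrt (R\<^sup>2))"
    using assms by (intro l2_le_supp[of F]) (auto simp: supp_in_def pnorm_def)
  then show ?thesis using assms(1) by (simp add: state_le_def)
qed

lemma state_le_mono:
  assumes "state_le V u \<rho> R" "\<And>n. 0 \<le> V' n" "\<And>n. V' n \<le> V n" "R \<le> R'"
    "\<And>n. cmod (u' n) \<le> cmod (u n)" "\<And>n. cmod (\<rho>' n) \<le> cmod (\<rho> n)"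
  shows "state_le V' u' \<rho>' R'"
  unfolding state_le_def
proof (rule l2_le_mono[OF assms(1)[unfolded state_le_def]])
  fix n
  have "0 \<le> V n" using assms(2,3)[of n] by linarith
  then show "pnorm V' u' \<rho>' n \<le> pnorm V u \<rho> n"
    unfolding pnorm_def using assms(2,3,5,6)[of n]
    by (intro real_sqrt_le_mono add_mono power_mono mult_mono mult_nonneg_nonneg) auto
qed (use assms in auto)

text \<open>The weights are compared only where the state does not vanish: for the remainder of a
  truncation the comparison holds at high frequencies only.\<close>

lemma state_le_scale:
  assumes "state_le V u \<rho> R" "0 \<le> c" "\<And>n. 0 \<le> V' n" "\<And>n. u n \<noteq> 0 \<or> \<rho> n \<noteq> 0 \<Longrightarrow> V' n \<le> c * V n" "\<And>n. 0 \<le> V n"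
  shows "state_le V' u \<rho> (c * R)"
  unfolding state_le_def
proof (rule l2_le_mono[OF l2_le_mult[OF assms(1)[unfolded state_le_def] assms(2)]])
  fix n
  show "pnorm V' u \<rho> n \<le> c * pnorm V u \<rho> n"
  proof (cases "u n \<noteq> 0 \<or> \<rho> n \<noteq> 0")
    case True
    have "pnorm V' u \<rho> n \<le> sqrt ((jb n * (c * V n) * cmod (u n))\<^sup>2 + ((c * V n) * cmod (\<rho> n))\<^sup>2)"
      unfolding pnorm_def using assms(2) assms(3,5)[of n] assms(4)[OF True]
      by (intro real_sqrt_le_mono add_mono power_mono mult_mono mult_nonneg_nonneg) auto
    also have "\<dots> = sqrt (c\<^sup>2 * ((jb n * V n * cmod (u n))\<^sup>2 + (V n * cmod (\<rho> n))\<^sup>2))"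
      by (simp add: power_mult_distrib algebra_simps)
    also have "\<dots> = c * pnorm V u \<rho> n" using assms(2) by (simp add: pnorm_def real_sqrt_mult)
    finally show ?thesis .
  qed (simp add: pnorm_def)
qed auto

lemma state_le_add:
  assumes "state_le V u \<rho> a" "state_le V v \<eta> b" and V: "\<And>n. 0 \<le> V n"
  shows "state_le V (\<lambda>n. u n + v n) (\<lambda>n. \<rho> n + \<eta> n) (a + b)"
  unfolding state_le_def
proof (rule l2_le_mono[OF l2_le_add[OF assms(1,2)[unfolded state_le_def]]])
  fix n
  have "pnorm V (\<lambda>n. u n + v n) (\<lambda>n. \<rho> n + \<eta> n) n \<le>
     sqrt ((jb n * V n * cmod (u n) + jb n * V n * cmod (v n))\<^sup>2 + (V n * cmod (\<rho> n) + V n * cmod (\<eta> n))\<^sup>2)"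
    unfolding pnorm_def distrib_left[symmetric] using V[of n]
    by (intro real_sqrt_le_mono add_mono power_mono mult_left_mono norm_triangle_ineq) auto
  also have "\<dots> \<le> pnorm V u \<rho> n + pnorm V v \<eta> n"
    unfolding pnorm_def by (rule real_sqrt_sum_squares_triangle_ineq)
  finally show "pnorm V (\<lambda>n. u n + v n) (\<lambda>n. \<rho> n + \<eta> n) n \<le> pnorm V u \<rho> n + pnorm V v \<eta> n" .
qed auto

lemma state_le_uminus: "state_le V (\<lambda>n. - u n) (\<lambda>n. - \<rho> n) R = state_le V u \<rho> R"
  by (simp add: state_le_def pnorm_def[abs_def])

lemma state_le_diff:
  assumes "state_le V u \<rho> a" "state_le V v \<eta> b" and V: "\<And>n. 0 \<le> V n"
  shows "state_le V (\<lambda>n. u n - v n) (\<lambda>n. \<rho> n - \<eta> n) (a + b)"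
  using state_le_add[of V u \<rho> a "\<lambda>n. - v n" "\<lambda>n. - \<eta> n" b] assms by (simp add: state_le_uminus)

lemma state_le_components:
  assumes "state_le V u \<rho> R" "\<And>n. 0 \<le> V n"
  shows "l2_le (\<lambda>n. jb n * V n * cmod (u n)) R" "l2_le (\<lambda>n. V n * cmod (\<rho> n)) R"
  by (rule l2_le_mono[OF assms(1)[unfolded state_le_def]];
      simp add: pnorm_def assms(2) real_le_rsqrt)+

lemma state_leI_components:
  assumes "l2_le (\<lambda>n. jb n * V n * cmod (u n)) a" "l2_le (\<lambda>n. V n * cmod (\<rho> n)) b" "\<And>n. 0 \<le> V n"
  shows "state_le V u \<rho> (a + b)"
  unfolding state_le_def
  by (rule l2_le_mono[OF l2_le_add[OF assms(1,2)]])
    (auto simp: pnorm_def assms(3) intro: sqrt_add_le_add_sqrt[THEN order_trans])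

definition trunc :: "int set \<Rightarrow> (int \<Rightarrow> complex) \<Rightarrow> int \<Rightarrow> complex" where
  "trunc F f n = (if n \<in> F then f n else 0)"

lemma supp_in_trunc [simp]: "supp_in F (trunc F f)"
  by (simp add: supp_in_def trunc_def)

lemma cmod_trunc_le: "cmod (trunc F f n) \<le> cmod (f n)"
  by (simp add: trunc_def)

section \<open>Summability of powers of the weight\<close>

text \<open>The constant of the Sobolev embedding into absolutely summable coefficients. A bound as
  described exists for \<sigma> > 1/2.\<close>

definition bracket_const :: "real \<Rightarrow> real" where
  "bracket_const \<sigma> = (SOME c. l2_le (\<lambda>n. jb n powr (- \<sigma>)) c)"

lemma sum_symmetric_interval_le:
  fixes f :: "int \<Rightarrow> real"
  assumes "f 0 \<le> 1" "\<And>m. f (int (Suc m)) \<le> g (Suc m)" "\<And>m. f (- int (Suc m)) \<le> g (Suc m)"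
  shows "sum f {- int N..int N} \<le> 1 + 2 * (\<Sum>m<N. g (Suc m))"
proof (induction N)
  case (Suc N)
  have "{- int (Suc N)..int (Suc N)} = insert (int (Suc N)) (insert (- int (Suc N)) {- int N..int N})"
    by auto
  then have "sum f {- int (Suc N)..int (Suc N)} = f (int (Suc N)) + f (- int (Suc N)) + sum f {- int N..int N}"
    by simp
  with Suc assms(2,3)[of N] show ?case by simp
qed (simp add: assms)

text \<open>As \<open>jb n\<close> is at least the absolute value of n, the squares are dominated by
  a p-series of exponent 2 \<sigma> > 1, counted twice for the two signs of n.\<close>

lemma bracket_const:
  assumes "\<sigma> > 1/2" shows "l2_le (\<lambda>n. jb n powr (- \<sigma>)) (bracket_const \<sigma>)"
proof -
  define g :: "nat \<Rightarrow> real" where "g m = real m powr (- (2 * \<sigma>))" for m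
  have g: "summable (\<lambda>m. g (Suc m))"
    using assms by (subst summable_Suc_iff) (simp add: g_def[abs_def] summable_real_powr_iff)
  define C where "C = 1 + 2 * (\<Sum>m. g (Suc m))"
  have sq: "(jb n powr (- \<sigma>))\<^sup>2 = jb n powr (- (2 * \<sigma>))" for n
    by (simp add: power2_eq_square powr_add[symmetric])
  have "(\<Sum>n\<in>F. (jb n powr (- \<sigma>))\<^sup>2) \<le> C" if F: "finite F" for F
  proof -
    obtain N where N: "F \<subseteq> {- int N..int N}"
    proof
      show "F \<subseteq> {- int (nat (\<Sum>n\<in>F. \<bar>n\<bar>))..int (nat (\<Sum>n\<in>F. \<bar>n\<bar>))}"
      proof
        fix n assume "n \<in> F"
        then have "\<bar>n\<bar> \<le> (\<Sum>n\<in>F. \<bar>n\<bar>)" using F by (intro member_le_sum) auto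
        then show "n \<in> {- int (nat (\<Sum>n\<in>F. \<bar>n\<bar>))..int (nat (\<Sum>n\<in>F. \<bar>n\<bar>))}" by auto
      qed
    qed
    have b: "jb k powr (- (2 * \<sigma>)) \<le> g (Suc m)" if "\<bar>k\<bar> = int (Suc m)" for k m
    proof -
      have "\<bar>real_of_int k\<bar> = real (Suc m)" using that by linarith
      then have "real (Suc m) \<le> jb k" using jb_int_ge[of k] by simp
      then show ?thesis unfolding g_def using assms by (intro powr_mono2') auto
    qed
    have "(\<Sum>n\<in>F. (jb n powr (- \<sigma>))\<^sup>2) \<le> (\<Sum>n\<in>{- int N..int N}. jb n powr (- (2 * \<sigma>)))"
      unfolding sq using N by (intro sum_mono2) auto
    also have "\<dots> \<le> 1 + 2 * (\<Sum>m<N. g (Suc m))"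
      by (intro sum_symmetric_interval_le b) (auto simp: jb_def)
    also have "\<dots> \<le> C"
      unfolding C_def using g by (intro add_left_mono mult_left_mono sum_le_suminf) (auto simp: g_def)
    finally show ?thesis .
  qed
  then have "l2_le (\<lambda>n. jb n powr (- \<sigma>)) (sqrt C)"
    by (simp add: l2_le_def L2_set_def)
  then show ?thesis unfolding bracket_const_def by (rule someI)
qed

text \<open>Cauchy-Schwarz against \<open>jb n powr (- \<sigma>)\<close>: absolute summability costs
  \<sigma> derivatives.\<close>

lemma state_le_l1:
  assumes z: "state_le (\<lambda>n. jb n powr (r - 1)) u \<rho> R" and \<sigma>: "\<sigma> > 1/2"
  shows "l1_le (\<lambda>n. jb n powr (r - \<sigma>) * cmod (u n)) (bracket_const \<sigma> * R)"
    and "l1_le (\<lambda>n. jb n powr (r - 1 - \<sigma>) * cmod (\<rho> n)) (bracket_const \<sigma> * R)"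
proof -
  note c = state_le_components[OF z, simplified]
  have e: "jb n powr (- \<sigma>) * jb n powr q = jb n powr (q - \<sigma>)" for n q
    by (simp add: powr_add[symmetric])
  have j: "jb n * jb n powr (r - 1) = jb n powr r" for n
    by (simp add: powr_diff)
  show "l1_le (\<lambda>n. jb n powr (r - \<sigma>) * cmod (u n)) (bracket_const \<sigma> * R)"
    using l1_l2_product[OF bracket_const[OF \<sigma>] c(1)] by (simp add: mult.assoc[symmetric] j e)
  show "l1_le (\<lambda>n. jb n powr (r - 1 - \<sigma>) * cmod (\<rho> n)) (bracket_const \<sigma> * R)"
    using l1_l2_product[OF bracket_const[OF \<sigma>] c(2)] by (simp add: mult.assoc[symmetric] e)
qed

section \<open>Bilinear bounds\<close>

lemma has_sum_finite_sum:
  fixes f :: "'b \<Rightarrow> 'a \<Rightarrow> 'c :: {comm_monoid_add, topological_comm_monoid_add}"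
  assumes "finite F" "\<And>n. n \<in> F \<Longrightarrow> (f n has_sum s n) A"
  shows "((\<lambda>k. \<Sum>n\<in>F. f n k) has_sum (\<Sum>n\<in>F. s n)) A"
  using assms by (induction F rule: finite_induct) (auto intro: has_sum_add)

text \<open>Weighted square summability of a convolution is tested against square summable functions,
  which reduces it to the trilinear estimates.\<close>

lemma conv_l2I:
  assumes f2: "l2_le (\<lambda>n. cmod (f n)) A" and g2: "l2_le (\<lambda>n. cmod (g n)) B" and W: "\<And>n. 0 \<le> W n"
    and T: "\<And>F K h H. finite F \<Longrightarrow> finite K \<Longrightarrow> (\<And>n. 0 \<le> h n) \<Longrightarrow> l2_le h H \<Longrightarrow>
      (\<Sum>n\<in>F. \<Sum>k\<in>K. W n * (cmod (f (n - k)) * cmod (g k) * h n)) \<le> C * H"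
  shows "l2_le (\<lambda>n. W n * cmod (conv f g n)) C"
  unfolding l2_le_def
proof (intro allI impI)
  fix F :: "int set" assume F: "finite F"
  have "l2_le (\<lambda>_. 0) 1" by (simp add: l2_le_def L2_set_def)
  from T[OF finite.emptyI finite.emptyI _ this] have C0: "0 \<le> C" by simp
  \<comment> \<open>The test function is the weighted convolution itself, cut off to F; testing then
    gives \<open>H * H \<le> C * H\<close>.\<close>
  define h where "h n = (if n \<in> F then W n * cmod (conv f g n) else 0)" for n
  define H where "H = L2_set h F"
  have H: "L2_set (\<lambda>n. W n * cmod (conv f g n)) F = H"
    unfolding H_def by (rule L2_set_cong) (auto simp: h_def)
  have h2: "l2_le h H"
    unfolding H_def L2_set_def by (rule l2_le_supp[OF F]) (auto simp: h_def)
  have h0: "0 \<le> h n" for n using W by (simp add: h_def)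
  define \<phi> where "\<phi> k = (\<Sum>n\<in>F. (h n * W n) * cmod (f (n - k) * g k))" for k
  have s: "(\<lambda>k. cmod (f (n - k) * g k)) summable_on UNIV" for n
    by (rule conv_abs_summable(1)[OF f2 g2])
  have \<phi>s: "(\<phi> has_sum (\<Sum>n\<in>F. (h n * W n) * (\<Sum>\<^sub>\<infinity>k. cmod (f (n - k) * g k)))) UNIV"
    unfolding \<phi>_def[abs_def] by (intro has_sum_finite_sum F has_sum_cmult_right has_sum_infsum s)
  have "H\<^sup>2 = (\<Sum>n\<in>F. (h n * W n) * cmod (conv f g n))"
  proof -
    have "H\<^sup>2 = (\<Sum>n\<in>F. (h n)\<^sup>2)" unfolding H_def L2_set_def by (simp add: sum_nonneg)
    also have "\<dots> = (\<Sum>n\<in>F. (h n * W n) * cmod (conv f g n))"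
      by (rule sum.cong) (simp_all add: h_def power2_eq_square)
    finally show ?thesis .
  qed
  also have "\<dots> \<le> (\<Sum>n\<in>F. (h n * W n) * (\<Sum>\<^sub>\<infinity>k. cmod (f (n - k) * g k)))"
    unfolding conv_def by (intro sum_mono mult_left_mono norm_infsum_bound s mult_nonneg_nonneg h0 W)
  also have "\<dots> = infsum \<phi> UNIV"
    using \<phi>s by (simp add: infsumI)
  also have "\<dots> \<le> C * H"
  proof (rule infsum_le_finite_sums[OF has_sum_imp_summable[OF \<phi>s]])
    fix K :: "int set" assume K: "finite K"
    have "sum \<phi> K = (\<Sum>n\<in>F. \<Sum>k\<in>K. W n * (cmod (f (n - k)) * cmod (g k) * h n))"
      unfolding \<phi>_def by (subst sum.swap) (simp add: norm_mult mult_ac)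
    also have "\<dots> \<le> C * H" by (rule T[OF F K h0 h2])
    finally show "sum \<phi> K \<le> C * H" .
  qed
  finally have "H * H \<le> C * H" by (simp add: power2_eq_square)
  then have "H \<le> C"
    using C0 l2_le_nonneg[OF h2] by (cases "H = 0") (auto simp: mult_le_cancel_right)
  then show "L2_set (\<lambda>n. W n * cmod (conv f g n)) F \<le> C" by (simp add: H)
qed

lemma jb_powr_ge_1: "0 \<le> \<sigma> \<Longrightarrow> 1 \<le> jb n powr \<sigma>"
  by (intro ge_one_powr_ge_zero) auto

lemma le_jb_powr_mult: "0 \<le> \<sigma> \<Longrightarrow> 0 \<le> x \<Longrightarrow> x \<le> jb n powr \<sigma> * x"
  using mult_right_mono[OF jb_powr_ge_1, of \<sigma> x n] by simp

lemma l1_le_imp_l2_le: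
  assumes "l1_le f A" "\<And>n. 0 \<le> f n" shows "l2_le f A"
  unfolding l2_le_def using L2_set_le_sum assms l1_leD order_trans by metis

text \<open>Here the weight is split multiplicatively and stays on both factors. In
  \<open>conv_algebra\<close> it is split additively, so that the l1 factors there carry no
  weight.\<close>

lemma conv_weighted:
  assumes \<sigma>: "0 \<le> \<sigma>" and f: "l1_le (\<lambda>n. jb n powr \<sigma> * cmod (f n)) A" and g: "l2_le (\<lambda>n. jb n powr \<sigma> * cmod (g n)) B"
  shows "l2_le (\<lambda>n. jb n powr \<sigma> * cmod (conv f g n)) (2 powr \<sigma> * A * B)"
proof (rule conv_l2I)
  show "l2_le (\<lambda>n. cmod (f n)) A"
    by (intro l1_le_imp_l2_le l1_le_mono[OF f] le_jb_powr_mult \<sigma>) auto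
  show "l2_le (\<lambda>n. cmod (g n)) B"
    by (rule l2_le_mono[OF g]) (auto intro: le_jb_powr_mult \<sigma>)
  fix F K :: "int set" and h H assume F: "finite F" and K: "finite K" and h0: "\<And>n. 0 \<le> h n" and h2: "l2_le h H"
  have "(\<Sum>n\<in>F. \<Sum>k\<in>K. jb n powr \<sigma> * (cmod (f (n - k)) * cmod (g k) * h n))
     \<le> (\<Sum>n\<in>F. \<Sum>k\<in>K. (2 powr \<sigma> * jb (n - k) powr \<sigma> * jb k powr \<sigma>) * (cmod (f (n - k)) * cmod (g k) * h n))"
  proof (intro sum_mono mult_right_mono mult_nonneg_nonneg h0 norm_ge_zero)
    fix n k
    have "jb n powr \<sigma> \<le> (2 * jb (n - k) * jb k) powr \<sigma>" using \<sigma> by (intro powr_mono2 jb_submult) auto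
    then show "jb n powr \<sigma> \<le> 2 powr \<sigma> * jb (n - k) powr \<sigma> * jb k powr \<sigma>" by (simp add: powr_mult)
  qed
  also have "\<dots> = 2 powr \<sigma> * (\<Sum>n\<in>F. \<Sum>k\<in>K. (jb (n - k) powr \<sigma> * cmod (f (n - k))) * (jb k powr \<sigma> * cmod (g k)) * h n)"
    by (simp add: sum_distrib_left mult_ac)
  also have "\<dots> \<le> 2 powr \<sigma> * (A * B * H)"
    by (intro mult_left_mono trilinear_1[where f="\<lambda>n. jb n powr \<sigma> * cmod (f n)"] f g h2 h0 F K) auto
  finally show "(\<Sum>n\<in>F. \<Sum>k\<in>K. jb n powr \<sigma> * (cmod (f (n - k)) * cmod (g k) * h n)) \<le> 2 powr \<sigma> * A * B * H"
    by (simp add: mult_ac)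
qed simp

text \<open>This makes the Sobolev spaces of order above 1/2 algebras: the l1 bounds come from the
  embedding at the same order.\<close>

lemma conv_algebra:
  assumes \<sigma>: "0 \<le> \<sigma>" and f: "l1_le (\<lambda>n. cmod (f n)) A1" "l2_le (\<lambda>n. jb n powr \<sigma> * cmod (f n)) A2"
    and g: "l1_le (\<lambda>n. cmod (g n)) B1" "l2_le (\<lambda>n. jb n powr \<sigma> * cmod (g n)) B2"
  shows "l2_le (\<lambda>n. jb n powr \<sigma> * cmod (conv f g n)) (2 powr \<sigma> * (A1 * B2 + A2 * B1))"
proof (rule conv_l2I)
  show "l2_le (\<lambda>n. cmod (f n)) A1" "l2_le (\<lambda>n. cmod (g n)) B1" by (intro l1_le_imp_l2_le f g; simp)+
  fix F K :: "int set" and h H assume F: "finite F" and K: "finite K" and h0: "\<And>n. 0 \<le> h n" and h2: "l2_le h H"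
  have "(\<Sum>n\<in>F. \<Sum>k\<in>K. jb n powr \<sigma> * (cmod (f (n - k)) * cmod (g k) * h n))
     \<le> (\<Sum>n\<in>F. \<Sum>k\<in>K. (2 powr \<sigma> * (jb k powr \<sigma> + jb (n - k) powr \<sigma>)) * (cmod (f (n - k)) * cmod (g k) * h n))"
  proof (intro sum_mono mult_right_mono mult_nonneg_nonneg h0 norm_ge_zero)
    fix n k
    consider "jb n \<le> 2 * jb (n - k)" | "jb n \<le> 2 * jb k" using jb_triangle[of n k] by linarith
    then show "jb n powr \<sigma> \<le> 2 powr \<sigma> * (jb k powr \<sigma> + jb (n - k) powr \<sigma>)"
    proof cases
      case 1
      then have "jb n powr \<sigma> \<le> (2 * jb (n - k)) powr \<sigma>" using \<sigma> by (intro powr_mono2) auto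
      then show ?thesis by (simp add: powr_mult distrib_left add_increasing)
    next
      case 2
      then have "jb n powr \<sigma> \<le> (2 * jb k) powr \<sigma>" using \<sigma> by (intro powr_mono2) auto
      then show ?thesis by (simp add: powr_mult distrib_left add_increasing2)
    qed
  qed
  also have "\<dots> = 2 powr \<sigma> * ((\<Sum>n\<in>F. \<Sum>k\<in>K. cmod (f (n - k)) * (jb k powr \<sigma> * cmod (g k)) * h n)
      + (\<Sum>n\<in>F. \<Sum>k\<in>K. (jb (n - k) powr \<sigma> * cmod (f (n - k))) * cmod (g k) * h n))"
    by (simp add: sum_distrib_left sum.distrib[symmetric] algebra_simps)
  also have "\<dots> \<le> 2 powr \<sigma> * (A1 * B2 * H + A2 * B1 * H)"
    by (intro mult_left_mono add_mono trilinear_1[where f="\<lambda>n. cmod (f n)"]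
        trilinear_2[where f="\<lambda>n. jb n powr \<sigma> * cmod (f n)"] f g h2 h0 F K) auto
  finally show "(\<Sum>n\<in>F. \<Sum>k\<in>K. jb n powr \<sigma> * (cmod (f (n - k)) * cmod (g k) * h n)) \<le> 2 powr \<sigma> * (A1 * B2 + A2 * B1) * H"
    by (simp add: algebra_simps)
qed simp

text \<open>The u component contributes 9/2 and the \<rho> component 3 times the bound of a single
  convolution; their sum is rounded up to 8.\<close>

definition bilinear_const :: "real \<Rightarrow> real" where
  "bilinear_const r = 8 * 2 powr (r - 1) * bracket_const 1"

lemma bracket_const_nonneg: "\<sigma> > 1/2 \<Longrightarrow> 0 \<le> bracket_const \<sigma>"
  using bracket_const l2_le_nonneg by blast

text \<open>The loss is exactly one derivative. The first pair enters in l1, by the embedding with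
  \<sigma> = 1. The transport of v is the one term that has to be convolved at the weight r - 1; all
  others need only r - 2.\<close>

lemma Bu_Br_bound:
  assumes r: "2 \<le> r" and z: "state_le (\<lambda>n. jb n powr (r - 1)) u \<rho> a" and y: "state_le (\<lambda>n. jb n powr (r - 1)) v \<eta> b"
  shows "state_le (\<lambda>n. jb n powr (r - 2)) (Bu u \<rho> v \<eta>) (Br u \<rho> v \<eta>) (bilinear_const r * a * b)"
proof -
  define c where "c = bracket_const 1"
  define M where "M = 2 powr (r - 1) * (c * a) * b"
  have c0: "0 \<le> c" unfolding c_def by (rule bracket_const_nonneg) simp
  have ab: "0 \<le> a" "0 \<le> b" using z y by (auto intro: state_le_nonneg)
  have M0: "0 \<le> M" using c0 ab by (simp add: M_def)
  have u1: "l1_le (\<lambda>n. jb n powr (r - 1) * cmod (u n)) (c * a)" and \<rho>1: "l1_le (\<lambda>n. jb n powr (r - 2) * cmod (\<rho> n)) (c * a)"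
    using state_le_l1[OF z, of 1] by (simp_all add: c_def)
  have le: "jb n powr (r - 2) * x \<le> jb n powr (r - 1) * x" if "0 \<le> x" for n x
    using that by (intro mult_right_mono powr_mono) auto
  have j: "jb n * jb n powr (r - 1) = jb n * (jb n * jb n powr (r - 2))" "jb n powr (r - 1) = jb n * jb n powr (r - 2)" for n
    by (simp_all add: powr_diff power2_eq_square)
  have u1': "l1_le (\<lambda>n. jb n powr (r - 2) * cmod (u n)) (c * a)"
    by (rule l1_le_mono[OF u1 le]) auto
  note yc = state_le_components[OF y, simplified]
  have dv: "l2_le (\<lambda>n. jb n powr (r - 1) * cmod (dx v n)) b"
  proof (rule l2_le_mono[OF yc(1)])
    fix n show "jb n powr (r - 1) * cmod (dx v n) \<le> jb n * jb n powr (r - 1) * cmod (v n)"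
      using mult_left_mono[OF cmod_dx[of v n], of "jb n powr (r - 1)"] by (simp add: mult_ac)
  qed auto
  have dv': "l2_le (\<lambda>n. jb n powr (r - 2) * cmod (dx v n)) b"
    by (rule l2_le_mono[OF dv _ le]) auto
  have v': "l2_le (\<lambda>n. jb n powr (r - 2) * cmod (v n)) b"
  proof (rule l2_le_mono[OF yc(1)])
    fix n
    have "1 \<le> jb n * jb n" using mult_mono[OF jb_ge_1[of n] jb_ge_1[of n]] by simp
    then have "1 * (jb n powr (r - 2) * cmod (v n)) \<le> (jb n * jb n) * (jb n powr (r - 2) * cmod (v n))"
      by (intro mult_right_mono) auto
    then show "jb n powr (r - 2) * cmod (v n) \<le> jb n * jb n powr (r - 1) * cmod (v n)"
      by (simp add: j(1) mult_ac)
  qed auto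
  have \<eta>': "l2_le (\<lambda>n. jb n powr (r - 2) * cmod (\<eta> n)) b"
    by (rule l2_le_mono[OF yc(2) _ le]) auto
  have d\<eta>: "l2_le (\<lambda>n. jb n powr (r - 2) * cmod (dx \<eta> n)) b"
  proof (rule l2_le_mono[OF yc(2)])
    fix n show "jb n powr (r - 2) * cmod (dx \<eta> n) \<le> jb n powr (r - 1) * cmod (\<eta> n)"
      using mult_left_mono[OF cmod_dx[of \<eta> n], of "jb n powr (r - 2)"] by (simp add: j(2) mult_ac)
  qed auto
  have M': "2 powr (r - 2) * (c * a) * b \<le> M"
    unfolding M_def using c0 ab by (intro mult_right_mono powr_mono) auto
  have conv': "l2_le (\<lambda>n. jb n powr (r - 2) * cmod (conv f g n)) M"
    if "l1_le (\<lambda>n. jb n powr (r - 2) * cmod (f n)) (c * a)" "l2_le (\<lambda>n. jb n powr (r - 2) * cmod (g n)) b" for f g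
    by (rule l2_le_mono[OF conv_weighted[OF _ that]]) (use r M' in auto)
  have k1: "l2_le (\<lambda>n. jb n powr (r - 1) * cmod (conv u (dx v) n)) M"
    unfolding M_def using r by (intro conv_weighted u1 dv) auto
  note k2 = conv'[OF u1' v'] and k3 = conv'[OF \<rho>1 \<eta>'] and k4 = conv'[OF \<rho>1 dv'] and k5 = conv'[OF u1' d\<eta>]
  have U: "l2_le (\<lambda>n. jb n * jb n powr (r - 2) * cmod (Bu u \<rho> v \<eta> n)) (M + (3/2 * M + M) + M)"
  proof (rule l2_le_mono[OF l2_le_add[OF l2_le_add[OF k1 l2_le_add[OF l2_le_mult[OF k2, of "3/2"] k3]] k4]])
    fix n
    define p where "p = jb n powr (r - 2)"
    have p: "0 \<le> p" by (simp add: p_def)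
    \<comment> \<open>The inverse of \<open>A\<close> pays for the extra factor \<open>jb n\<close>,
      even after the derivative in front of the quadratic terms.\<close>
    have f1: "jb n * (\<bar>freq n\<bar> / (jb n)\<^sup>2) \<le> 1" and f2: "jb n * (1 / (jb n)\<^sup>2) \<le> 1"
      using freq_le_jb[of n] by (auto simp: power2_eq_square field_simps)
    have "cmod (Bu u \<rho> v \<eta> n) \<le> cmod (conv u (dx v) n)
        + \<bar>freq n\<bar> / (jb n)\<^sup>2 * (3/2 * cmod (conv u v n) + cmod (conv \<rho> \<eta> n)) + 1 / (jb n)\<^sup>2 * cmod (conv \<rho> (dx v) n)"
    proof -
      have "cmod (3/2 * conv u v n - conv \<rho> \<eta> n) \<le> 3/2 * cmod (conv u v n) + cmod (conv \<rho> \<eta> n)"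
        by (rule order_trans[OF norm_triangle_ineq4]) (simp add: norm_mult)
      then have "cmod (\<i> * of_real (freq n / (jb n)\<^sup>2) * (3/2 * conv u v n - conv \<rho> \<eta> n)) \<le>
          \<bar>freq n\<bar> / (jb n)\<^sup>2 * (3/2 * cmod (conv u v n) + cmod (conv \<rho> \<eta> n))"
        unfolding norm_mult norm_of_real by (simp add: abs_divide mult_left_mono divide_right_mono)
      moreover have "cmod (of_real (1 / (jb n)\<^sup>2) * conv \<rho> (dx v) n) = 1 / (jb n)\<^sup>2 * cmod (conv \<rho> (dx v) n)"
        by (simp add: norm_mult norm_divide norm_power)
      ultimately show ?thesis unfolding Bu_def
        by (smt (verit) norm_minus_cancel norm_triangle_ineq4)
    qed
    then have "jb n * p * cmod (Bu u \<rho> v \<eta> n) \<le> jb n * p * (cmod (conv u (dx v) n)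
        + \<bar>freq n\<bar> / (jb n)\<^sup>2 * (3/2 * cmod (conv u v n) + cmod (conv \<rho> \<eta> n)) + 1 / (jb n)\<^sup>2 * cmod (conv \<rho> (dx v) n))"
      using p by (intro mult_left_mono) auto
    also have "\<dots> = jb n * p * cmod (conv u (dx v) n)
        + (jb n * (\<bar>freq n\<bar> / (jb n)\<^sup>2)) * (p * (3/2 * cmod (conv u v n) + cmod (conv \<rho> \<eta> n)))
        + (jb n * (1 / (jb n)\<^sup>2)) * (p * cmod (conv \<rho> (dx v) n))"
      by (simp only: distrib_left mult_ac)
    also have "\<dots> \<le> jb n * p * cmod (conv u (dx v) n)
        + 1 * (p * (3/2 * cmod (conv u v n) + cmod (conv \<rho> \<eta> n))) + 1 * (p * cmod (conv \<rho> (dx v) n))"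
      using p by (intro add_mono mult_right_mono f1 f2) auto
    finally show "jb n * jb n powr (r - 2) * cmod (Bu u \<rho> v \<eta> n) \<le> jb n powr (r - 1) * cmod (conv u (dx v) n)
        + (3/2 * (jb n powr (r - 2) * cmod (conv u v n)) + jb n powr (r - 2) * cmod (conv \<rho> \<eta> n))
        + jb n powr (r - 2) * cmod (conv \<rho> (dx v) n)"
      unfolding p_def j(2) by (simp add: distrib_left)
  qed auto
  have R: "l2_le (\<lambda>n. jb n powr (r - 2) * cmod (Br u \<rho> v \<eta> n)) (M + 2 * M)"
  proof (rule l2_le_mono[OF l2_le_add[OF k5 l2_le_mult[OF k4, of 2]]])
    fix n
    have "cmod (Br u \<rho> v \<eta> n) \<le> cmod (conv u (dx \<eta>) n) + 2 * cmod (conv \<rho> (dx v) n)"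
      unfolding Br_def by (rule order_trans[OF norm_triangle_ineq4]) (simp add: norm_mult)
    then have "jb n powr (r - 2) * cmod (Br u \<rho> v \<eta> n) \<le> jb n powr (r - 2) * (cmod (conv u (dx \<eta>) n) + 2 * cmod (conv \<rho> (dx v) n))"
      by (rule mult_left_mono) simp
    then show "jb n powr (r - 2) * cmod (Br u \<rho> v \<eta> n) \<le> jb n powr (r - 2) * cmod (conv u (dx \<eta>) n) + 2 * (jb n powr (r - 2) * cmod (conv \<rho> (dx v) n))"
      by (simp add: distrib_left)
  qed auto
  have "state_le (\<lambda>n. jb n powr (r - 2)) (Bu u \<rho> v \<eta>) (Br u \<rho> v \<eta>) ((M + (3/2 * M + M) + M) + (M + 2 * M))"
    by (intro state_leI_components U R) simp
  then show ?thesis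
  proof (rule state_le_mono)
    have "bilinear_const r * a * b = 8 * M" by (simp add: bilinear_const_def M_def c_def)
    then show "(M + (3/2 * M + M) + M) + (M + 2 * M) \<le> bilinear_const r * a * b" using M0 by simp
  qed auto
qed

section \<open>Stability of truncated solutions in the low norm\<close>

lemma has_real_derivative_cmod_square:
  assumes "(x has_vector_derivative x') (at t)"
  shows "((\<lambda>t. (cmod (x t))\<^sup>2) has_real_derivative 2 * Re (cnj (x t) * x')) (at t)"
proof -
  have re: "((\<lambda>t. Re (x t)) has_real_derivative Re x') (at t)" and im: "((\<lambda>t. Im (x t)) has_real_derivative Im x') (at t)"
    using bounded_linear.has_vector_derivative[OF bounded_linear_Re assms]
      bounded_linear.has_vector_derivative[OF bounded_linear_Im assms]
    by (simp_all add: has_real_derivative_iff_has_vector_derivative)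
  from DERIV_add[OF DERIV_power[OF re, of 2] DERIV_power[OF im, of 2]] show ?thesis
    by (simp add: cmod_power2 algebra_simps)
qed

lemma energy_deriv:
  assumes "\<And>n. n \<in> F \<Longrightarrow> ((\<lambda>t. u t n) has_vector_derivative du n) (at t)"
    and "\<And>n. n \<in> F \<Longrightarrow> ((\<lambda>t. \<rho> t n) has_vector_derivative d\<rho> n) (at t)"
  shows "((\<lambda>t. energy F V (u t) (\<rho> t)) has_real_derivative energy_rate F V (u t) (\<rho> t) du d\<rho>) (at t)"
proof -
  have "((\<lambda>t. energy F V (u t) (\<rho> t)) has_real_derivative
     (\<Sum>n\<in>F. (jb n * V n)\<^sup>2 * (2 * Re (cnj (u t n) * du n)) + (V n)\<^sup>2 * (2 * Re (cnj (\<rho> t n) * d\<rho> n)))) (at t)"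
    unfolding energy_def power_mult_distrib[of _ "cmod _"]
    by (intro DERIV_sum DERIV_add DERIV_cmult has_real_derivative_cmod_square assms)
  also have "(\<Sum>n\<in>F. (jb n * V n)\<^sup>2 * (2 * Re (cnj (u t n) * du n)) + (V n)\<^sup>2 * (2 * Re (cnj (\<rho> t n) * d\<rho> n)))
      = energy_rate F V (u t) (\<rho> t) du d\<rho>"
    unfolding energy_rate_def sum_distrib_left sum.distrib[symmetric]
    by (rule sum.cong[OF refl]) (simp add: algebra_simps)
  finally show ?thesis .
qed

lemma abs_square_mult_le:
  fixes c r x y :: real
  assumes "\<bar>r\<bar> \<le> x * y" shows "\<bar>2 * (c\<^sup>2 * r)\<bar> \<le> (c * x)\<^sup>2 + (c * y)\<^sup>2"
proof -
  have "\<bar>2 * (c\<^sup>2 * r)\<bar> = 2 * (c\<^sup>2 * \<bar>r\<bar>)" by (simp add: abs_mult)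
  also have "\<dots> \<le> 2 * (c\<^sup>2 * (x * y))" using assms by (intro mult_left_mono) auto
  also have "\<dots> = 2 * (c * x) * (c * y)" by (simp add: power2_eq_square)
  also have "\<dots> \<le> (c * x)\<^sup>2 + (c * y)\<^sup>2" by (rule sum_squares_bound)
  finally show ?thesis .
qed

text \<open>Young's inequality. It lets e act as a forcing term in the stability estimate and as a
  velocity in the mean value inequality for states.\<close>

lemma energy_rate_le:
  "\<bar>energy_rate F V w r e e'\<bar> \<le> energy F V w r + energy F V e e'"
proof -
  define S where "S n = 2 * ((jb n * V n)\<^sup>2 * Re (cnj (w n) * e n)) + 2 * ((V n)\<^sup>2 * Re (cnj (r n) * e' n))" for n
  define B where "B n = ((jb n * V n * cmod (w n))\<^sup>2 + (jb n * V n * cmod (e n))\<^sup>2) + ((V n * cmod (r n))\<^sup>2 + (V n * cmod (e' n))\<^sup>2)" for n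
  have re: "\<bar>Re (cnj x * y)\<bar> \<le> cmod x * cmod y" for x y
    by (metis abs_Re_le_cmod complex_mod_cnj norm_mult)
  have "\<bar>S n\<bar> \<le> B n" for n
    unfolding S_def B_def
    by (rule order_trans[OF abs_triangle_ineq]) (intro add_mono abs_square_mult_le re)
  moreover have "energy_rate F V w r e e' = sum S F"
    unfolding energy_rate_def S_def sum.distrib sum_distrib_left ..
  ultimately have "\<bar>energy_rate F V w r e e'\<bar> \<le> sum B F"
    by (simp add: order_trans[OF sum_abs] sum_mono)
  also have "sum B F = energy F V w r + energy F V e e'"
    unfolding B_def energy_def sum.distrib by (simp only: add_ac)
  finally show ?thesis .
qed

section \<open>Gronwall's inequality in both directions of time\<close>

text \<open>With the integrating factor, \<open>(f t + b / a) * exp (- a * t)\<close> is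
  nonincreasing.\<close>

lemma gronwall_aux:
  fixes f f' :: "real \<Rightarrow> real"
  assumes "a > 0" and d: "\<And>t. 0 \<le> t \<Longrightarrow> t < T \<Longrightarrow> (f has_real_derivative f' t) (at t)"
    and "\<And>t. 0 \<le> t \<Longrightarrow> t < T \<Longrightarrow> f' t \<le> a * f t + b" and t: "0 \<le> t" "t < T"
  shows "f t + b / a \<le> (f 0 + b / a) * exp (a * t)"
proof -
  define g where "g t = (f t + b / a) * exp (- a * t)" for t
  have "\<exists>y. (g has_real_derivative y) (at x) \<and> y \<le> 0" if "0 \<le> x" "x \<le> t" for x
  proof (intro exI conjI)
    show "(g has_real_derivative (f' x - a * f x - b) * exp (- a * x)) (at x)"
      unfolding g_def using d[of x] that t assms(1)
      by (auto intro!: derivative_eq_intros simp: algebra_simps)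
    show "(f' x - a * f x - b) * exp (- a * x) \<le> 0"
      using assms(3)[of x] that t by (simp add: mult_le_0_iff)
  qed
  then have "g t \<le> g 0" using t by (intro DERIV_nonpos_imp_nonincreasing[of 0 t g]) auto
  then have "g t * exp (a * t) \<le> g 0 * exp (a * t)" by (rule mult_right_mono) simp
  then show ?thesis by (simp add: g_def mult.assoc exp_add[symmetric])
qed

text \<open>Negative times follow by reversing time, which is why the derivative is bounded in
  absolute value.\<close>

lemma gronwall:
  fixes f f' :: "real \<Rightarrow> real"
  assumes a: "a > 0" and d: "\<And>t. \<bar>t\<bar> < T \<Longrightarrow> (f has_real_derivative f' t) (at t)"
    and le: "\<And>t. \<bar>t\<bar> < T \<Longrightarrow> \<bar>f' t\<bar> \<le> a * f t + b" and t: "\<bar>t\<bar> < T"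
  shows "f t + b / a \<le> (f 0 + b / a) * exp (a * \<bar>t\<bar>)"
proof (cases "0 \<le> t")
  case True
  have "f t + b / a \<le> (f 0 + b / a) * exp (a * t)"
  proof (rule gronwall_aux[where f' = f' and T = T, OF a])
    show "f' t \<le> a * f t + b" if "0 \<le> t" "t < T" for t using le[of t] that by simp
  qed (use d True t in auto)
  then show ?thesis using True by simp
next
  case False
  define g where "g t = f (- t)" for t
  have "g (-t) + b / a \<le> (g 0 + b / a) * exp (a * (- t))"
  proof (rule gronwall_aux[where f' = "\<lambda>t. - f' (- t)" and T = T, OF a])
    fix t :: real assume "0 \<le> t" "t < T"
    then have t: "\<bar>- t\<bar> < T" by simp
    show "- f' (- t) \<le> a * g t + b" using le[OF t] by (simp add: g_def)
    show "(g has_real_derivative - f' (- t)) (at t)"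
      unfolding g_def using DERIV_chain2[where g=uminus and x=t, OF d[OF t] DERIV_minus[OF DERIV_ident]] by simp
  qed (use False t in auto)
  then show ?thesis using False by (simp add: g_def)
qed

lemma le_jb_mult: "0 \<le> x \<Longrightarrow> x \<le> jb n * x"
  using mult_right_mono[OF jb_ge_1, of x n] by simp

text \<open>This is where s > 5/2 is used: with \<sigma> = s - 2 > 1/2 the embedding leaves two
  derivatives of u and one of \<rho> in l1, as the tame and the low energy estimates ask.\<close>

lemma state_le_l1_high:
  assumes s: "s > 5/2" and z: "state_le (\<lambda>n. jb n powr (s - 1)) u \<rho> R"
  shows "l1_le (\<lambda>n. (jb n)\<^sup>2 * cmod (u n)) (bracket_const (s - 2) * R)"
    and "l1_le (\<lambda>n. jb n * cmod (u n)) (bracket_const (s - 2) * R)"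
    and "l1_le (\<lambda>n. jb n * cmod (\<rho> n)) (bracket_const (s - 2) * R)"
proof -
  have "s - 2 > 1/2" using s by simp
  note l = state_le_l1[OF z this]
  have p: "jb n powr (s - (s - 2)) = (jb n)\<^sup>2" "jb n powr (s - 1 - (s - 2)) = jb n" for n
    using powr_numeral[of "jb n" Num.One] by (simp_all add: powr_numeral)
  show 1: "l1_le (\<lambda>n. (jb n)\<^sup>2 * cmod (u n)) (bracket_const (s - 2) * R)"
    using l(1) by (simp only: p)
  show "l1_le (\<lambda>n. jb n * cmod (\<rho> n)) (bracket_const (s - 2) * R)"
    using l(2) by (simp only: p)
  show "l1_le (\<lambda>n. jb n * cmod (u n)) (bracket_const (s - 2) * R)"
  proof (rule l1_le_mono[OF 1])
    show "jb n * cmod (u n) \<le> (jb n)\<^sup>2 * cmod (u n)" for n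
      using le_jb_mult[of "jb n * cmod (u n)" n] by (simp add: power2_eq_square mult.assoc)
  qed simp
qed

lemma state_le_square_summable:
  assumes s: "2 \<le> s" and z: "state_le (\<lambda>n. jb n powr (s - 1)) u \<rho> R"
  shows "square_summable u" "square_summable \<rho>" "square_summable (dx u)" "square_summable (dx \<rho>)"
proof -
  have "state_le jb u \<rho> R"
  proof (rule state_le_mono[OF z])
    show "jb n \<le> jb n powr (s - 1)" for n
      using powr_mono[of 1 "s - 1" "jb n"] s by simp
  qed auto
  note c = state_le_components[OF this, simplified]
  have le2: "jb n * x \<le> jb n * (jb n * x)" if "0 \<le> x" for n x
    by (intro le_jb_mult mult_nonneg_nonneg jb_nonneg that)
  have "cmod (dx u n) \<le> jb n * jb n * cmod (u n)" for n
    using cmod_dx[of u n] le2[OF norm_ge_zero, of n "u n"]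
    unfolding mult.assoc by (rule order_trans)
  then have "l2_le (\<lambda>n. cmod (dx u n)) R"
    by (intro l2_le_mono[OF c(1)]) auto
  moreover have "cmod (u n) \<le> jb n * jb n * cmod (u n)" for n
    using le_jb_mult[OF norm_ge_zero, of "u n" n] le2[OF norm_ge_zero, of n "u n"]
    unfolding mult.assoc by (rule order_trans)
  then have "l2_le (\<lambda>n. cmod (u n)) R"
    by (intro l2_le_mono[OF c(1)]) auto
  moreover have "l2_le (\<lambda>n. cmod (dx \<rho> n)) R"
    by (rule l2_le_mono[OF c(2)]) (auto simp: cmod_dx)
  moreover have "l2_le (\<lambda>n. cmod (\<rho> n)) R"
    by (rule l2_le_mono[OF c(2)]) (auto simp: le_jb_mult)
  ultimately show "square_summable u" "square_summable \<rho>" "square_summable (dx u)" "square_summable (dx \<rho>)"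
    by (auto simp: square_summable_def)
qed

section \<open>Truncation errors and stability in the low norm\<close>

abbreviation freqs :: "nat \<Rightarrow> int set" where "freqs N \<equiv> {- int N..int N}"

text \<open>Beyond the truncation all brackets are at least N + 1, and passing from the weight
  \<open>jb n powr (s - 1)\<close> down to \<open>jb n\<close> gains this factor.\<close>

definition trunc_error :: "real \<Rightarrow> nat \<Rightarrow> real" where
  "trunc_error s N = (real N + 1) powr (2 - s)"

lemma hermitian_trunc: "hermitian f \<Longrightarrow> hermitian (trunc (freqs N) f)"
  by (auto simp: hermitian_def trunc_def)

text \<open>By polarisation the field is Lipschitz on bounded sets, provided that its values are
  measured one derivative lower.\<close>

lemma vector_field_diff_bound:
  assumes z: "state_le (\<lambda>n. jb n powr (r - 1)) u \<rho> R" and y: "state_le (\<lambda>n. jb n powr (r - 1)) v \<eta> R" and r: "2 \<le> r"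
    and d: "state_le (\<lambda>n. jb n powr (r - 1)) (\<lambda>n. u n - v n) (\<lambda>n. \<rho> n - \<eta> n) \<delta>"
  shows "state_le (\<lambda>n. jb n powr (r - 2)) (\<lambda>n. Bu u \<rho> u \<rho> n - Bu v \<eta> v \<eta> n) (\<lambda>n. Br u \<rho> u \<rho> n - Br v \<eta> v \<eta> n)
     (2 * bilinear_const r * R * \<delta>)"
proof -
  note sq = state_le_square_summable[OF r z] state_le_square_summable[OF r y]
  have "state_le (\<lambda>n. jb n powr (r - 2)) (\<lambda>n. Bu u \<rho> u \<rho> n - Bu v \<eta> v \<eta> n) (\<lambda>n. Br u \<rho> u \<rho> n - Br v \<eta> v \<eta> n)
     (bilinear_const r * R * \<delta> + bilinear_const r * \<delta> * R)"
    unfolding Bu_Br_diff[OF sq(1,2,5,6,3,4,7,8)]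
    by (intro state_le_add Bu_Br_bound r z y d) simp
  then show ?thesis by (simp add: algebra_simps)
qed

lemma trunc_remainder:
  assumes s: "s > 5/2" and z: "state_le (\<lambda>n. jb n powr (s - 1)) u \<rho> R" and F: "F = freqs N"
  shows "state_le (\<lambda>n. jb n powr (2 - 1)) (\<lambda>n. u n - trunc F u n) (\<lambda>n. \<rho> n - trunc F \<rho> n) (trunc_error s N * R)"
proof -
  have "state_le (\<lambda>n. jb n powr (s - 1)) (\<lambda>n. u n - trunc F u n) (\<lambda>n. \<rho> n - trunc F \<rho> n) R"
    by (rule state_le_mono[OF z]) (auto simp: trunc_def)
  then show ?thesis
  proof (rule state_le_scale)
    fix n assume "u n - trunc F u n \<noteq> 0 \<or> \<rho> n - trunc F \<rho> n \<noteq> 0"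
    then have "n \<notin> F" by (auto simp: trunc_def)
    then have "real N + 1 \<le> \<bar>of_int n\<bar>" unfolding F by auto
    then have N: "real N + 1 \<le> jb n" using jb_int_ge[of n] by linarith
    have "jb n powr (2 - 1) = jb n powr (2 - s) * jb n powr (s - 1)" by (simp add: powr_add[symmetric])
    also have "\<dots> \<le> trunc_error s N * jb n powr (s - 1)"
      unfolding trunc_error_def using N s by (intro mult_right_mono powr_mono2') auto
    finally show "jb n powr (2 - 1) \<le> trunc_error s N * jb n powr (s - 1)" .
  qed (auto simp: trunc_error_def)
qed

text \<open>The Lipschitz bound at r = 2: the loss of one derivative leads from the weight
  \<open>jb n\<close> to the low weight, and in the weight \<open>jb n\<close> the omitted tail is
  small because s > 2.\<close>

lemma trunc_error_bound:
  assumes s: "s > 5/2" and z: "state_le (\<lambda>n. jb n powr (s - 1)) u \<rho> R" and F: "F = freqs N"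
  shows "state_le (\<lambda>_. 1)
     (\<lambda>n. Bu u \<rho> u \<rho> n - Bu (trunc F u) (trunc F \<rho>) (trunc F u) (trunc F \<rho>) n)
     (\<lambda>n. Br u \<rho> u \<rho> n - Br (trunc F u) (trunc F \<rho>) (trunc F u) (trunc F \<rho>) n)
     (2 * bilinear_const 2 * R * (trunc_error s N * R))"
proof -
  have jbp: "jb n powr 1 \<le> jb n powr (s - 1)" for n using s by (intro powr_mono) auto
  have z2: "state_le (\<lambda>n. jb n powr (2 - 1)) u \<rho> R"
    by (rule state_le_mono[OF z]) (use jbp in auto)
  have t2: "state_le (\<lambda>n. jb n powr (2 - 1)) (trunc F u) (trunc F \<rho>) R"
    by (rule state_le_mono[OF z2]) (auto simp: cmod_trunc_le)
  show ?thesis using vector_field_diff_bound[OF z2 t2 _ trunc_remainder[OF s z F]] by simp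
qed

text \<open>Imposing the equations on F alone covers the Galerkin systems, the full system (F =
  \<open>UNIV\<close>), and either of them viewed on a smaller set of frequencies.\<close>

definition solves_freq :: "real \<Rightarrow> int set \<Rightarrow> (real \<Rightarrow> int \<Rightarrow> complex) \<Rightarrow> (real \<Rightarrow> int \<Rightarrow> complex) \<Rightarrow> bool" where
  "solves_freq T F u \<rho> \<longleftrightarrow> (\<forall>t n. \<bar>t\<bar> < T \<longrightarrow> n \<in> F \<longrightarrow>
     ((\<lambda>t. u t n) has_vector_derivative Bu (u t) (\<rho> t) (u t) (\<rho> t) n) (at t) \<and>
     ((\<lambda>t. \<rho> t n) has_vector_derivative Br (u t) (\<rho> t) (u t) (\<rho> t) n) (at t))"

text \<open>The summand 1 absorbs the truncation errors after Young's inequality.\<close>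

definition low_rate :: "real \<Rightarrow> real \<Rightarrow> real" where
  "low_rate s R = 40 * (bracket_const (s - 2) * R) + 1"

text \<open>The truncation error of the field, counted once for each of the two curves
  compared.\<close>

definition low_error :: "real \<Rightarrow> real \<Rightarrow> nat \<Rightarrow> real" where
  "low_error s R N = 4 * bilinear_const 2 * R * (trunc_error s N * R)"

lemma energy_cong:
  assumes "\<And>n. n \<in> F \<Longrightarrow> u n = u' n" "\<And>n. n \<in> F \<Longrightarrow> \<rho> n = \<rho>' n"
  shows "energy F V u \<rho> = energy F V u' \<rho>'"
  unfolding energy_def by (rule sum.cong) (simp_all add: assms)

lemma energy_rate_cong:
  assumes "\<And>n. n \<in> F \<Longrightarrow> u n = u' n" "\<And>n. n \<in> F \<Longrightarrow> \<rho> n = \<rho>' n"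
  shows "energy_rate F V u \<rho> du d\<rho> = energy_rate F V u' \<rho>' du d\<rho>"
  unfolding energy_rate_def by (simp add: assms cong: sum.cong del: cnj.simps times_complex.simps)

text \<open>The curves satisfy the equations on F without being supported there, so exact solutions
  and Galerkin solutions of higher level are included. On F their difference moves by the fields of
  the truncated states, which \<open>low_energy_estimate\<close> controls, plus a consistency
  error.\<close>

lemma low_stability:
  assumes s: "s > 5/2" and F: "F = freqs N"
    and eq: "solves_freq T F u \<rho>" "solves_freq T F v \<eta>"
    and bd: "\<And>t. \<bar>t\<bar> < T \<Longrightarrow> state_le (\<lambda>n. jb n powr (s - 1)) (u t) (\<rho> t) R"
      "\<And>t. \<bar>t\<bar> < T \<Longrightarrow> state_le (\<lambda>n. jb n powr (s - 1)) (v t) (\<eta> t) R"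
    and h: "\<And>t. \<bar>t\<bar> < T \<Longrightarrow> hermitian (u t)" and t: "\<bar>t\<bar> < T"
  shows "energy F (\<lambda>_. 1) (\<lambda>n. u t n - v t n) (\<lambda>n. \<rho> t n - \<eta> t n)
    \<le> (energy F (\<lambda>_. 1) (\<lambda>n. u 0 n - v 0 n) (\<lambda>n. \<rho> 0 n - \<eta> 0 n) + (low_error s R N)\<^sup>2) * exp (low_rate s R * T)"
proof -
  define A where "A = bracket_const (s - 2) * R"
  define f where "f t = energy F (\<lambda>_. 1) (\<lambda>n. u t n - v t n) (\<lambda>n. \<rho> t n - \<eta> t n)" for t
  define \<epsilon> where "\<epsilon> = low_error s R N"
  have T: "T > 0" using t by linarith
  have A0: "0 \<le> A" unfolding A_def
    using s T by (intro mult_nonneg_nonneg bracket_const_nonneg state_le_nonneg[OF bd(1)[of 0]]) auto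
  have a: "low_rate s R > 0" "low_rate s R \<ge> 1" using A0 by (auto simp: low_rate_def A_def)
  have finF: "finite F" by (simp add: F)
  define du d\<rho> where "du t = (\<lambda>n. Bu (u t) (\<rho> t) (u t) (\<rho> t) n - Bu (v t) (\<eta> t) (v t) (\<eta> t) n)"
    and "d\<rho> t = (\<lambda>n. Br (u t) (\<rho> t) (u t) (\<rho> t) n - Br (v t) (\<eta> t) (v t) (\<eta> t) n)" for t
  define f' where "f' t = energy_rate F (\<lambda>_. 1) (\<lambda>n. u t n - v t n) (\<lambda>n. \<rho> t n - \<eta> t n) (du t) (d\<rho> t)" for t
  have "(f has_real_derivative f' t) (at t)" if t: "\<bar>t\<bar> < T" for t
    unfolding f_def f'_def du_def d\<rho>_def
    by (rule energy_deriv; rule has_vector_derivative_diff) (use eq t in \<open>auto simp: solves_freq_def\<close>)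
  moreover have "\<bar>f' t\<bar> \<le> low_rate s R * f t + \<epsilon>\<^sup>2" if t: "\<bar>t\<bar> < T" for t
  proof -
    define a \<alpha> b \<beta> where "a = trunc F (u t)" and "\<alpha> = trunc F (\<rho> t)" and "b = trunc F (v t)" and "\<beta> = trunc F (\<eta> t)"
    define w r where "w = (\<lambda>n. a n - b n)" and "r = (\<lambda>n. \<alpha> n - \<beta> n)"
    have E: "energy F (\<lambda>_. 1) w r = f t"
      unfolding f_def by (rule energy_cong) (simp_all add: w_def r_def a_def \<alpha>_def b_def \<beta>_def trunc_def)
    have tr: "state_le (\<lambda>n. jb n powr (s - 1)) a \<alpha> R" "state_le (\<lambda>n. jb n powr (s - 1)) b \<beta> R"
      unfolding a_def \<alpha>_def b_def \<beta>_def by (rule state_le_mono[OF bd(1)[OF t]] state_le_mono[OF bd(2)[OF t]]; simp add: cmod_trunc_le)+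
    note la = state_le_l1_high[OF s tr(1), folded A_def] and lb = state_le_l1_high[OF s tr(2), folded A_def]
    \<comment> \<open>The consistency error: what truncating both states changes in the difference
      of the fields.\<close>
    define e1 e2 where "e1 = (\<lambda>n. (Bu (u t) (\<rho> t) (u t) (\<rho> t) n - Bu a \<alpha> a \<alpha> n) - (Bu (v t) (\<eta> t) (v t) (\<eta> t) n - Bu b \<beta> b \<beta> n))"
      and "e2 = (\<lambda>n. (Br (u t) (\<rho> t) (u t) (\<rho> t) n - Br a \<alpha> a \<alpha> n) - (Br (v t) (\<eta> t) (v t) (\<eta> t) n - Br b \<beta> b \<beta> n))"
    have du: "du t = (\<lambda>n. (Bu a \<alpha> a \<alpha> n - Bu b \<beta> b \<beta> n) + e1 n)" and d\<rho>: "d\<rho> t = (\<lambda>n. (Br a \<alpha> a \<alpha> n - Br b \<beta> b \<beta> n) + e2 n)"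
      by (simp_all add: du_def d\<rho>_def e1_def e2_def fun_eq_iff)
    have "state_le (\<lambda>_. 1) e1 e2 (2 * bilinear_const 2 * R * (trunc_error s N * R) + 2 * bilinear_const 2 * R * (trunc_error s N * R))"
      unfolding e1_def e2_def a_def \<alpha>_def b_def \<beta>_def
      by (rule state_le_diff[OF trunc_error_bound[OF s bd(1)[OF t] F] trunc_error_bound[OF s bd(2)[OF t] F]]) simp
    then have "state_le (\<lambda>_. 1) e1 e2 \<epsilon>"
      by (simp add: \<epsilon>_def low_error_def mult_ac)
    then have e: "energy F (\<lambda>_. 1) e1 e2 \<le> \<epsilon>\<^sup>2" using finF by (rule state_le_energy)
    have "f' t = energy_rate F (\<lambda>_. 1) w r (du t) (d\<rho> t)"
      unfolding f'_def by (rule energy_rate_cong) (simp_all add: w_def r_def a_def \<alpha>_def b_def \<beta>_def trunc_def)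
    also have "\<dots> = energy_rate F (\<lambda>_. 1) w r (\<lambda>n. Bu a \<alpha> a \<alpha> n - Bu b \<beta> b \<beta> n) (\<lambda>n. Br a \<alpha> a \<alpha> n - Br b \<beta> b \<beta> n)
       + energy_rate F (\<lambda>_. 1) w r e1 e2"
      unfolding du d\<rho> by (rule energy_rate_add)
    finally have f': "f' t = \<dots>" .
    have "\<bar>f' t\<bar> \<le> 40 * A * energy F (\<lambda>_. 1) w r + (energy F (\<lambda>_. 1) w r + energy F (\<lambda>_. 1) e1 e2)"
      unfolding f'
    proof (rule order_trans[OF abs_triangle_ineq add_mono[OF _ energy_rate_le]])
      show "\<bar>energy_rate F (\<lambda>_. 1) w r (\<lambda>n. Bu a \<alpha> a \<alpha> n - Bu b \<beta> b \<beta> n) (\<lambda>n. Br a \<alpha> a \<alpha> n - Br b \<beta> b \<beta> n)\<bar> \<le> 40 * A * energy F (\<lambda>_. 1) w r"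
        unfolding w_def r_def
      proof (rule low_energy_estimate[OF finF _ _ _ _ _ la(2) l1_le_jbD(1)[OF la(3)] lb(1) lb(3)])
        show "hermitian a" unfolding a_def F by (intro hermitian_trunc h t)
      qed (simp_all add: a_def \<alpha>_def b_def \<beta>_def)
    qed
    also have "\<dots> \<le> low_rate s R * f t + \<epsilon>\<^sup>2"
      unfolding E using e by (simp add: low_rate_def A_def algebra_simps)
    finally show ?thesis .
  qed
  ultimately have "f t + \<epsilon>\<^sup>2 / low_rate s R \<le> (f 0 + \<epsilon>\<^sup>2 / low_rate s R) * exp (low_rate s R * \<bar>t\<bar>)"
    by (rule gronwall[OF a(1)]) (use t in auto)
  also have "\<dots> \<le> (f 0 + \<epsilon>\<^sup>2) * exp (low_rate s R * T)"
  proof (intro mult_mono add_left_mono)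
    show "\<epsilon>\<^sup>2 / low_rate s R \<le> \<epsilon>\<^sup>2" using a by (simp add: divide_le_eq mult_le_cancel_left1)
    show "exp (low_rate s R * \<bar>t\<bar>) \<le> exp (low_rate s R * T)" using a t by simp
    show "0 \<le> f 0 + \<epsilon>\<^sup>2" by (simp add: f_def energy_nonneg)
  qed simp
  finally show ?thesis unfolding f_def[symmetric] \<epsilon>_def[symmetric]
    using a by (smt (verit) divide_nonneg_pos zero_le_power2)
qed

section \<open>Global solutions of Lipschitz ordinary differential equations\<close>

definition prim :: "(real \<Rightarrow> 'a::banach) \<Rightarrow> real \<Rightarrow> 'a" where
  "prim g t = (if 0 \<le> t then integral {0..t} g else - integral {t..0} g)"

lemma prim_0 [simp]: "prim g 0 = 0" by (simp add: prim_def)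

lemma prim_has_vector_derivative:
  fixes g :: "real \<Rightarrow> 'a::banach"
  assumes g: "continuous_on UNIV g"
  shows "(prim g has_vector_derivative g t) (at t)"
proof -
  define S where "S = \<bar>t\<bar> + 1"
  have S: "S > 0" "- S < t" "t < S" by (auto simp: S_def)
  have gi: "g integrable_on {a..b}" for a b
    by (intro integrable_continuous_real continuous_on_subset[OF g]) auto
  have eq: "prim g \<tau> = integral {- S..\<tau>} g - integral {- S..0} g" if "\<tau> \<in> {- S<..<S}" for \<tau>
  proof (cases "0 \<le> \<tau>")
    case True
    then show ?thesis using Henstock_Kurzweil_Integration.integral_combine[where f=g and a="- S" and c=0 and b=\<tau>] gi S by (auto simp: prim_def algebra_simps)
  next
    case False
    then show ?thesis using Henstock_Kurzweil_Integration.integral_combine[where f=g and a="- S" and c=\<tau> and b=0] gi S that by (auto simp: prim_def algebra_simps)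
  qed
  have "((\<lambda>u. integral {- S..u} g) has_vector_derivative g t) (at t within {- S..S})"
    using S by (intro integral_has_vector_derivative continuous_on_subset[OF g]) auto
  then have "((\<lambda>u. integral {- S..u} g) has_vector_derivative g t) (at t)"
    using S by (simp add: at_within_Icc_at)
  then have "((\<lambda>u. integral {- S..u} g - integral {- S..0} g) has_vector_derivative g t - 0) (at t)"
    by (intro has_vector_derivative_diff has_vector_derivative_const)
  then show ?thesis
    by (subst has_vector_derivative_transform_within_open[of _ _ _ "{- S<..<S}" "prim g"]) (use S eq in auto)
qed

lemma prim_diff:
  fixes g h :: "real \<Rightarrow> 'a::banach"
  assumes "continuous_on UNIV g" "continuous_on UNIV h"
  shows "prim g t - prim h t = prim (\<lambda>s. g s - h s) t"
proof -
  have "g integrable_on {a..b}" "h integrable_on {a..b}" for a b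
    by (intro integrable_continuous_real continuous_on_subset[OF assms(1)] continuous_on_subset[OF assms(2)]; simp)+
  then show ?thesis by (simp add: prim_def integral_diff)
qed

text \<open>Against growth of order \<open>exp (c * \<bar>s\<bar>)\<close> integration gains the
  factor 1 / c. This is what makes the Picard map contract on the whole line at once.\<close>

lemma norm_prim_le:
  fixes g :: "real \<Rightarrow> 'a::banach"
  assumes g: "continuous_on UNIV g" and c: "c > 0" and K: "\<And>s. norm (g s) \<le> K * exp (c * \<bar>s\<bar>)"
  shows "norm (prim g t) \<le> K / c * exp (c * \<bar>t\<bar>)"
proof -
  have gi: "g integrable_on {a..b}" for a b
    by (intro integrable_continuous_real continuous_on_subset[OF g]) auto
  have K0: "0 \<le> K" using K[of 0] norm_ge_zero[of "g 0"] by (simp del: norm_ge_zero)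
  show ?thesis
  proof (cases "0 \<le> t")
    case True
    have i: "((\<lambda>s. K * exp (c * s)) has_integral K / c * exp (c * t) - K / c * exp (c * 0)) {0..t}"
      using c by (intro fundamental_theorem_of_calculus True)
        (auto intro!: derivative_eq_intros simp flip: has_real_derivative_iff_has_vector_derivative)
    have "norm (integral {0..t} g) \<le> integral {0..t} (\<lambda>s. K * exp (c * s))"
      using K by (intro integral_norm_bound_integral gi has_integral_integrable[OF i]) (metis abs_of_nonneg atLeastAtMost_iff)
    also have "\<dots> = K / c * exp (c * t) - K / c * exp (c * 0)" using i by (rule integral_unique)
    finally show ?thesis using True divide_nonneg_pos[OF K0 c] by (simp add: prim_def)
  next
    case False
    have i: "((\<lambda>s. K * exp (- c * s)) has_integral (- K / c * exp (- c * 0)) - (- K / c * exp (- c * t))) {t..0}"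
      using c False by (intro fundamental_theorem_of_calculus)
        (auto intro!: derivative_eq_intros simp flip: has_real_derivative_iff_has_vector_derivative)
    have "norm (integral {t..0} g) \<le> integral {t..0} (\<lambda>s. K * exp (- c * s))"
      using K by (intro integral_norm_bound_integral gi has_integral_integrable[OF i])
        (metis abs_of_nonpos atLeastAtMost_iff minus_mult_minus mult_minus_right mult_minus_left)
    also have "\<dots> = (- K / c * exp (- c * 0)) - (- K / c * exp (- c * t))" using i by (rule integral_unique)
    finally show ?thesis using False divide_nonneg_pos[OF K0 c] by (simp add: prim_def)
  qed
qed

text \<open>Lets bounded continuous functions serve as the phase space of the Galerkin
  systems.\<close>

instance bcontfun :: (metric_space, banach) banach ..

text \<open>Picard iteration for the curve multiplied by \<open>exp (- c * \<bar>t\<bar>)\<close>.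
  The exponential weight gives a contraction without any restriction on time, and the bound M keeps
  the iterates among the bounded continuous functions.\<close>

lemma lipschitz_ode_global:
  fixes f :: "'a::banach \<Rightarrow> 'a"
  assumes L: "\<And>x y. norm (f x - f y) \<le> L * norm (x - y)" and L0: "0 \<le> L" and M: "\<And>x. norm (f x) \<le> M"
  shows "\<exists>x. x 0 = x0 \<and> (\<forall>t. (x has_vector_derivative f (x t)) (at t))"
proof -
  \<comment> \<open>Makes the contraction factor \<open>L / c\<close> at most 1/2, and stays
    positive when L = 0.\<close>
  define c where "c = 2 * L + 1"
  have c: "c > 0" "L / c \<le> 1/2" using L0 by (auto simp: c_def field_simps)
  have M0: "0 \<le> M" using M[of 0] norm_ge_zero[of "f 0"] by linarith
  have fc: "continuous_on UNIV f"
    using L L0 by (intro lipschitz_on_continuous_on[of L] lipschitz_onI) (auto simp: dist_norm)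
  \<comment> \<open>The field along the curve that y encodes, with the exponential weight
    removed.\<close>
  define g where "g y s = f (exp (c * \<bar>s\<bar>) *\<^sub>R apply_bcontfun y s)" for y :: "real \<Rightarrow>\<^sub>C 'a" and s
  have gc: "continuous_on UNIV (g y)" for y
    unfolding g_def by (intro continuous_on_compose2[OF fc] continuous_intros) auto
  have gM: "norm (g y s) \<le> M * exp (c * \<bar>s\<bar>)" for y s
  proof -
    have "M * 1 \<le> M * exp (c * \<bar>s\<bar>)" using c M0 by (intro mult_left_mono) auto
    then show ?thesis using M[of "exp (c * \<bar>s\<bar>) *\<^sub>R apply_bcontfun y s"] by (simp add: g_def)
  qed
  define G where "G y t = exp (- c * \<bar>t\<bar>) *\<^sub>R (x0 + prim (g y) t)" for y t
  have pc: "continuous_on UNIV (prim (g y))" for y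
    using prim_has_vector_derivative[OF gc] by (meson continuous_at_imp_continuous_on has_vector_derivative_continuous)
  have expc: "exp (- c * \<bar>t\<bar>) \<le> 1" for t using c by simp
  have Gb: "G y \<in> bcontfun" for y
  proof (rule bcontfun_normI)
    show "continuous_on UNIV (G y)" unfolding G_def by (intro continuous_intros pc)
    fix t
    have "norm (G y t) \<le> exp (- c * \<bar>t\<bar>) * (norm x0 + M / c * exp (c * \<bar>t\<bar>))"
      unfolding G_def norm_scaleR using norm_prim_le[OF gc c(1) gM]
      by (simp add: order_trans[OF norm_triangle_ineq])
    also have "\<dots> = exp (- c * \<bar>t\<bar>) * norm x0 + M / c"
      by (simp add: distrib_left exp_minus)
    also have "\<dots> \<le> 1 * norm x0 + M / c" by (intro add_mono mult_right_mono expc) auto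
    finally show "norm (G y t) \<le> norm x0 + M / c" by simp
  qed
  have "\<exists>!y. Bcontfun (G y) = y"
  proof (rule banach_fix_type[of "1/2"], simp, simp, intro allI)
    fix y z
    show "dist (Bcontfun (G y)) (Bcontfun (G z)) \<le> 1/2 * dist y z"
    proof (rule dist_bound)
      fix t
      have "norm (g y s - g z s) \<le> (L * dist y z) * exp (c * \<bar>s\<bar>)" for s
      proof -
        have "norm (g y s - g z s) \<le> L * norm (exp (c * \<bar>s\<bar>) *\<^sub>R (apply_bcontfun y s - apply_bcontfun z s))"
          unfolding g_def scaleR_diff_right by (rule L)
        also have "\<dots> = L * (exp (c * \<bar>s\<bar>) * dist (apply_bcontfun y s) (apply_bcontfun z s))"
          by (simp add: dist_norm)
        also have "\<dots> \<le> L * (exp (c * \<bar>s\<bar>) * dist y z)"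
          using L0 by (intro mult_left_mono dist_bounded) auto
        finally show ?thesis by (simp add: mult_ac)
      qed
      then have "norm (prim (\<lambda>s. g y s - g z s) t) \<le> (L * dist y z) / c * exp (c * \<bar>t\<bar>)"
        by (intro norm_prim_le c continuous_intros gc)
      then have 1: "norm (prim (g y) t - prim (g z) t) \<le> (L * dist y z) / c * exp (c * \<bar>t\<bar>)"
        by (simp add: prim_diff gc)
      have "dist (G y t) (G z t) = exp (- c * \<bar>t\<bar>) * norm (prim (g y) t - prim (g z) t)"
        by (simp add: G_def dist_norm scaleR_diff_right[symmetric])
      also have "\<dots> \<le> exp (- c * \<bar>t\<bar>) * ((L * dist y z) / c * exp (c * \<bar>t\<bar>))"
        by (intro mult_left_mono 1) auto
      also have "\<dots> = L / c * dist y z" by (simp add: exp_minus)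
      also have "\<dots> \<le> 1/2 * dist y z" by (intro mult_right_mono c) auto
      finally show "dist (apply_bcontfun (Bcontfun (G y)) t) (apply_bcontfun (Bcontfun (G z)) t) \<le> 1/2 * dist y z"
        by (simp add: Bcontfun_inverse Gb)
    qed
  qed
  then obtain y where "Bcontfun (G y) = y" by blast
  then have y: "apply_bcontfun y t = G y t" for t by (metis Bcontfun_inverse Gb)
  define x where "x t = x0 + prim (g y) t" for t
  have e: "exp (c * \<bar>t\<bar>) *\<^sub>R apply_bcontfun y t = x t" for t
    by (simp add: y G_def x_def exp_minus[symmetric] exp_add[symmetric])
  have "(x has_vector_derivative f (x t)) (at t)" for t
  proof -
    have "(x has_vector_derivative 0 + g y t) (at t)"
      unfolding x_def by (intro has_vector_derivative_add has_vector_derivative_const prim_has_vector_derivative gc)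
    then show ?thesis by (simp add: g_def e)
  qed
  moreover have "x 0 = x0" by (simp add: x_def)
  ultimately show ?thesis by blast
qed

section \<open>Galerkin approximations\<close>

text \<open>Boundedness is part of the class because a product of Lipschitz maps is Lipschitz only
  with it; the class is then closed under all operations that build the field.\<close>

definition bounded_lipschitz :: "('a::metric_space \<Rightarrow> 'b::real_normed_vector) \<Rightarrow> bool" where
  "bounded_lipschitz g \<longleftrightarrow> (\<exists>L M. 0 \<le> L \<and> 0 \<le> M \<and> (\<forall>x. norm (g x) \<le> M) \<and> (\<forall>x y. norm (g x - g y) \<le> L * dist x y))"

lemma bounded_lipschitzI:
  "0 \<le> L \<Longrightarrow> 0 \<le> M \<Longrightarrow> (\<And>x. norm (g x) \<le> M) \<Longrightarrow> (\<And>x y. norm (g x - g y) \<le> L * dist x y) \<Longrightarrow> bounded_lipschitz g"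
  unfolding bounded_lipschitz_def by blast

lemma bounded_lipschitz_const: "bounded_lipschitz (\<lambda>x. c)"
  by (rule bounded_lipschitzI[of 0 "norm c"]) auto

lemma bounded_lipschitz_add:
  assumes "bounded_lipschitz f" "bounded_lipschitz g" shows "bounded_lipschitz (\<lambda>x. f x + g x)"
proof -
  obtain L M L' M' where *: "0 \<le> L" "0 \<le> M" "\<And>x. norm (f x) \<le> M" "\<And>x y. norm (f x - f y) \<le> L * dist x y"
    "0 \<le> L'" "0 \<le> M'" "\<And>x. norm (g x) \<le> M'" "\<And>x y. norm (g x - g y) \<le> L' * dist x y"
    using assms unfolding bounded_lipschitz_def by metis
  show ?thesis
  proof (rule bounded_lipschitzI)
    show "norm (f x + g x) \<le> M + M'" for x using * by (intro norm_triangle_mono)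
    fix x y
    have "norm ((f x - f y) + (g x - g y)) \<le> L * dist x y + L' * dist x y" using * by (intro norm_triangle_mono)
    then show "norm (f x + g x - (f y + g y)) \<le> (L + L') * dist x y" by (simp add: algebra_simps)
  qed (use * in auto)
qed

lemma bounded_lipschitz_mult:
  fixes f g :: "'a::metric_space \<Rightarrow> 'b::real_normed_algebra"
  assumes "bounded_lipschitz f" "bounded_lipschitz g" shows "bounded_lipschitz (\<lambda>x. f x * g x)"
proof -
  obtain L M L' M' where *: "0 \<le> L" "0 \<le> M" "\<And>x. norm (f x) \<le> M" "\<And>x y. norm (f x - f y) \<le> L * dist x y"
    "0 \<le> L'" "0 \<le> M'" "\<And>x. norm (g x) \<le> M'" "\<And>x y. norm (g x - g y) \<le> L' * dist x y"
    using assms unfolding bounded_lipschitz_def by metis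
  show ?thesis
  proof (rule bounded_lipschitzI)
    show "norm (f x * g x) \<le> M * M'" for x
      using * by (intro order_trans[OF norm_mult_ineq] mult_mono) auto
    fix x y
    have "f x * g x - f y * g y = f x * (g x - g y) + (f x - f y) * g y" by (simp add: algebra_simps)
    also have "norm (f x * (g x - g y) + (f x - f y) * g y) \<le> M * (L' * dist x y) + (L * dist x y) * M'"
    proof (rule norm_triangle_mono)
      show "norm (f x * (g x - g y)) \<le> M * (L' * dist x y)"
        using * by (rule_tac order_trans[OF norm_mult_ineq mult_mono]) auto
      show "norm ((f x - f y) * g y) \<le> (L * dist x y) * M'"
        using * by (rule_tac order_trans[OF norm_mult_ineq mult_mono]) auto
    qed
    finally show "norm (f x * g x - f y * g y) \<le> (M * L' + L * M') * dist x y" by (simp add: algebra_simps)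
  qed (use * in auto)
qed

lemma bounded_lipschitz_diff:
  fixes f g :: "'a::metric_space \<Rightarrow> 'b::real_normed_algebra_1"
  assumes "bounded_lipschitz f" "bounded_lipschitz g" shows "bounded_lipschitz (\<lambda>x. f x - g x)"
  using bounded_lipschitz_add[OF assms(1) bounded_lipschitz_mult[OF bounded_lipschitz_const[of "-1"] assms(2)]] by simp

lemma bounded_lipschitz_sum:
  "finite F \<Longrightarrow> (\<And>k. k \<in> F \<Longrightarrow> bounded_lipschitz (f k)) \<Longrightarrow> bounded_lipschitz (\<lambda>x. \<Sum>k\<in>F. f k x)"
  by (induction F rule: finite_induct) (auto intro: bounded_lipschitz_const bounded_lipschitz_add)

text \<open>Real and imaginary parts are clamped separately: this commutes with conjugation, is the
  identity on the disc of radius R, and is Lipschitz by one-dimensional estimates.\<close>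

definition clamp :: "real \<Rightarrow> complex \<Rightarrow> complex" where
  "clamp R z = Complex (max (- R) (min R (Re z))) (max (- R) (min R (Im z)))"

lemma clamp_cnj: "0 \<le> R \<Longrightarrow> clamp R (cnj z) = cnj (clamp R z)"
  by (auto simp: clamp_def complex_eq_iff max_def min_def)

lemma clamp_eq: "cmod z \<le> R \<Longrightarrow> clamp R z = z"
  using abs_Re_le_cmod[of z] abs_Im_le_cmod[of z] by (auto simp: clamp_def complex_eq_iff max_def min_def)

lemma cmod_clamp_le: "0 \<le> R \<Longrightarrow> cmod (clamp R z) \<le> 2 * R"
  by (rule order_trans[OF cmod_le]) (auto simp: clamp_def max_def min_def)

lemma clamp_lipschitz: "cmod (clamp R z - clamp R w) \<le> 2 * cmod (z - w)"
proof -
  have m: "\<bar>max (- R) (min R x) - max (- R) (min R y)\<bar> \<le> \<bar>x - y\<bar>" for x y :: real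
    by (auto simp: max_def min_def)
  have "cmod (clamp R z - clamp R w) \<le> \<bar>Re (z - w)\<bar> + \<bar>Im (z - w)\<bar>"
    by (rule order_trans[OF cmod_le]) (auto simp: clamp_def intro!: add_mono m)
  then show ?thesis using abs_Re_le_cmod[of "z - w"] abs_Im_le_cmod[of "z - w"] by linarith
qed

text \<open>Clamping makes the truncated vector field bounded and Lipschitz; averaging with the reflected
  conjugate makes it preserve Hermitian symmetry.\<close>

definition clamped :: "int set \<Rightarrow> real \<Rightarrow> (int \<Rightarrow> complex) \<Rightarrow> int \<Rightarrow> complex" where
  "clamped F R z n = (if n \<in> F then clamp R ((z n + cnj (z (- n))) / 2) else 0)"

lemma supp_in_clamped: "supp_in F (clamped F R z)"
  by (simp add: supp_in_def clamped_def)

lemma hermitian_clamped: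
  assumes "0 \<le> R" shows "hermitian (clamped (freqs N) R z)"
  unfolding hermitian_def
proof
  fix n
  have "(z (- n) + cnj (z n)) / 2 = cnj ((z n + cnj (z (- n))) / 2)" by simp
  then show "clamped (freqs N) R z (- n) = cnj (clamped (freqs N) R z n)"
    by (auto simp: clamped_def clamp_cnj[OF assms] simp del: complex_cnj_divide complex_cnj_add)
qed

lemma clamped_eq:
  assumes "hermitian z" "supp_in F z" "\<And>n. cmod (z n) \<le> R" shows "clamped F R z = z"
  using assms by (auto simp: clamped_def hermitian_def supp_in_def fun_eq_iff clamp_eq)

lemma bounded_lipschitz_clamped:
  fixes p :: "'a::metric_space \<Rightarrow> int \<Rightarrow> complex"
  assumes R: "0 \<le> R" and p: "\<And>x y n. cmod (p x n - p y n) \<le> dist x y"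
  shows "bounded_lipschitz (\<lambda>x. clamped F R (p x) n)"
proof (rule bounded_lipschitzI[of 2 "2 * R"])
  show "cmod (clamped F R (p x) n) \<le> 2 * R" for x using R by (simp add: clamped_def cmod_clamp_le)
  fix x y
  have "cmod ((p x n + cnj (p x (- n))) / 2 - (p y n + cnj (p y (- n))) / 2) =
     cmod ((p x n - p y n) + cnj (p x (- n) - p y (- n))) / 2"
    by (simp add: norm_divide diff_divide_distrib[symmetric] algebra_simps)
  also have "\<dots> \<le> (dist x y + dist x y) / 2"
    by (rule divide_right_mono[OF norm_triangle_mono[OF p]]) (subst complex_mod_cnj, rule p, simp)
  finally have "cmod ((p x n + cnj (p x (- n))) / 2 - (p y n + cnj (p y (- n))) / 2) \<le> dist x y" by simp
  then show "cmod (clamped F R (p x) n - clamped F R (p y) n) \<le> 2 * dist x y"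
    using clamp_lipschitz[of R "(p x n + cnj (p x (- n))) / 2" "(p y n + cnj (p y (- n))) / 2"]
    by (auto simp: clamped_def)
qed (use R in auto)

lemma bounded_lipschitz_conv:
  assumes F: "finite F" and s: "\<And>x. supp_in F (q x)"
    and "\<And>n. bounded_lipschitz (\<lambda>x. p x n)" "\<And>n. bounded_lipschitz (\<lambda>x. q x n)"
  shows "bounded_lipschitz (\<lambda>x. conv (p x) (q x) n)"
  unfolding conv_finite[OF F s] by (intro bounded_lipschitz_sum bounded_lipschitz_mult F assms)

lemma conv_cnj:
  assumes "hermitian f" "hermitian g" "supp_in (freqs N) g"
  shows "conv f g (- n) = cnj (conv f g n)"
proof -
  have "conv f g (- n) = (\<Sum>k\<in>freqs N. f (- n - k) * g k)" by (rule conv_finite) (use assms in auto)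
  also have "\<dots> = (\<Sum>k\<in>freqs N. f (- (n - k)) * g (- k))"
    by (rule sum.reindex_bij_witness[of _ uminus uminus]) auto
  also have "\<dots> = cnj (\<Sum>k\<in>freqs N. f (n - k) * g k)"
    unfolding assms(1,2)[unfolded hermitian_def, rule_format] cnj_sum complex_cnj_mult ..
  also have "(\<Sum>k\<in>freqs N. f (n - k) * g k) = conv f g n"
    by (rule conv_finite[symmetric]) (use assms in auto)
  finally show ?thesis .
qed

lemma hermitian_dx: "hermitian f \<Longrightarrow> hermitian (dx f)"
  by (simp add: hermitian_def dx_def)

lemma hermitian_Bu_Br:
  assumes h: "hermitian u" "hermitian \<rho>" and s: "supp_in (freqs N) u" "supp_in (freqs N) \<rho>"
  shows "hermitian (Bu u \<rho> u \<rho>)" "hermitian (Br u \<rho> u \<rho>)"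
proof -
  note c = conv_cnj[OF _ _ s(1)] conv_cnj[OF _ _ s(2)]
    conv_cnj[OF _ _ supp_in_dx[OF s(1)]] conv_cnj[OF _ _ supp_in_dx[OF s(2)]]
  show "hermitian (Bu u \<rho> u \<rho>)" "hermitian (Br u \<rho> u \<rho>)"
    unfolding hermitian_def Bu_def Br_def by (simp_all add: c h hermitian_dx)
qed

lemma constant_if_zero_derivative:
  fixes f :: "real \<Rightarrow> 'a::real_normed_vector"
  assumes "\<And>t. (f has_vector_derivative 0) (at t)" shows "f t = f 0"
proof -
  have "\<exists>c. \<forall>x\<in>UNIV. f x = c"
    using assms by (intro has_derivative_zero_constant) (auto simp: has_vector_derivative_def)
  then show ?thesis by auto
qed

text \<open>The library provides completeness of the bounded continuous functions only on metric
  spaces, and \<open>int\<close> is not one; so families indexed by integers are extended to the line.\<close>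

definition interp :: "int set \<Rightarrow> (int \<Rightarrow> 'a::real_normed_vector) \<Rightarrow> real \<Rightarrow> 'a" where
  "interp F v x = (\<Sum>n\<in>F. max 0 (1 - \<bar>x - of_int n\<bar>) *\<^sub>R v n)"

lemma interp_of_int:
  assumes "finite F" shows "interp F v (of_int n) = (if n \<in> F then v n else 0)"
proof -
  have "max 0 (1 - \<bar>real_of_int n - of_int k\<bar>) = (if k = n then 1 else 0)" for k
  proof (cases "k = n")
    case False
    then have "1 \<le> \<bar>n - k\<bar>" by simp
    then have "1 \<le> \<bar>real_of_int n - of_int k\<bar>" by linarith
    then show ?thesis using False by simp
  qed simp
  then have "interp F v (of_int n) = (\<Sum>k\<in>F. if k = n then v k else 0)"
    unfolding interp_def by (intro sum.cong) auto
  then show ?thesis using assms by simp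
qed

lemma continuous_on_interp: "continuous_on UNIV (interp F v)"
  unfolding interp_def by (intro continuous_intros)

lemma norm_interp_le:
  assumes "\<And>n. n \<in> F \<Longrightarrow> norm (v n) \<le> M n" shows "norm (interp F v x) \<le> sum M F"
  unfolding interp_def
proof (rule order_trans[OF norm_sum sum_mono])
  fix n assume n: "n \<in> F"
  have "norm (max 0 (1 - \<bar>x - of_int n\<bar>) *\<^sub>R v n) \<le> 1 * norm (v n)"
    unfolding norm_scaleR by (rule mult_right_mono) auto
  then show "norm (max 0 (1 - \<bar>x - of_int n\<bar>) *\<^sub>R v n) \<le> M n" using assms[OF n] by simp
qed

lemma interp_diff: "interp F v x - interp F w x = interp F (\<lambda>n. v n - w n) x"
  by (simp add: interp_def sum_subtractf scaleR_diff_right)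

text \<open>The clamped field is bounded and Lipschitz, so the solution is global. Support and
  Hermitian symmetry are preserved because the quantities that measure their failure vanish at time
  0 and have zero derivative.\<close>

lemma clamped_galerkin:
  assumes R: "0 \<le> R" and F: "F = freqs N" and h: "hermitian u0" "hermitian \<rho>0" and s: "supp_in F u0" "supp_in F \<rho>0"
  shows "\<exists>u \<rho>. u 0 = u0 \<and> \<rho> 0 = \<rho>0 \<and>
    (\<forall>t. supp_in F (u t) \<and> supp_in F (\<rho> t) \<and> hermitian (u t) \<and> hermitian (\<rho> t) \<and>
      (\<forall>n\<in>F. let U = clamped F R (u t); P = clamped F R (\<rho> t) in
        ((\<lambda>t. u t n) has_vector_derivative Bu U P U P n) (at t) \<and>
        ((\<lambda>t. \<rho> t n) has_vector_derivative Br U P U P n) (at t)))"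
proof -
  have finF: "finite F" by (simp add: F)
  \<comment> \<open>A bounded continuous function on the line stands for a state through its values
    at the integers.\<close>
  define U P where "U X = clamped F R (\<lambda>n. fst (apply_bcontfun X (of_int n)))"
    and "P X = clamped F R (\<lambda>n. snd (apply_bcontfun X (of_int n)))" for X :: "real \<Rightarrow>\<^sub>C (complex \<times> complex)"
  define V where "V X n = (if n \<in> F then (Bu (U X) (P X) (U X) (P X) n, Br (U X) (P X) (U X) (P X) n) else 0)" for X n
  have comp: "cmod (fst (apply_bcontfun X (of_int n)) - fst (apply_bcontfun Y (of_int n))) \<le> dist X Y"
    "cmod (snd (apply_bcontfun X (of_int n)) - snd (apply_bcontfun Y (of_int n))) \<le> dist X Y" for X Y :: "real \<Rightarrow>\<^sub>C (complex \<times> complex)" and n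
    using dist_bounded[of X "of_int n" Y] dist_fst_le[of "apply_bcontfun X (of_int n)" "apply_bcontfun Y (of_int n)"]
      dist_snd_le[of "apply_bcontfun X (of_int n)" "apply_bcontfun Y (of_int n)"] by (simp_all add: dist_norm)
  have bU: "bounded_lipschitz (\<lambda>X. U X n)" and bP: "bounded_lipschitz (\<lambda>X. P X n)" for n
    unfolding U_def P_def by (intro bounded_lipschitz_clamped R comp)+
  have bdx: "bounded_lipschitz (\<lambda>X. dx (U X) n)" "bounded_lipschitz (\<lambda>X. dx (P X) n)" for n
    unfolding dx_def by (intro bounded_lipschitz_mult bounded_lipschitz_const bU bP)+
  have sUP: "supp_in F (U X)" "supp_in F (P X)" for X by (simp_all add: U_def P_def supp_in_clamped)
  have hUP: "hermitian (U X)" "hermitian (P X)" for X using hermitian_clamped[OF R] by (simp_all add: U_def P_def F)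
  note bc = bounded_lipschitz_conv[OF finF sUP(1)] bounded_lipschitz_conv[OF finF sUP(2)]
    bounded_lipschitz_conv[OF finF supp_in_dx[OF sUP(1)]] bounded_lipschitz_conv[OF finF supp_in_dx[OF sUP(2)]]
  have neg: "bounded_lipschitz (\<lambda>x. - f x)" if "bounded_lipschitz f" for f :: "(real \<Rightarrow>\<^sub>C (complex \<times> complex)) \<Rightarrow> complex"
    using bounded_lipschitz_diff[OF bounded_lipschitz_const[of 0] that] by simp
  have bBu: "bounded_lipschitz (\<lambda>X. Bu (U X) (P X) (U X) (P X) n)" for n
    unfolding Bu_def by (intro bounded_lipschitz_diff bounded_lipschitz_mult bounded_lipschitz_const neg bc bU bP bdx)
  have bBr: "bounded_lipschitz (\<lambda>X. Br (U X) (P X) (U X) (P X) n)" for n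
    unfolding Br_def by (intro bounded_lipschitz_diff bounded_lipschitz_mult bounded_lipschitz_const neg bc bU bP bdx)
  have "\<exists>L M. 0 \<le> L \<and> 0 \<le> M \<and> (\<forall>X. norm (V X n) \<le> M) \<and> (\<forall>X Y. norm (V X n - V Y n) \<le> L * dist X Y)" for n
  proof -
    obtain L M where 1: "0 \<le> L" "0 \<le> M" "\<And>X. cmod (Bu (U X) (P X) (U X) (P X) n) \<le> M"
      "\<And>X Y. cmod (Bu (U X) (P X) (U X) (P X) n - Bu (U Y) (P Y) (U Y) (P Y) n) \<le> L * dist X Y"
      using bBu[of n] unfolding bounded_lipschitz_def by metis
    obtain L' M' where 2: "0 \<le> L'" "0 \<le> M'" "\<And>X. cmod (Br (U X) (P X) (U X) (P X) n) \<le> M'"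
      "\<And>X Y. cmod (Br (U X) (P X) (U X) (P X) n - Br (U Y) (P Y) (U Y) (P Y) n) \<le> L' * dist X Y"
      using bBr[of n] unfolding bounded_lipschitz_def by metis
    have pr: "norm (a :: complex, b :: complex) \<le> m + m'" if "cmod a \<le> m" "cmod b \<le> m'" for a b m m'
      using norm_Pair_le[of a b] that by linarith
    show ?thesis
    proof (rule exI[of _ "L + L'"], rule exI[of _ "M + M'"], intro conjI allI)
      show "norm (V X n) \<le> M + M'" for X using 1 2 by (auto simp: V_def intro!: pr)
      show "norm (V X n - V Y n) \<le> (L + L') * dist X Y" for X Y
        using 1 2 by (auto simp: V_def distrib_right intro!: pr)
    qed (use 1 2 in auto)
  qed
  then obtain L M where LM: "\<And>n. 0 \<le> L n" "\<And>n. 0 \<le> M n" "\<And>n X. norm (V X n) \<le> M n"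
    "\<And>n X Y. norm (V X n - V Y n) \<le> L n * dist X Y"
    by metis
  have V0: "V X n = 0" if "n \<notin> F" for X n using that by (simp add: V_def)
  have Vb: "interp F (V X) \<in> bcontfun" for X
    by (rule bcontfun_normI[OF continuous_on_interp norm_interp_le[OF LM(3)]])
  \<comment> \<open>Interpolation turns the vector of velocities back into an element of the phase
    space.\<close>
  define f where "f X = Bcontfun (interp F (V X))" for X
  have fV: "apply_bcontfun (f X) = interp F (V X)" for X by (simp add: f_def Bcontfun_inverse Vb)
  have x0: "interp F (\<lambda>n. (u0 n, \<rho>0 n)) \<in> bcontfun"
    by (rule bcontfun_normI[OF continuous_on_interp norm_interp_le[OF order_refl]])
  have f1: "norm (f X - f Y) \<le> sum L F * norm (X - Y)" for X Y
  proof (rule norm_bound)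
    fix x
    have "norm (interp F (\<lambda>n. V X n - V Y n) x) \<le> (\<Sum>n\<in>F. L n * dist X Y)"
      by (rule norm_interp_le) (rule LM(4))
    then show "norm (apply_bcontfun (f X - f Y) x) \<le> sum L F * norm (X - Y)"
      by (simp add: fV interp_diff dist_norm sum_distrib_right)
  qed
  have f2: "norm (f X) \<le> sum M F" for X
    by (rule norm_bound) (simp add: fV norm_interp_le[OF LM(3)])
  have "0 \<le> sum L F" by (simp add: sum_nonneg LM)
  from lipschitz_ode_global[where f = f, OF f1 this f2, of "Bcontfun (interp F (\<lambda>n. (u0 n, \<rho>0 n)))"]
  obtain x where x: "x 0 = Bcontfun (interp F (\<lambda>n. (u0 n, \<rho>0 n)))" "\<And>t. (x has_vector_derivative f (x t)) (at t)" by blast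
  define u \<rho> where "u t n = fst (apply_bcontfun (x t) (of_int n))" and "\<rho> t n = snd (apply_bcontfun (x t) (of_int n))" for t n
  have ev: "bounded_linear (\<lambda>X :: real \<Rightarrow>\<^sub>C (complex \<times> complex). apply_bcontfun X (real_of_int n))" for n
    by (rule bounded_linear_intro[where K=1]) (auto simp: norm_bounded)
  have d: "((\<lambda>t. apply_bcontfun (x t) (of_int n)) has_vector_derivative V (x t) n) (at t)" for n t
    using bounded_linear.has_vector_derivative[OF ev x(2), of n t]
    by (auto simp: fV interp_of_int finF V0 split: if_splits)
  have du: "((\<lambda>t. u t n) has_vector_derivative fst (V (x t) n)) (at t)" for n t
    unfolding u_def by (rule bounded_linear.has_vector_derivative[OF bounded_linear_fst d])
  have d\<rho>: "((\<lambda>t. \<rho> t n) has_vector_derivative snd (V (x t) n)) (at t)" for n t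
    unfolding \<rho>_def by (rule bounded_linear.has_vector_derivative[OF bounded_linear_snd d])
  have UP: "U (x t) = clamped F R (u t)" "P (x t) = clamped F R (\<rho> t)" for t
    by (simp_all add: U_def P_def u_def[abs_def] \<rho>_def[abs_def])
  have init: "u 0 = u0" "\<rho> 0 = \<rho>0"
    using s by (auto simp: u_def \<rho>_def x(1) Bcontfun_inverse x0 fun_eq_iff interp_of_int finF supp_in_def)
  have supp: "supp_in F (u t)" "supp_in F (\<rho> t)" for t
  proof -
    have "u t n = u 0 n" "\<rho> t n = \<rho> 0 n" if "n \<notin> F" for n
      using constant_if_zero_derivative[of "\<lambda>t. u t n" t] constant_if_zero_derivative[of "\<lambda>t. \<rho> t n" t]
        du[of n] d\<rho>[of n] V0[OF that] by simp_all
    then show "supp_in F (u t)" "supp_in F (\<rho> t)" using s by (auto simp: supp_in_def init)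
  qed
  \<comment> \<open>The field is built from symmetrised coefficients, so it is Hermitian at every
    point of the phase space and the asymmetry of the solution is constant.\<close>
  have herm: "hermitian (u t)" "hermitian (\<rho> t)" for t
  proof -
    have sym: "- n \<in> F \<longleftrightarrow> n \<in> F" for n by (auto simp: F)
    have hV: "fst (V X (- n)) = cnj (fst (V X n))" "snd (V X (- n)) = cnj (snd (V X n))" for X n
      using hermitian_Bu_Br[OF hUP(1,2)[of X] sUP[of X, unfolded F]] by (auto simp: V_def sym hermitian_def)
    have "u t (- n) - cnj (u t n) = u 0 (- n) - cnj (u 0 n)" for n
    proof (rule constant_if_zero_derivative)
      show "((\<lambda>t. u t (- n) - cnj (u t n)) has_vector_derivative 0) (at t)" for t
        using has_vector_derivative_diff[OF du[of "- n" t] bounded_linear.has_vector_derivative[OF bounded_linear_cnj du[of n t]]]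
        by (simp add: hV)
    qed
    moreover have "\<rho> t (- n) - cnj (\<rho> t n) = \<rho> 0 (- n) - cnj (\<rho> 0 n)" for n
    proof (rule constant_if_zero_derivative)
      show "((\<lambda>t. \<rho> t (- n) - cnj (\<rho> t n)) has_vector_derivative 0) (at t)" for t
        using has_vector_derivative_diff[OF d\<rho>[of "- n" t] bounded_linear.has_vector_derivative[OF bounded_linear_cnj d\<rho>[of n t]]]
        by (simp add: hV)
    qed
    ultimately show "hermitian (u t)" "hermitian (\<rho> t)" using h by (simp_all add: hermitian_def init)
  qed
  have dF: "((\<lambda>t. u t n) has_vector_derivative Bu (clamped F R (u t)) (clamped F R (\<rho> t)) (clamped F R (u t)) (clamped F R (\<rho> t)) n) (at t)"
    "((\<lambda>t. \<rho> t n) has_vector_derivative Br (clamped F R (u t)) (clamped F R (\<rho> t)) (clamped F R (u t)) (clamped F R (\<rho> t)) n) (at t)"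
    if "n \<in> F" for n t
    using du[of n t] d\<rho>[of n t] that by (simp_all add: V_def UP)
  show ?thesis
    by (rule exI[of _ u], rule exI[of _ \<rho>]) (simp add: init supp herm dF Let_def)
qed

section \<open>Propagation of weighted norms\<close>

definition tail_weight :: "real \<Rightarrow> real \<Rightarrow> int \<Rightarrow> real" where
  "tail_weight s K n = jb n powr (s - 1) * min 1 (jb n / K)"

text \<open>All brackets are at least 1, so K = 1 cuts off nothing; the estimates for tails thus
  contain the one for the full norm.\<close>

lemma tail_weight_1: "tail_weight s 1 = (\<lambda>n. jb n powr (s - 1))"
  by (simp add: tail_weight_def fun_eq_iff)

lemma tail_weight_nonneg: "0 < K \<Longrightarrow> 0 \<le> tail_weight s K n"
  by (simp add: tail_weight_def)

lemma tail_weight_le: "tail_weight s K n \<le> jb n powr (s - 1)"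
  unfolding tail_weight_def using mult_left_mono[of "min 1 (jb n / K)" 1 "jb n powr (s - 1)"] by simp

text \<open>The power has order s - 1 and the cut-off grows at most linearly, so order s suffices,
  rounded up to a natural number. The order does not involve K; hence neither does the growth rate
  of the tails.\<close>

lemma admissible_tail_weight:
  assumes s: "1 \<le> s" and K: "0 < K" shows "admissible (nat \<lceil>s\<rceil>) (tail_weight s K)"
  unfolding admissible_def
proof (intro conjI allI impI)
  show "0 < tail_weight s K n" for n using K by (simp add: tail_weight_def)
  fix n k assume le: "jb n \<le> jb k"
  show "tail_weight s K n \<le> tail_weight s K k"
    unfolding tail_weight_def using s K le
    by (intro mult_mono powr_mono2 min.mono divide_right_mono) auto
  define x where "x = jb k / jb n"
  have x: "1 \<le> x" using le by (simp add: x_def field_simps)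
  have k: "jb k = x * jb n" by (simp add: x_def)
  have m: "min 1 (jb k / K) \<le> x * min 1 (jb n / K)"
  proof (cases "jb n \<le> K")
    case True
    then have "min 1 (jb n / K) = jb n / K" using K by (simp add: min_def)
    then show ?thesis by (simp add: k)
  next
    case False
    then have "min 1 (jb n / K) = 1" using K by (simp add: min_def field_simps)
    then show ?thesis using x by simp
  qed
  have "tail_weight s K k \<le> jb k powr (s - 1) * (x * min 1 (jb n / K))"
    unfolding tail_weight_def by (intro mult_left_mono m) simp
  also have "\<dots> = (x powr (s - 1) * x) * tail_weight s K n"
    using x by (simp add: tail_weight_def k powr_mult)
  also have "x powr (s - 1) * x = x powr s"
    using x by (simp add: powr_diff)
  also have "x powr s * tail_weight s K n \<le> x powr real (nat \<lceil>s\<rceil>) * tail_weight s K n"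
    using x s by (intro mult_right_mono powr_mono tail_weight_nonneg K) linarith+
  finally show "tail_weight s K k \<le> (jb k / jb n) ^ nat \<lceil>s\<rceil> * tail_weight s K n"
    using x by (simp add: powr_realpow x_def)
qed

text \<open>The summand 1 keeps the rate away from 0, so that \<open>life\<close> can be defined by
  dividing by it.\<close>

definition tail_rate :: "real \<Rightarrow> real \<Rightarrow> real" where
  "tail_rate s R = tame_const (nat \<lceil>s\<rceil>) * (bracket_const (s - 2) * R) + 1"

lemma tame_const_nonneg: "0 \<le> tame_const p"
  by (simp add: tame_const_def comm_const_def)

lemma tail_rate_ge_1: "s > 5/2 \<Longrightarrow> 0 \<le> R \<Longrightarrow> 1 \<le> tail_rate s R"
  by (simp add: tail_rate_def tame_const_nonneg bracket_const_nonneg)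

lemma tame_rate_bound:
  assumes s: "s > 5/2" and F: "finite F" and K: "0 < K" and u: "hermitian u" "supp_in F u" "supp_in F \<rho>"
    and b: "state_le (\<lambda>n. jb n powr (s - 1)) u \<rho> R"
  shows "\<bar>energy_rate F (tail_weight s K) u \<rho> (Bu u \<rho> u \<rho>) (Br u \<rho> u \<rho>)\<bar> \<le> tail_rate s R * energy F (tail_weight s K) u \<rho>"
proof -
  have "\<bar>energy_rate F (tail_weight s K) u \<rho> (Bu u \<rho> u \<rho>) (Br u \<rho> u \<rho>)\<bar>
     \<le> tame_const (nat \<lceil>s\<rceil>) * (bracket_const (s - 2) * R) * energy F (tail_weight s K) u \<rho>"
    by (intro tame_energy_estimate F admissible_tail_weight K u state_le_l1_high[OF s b]) (use s in simp)
  also have "\<dots> \<le> tail_rate s R * energy F (tail_weight s K) u \<rho>"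
    by (intro mult_right_mono energy_nonneg) (simp add: tail_rate_def)
  finally show ?thesis .
qed

text \<open>The rate involves the bound R on the full norm but not K: given that bound, every tail
  grows by the same factor at most.\<close>

lemma energy_propagation:
  assumes s: "s > 5/2" and F: "finite F" and K: "0 < K" and R: "0 \<le> R"
    and u: "\<And>t. \<bar>t\<bar> < T \<Longrightarrow> hermitian (u t)" "\<And>t. \<bar>t\<bar> < T \<Longrightarrow> supp_in F (u t)" "\<And>t. \<bar>t\<bar> < T \<Longrightarrow> supp_in F (\<rho> t)"
    and b: "\<And>t. \<bar>t\<bar> < T \<Longrightarrow> state_le (\<lambda>n. jb n powr (s - 1)) (u t) (\<rho> t) R"
    and eq: "solves_freq T F u \<rho>" and t: "\<bar>t\<bar> < T"
  shows "energy F (tail_weight s K) (u t) (\<rho> t) \<le> energy F (tail_weight s K) (u 0) (\<rho> 0) * exp (tail_rate s R * T)"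
proof -
  define a where "a = tail_rate s R"
  have a: "a > 0" using tail_rate_ge_1[OF s R] by (simp add: a_def)
  define f where "f t = energy F (tail_weight s K) (u t) (\<rho> t)" for t
  define f' where "f' t = energy_rate F (tail_weight s K) (u t) (\<rho> t) (Bu (u t) (\<rho> t) (u t) (\<rho> t)) (Br (u t) (\<rho> t) (u t) (\<rho> t))" for t
  have "f t + 0 / a \<le> (f 0 + 0 / a) * exp (a * \<bar>t\<bar>)"
  proof (rule gronwall[OF a, where f' = f' and T = T])
    fix t assume t: "\<bar>t\<bar> < T"
    show "(f has_real_derivative f' t) (at t)"
      unfolding f_def f'_def by (rule energy_deriv) (use eq t in \<open>auto simp: solves_freq_def\<close>)
    have "\<bar>f' t\<bar> \<le> a * f t"
      unfolding f'_def f_def a_def by (rule tame_rate_bound[OF s F K u(1)[OF t] u(2)[OF t] u(3)[OF t] b[OF t]])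
    then show "\<bar>f' t\<bar> \<le> a * f t + 0" by simp
  qed (rule t)
  also have "\<dots> \<le> f 0 * exp (a * T)"
    using a t by (simp add: f_def energy_nonneg mult_left_mono)
  finally show ?thesis by (simp add: f_def a_def)
qed

section \<open>Uniform time of existence for the Galerkin system\<close>

text \<open>A bootstrap. If E ever exceeded M, take the earliest time m at which it reaches M / 2.
  Up to m the derivative is bounded by C, so the mean value theorem gives a value of at most M / 4 +
  M / 8 at m, which is below M / 2.\<close>

lemma continuity_argument_aux:
  fixes E E' :: "real \<Rightarrow> real"
  assumes d: "\<And>t. (E has_real_derivative E' t) (at t)" and E0: "E 0 \<le> M / 4" and M: "0 < M"
    and b: "\<And>t. E t \<le> M \<Longrightarrow> \<bar>E' t\<bar> \<le> C" and C: "C * T \<le> M / 8" "0 \<le> C" and t: "0 \<le> t" "t \<le> T"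
  shows "E t \<le> M"
proof (rule ccontr)
  assume nt: "\<not> E t \<le> M"
  have cont: "continuous_on UNIV E"
    using d by (meson DERIV_isCont continuous_at_imp_continuous_on)
  define S where "S = {\<tau> \<in> {0..t}. M / 2 \<le> E \<tau>}"
  have "S = {0..t} \<inter> {\<tau>. M / 2 \<le> E \<tau>}" by (auto simp: S_def)
  moreover have "closed {\<tau>. M / 2 \<le> E \<tau>}" using cont by (intro closed_Collect_le continuous_intros) auto
  ultimately have "compact S" by (simp add: compact_Int_closed)
  moreover have "t \<in> S" using nt t M by (auto simp: S_def)
  ultimately obtain m where m: "m \<in> S" "\<And>\<tau>. \<tau> \<in> S \<Longrightarrow> m \<le> \<tau>"
    using compact_attains_inf[of S] by blast
  have m0: "0 < m"
  proof (rule ccontr)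
    assume "\<not> 0 < m"
    then have "m = 0" using m by (auto simp: S_def)
    then show False using m(1) E0 M by (simp add: S_def)
  qed
  obtain \<xi> where \<xi>: "0 < \<xi>" "\<xi> < m" "E m - E 0 = (m - 0) * E' \<xi>"
    using MVT2[OF m0 d] by blast
  have "\<xi> \<notin> S" using m(2)[of \<xi>] \<xi> by force
  then have "E \<xi> \<le> M" using \<xi> m(1) M by (auto simp: S_def)
  then have "\<bar>E' \<xi>\<bar> \<le> C" by (rule b)
  then have "m * E' \<xi> \<le> m * C" using m0 by (intro mult_left_mono) auto
  also have "\<dots> \<le> T * C" using m(1) t C by (intro mult_right_mono) (auto simp: S_def)
  finally have "E m - E 0 \<le> M / 8" using \<xi>(3) C by (simp add: mult.commute)
  then show False using m(1) E0 M by (simp add: S_def)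
qed

lemma continuity_argument:
  fixes E E' :: "real \<Rightarrow> real"
  assumes d: "\<And>t. (E has_real_derivative E' t) (at t)" and E0: "E 0 \<le> M / 4" and M: "0 < M"
    and b: "\<And>t. E t \<le> M \<Longrightarrow> \<bar>E' t\<bar> \<le> C" and C: "C * T \<le> M / 8" "0 \<le> C" and t: "\<bar>t\<bar> \<le> T"
  shows "E t \<le> M"
proof (cases "0 \<le> t")
  case True
  show ?thesis by (rule continuity_argument_aux[OF d E0 M b C]) (use True t in auto)
next
  case False
  have "E (- (- t)) \<le> M"
  proof (rule continuity_argument_aux[where E = "\<lambda>t. E (- t)" and E' = "\<lambda>t. - E' (- t)", OF _ _ M _ C])
    show "((\<lambda>t. E (- t)) has_real_derivative - E' (- t)) (at t)" for t
      using DERIV_chain2[where g=uminus and x=t, OF d[of "- t"] DERIV_minus[OF DERIV_ident]] by simp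
    show "\<bar>- E' (- t)\<bar> \<le> C" if "E (- t) \<le> M" for t using b[OF that] by simp
  qed (use False t E0 in auto)
  then show ?thesis by simp
qed

text \<open>With M = \<open>R\<^sup>2\<close> and \<open>C = tail_rate s R * R\<^sup>2\<close> this
  is the time for which the continuity argument has C * T = M / 8.\<close>

definition life :: "real \<Rightarrow> real \<Rightarrow> real" where
  "life s R = 1 / (8 * tail_rate s R)"

text \<open>Data of norm R / 2 have a quarter of the energy \<open>R\<^sup>2\<close>, as the
  continuity argument asks. Below that energy each coefficient is bounded by R, since the weights
  are at least 1; the clamps are then inactive and the clamped system is the Galerkin
  system.\<close>

lemma galerkin_solution:
  assumes s: "s > 5/2" and R: "0 < R" and F: "F = freqs N" and h: "hermitian u0" "hermitian \<rho>0" and sp: "supp_in F u0" "supp_in F \<rho>0"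
    and b: "state_le (\<lambda>n. jb n powr (s - 1)) u0 \<rho>0 (R / 2)"
  shows "\<exists>u \<rho>. u 0 = u0 \<and> \<rho> 0 = \<rho>0 \<and> solves_freq (life s R) F u \<rho> \<and>
    (\<forall>t. \<bar>t\<bar> < life s R \<longrightarrow> supp_in F (u t) \<and> supp_in F (\<rho> t) \<and> hermitian (u t) \<and> hermitian (\<rho> t) \<and>
       state_le (\<lambda>n. jb n powr (s - 1)) (u t) (\<rho> t) R)"
proof -
  have finF: "finite F" by (simp add: F)
  obtain u \<rho> where init: "u 0 = u0" "\<rho> 0 = \<rho>0"
    and sup: "\<And>t. supp_in F (u t)" "\<And>t. supp_in F (\<rho> t)" and her: "\<And>t. hermitian (u t)" "\<And>t. hermitian (\<rho> t)"
    and du: "\<And>t n. n \<in> F \<Longrightarrow> ((\<lambda>t. u t n) has_vector_derivative Bu (clamped F R (u t)) (clamped F R (\<rho> t)) (clamped F R (u t)) (clamped F R (\<rho> t)) n) (at t)"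
    and d\<rho>: "\<And>t n. n \<in> F \<Longrightarrow> ((\<lambda>t. \<rho> t n) has_vector_derivative Br (clamped F R (u t)) (clamped F R (\<rho> t)) (clamped F R (u t)) (clamped F R (\<rho> t)) n) (at t)"
    using clamped_galerkin[OF less_imp_le[OF R] F h sp] unfolding Let_def by blast
  define V where "V = (\<lambda>n. jb n powr (s - 1))"
  define E where "E t = energy F V (u t) (\<rho> t)" for t
  define E' where "E' t = energy_rate F V (u t) (\<rho> t) (Bu (clamped F R (u t)) (clamped F R (\<rho> t)) (clamped F R (u t)) (clamped F R (\<rho> t)))
     (Br (clamped F R (u t)) (clamped F R (\<rho> t)) (clamped F R (u t)) (clamped F R (\<rho> t)))" for t
  have small: "state_le V (u t) (\<rho> t) R" if "E t \<le> R\<^sup>2" for t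
    using that R by (intro state_leI_energy_supp[OF _ finF sup]) (auto simp: E_def)
  have inactive: "clamped F R (u t) = u t" "clamped F R (\<rho> t) = \<rho> t" if "E t \<le> R\<^sup>2" for t
  proof -
    have V1: "1 \<le> V n" for n unfolding V_def using s by (intro ge_one_powr_ge_zero) auto
    then have V0: "0 \<le> V n" for n by (metis order_trans zero_le_one)
    note c = state_le_components[OF small[OF that] V0]
    have "cmod (\<rho> t n) \<le> R" for n
      using l2_le_point[OF c(2), of n] mult_right_mono[OF V1, of "cmod (\<rho> t n)" n] by simp
    moreover have "cmod (u t n) \<le> R" for n
      using l2_le_point[OF c(1), of n] mult_right_mono[OF V1, of "cmod (u t n)" n]
        le_jb_mult[of "V n * cmod (u t n)" n] V0[of n] by (simp add: mult.assoc)
    ultimately show "clamped F R (u t) = u t" "clamped F R (\<rho> t) = \<rho> t"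
      by (intro clamped_eq her sup; simp)+
  qed
  have bound: "E t \<le> R\<^sup>2" if t: "\<bar>t\<bar> \<le> life s R" for t
  proof (rule continuity_argument[where E = E and E' = E' and C = "tail_rate s R * R\<^sup>2" and T = "life s R"])
    show "(E has_real_derivative E' t) (at t)" for t
      unfolding E_def E'_def by (rule energy_deriv) (rule du d\<rho>; assumption)+
    have "energy F V u0 \<rho>0 \<le> (R / 2)\<^sup>2" using b finF unfolding V_def by (rule state_le_energy)
    then show "E 0 \<le> R\<^sup>2 / 4" by (simp add: E_def init power_divide)
    show "\<bar>E' t\<bar> \<le> tail_rate s R * R\<^sup>2" if le: "E t \<le> R\<^sup>2" for t
    proof -
      have "\<bar>E' t\<bar> \<le> tail_rate s R * E t"
        unfolding E'_def E_def inactive[OF le]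
        using tame_rate_bound[OF s finF _ her(1) sup small[OF le, unfolded V_def], of 1]
        by (simp add: tail_weight_1 V_def)
      also have "\<dots> \<le> tail_rate s R * R\<^sup>2" using le tail_rate_ge_1[OF s, of R] R by (intro mult_left_mono) auto
      finally show ?thesis .
    qed
    show "tail_rate s R * R\<^sup>2 * life s R \<le> R\<^sup>2 / 8" "0 \<le> tail_rate s R * R\<^sup>2"
      using tail_rate_ge_1[OF s, of R] R by (auto simp: life_def)
  qed (use R t in auto)
  show ?thesis
  proof (intro exI conjI allI impI)
    show "solves_freq (life s R) F u \<rho>"
      unfolding solves_freq_def using du d\<rho> bound inactive by (metis less_imp_le)
    show "state_le (\<lambda>n. jb n powr (s - 1)) (u t) (\<rho> t) R" if "\<bar>t\<bar> < life s R" for t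
      using small[OF bound] that by (simp add: V_def)
  qed (use init sup her in auto)
qed

section \<open>Interpolation and mean value inequality\<close>

text \<open>At each frequency \<open>pnorm\<close> is linear in the weight.\<close>

lemma state_le_interpolate:
  assumes "state_le V1 w r a" "state_le V2 w r b" "0 \<le> c1" "0 \<le> c2" "\<And>n. V n \<le> c1 * V1 n + c2 * V2 n"
    and V0: "\<And>n. 0 \<le> V n" "\<And>n. 0 \<le> V1 n" "\<And>n. 0 \<le> V2 n"
  shows "state_le V w r (c1 * a + c2 * b)"
  unfolding state_le_def
proof (rule l2_le_mono[OF l2_le_add[OF l2_le_mult[OF assms(1)[unfolded state_le_def] assms(3)] l2_le_mult[OF assms(2)[unfolded state_le_def] assms(4)]]])
  fix n
  have f: "pnorm W w r n = W n * sqrt ((jb n * cmod (w n))\<^sup>2 + (cmod (r n))\<^sup>2)" if "0 \<le> W n" for W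
  proof -
    have "(jb n * W n * cmod (w n))\<^sup>2 + (W n * cmod (r n))\<^sup>2 = (W n)\<^sup>2 * ((jb n * cmod (w n))\<^sup>2 + (cmod (r n))\<^sup>2)"
      by (simp add: power_mult_distrib algebra_simps)
    then show ?thesis using that by (simp add: pnorm_def real_sqrt_mult)
  qed
  have "V n * sqrt ((jb n * cmod (w n))\<^sup>2 + (cmod (r n))\<^sup>2) \<le> (c1 * V1 n + c2 * V2 n) * sqrt ((jb n * cmod (w n))\<^sup>2 + (cmod (r n))\<^sup>2)"
    by (intro mult_right_mono assms) simp
  then show "pnorm V w r n \<le> c1 * pnorm V1 w r n + c2 * pnorm V2 w r n"
    using f[of V] f[of V1] f[of V2] V0 by (simp add: distrib_right)
qed auto

lemma state_le_low_tail:
  assumes "1 \<le> s" "1 \<le> K" "state_le (\<lambda>_. 1) w r a" "state_le (tail_weight s K) w r b"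
  shows "state_le (\<lambda>n. jb n powr (s - 1)) w r (K powr (s - 1) * a + b)"
proof -
  have "state_le (\<lambda>n. jb n powr (s - 1)) w r (K powr (s - 1) * a + 1 * b)"
  proof (rule state_le_interpolate[OF assms(3,4)])
    fix n
    show "jb n powr (s - 1) \<le> K powr (s - 1) * 1 + 1 * tail_weight s K n"
    proof (cases "jb n \<le> K")
      case True
      then have "jb n powr (s - 1) \<le> K powr (s - 1)" using assms(1) by (intro powr_mono2) auto
      then show ?thesis using tail_weight_nonneg[of K s n] assms(2) by simp
    next
      case False
      then have "min 1 (jb n / K) = 1" using assms(2) by (simp add: min_def field_simps)
      then show ?thesis by (simp add: tail_weight_def)
    qed
  qed (use assms tail_weight_nonneg in auto)
  then show ?thesis by simp
qed

text \<open>Frequencies are split at K. The weight \<open>jb n\<close> is what the field needs in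
  order to be controlled in the low norm; it lies between the low weight, where convergence is
  known, and the top weight, where only boundedness is.\<close>

lemma state_le_interpolate_2:
  assumes "2 \<le> s" "1 \<le> K" "state_le (\<lambda>_. 1) w r a" "state_le (\<lambda>n. jb n powr (s - 1)) w r b"
  shows "state_le (\<lambda>n. jb n powr (2 - 1)) w r (K * a + K powr (2 - s) * b)"
proof (rule state_le_interpolate[OF assms(3,4)])
  fix n
  show "jb n powr (2 - 1) \<le> K * 1 + K powr (2 - s) * jb n powr (s - 1)"
  proof (cases "jb n \<le> K")
    case False
    have "jb n powr (2 - 1) = jb n powr (2 - s) * jb n powr (s - 1)" by (simp add: powr_add[symmetric])
    also have "\<dots> \<le> K powr (2 - s) * jb n powr (s - 1)"
      using False assms(1,2) by (intro mult_right_mono powr_mono2') auto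
    finally show ?thesis using assms(2) by simp
  qed (simp add: add_increasing2)
qed (use assms in auto)

text \<open>The reference velocity (e, e') serves two purposes: with 0 the lemma gives a Lipschitz
  bound in time, with the field at a base point it gives the error of a difference quotient.\<close>

lemma mean_value_state:
  assumes "t1 < t2"
    and d: "\<And>\<tau> n. t1 \<le> \<tau> \<Longrightarrow> \<tau> \<le> t2 \<Longrightarrow> ((\<lambda>t. u t n) has_vector_derivative du \<tau> n) (at \<tau>)"
      "\<And>\<tau> n. t1 \<le> \<tau> \<Longrightarrow> \<tau> \<le> t2 \<Longrightarrow> ((\<lambda>t. \<rho> t n) has_vector_derivative d\<rho> \<tau> n) (at \<tau>)"
    and b: "\<And>\<tau>. t1 \<le> \<tau> \<Longrightarrow> \<tau> \<le> t2 \<Longrightarrow> state_le V (\<lambda>n. du \<tau> n - e n) (\<lambda>n. d\<rho> \<tau> n - e' n) R"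
  shows "state_le V (\<lambda>n. u t2 n - u t1 n - of_real (t2 - t1) * e n) (\<lambda>n. \<rho> t2 n - \<rho> t1 n - of_real (t2 - t1) * e' n) ((t2 - t1) * R)"
proof (rule state_leI_energy)
  show "0 \<le> (t2 - t1) * R" using assms(1) state_le_nonneg[OF b[of t1]] by simp
  fix F :: "int set" assume F: "finite F"
  define D D' where "D = (\<lambda>n. u t2 n - u t1 n - of_real (t2 - t1) * e n)"
    and "D' = (\<lambda>n. \<rho> t2 n - \<rho> t1 n - of_real (t2 - t1) * e' n)"
  \<comment> \<open>Pairing with the fixed increment (D, D') reduces the claim to the scalar mean
    value theorem. The increment of \<phi> is twice the energy of (D, D'), and Young's inequality
    absorbs half of it.\<close>
  define \<phi> where "\<phi> t = energy_rate F V D D' (\<lambda>n. u t n - of_real t * e n) (\<lambda>n. \<rho> t n - of_real t * e' n)" for t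
  have d1: "((\<lambda>t. u t n - of_real t * e n) has_vector_derivative du \<tau> n - e n) (at \<tau>)"
    "((\<lambda>t. \<rho> t n - of_real t * e' n) has_vector_derivative d\<rho> \<tau> n - e' n) (at \<tau>)" if "t1 \<le> \<tau>" "\<tau> \<le> t2" for \<tau> n
    using that by (auto intro!: derivative_eq_intros d)
  have "(\<phi> has_real_derivative energy_rate F V D D' (\<lambda>n. du \<tau> n - e n) (\<lambda>n. d\<rho> \<tau> n - e' n)) (at \<tau>)"
    if \<tau>: "t1 \<le> \<tau>" "\<tau> \<le> t2" for \<tau>
  proof -
    have re: "((\<lambda>t. Re (c * f t)) has_real_derivative Re (c * f')) (at \<tau>)" if "(f has_vector_derivative f') (at \<tau>)" for f f' c
    proof -
      have "((\<lambda>t. c * f t) has_vector_derivative c * f') (at \<tau>)"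
        using bounded_linear.has_vector_derivative[OF bounded_linear_mult_right that] .
      from bounded_linear.has_vector_derivative[OF bounded_linear_Re this] show ?thesis
        by (simp only: has_real_derivative_iff_has_vector_derivative)
    qed
    show ?thesis unfolding \<phi>_def energy_rate_def
      by (intro DERIV_add DERIV_cmult DERIV_sum re d1 \<tau>)
  qed
  from MVT2[OF assms(1) this]
  obtain \<xi> where \<xi>: "t1 < \<xi>" "\<xi> < t2" and \<xi>2: "\<phi> t2 - \<phi> t1 = (t2 - t1) * energy_rate F V D D' (\<lambda>n. du \<xi> n - e n) (\<lambda>n. d\<rho> \<xi> n - e' n)"
    by blast
  have sc: "energy_rate F V w r (\<lambda>n. of_real c * x n) (\<lambda>n. of_real c * y n) = c * energy_rate F V w r x y" for w r c x y
  proof -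
    have "Re (of_real c * z) = c * Re z" for z by simp
    then show ?thesis unfolding energy_rate_def by (simp only: distrib_left sum_distrib_left mult.left_commute)
  qed
  have "\<phi> t2 - \<phi> t1 = energy_rate F V D D' D D'"
  proof -
    have "energy_rate F V D D' (\<lambda>n. (u t1 n - of_real t1 * e n) + D n) (\<lambda>n. (\<rho> t1 n - of_real t1 * e' n) + D' n) = \<phi> t1 + energy_rate F V D D' D D'"
      unfolding energy_rate_add \<phi>_def ..
    moreover have "(u t1 n - of_real t1 * e n) + D n = u t2 n - of_real t2 * e n"
      "(\<rho> t1 n - of_real t1 * e' n) + D' n = \<rho> t2 n - of_real t2 * e' n" for n
      by (simp_all add: D_def D'_def algebra_simps)
    ultimately show ?thesis by (simp add: \<phi>_def)
  qed
  also have "energy_rate F V D D' D D' = 2 * energy F V D D'"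
  proof -
    have "Re (cnj z * z) = (cmod z)\<^sup>2" for z :: complex
      by (simp add: cmod_power2) (simp add: power2_eq_square)
    then show ?thesis unfolding energy_rate_def energy_def by (simp add: sum.distrib power_mult_distrib)
  qed
  finally have 2: "2 * energy F V D D' = energy_rate F V D D' (\<lambda>n. of_real (t2 - t1) * (du \<xi> n - e n)) (\<lambda>n. of_real (t2 - t1) * (d\<rho> \<xi> n - e' n))"
    unfolding sc \<xi>2 by simp
  have "energy F V (\<lambda>n. of_real (t2 - t1) * (du \<xi> n - e n)) (\<lambda>n. of_real (t2 - t1) * (d\<rho> \<xi> n - e' n)) =
      (t2 - t1)\<^sup>2 * energy F V (\<lambda>n. du \<xi> n - e n) (\<lambda>n. d\<rho> \<xi> n - e' n)"
    unfolding energy_def sum_distrib_left norm_mult norm_of_real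
    by (rule sum.cong[OF refl]) (simp add: power_mult_distrib algebra_simps)
  also have "\<dots> \<le> (t2 - t1)\<^sup>2 * R\<^sup>2"
    using \<xi> by (intro mult_left_mono state_le_energy[OF b F]) auto
  finally have "energy F V D D' \<le> (t2 - t1)\<^sup>2 * R\<^sup>2"
    using energy_rate_le[of F V D D' "\<lambda>n. of_real (t2 - t1) * (du \<xi> n - e n)" "\<lambda>n. of_real (t2 - t1) * (d\<rho> \<xi> n - e' n)"] 2
    by linarith
  then show "energy F V (\<lambda>n. u t2 n - u t1 n - of_real (t2 - t1) * e n) (\<lambda>n. \<rho> t2 n - \<rho> t1 n - of_real (t2 - t1) * e' n) \<le> ((t2 - t1) * R)\<^sup>2"
    by (simp add: D_def D'_def power_mult_distrib)
qed

section \<open>Existence for the system of Fourier coefficients\<close>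

definition coeff_solution :: "real \<Rightarrow> real \<Rightarrow> real \<Rightarrow> (real \<Rightarrow> int \<Rightarrow> complex) \<Rightarrow> (real \<Rightarrow> int \<Rightarrow> complex) \<Rightarrow> bool" where
  "coeff_solution s T R u \<rho> \<longleftrightarrow> solves_freq T UNIV u \<rho> \<and>
     (\<forall>t. \<bar>t\<bar> < T \<longrightarrow> hermitian (u t) \<and> hermitian (\<rho> t) \<and> state_le (\<lambda>n. jb n powr (s - 1)) (u t) (\<rho> t) R)"

lemma solves_freq_subset: "solves_freq T F u \<rho> \<Longrightarrow> G \<subseteq> F \<Longrightarrow> T' \<le> T \<Longrightarrow> solves_freq T' G u \<rho>"
  unfolding solves_freq_def by (meson less_le_trans subsetD)

lemma trunc_error_tendsto_0: "s > 2 \<Longrightarrow> trunc_error s \<longlonglongrightarrow> 0"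
  unfolding trunc_error_def by real_asymp

definition galerkin_error :: "real \<Rightarrow> real \<Rightarrow> real \<Rightarrow> nat \<Rightarrow> real" where
  "galerkin_error s R T N = sqrt ((low_error s R N)\<^sup>2 * exp (low_rate s R * T))"

lemma galerkin_error_tendsto_0: "s > 2 \<Longrightarrow> galerkin_error s R T \<longlonglongrightarrow> 0"
proof -
  assume "s > 2"
  from trunc_error_tendsto_0[OF this]
  have "(\<lambda>N. sqrt ((4 * bilinear_const 2 * R * (trunc_error s N * R))\<^sup>2 * exp (low_rate s R * T)))
    \<longlonglongrightarrow> sqrt ((4 * bilinear_const 2 * R * (0 * R))\<^sup>2 * exp (low_rate s R * T))"
    by (intro tendsto_intros)
  then show ?thesis by (simp add: galerkin_error_def[abs_def] low_error_def)
qed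

lemma energy_mono_supp:
  assumes "finite F" "finite G" "supp_in G u" "supp_in G \<rho>" shows "energy F V u \<rho> \<le> energy G V u \<rho>"
proof -
  have "energy F V u \<rho> = energy (F \<inter> G) V u \<rho>"
    unfolding energy_def using assms by (intro sum.mono_neutral_right) (auto simp: supp_in_def)
  also have "\<dots> \<le> energy G V u \<rho>" unfolding energy_def using assms by (intro sum_mono2) auto
  finally show ?thesis .
qed

lemma cmod_le_sqrt_energy:
  assumes "finite F" "n \<in> F" "energy F (\<lambda>_. 1) w r \<le> d\<^sup>2" "0 \<le> d"
  shows "cmod (w n) \<le> d" "cmod (r n) \<le> d"
proof -
  have "(jb n * 1 * cmod (w n))\<^sup>2 + (1 * cmod (r n))\<^sup>2 \<le> energy F (\<lambda>_. 1) w r"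
    unfolding energy_def using assms by (intro member_le_sum) auto
  then have "(jb n * 1 * cmod (w n))\<^sup>2 \<le> d\<^sup>2" "(1 * cmod (r n))\<^sup>2 \<le> d\<^sup>2"
    using assms(3) zero_le_power2[of "jb n * 1 * cmod (w n)"] zero_le_power2[of "1 * cmod (r n)"] by linarith+
  then have "jb n * 1 * cmod (w n) \<le> d" "1 * cmod (r n) \<le> d" using assms(4) power2_le_imp_le by blast+
  then show "cmod (w n) \<le> d" "cmod (r n) \<le> d" using le_jb_mult[of "cmod (w n)" n] by simp_all
qed

lemma state_le_low_bound: "state_le (\<lambda>_. 1) w r d \<Longrightarrow> cmod (w n) \<le> d \<and> cmod (r n) \<le> d"
  using cmod_le_sqrt_energy[of "{n}" n w r d] state_le_energy[of "\<lambda>_. 1" w r d "{n}"] state_le_nonneg by auto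

lemma low_stability_Galerkin:
  assumes s: "s > 5/2" and F: "F = freqs N"
    and eq: "solves_freq T F u \<rho>" "solves_freq T F v \<eta>"
    and bd: "\<And>t. \<bar>t\<bar> < T \<Longrightarrow> state_le (\<lambda>n. jb n powr (s - 1)) (u t) (\<rho> t) R"
      "\<And>t. \<bar>t\<bar> < T \<Longrightarrow> state_le (\<lambda>n. jb n powr (s - 1)) (v t) (\<eta> t) R"
    and h: "\<And>t. \<bar>t\<bar> < T \<Longrightarrow> hermitian (u t)" and t: "\<bar>t\<bar> < T"
    and init: "\<And>n. n \<in> F \<Longrightarrow> u 0 n = v 0 n" "\<And>n. n \<in> F \<Longrightarrow> \<rho> 0 n = \<eta> 0 n"
  shows "energy F (\<lambda>_. 1) (\<lambda>n. u t n - v t n) (\<lambda>n. \<rho> t n - \<eta> t n) \<le> (galerkin_error s R T N)\<^sup>2"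
proof -
  have "energy F (\<lambda>_. 1) (\<lambda>n. u 0 n - v 0 n) (\<lambda>n. \<rho> 0 n - \<eta> 0 n) = 0"
    unfolding energy_def by (rule sum.neutral) (simp add: init)
  then show ?thesis using low_stability[OF s F eq bd h t] by (simp add: galerkin_error_def)
qed

text \<open>The start index M is there because the equation of a coefficient holds only once its
  frequency belongs to the truncation.\<close>

lemma limit_has_vector_derivative:
  fixes f :: "nat \<Rightarrow> real \<Rightarrow> 'a::banach"
  assumes d: "\<And>N t. M \<le> N \<Longrightarrow> \<bar>t\<bar> < T \<Longrightarrow> (f N has_vector_derivative f' N t) (at t)"
    and lim: "\<And>t. \<bar>t\<bar> < T \<Longrightarrow> (\<lambda>N. f N t) \<longlonglongrightarrow> g t"
    and u: "\<And>e. e > 0 \<Longrightarrow> \<exists>N1. \<forall>N\<ge>N1. \<forall>t. \<bar>t\<bar> < T \<longrightarrow> norm (f' N t - g' t) \<le> e" and t: "\<bar>t\<bar> < T"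
  shows "(g has_vector_derivative g' t) (at t)"
proof -
  define S where "S = {- T<..<T}"
  have S: "t \<in> S" "open S" "convex S" "0 \<in> S" using t by (auto simp: S_def)
  have der: "(f (N + M) has_derivative (\<lambda>y. y *\<^sub>R f' (N + M) x)) (at x within S)" if "x \<in> S" for N x
  proof -
    have "\<bar>x\<bar> < T" using that by (auto simp: S_def)
    from d[OF _ this, of "N + M"] show ?thesis
      unfolding has_vector_derivative_def by (simp add: has_derivative_at_withinI)
  qed
  have "\<exists>h. \<forall>x\<in>S. (\<lambda>N. f (N + M) x) \<longlonglongrightarrow> h x \<and> (h has_derivative (\<lambda>y. y *\<^sub>R g' x)) (at x within S)"
  proof (rule has_derivative_sequence[OF S(3) der _ S(4)])
    show "(\<lambda>N. f (N + M) 0) \<longlonglongrightarrow> g 0"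
      by (rule LIMSEQ_ignore_initial_segment[OF lim]) (use t in auto)
    fix e :: real assume "e > 0"
    then obtain N1 where N1: "\<And>N t. N \<ge> N1 \<Longrightarrow> \<bar>t\<bar> < T \<Longrightarrow> norm (f' N t - g' t) \<le> e" using u by blast
    show "\<forall>\<^sub>F N in sequentially. \<forall>x\<in>S. \<forall>h. norm (h *\<^sub>R f' (N + M) x - h *\<^sub>R g' x) \<le> e * norm h"
      using eventually_ge_at_top[of N1]
    proof eventually_elim
      case (elim N)
      show ?case
      proof (intro ballI allI)
        fix x h assume "x \<in> S"
        then have "norm (f' (N + M) x - g' x) \<le> e" using elim by (intro N1) (auto simp: S_def)
        then have "\<bar>h\<bar> * norm (f' (N + M) x - g' x) \<le> \<bar>h\<bar> * e" by (rule mult_left_mono) simp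
        then show "norm (h *\<^sub>R f' (N + M) x - h *\<^sub>R g' x) \<le> e * norm h"
          by (simp add: scaleR_diff_right[symmetric] mult.commute)
      qed
    qed
  qed
  then obtain h where "\<forall>x\<in>S. (\<lambda>N. f (N + M) x) \<longlonglongrightarrow> h x \<and> (h has_derivative (\<lambda>y. y *\<^sub>R g' x)) (at x within S)"
    by (rule exE)
  then have h: "(\<lambda>N. f (N + M) x) \<longlonglongrightarrow> h x" "(h has_derivative (\<lambda>y. y *\<^sub>R g' x)) (at x within S)" if "x \<in> S" for x
    using that by simp_all
  have hg: "h x = g x" if "x \<in> S" for x
  proof (rule LIMSEQ_unique[OF h(1)[OF that]])
    have "\<bar>x\<bar> < T" using that by (auto simp: S_def)
    then show "(\<lambda>N. f (N + M) x) \<longlonglongrightarrow> g x" by (rule LIMSEQ_ignore_initial_segment[OF lim])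
  qed
  have "(h has_derivative (\<lambda>y. y *\<^sub>R g' t)) (at t)"
    using h(2)[OF S(1)] unfolding at_within_open[OF S(1,2)] .
  then show ?thesis
    unfolding has_vector_derivative_def
    by (rule has_derivative_transform_within_open[OF _ S(2,1)]) (rule hg)
qed

text \<open>Stability in the low norm makes the coefficients Cauchy. Bounds on finite energies pass
  to the limit, for all tail weights at once. The equations pass to the limit after convergence has
  been upgraded from the low weight to \<open>jb n\<close>, from which the field is Lipschitz into
  the low weight.\<close>

lemma coeff_solution_exists:
  assumes s: "s > 5/2" and R: "0 < R" and h: "hermitian u0" "hermitian \<rho>0"
    and b: "state_le (\<lambda>n. jb n powr (s - 1)) u0 \<rho>0 (R / 2)"
  shows "\<exists>u \<rho>. u 0 = u0 \<and> \<rho> 0 = \<rho>0 \<and> coeff_solution s (life s R) R u \<rho> \<and>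
    (\<forall>K a t. 0 < K \<longrightarrow> state_le (tail_weight s K) u0 \<rho>0 a \<longrightarrow> \<bar>t\<bar> < life s R \<longrightarrow>
       state_le (tail_weight s K) (u t) (\<rho> t) (a * exp (tail_rate s R * life s R)))"
proof -
  define T where "T = life s R"
  have rate: "1 \<le> tail_rate s R" using s R by (intro tail_rate_ge_1) auto
  have T: "0 < T" using rate by (simp add: T_def life_def)
  define F where "F N = freqs N" for N
  have finF: "finite (F N)" for N by (simp add: F_def)
  have "\<exists>u \<rho>. u 0 = trunc (F N) u0 \<and> \<rho> 0 = trunc (F N) \<rho>0 \<and> solves_freq T (F N) u \<rho> \<and>
    (\<forall>t. \<bar>t\<bar> < T \<longrightarrow> supp_in (F N) (u t) \<and> supp_in (F N) (\<rho> t) \<and> hermitian (u t) \<and> hermitian (\<rho> t) \<and>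
       state_le (\<lambda>n. jb n powr (s - 1)) (u t) (\<rho> t) R)" for N
    unfolding T_def F_def
    by (rule galerkin_solution[OF s R refl])
      (auto intro!: hermitian_trunc h state_le_mono[OF b] simp: cmod_trunc_le)
  then obtain uN \<rho>N where init: "\<And>N. uN N 0 = trunc (F N) u0" "\<And>N. \<rho>N N 0 = trunc (F N) \<rho>0"
    and eqN: "\<And>N. solves_freq T (F N) (uN N) (\<rho>N N)"
    and sup: "\<And>N t. \<bar>t\<bar> < T \<Longrightarrow> supp_in (F N) (uN N t)" "\<And>N t. \<bar>t\<bar> < T \<Longrightarrow> supp_in (F N) (\<rho>N N t)"
    and her: "\<And>N t. \<bar>t\<bar> < T \<Longrightarrow> hermitian (uN N t)" "\<And>N t. \<bar>t\<bar> < T \<Longrightarrow> hermitian (\<rho>N N t)"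
    and bd: "\<And>N t. \<bar>t\<bar> < T \<Longrightarrow> state_le (\<lambda>n. jb n powr (s - 1)) (uN N t) (\<rho>N N t) R"
    by metis
  define \<delta> where "\<delta> = galerkin_error s R T"
  have \<delta>: "\<delta> \<longlonglongrightarrow> 0" unfolding \<delta>_def using s by (intro galerkin_error_tendsto_0) auto
  have \<delta>0: "0 \<le> \<delta> N" for N by (simp add: \<delta>_def galerkin_error_def)
  have FM: "F N \<subseteq> F M" if "N \<le> M" for N M using that by (auto simp: F_def)
  \<comment> \<open>The solution of level M also satisfies the equations on the smaller set
    \<open>F N\<close>, and on that set the two initial data agree.\<close>
  have low: "energy (F N) (\<lambda>_. 1) (\<lambda>n. uN M t n - uN N t n) (\<lambda>n. \<rho>N M t n - \<rho>N N t n) \<le> (\<delta> N)\<^sup>2"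
    if "N \<le> M" "\<bar>t\<bar> < T" for M N t
    unfolding \<delta>_def
  proof (rule low_stability_Galerkin[OF s _ solves_freq_subset[OF eqN FM[OF that(1)] order_refl] eqN bd bd her(1) that(2)])
    show "F N = freqs N" by (simp add: F_def)
    fix n assume "n \<in> F N"
    then have "n \<in> F N" "n \<in> F M" using FM[OF that(1)] by auto
    then show "uN M 0 n = uN N 0 n" "\<rho>N M 0 n = \<rho>N N 0 n" by (simp_all add: init trunc_def)
  qed auto
  have Cau: "Cauchy (\<lambda>N. uN N t n)" "Cauchy (\<lambda>N. \<rho>N N t n)" if t: "\<bar>t\<bar> < T" for t n
  proof -
    have *: "\<exists>N1. \<forall>N\<ge>N1. \<forall>M\<ge>N. cmod (uN M t n - uN N t n) < e \<and> cmod (\<rho>N M t n - \<rho>N N t n) < e" if e: "e > 0" for e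
    proof -
      obtain N1 where N1: "\<And>N. N \<ge> N1 \<Longrightarrow> \<delta> N < e"
        using order_tendstoD(2)[OF \<delta> e] by (auto simp: eventually_sequentially)
      show ?thesis
      proof (intro exI[of _ "max N1 (nat \<bar>n\<bar>)"] allI impI)
        fix N M assume "max N1 (nat \<bar>n\<bar>) \<le> N" "N \<le> M"
        then have "n \<in> F N" "\<delta> N < e" using N1 by (auto simp: F_def)
        then show "cmod (uN M t n - uN N t n) < e \<and> cmod (\<rho>N M t n - \<rho>N N t n) < e"
          using cmod_le_sqrt_energy[OF finF _ low[OF \<open>N \<le> M\<close> t] \<delta>0, of n] by auto
      qed
    qed
    show "Cauchy (\<lambda>N. uN N t n)"
      unfolding Cauchy_altdef2 dist_norm using *  by (metis order_refl)
    show "Cauchy (\<lambda>N. \<rho>N N t n)"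
      unfolding Cauchy_altdef2 dist_norm using * by (metis order_refl)
  qed
  define u \<rho> where "u t n = lim (\<lambda>N. uN N t n)" and "\<rho> t n = lim (\<lambda>N. \<rho>N N t n)" for t n
  have lim: "(\<lambda>N. uN N t n) \<longlonglongrightarrow> u t n" "(\<lambda>N. \<rho>N N t n) \<longlonglongrightarrow> \<rho> t n" if t: "\<bar>t\<bar> < T" for t n
    using Cau[OF t, of n] unfolding u_def \<rho>_def by (simp_all add: Cauchy_convergent_iff convergent_LIMSEQ_iff)
  have energy_lim: "(\<lambda>N. energy G V (\<lambda>n. uN N t n - v n) (\<lambda>n. \<rho>N N t n - w n)) \<longlonglongrightarrow> energy G V (\<lambda>n. u t n - v n) (\<lambda>n. \<rho> t n - w n)"
    if t: "\<bar>t\<bar> < T" for G V t v w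
    unfolding energy_def by (intro tendsto_intros lim t)
  have init0: "u 0 = u0" "\<rho> 0 = \<rho>0"
  proof -
    have "(\<lambda>N. trunc (F N) f n) \<longlonglongrightarrow> f n" for f n
      by (rule tendsto_eventually) (use eventually_ge_at_top[of "nat \<bar>n\<bar>"] in eventually_elim, auto simp: trunc_def F_def)
    then have "u 0 n = u0 n" "\<rho> 0 n = \<rho>0 n" for n
      using lim[of 0 n, unfolded init] T LIMSEQ_unique by (auto, blast+)
    then show "u 0 = u0" "\<rho> 0 = \<rho>0" by auto
  qed
  have hermu: "hermitian (u t)" "hermitian (\<rho> t)" if t: "\<bar>t\<bar> < T" for t
  proof -
    have "(\<lambda>N. uN N t (- n)) \<longlonglongrightarrow> cnj (u t n)" "(\<lambda>N. \<rho>N N t (- n)) \<longlonglongrightarrow> cnj (\<rho> t n)" for n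
      using tendsto_cnj[OF lim(1)[OF t, of n]] tendsto_cnj[OF lim(2)[OF t, of n]] her[OF t]
      by (simp_all add: hermitian_def)
    then show "hermitian (u t)" "hermitian (\<rho> t)"
      unfolding hermitian_def using lim[OF t] LIMSEQ_unique by blast+
  qed
  have tail: "state_le (tail_weight s K) (u t) (\<rho> t) (a * exp (tail_rate s R * T))"
    if K: "0 < K" and a: "state_le (tail_weight s K) u0 \<rho>0 a" and t: "\<bar>t\<bar> < T" for K a t
  proof (rule state_leI_energy)
    have a0: "0 \<le> a" using a by (rule state_le_nonneg)
    show "0 \<le> a * exp (tail_rate s R * T)" using a0 by simp
    fix G :: "int set" assume G: "finite G"
    have "energy G (tail_weight s K) (uN N t) (\<rho>N N t) \<le> (a * exp (tail_rate s R * T))\<^sup>2" for N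
    proof -
      have "energy G (tail_weight s K) (uN N t) (\<rho>N N t) \<le> energy (F N) (tail_weight s K) (uN N t) (\<rho>N N t)"
        by (intro energy_mono_supp G finF sup t)
      also have "\<dots> \<le> energy (F N) (tail_weight s K) (uN N 0) (\<rho>N N 0) * exp (tail_rate s R * T)"
        by (rule energy_propagation[OF s finF K less_imp_le[OF R] her(1) sup bd eqN t])
      also have "energy (F N) (tail_weight s K) (uN N 0) (\<rho>N N 0) \<le> a\<^sup>2"
        unfolding init
        by (rule state_le_energy[OF state_le_mono[OF a] finF]) (auto simp: cmod_trunc_le tail_weight_nonneg K)
      \<comment> \<open>Squaring the exponential makes the energy bound the square of a bound of the
        form required for \<open>state_le\<close>.\<close>
      also have "a\<^sup>2 * exp (tail_rate s R * T) \<le> a\<^sup>2 * (exp (tail_rate s R * T))\<^sup>2"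
        using rate T by (intro mult_left_mono self_le_power) auto
      finally show ?thesis by (simp add: power_mult_distrib)
    qed
    then show "energy G (tail_weight s K) (u t) (\<rho> t) \<le> (a * exp (tail_rate s R * T))\<^sup>2"
      using energy_lim[OF t, of G _ "\<lambda>_. 0" "\<lambda>_. 0"] by (intro LIMSEQ_le_const2[where X = "\<lambda>N. energy G (tail_weight s K) (uN N t) (\<rho>N N t)"]) auto
  qed
  have bdu: "state_le (\<lambda>n. jb n powr (s - 1)) (u t) (\<rho> t) R" if t: "\<bar>t\<bar> < T" for t
  proof (rule state_leI_energy)
    fix G :: "int set" assume G: "finite G"
    have "energy G (\<lambda>n. jb n powr (s - 1)) (uN N t) (\<rho>N N t) \<le> R\<^sup>2" for N
      by (rule state_le_energy[OF bd[OF t] G])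
    then show "energy G (\<lambda>n. jb n powr (s - 1)) (u t) (\<rho> t) \<le> R\<^sup>2"
      using energy_lim[OF t, of G _ "\<lambda>_. 0" "\<lambda>_. 0"]
      by (intro LIMSEQ_le_const2[where X = "\<lambda>N. energy G (\<lambda>n. jb n powr (s - 1)) (uN N t) (\<rho>N N t)"]) auto
  qed (use R in simp)
  have lowu: "energy (F N) (\<lambda>_. 1) (\<lambda>n. u t n - uN N t n) (\<lambda>n. \<rho> t n - \<rho>N N t n) \<le> (\<delta> N)\<^sup>2" if t: "\<bar>t\<bar> < T" for N t
    by (rule LIMSEQ_le_const2[OF energy_lim[OF t, of "F N" _ "uN N t" "\<rho>N N t"]]) (use low t in blast)
  \<comment> \<open>Three contributions: the low error below K, the bounded top norm beyond K, and
    the part of the limit that lies outside \<open>F N\<close>.\<close>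
  have conv2: "state_le (\<lambda>n. jb n powr (2 - 1)) (\<lambda>n. u t n - uN N t n) (\<lambda>n. \<rho> t n - \<rho>N N t n)
      (K * \<delta> N + K powr (2 - s) * (2 * R) + trunc_error s N * R)" if t: "\<bar>t\<bar> < T" and K: "1 \<le> K" for K N t
  proof -
    have 1: "state_le (\<lambda>n. jb n powr (2 - 1)) (\<lambda>n. trunc (F N) (u t) n - uN N t n) (\<lambda>n. trunc (F N) (\<rho> t) n - \<rho>N N t n)
        (K * \<delta> N + K powr (2 - s) * (R + R))"
    proof (rule state_le_interpolate_2[OF _ K])
      have "energy (F N) (\<lambda>_. 1) (\<lambda>n. trunc (F N) (u t) n - uN N t n) (\<lambda>n. trunc (F N) (\<rho> t) n - \<rho>N N t n) =
          energy (F N) (\<lambda>_. 1) (\<lambda>n. u t n - uN N t n) (\<lambda>n. \<rho> t n - \<rho>N N t n)"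
        by (rule energy_cong) (simp_all add: trunc_def)
      then show "state_le (\<lambda>_. 1) (\<lambda>n. trunc (F N) (u t) n - uN N t n) (\<lambda>n. trunc (F N) (\<rho> t) n - \<rho>N N t n) (\<delta> N)"
        using lowu[OF t, of N]
        by (intro state_leI_energy_supp[OF \<delta>0 finF[of N]]) (simp_all add: supp_in_diff sup t)
      have "state_le (\<lambda>n. jb n powr (s - 1)) (trunc (F N) (u t)) (trunc (F N) (\<rho> t)) R"
        by (rule state_le_mono[OF bdu[OF t]]) (auto simp: cmod_trunc_le)
      then show "state_le (\<lambda>n. jb n powr (s - 1)) (\<lambda>n. trunc (F N) (u t) n - uN N t n) (\<lambda>n. trunc (F N) (\<rho> t) n - \<rho>N N t n) (R + R)"
        by (rule state_le_diff[OF _ bd[OF t]]) simp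
    qed (use s in simp)
    have 2: "state_le (\<lambda>n. jb n powr (2 - 1)) (\<lambda>n. u t n - trunc (F N) (u t) n) (\<lambda>n. \<rho> t n - trunc (F N) (\<rho> t) n) (trunc_error s N * R)"
      by (rule trunc_remainder[OF s bdu[OF t]]) (simp add: F_def)
    show ?thesis
      using state_le_add[OF 1 2] by simp
  qed
  have unif: "\<exists>N1. \<forall>N\<ge>N1. \<forall>t. \<bar>t\<bar> < T \<longrightarrow>
     state_le (\<lambda>n. jb n powr (2 - 1)) (\<lambda>n. uN N t n - u t n) (\<lambda>n. \<rho>N N t n - \<rho> t n) e" if e: "e > 0" for e
  proof -
    \<comment> \<open>K is fixed here, independently of N and t, by the decay of the second
      contribution; the others become small as N grows with K held fixed.\<close>
    have "((\<lambda>K. K powr (2 - s) * (2 * R)) \<longlongrightarrow> 0) at_top"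
      using s by real_asymp
    from order_tendstoD(2)[OF this, of "e / 2"] e
    have "\<forall>\<^sub>F K in at_top. K powr (2 - s) * (2 * R) < e / 2 \<and> 1 \<le> K"
      by (auto intro: eventually_conj eventually_ge_at_top)
    then obtain K where K: "K powr (2 - s) * (2 * R) < e / 2" "1 \<le> K"
      by (metis (mono_tags, lifting) eventually_at_top_linorder order_refl)
    have "(\<lambda>N. K * \<delta> N + trunc_error s N * R) \<longlonglongrightarrow> K * 0 + 0 * R"
      using s by (intro tendsto_intros \<delta> trunc_error_tendsto_0) auto
    from order_tendstoD(2)[OF this, of "e / 2"] e
    obtain N1 where N1: "\<And>N. N \<ge> N1 \<Longrightarrow> K * \<delta> N + trunc_error s N * R < e / 2"
      by (auto simp: eventually_sequentially)
    show ?thesis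
    proof (intro exI allI impI)
      fix N t assume N: "N1 \<le> N" and t: "\<bar>t\<bar> < T"
      have "state_le (\<lambda>n. jb n powr (2 - 1)) (\<lambda>n. u t n - uN N t n) (\<lambda>n. \<rho> t n - \<rho>N N t n) e"
        by (rule state_le_mono[OF conv2[OF t K(2), of N]]) (use N1[OF N] K(1) in auto)
      then show "state_le (\<lambda>n. jb n powr (2 - 1)) (\<lambda>n. uN N t n - u t n) (\<lambda>n. \<rho>N N t n - \<rho> t n) e"
        by (rule state_le_mono) (auto simp: norm_minus_commute)
    qed
  qed
  have to2: "state_le (\<lambda>n. jb n powr (2 - 1)) v w R" if "state_le (\<lambda>n. jb n powr (s - 1)) v w R" for v w
  proof (rule state_le_mono[OF that])
    show "jb n powr (2 - 1) \<le> jb n powr (s - 1)" for n using s by (intro powr_mono) auto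
  qed auto
  have field: "\<exists>N1. \<forall>N\<ge>N1. \<forall>t. \<bar>t\<bar> < T \<longrightarrow>
      cmod (Bu (uN N t) (\<rho>N N t) (uN N t) (\<rho>N N t) n - Bu (u t) (\<rho> t) (u t) (\<rho> t) n) \<le> e \<and>
      cmod (Br (uN N t) (\<rho>N N t) (uN N t) (\<rho>N N t) n - Br (u t) (\<rho> t) (u t) (\<rho> t) n) \<le> e" if e: "e > 0" for e n
  proof -
    define C where "C = 2 * bilinear_const 2 * R"
    have C0: "0 \<le> C" unfolding C_def bilinear_const_def using R bracket_const_nonneg[of 1] by simp
    have "e / (C + 1) > 0" using e C0 by simp
    then obtain N1 where N1: "\<And>N t. N \<ge> N1 \<Longrightarrow> \<bar>t\<bar> < T \<Longrightarrow>
      state_le (\<lambda>n. jb n powr (2 - 1)) (\<lambda>n. uN N t n - u t n) (\<lambda>n. \<rho>N N t n - \<rho> t n) (e / (C + 1))"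
      using unif by blast
    have Ce: "C * (e / (C + 1)) \<le> e" using e C0 by (simp add: field_simps)
    show ?thesis
    proof (intro exI allI impI)
      fix N t assume N: "N1 \<le> N" and t: "\<bar>t\<bar> < T"
      have "state_le (\<lambda>n. jb n powr (2 - 2)) (\<lambda>n. Bu (uN N t) (\<rho>N N t) (uN N t) (\<rho>N N t) n - Bu (u t) (\<rho> t) (u t) (\<rho> t) n)
          (\<lambda>n. Br (uN N t) (\<rho>N N t) (uN N t) (\<rho>N N t) n - Br (u t) (\<rho> t) (u t) (\<rho> t) n) (C * (e / (C + 1)))"
        unfolding C_def
        by (rule vector_field_diff_bound[OF to2[OF bd[OF t]] to2[OF bdu[OF t]] order_refl N1[OF N t, unfolded C_def]])
      then show "cmod (Bu (uN N t) (\<rho>N N t) (uN N t) (\<rho>N N t) n - Bu (u t) (\<rho> t) (u t) (\<rho> t) n) \<le> e \<and>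
        cmod (Br (uN N t) (\<rho>N N t) (uN N t) (\<rho>N N t) n - Br (u t) (\<rho> t) (u t) (\<rho> t) n) \<le> e"
        using state_le_low_bound[of _ _ "C * (e / (C + 1))" n] Ce by fastforce
    qed
  qed
  have "solves_freq T UNIV u \<rho>"
    unfolding solves_freq_def
  proof (intro allI impI conjI)
    fix t n assume t: "\<bar>t\<bar> < T"
    have nF: "n \<in> F N" if "nat \<bar>n\<bar> \<le> N" for N using that by (auto simp: F_def)
    show "((\<lambda>t. u t n) has_vector_derivative Bu (u t) (\<rho> t) (u t) (\<rho> t) n) (at t)"
    proof (rule limit_has_vector_derivative[where f = "\<lambda>N t. uN N t n" and T = T and M = "nat \<bar>n\<bar>"
          and f' = "\<lambda>N t. Bu (uN N t) (\<rho>N N t) (uN N t) (\<rho>N N t) n" and g' = "\<lambda>t. Bu (u t) (\<rho> t) (u t) (\<rho> t) n"])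
      show "((\<lambda>t. uN N t n) has_vector_derivative Bu (uN N t) (\<rho>N N t) (uN N t) (\<rho>N N t) n) (at t)"
        if "nat \<bar>n\<bar> \<le> N" "\<bar>t\<bar> < T" for N t
        using eqN[of N] nF[OF that(1)] that(2) unfolding solves_freq_def by blast
      show "\<exists>N1. \<forall>N\<ge>N1. \<forall>t. \<bar>t\<bar> < T \<longrightarrow> cmod (Bu (uN N t) (\<rho>N N t) (uN N t) (\<rho>N N t) n - Bu (u t) (\<rho> t) (u t) (\<rho> t) n) \<le> e" if "e > 0" for e
        using field[OF that, of n] by meson
    qed (use lim t in simp_all)
    show "((\<lambda>t. \<rho> t n) has_vector_derivative Br (u t) (\<rho> t) (u t) (\<rho> t) n) (at t)"
    proof (rule limit_has_vector_derivative[where f = "\<lambda>N t. \<rho>N N t n" and T = T and M = "nat \<bar>n\<bar>"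
          and f' = "\<lambda>N t. Br (uN N t) (\<rho>N N t) (uN N t) (\<rho>N N t) n" and g' = "\<lambda>t. Br (u t) (\<rho> t) (u t) (\<rho> t) n"])
      show "((\<lambda>t. \<rho>N N t n) has_vector_derivative Br (uN N t) (\<rho>N N t) (uN N t) (\<rho>N N t) n) (at t)"
        if "nat \<bar>n\<bar> \<le> N" "\<bar>t\<bar> < T" for N t
        using eqN[of N] nF[OF that(1)] that(2) unfolding solves_freq_def by blast
      show "\<exists>N1. \<forall>N\<ge>N1. \<forall>t. \<bar>t\<bar> < T \<longrightarrow> cmod (Br (uN N t) (\<rho>N N t) (uN N t) (\<rho>N N t) n - Br (u t) (\<rho> t) (u t) (\<rho> t) n) \<le> e" if "e > 0" for e
        using field[OF that, of n] by meson
    qed (use lim t in simp_all)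
  qed
  then have "coeff_solution s T R u \<rho>"
    using hermu bdu by (simp add: coeff_solution_def)
  then show ?thesis using init0 tail unfolding T_def by blast
qed

section \<open>Stability of solutions\<close>

text \<open>Truncating at N costs the error \<open>low_error s R N\<close>, which tends to 0; in the
  limit only the initial difference remains.\<close>

lemma coeff_solution_low_stability:
  assumes s: "s > 5/2" and z: "coeff_solution s T R u \<rho>" and y: "coeff_solution s T R v \<eta>" and t: "\<bar>t\<bar> < T"
    and a: "state_le (\<lambda>_. 1) (\<lambda>n. u 0 n - v 0 n) (\<lambda>n. \<rho> 0 n - \<eta> 0 n) a"
  shows "state_le (\<lambda>_. 1) (\<lambda>n. u t n - v t n) (\<lambda>n. \<rho> t n - \<eta> t n) (a * exp (low_rate s R * T))"
proof (rule state_leI_energy)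
  have a0: "0 \<le> a" using a by (rule state_le_nonneg)
  then show "0 \<le> a * exp (low_rate s R * T)" by simp
  fix G :: "int set" assume G: "finite G"
  obtain N0 where N0: "G \<subseteq> freqs N0"
  proof
    show "G \<subseteq> freqs (nat (\<Sum>n\<in>G. \<bar>n\<bar>))"
    proof
      fix n assume "n \<in> G"
      then have "\<bar>n\<bar> \<le> (\<Sum>n\<in>G. \<bar>n\<bar>)" using G by (intro member_le_sum) auto
      then show "n \<in> freqs (nat (\<Sum>n\<in>G. \<bar>n\<bar>))" by auto
    qed
  qed
  have bd: "\<And>t. \<bar>t\<bar> < T \<Longrightarrow> state_le (\<lambda>n. jb n powr (s - 1)) (u t) (\<rho> t) R"
    "\<And>t. \<bar>t\<bar> < T \<Longrightarrow> state_le (\<lambda>n. jb n powr (s - 1)) (v t) (\<eta> t) R" "\<And>t. \<bar>t\<bar> < T \<Longrightarrow> hermitian (u t)"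
    and eq: "solves_freq T UNIV u \<rho>" "solves_freq T UNIV v \<eta>"
    using z y by (auto simp: coeff_solution_def)
  have R0: "0 \<le> R" using bd(1)[OF t] by (rule state_le_nonneg)
  have rate: "0 \<le> low_rate s R" unfolding low_rate_def using s R0 by (simp add: bracket_const_nonneg)
  have "energy G (\<lambda>_. 1) (\<lambda>n. u t n - v t n) (\<lambda>n. \<rho> t n - \<eta> t n) \<le> (a\<^sup>2 + (low_error s R N)\<^sup>2) * exp (low_rate s R * T)"
    if N: "N \<ge> N0" for N
  proof -
    have "G \<subseteq> freqs N" using N0 N by fastforce
    then have "energy G (\<lambda>_. 1) (\<lambda>n. u t n - v t n) (\<lambda>n. \<rho> t n - \<eta> t n) \<le>
       energy (freqs N) (\<lambda>_. 1) (\<lambda>n. u t n - v t n) (\<lambda>n. \<rho> t n - \<eta> t n)"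
      unfolding energy_def by (intro sum_mono2) auto
    also have "\<dots> \<le> (energy (freqs N) (\<lambda>_. 1) (\<lambda>n. u 0 n - v 0 n) (\<lambda>n. \<rho> 0 n - \<eta> 0 n) + (low_error s R N)\<^sup>2) * exp (low_rate s R * T)"
      by (rule low_stability[OF s refl solves_freq_subset[OF eq(1) subset_UNIV order_refl] solves_freq_subset[OF eq(2) subset_UNIV order_refl] bd t])
    also have "\<dots> \<le> (a\<^sup>2 + (low_error s R N)\<^sup>2) * exp (low_rate s R * T)"
      by (intro mult_right_mono add_right_mono state_le_energy[OF a]) auto
    finally show ?thesis .
  qed
  moreover have "(\<lambda>N. (a\<^sup>2 + (low_error s R N)\<^sup>2) * exp (low_rate s R * T)) \<longlonglongrightarrow> (a\<^sup>2 + (4 * bilinear_const 2 * R * (0 * R))\<^sup>2) * exp (low_rate s R * T)"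
    unfolding low_error_def using s by (intro tendsto_intros trunc_error_tendsto_0) auto
  ultimately have "energy G (\<lambda>_. 1) (\<lambda>n. u t n - v t n) (\<lambda>n. \<rho> t n - \<eta> t n) \<le> (a\<^sup>2 + (4 * bilinear_const 2 * R * (0 * R))\<^sup>2) * exp (low_rate s R * T)"
    by (intro LIMSEQ_le_const[where X = "\<lambda>N. (a\<^sup>2 + (low_error s R N)\<^sup>2) * exp (low_rate s R * T)"]) blast+
  also have "\<dots> = a\<^sup>2 * exp (low_rate s R * T)" by simp
  also have "\<dots> \<le> a\<^sup>2 * (exp (low_rate s R * T))\<^sup>2"
    using rate t by (intro mult_left_mono self_le_power) auto
  finally show "energy G (\<lambda>_. 1) (\<lambda>n. u t n - v t n) (\<lambda>n. \<rho> t n - \<eta> t n) \<le> (a * exp (low_rate s R * T))\<^sup>2"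
    by (simp add: power_mult_distrib)
qed

section \<open>Functions with absolutely summable Fourier coefficients\<close>

definition l1_coeffs :: "(int \<Rightarrow> complex) \<Rightarrow> bool" where
  "l1_coeffs a \<longleftrightarrow> (\<lambda>n. cmod (a n)) summable_on UNIV"

definition fourier_sum :: "(int \<Rightarrow> complex) \<Rightarrow> real \<Rightarrow> complex" where
  "fourier_sum a x = (\<Sum>\<^sub>\<infinity>n. a n * cis (freq n * x))"

text \<open>Taking the real part is the change of type that \<open>circle_fun\<close> requires; for
  Hermitian coefficients nothing is lost. Absolute summability makes the sum continuous, hence a
  legitimate representative.\<close>

definition synth :: "(int \<Rightarrow> complex) \<Rightarrow> circle_fun" where
  "synth a = abs_circle_fun (\<lambda>x. Re (fourier_sum a x))"

lemma l1_coeffsI: "l1_le (\<lambda>n. cmod (a n)) A \<Longrightarrow> l1_coeffs a"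
  unfolding l1_coeffs_def l1_le_def
  by (intro nonneg_bdd_above_summable_on bdd_aboveI2[where M = A]) auto

text \<open>The bounded factor h is carried along so that one statement yields continuity of the
  sum, with h = 1, and termwise integration against a continuous function.\<close>

lemma fourier_sum_uniform_limit:
  assumes a: "l1_coeffs a" and h: "\<And>x. x \<in> S \<Longrightarrow> cmod (h x) \<le> B"
  shows "uniform_limit S (\<lambda>F x. \<Sum>n\<in>F. a n * (cis (freq n * x) * h x)) (\<lambda>x. fourier_sum a x * h x) (finite_subsets_at_top UNIV)"
proof -
  have "uniform_limit S (\<lambda>F x. \<Sum>n\<in>F. a n * (cis (freq n * x) * h x)) (\<lambda>x. \<Sum>\<^sub>\<infinity>n. a n * (cis (freq n * x) * h x)) (finite_subsets_at_top UNIV)"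
  proof (rule Weierstrass_m_test_general)
    show "(\<lambda>n. cmod (a n) * B) summable_on UNIV"
      using a unfolding l1_coeffs_def by (rule summable_on_cmult_left)
    show "cmod (a n * (cis (freq n * x) * h x)) \<le> cmod (a n) * B" if "x \<in> S" for n x
      using h[OF that] by (simp add: norm_mult mult_left_mono)
  qed
  moreover have "(\<Sum>\<^sub>\<infinity>n. a n * (cis (freq n * x) * h x)) = fourier_sum a x * h x" for x
    unfolding fourier_sum_def by (subst infsum_cmult_left'[symmetric]) (simp add: mult.assoc)
  ultimately show ?thesis by simp
qed

lemma continuous_on_fourier_sum:
  assumes "l1_coeffs a" shows "continuous_on S (fourier_sum a)"
proof -
  have "continuous_on UNIV (\<lambda>x. fourier_sum a x * 1)"
  proof (rule uniform_limit_theorem[OF _ fourier_sum_uniform_limit[OF assms, of _ "\<lambda>_. 1" 1]])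
    show "\<forall>\<^sub>F F in finite_subsets_at_top UNIV. continuous_on UNIV (\<lambda>x. \<Sum>n\<in>F. a n * (cis (freq n * x) * 1))"
      by (intro always_eventually allI continuous_intros)
  qed auto
  then show ?thesis using continuous_on_subset by force
qed

lemma cis_freq_periodic: "cis (freq n * (x + 1)) = cis (freq n * x)"
proof -
  have "cis (freq n * (x + 1)) = cis (freq n * x) * cis (2 * pi * of_int n)"
    by (simp add: cis_mult freq_def algebra_simps)
  then show ?thesis by simp
qed

lemma fourier_sum_periodic: "fourier_sum a (x + 1) = fourier_sum a x"
  unfolding fourier_sum_def cis_freq_periodic ..

lemma fourier_sum_real:
  assumes "hermitian a" shows "of_real (Re (fourier_sum a x)) = fourier_sum a x"
proof -
  have "cnj (fourier_sum a x) = (\<Sum>\<^sub>\<infinity>n. cnj (a n * cis (freq n * x)))"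
    unfolding fourier_sum_def by (rule infsum_cnj[symmetric])
  also have "\<dots> = (\<Sum>\<^sub>\<infinity>n. a (- n) * cis (freq (- n) * x))"
    using assms by (simp add: hermitian_def cis_cnj)
  also have "\<dots> = fourier_sum a x"
    unfolding fourier_sum_def
    by (rule infsum_reindex_bij_betw[where g = uminus and f = "\<lambda>n. a n * cis (freq n * x)"]) (rule bij_uminus)
  finally show ?thesis by (simp add: complex_eq_iff)
qed

text \<open>Used with three kinds of h: exponentials give the Fourier coefficients, a second Fourier
  sum gives products, and test functions give weak derivatives.\<close>

lemma has_sum_integral_fourier_sum:
  assumes a: "l1_coeffs a" and h: "continuous_on {0..1} h"
  shows "((\<lambda>n. a n * integral {0..1} (\<lambda>x. cis (freq n * x) * h x)) has_sum integral {0..1} (\<lambda>x. fourier_sum a x * h x)) UNIV"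
proof -
  have "bounded (h ` {0..1})" by (intro compact_imp_bounded compact_continuous_image h) auto
  then obtain B where B: "\<And>x. x \<in> {0..1} \<Longrightarrow> cmod (h x) \<le> B" unfolding bounded_iff by blast
  have cF: "continuous_on {0..1} (\<lambda>x. \<Sum>n\<in>F. a n * (cis (freq n * x) * h x))" for F
    by (intro continuous_intros h)
  obtain I J where I: "\<And>F. ((\<lambda>x. \<Sum>n\<in>F. a n * (cis (freq n * x) * h x)) has_integral I F) {0..1}"
    and J: "((\<lambda>x. fourier_sum a x * h x) has_integral J) {0..1}" and IJ: "(I \<longlongrightarrow> J) (finite_subsets_at_top UNIV)"
    by (rule uniform_limit_integral[OF fourier_sum_uniform_limit[OF a, of "{0..1}" h B]])
      (use B cF in auto)
  have i: "(\<lambda>x. a n * (cis (freq n * x) * h x)) integrable_on {0..1}" for n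
    by (intro integrable_continuous_real continuous_intros h)
  have "I F = (\<Sum>n\<in>F. a n * integral {0..1} (\<lambda>x. cis (freq n * x) * h x))" if "finite F" for F
    using integral_unique[OF I[of F]] integral_sum[OF that, of "\<lambda>n x. a n * (cis (freq n * x) * h x)" "{0..1}"] i
    by simp
  then have "\<forall>\<^sub>F F in finite_subsets_at_top UNIV. I F = (\<Sum>n\<in>F. a n * integral {0..1} (\<lambda>x. cis (freq n * x) * h x))"
    by (intro eventually_finite_subsets_at_top_weakI) auto
  then have "((\<lambda>F. \<Sum>n\<in>F. a n * integral {0..1} (\<lambda>x. cis (freq n * x) * h x)) \<longlongrightarrow> J) (finite_subsets_at_top UNIV)"
    using IJ tendsto_cong by blast
  then show ?thesis unfolding has_sum_def using integral_unique[OF J] by simp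
qed

lemma cis_has_vector_derivative:
  "((\<lambda>x. cis (c * x)) has_vector_derivative (c * (\<i> * cis (c * x)))) (at x within S)"
proof -
  have "((\<lambda>z. exp (\<i> * of_real c * z)) has_field_derivative (\<i> * of_real c) * exp (\<i> * of_real c * of_real x)) (at (of_real x))"
    by (auto intro!: derivative_eq_intros)
  from has_vector_derivative_real_field[OF this] show ?thesis
    by (simp add: cis_conv_exp mult_ac)
qed

lemma integral_cis_freq: "integral {0..1} (\<lambda>x. cis (freq n * x)) = (if n = 0 then 1 else 0)"
proof (cases "n = 0")
  case False
  then have f: "freq n \<noteq> 0" by (simp add: freq_def)
  have "((\<lambda>x. cis (freq n * x)) has_integral (cis (freq n * 1) / (\<i> * freq n) - cis (freq n * 0) / (\<i> * freq n))) {0..1}"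
  proof (rule fundamental_theorem_of_calculus)
    fix x :: real
    have "((\<lambda>x. cis (freq n * x)) has_vector_derivative (freq n * (\<i> * cis (freq n * x)))) (at x within {0..1})"
      by (rule cis_has_vector_derivative)
    then have "((\<lambda>x. cis (freq n * x) / (\<i> * freq n)) has_vector_derivative (freq n * (\<i> * cis (freq n * x))) / (\<i> * freq n)) (at x within {0..1})"
      by (rule has_vector_derivative_divide)
    then show "((\<lambda>x. cis (freq n * x) / (\<i> * freq n)) has_vector_derivative cis (freq n * x)) (at x within {0..1})"
      using f by simp
  qed simp
  moreover have "cis (freq n * 1) = cis (freq n * 0)" using cis_freq_periodic[of n 0] by simp
  ultimately show ?thesis using False by (simp add: integral_unique)
qed simp

lemma LBINT_eq_integral:
  fixes f :: "real \<Rightarrow> 'a::euclidean_space"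
  assumes "continuous_on {0..1} f" shows "(LBINT x:{0..1}. f x) = integral {0..1} f"
  by (rule set_borel_integral_eq_integral(2)[OF borel_integrable_atLeastAtMost'[OF assms]])

lemma circle_eq_continuous: "continuous_on UNIV p \<Longrightarrow> periodic1 p \<Longrightarrow> circle_eq p p"
  unfolding circle_eq_def using borel_measurable_continuous_onI by auto

lemma continuous_on_Re_fourier_sum: "l1_coeffs a \<Longrightarrow> continuous_on S (\<lambda>x. Re (fourier_sum a x))"
  by (intro continuous_on_Re continuous_on_fourier_sum)

lemma periodic1_Re_fourier_sum: "periodic1 (\<lambda>x. Re (fourier_sum a x))"
  by (simp add: periodic1_def fourier_sum_periodic)

lemma circle_eq_synth: "l1_coeffs a \<Longrightarrow> circle_eq (\<lambda>x. Re (fourier_sum a x)) (\<lambda>x. Re (fourier_sum a x))"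
  by (intro circle_eq_continuous continuous_on_Re_fourier_sum periodic1_Re_fourier_sum)

lemma fourier_coeff_continuous:
  assumes "continuous_on UNIV p" "periodic1 p"
  shows "fourier_coeff (abs_circle_fun p) n = integral {0..1} (\<lambda>x. of_real (p x) * cis (freq (- n) * x))"
proof -
  have c: "continuous_on {0..1} (\<lambda>x. complex_of_real (p x) * cis (- (2 * pi * of_int n * x)))"
    by (intro continuous_intros continuous_on_subset[OF assms(1)]) auto
  show ?thesis
    unfolding fourier_coeff.abs_eq[OF circle_eq_continuous[OF assms]] LBINT_eq_integral[OF c]
    by (simp add: freq_def)
qed

lemma fourier_coeff_synth:
  assumes a: "l1_coeffs a" "hermitian a" shows "fourier_coeff (synth a) = a"
proof
  fix n
  have 1: "fourier_coeff (synth a) n = integral {0..1} (\<lambda>x. fourier_sum a x * cis (freq (- n) * x))"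
    unfolding synth_def
    by (subst fourier_coeff_continuous)
      (simp_all add: fourier_sum_real[OF a(2)] periodic1_Re_fourier_sum continuous_on_Re_fourier_sum a)
  have 2: "integral {0..1} (\<lambda>x. cis (freq k * x) * cis (freq (- n) * x)) = (if k = n then 1 else 0)" for k
    using integral_cis_freq[of "k - n"] by (simp add: cis_mult freq_diff left_diff_distrib)
  have "((\<lambda>k. a k * integral {0..1} (\<lambda>x. cis (freq k * x) * cis (freq (- n) * x))) has_sum
      fourier_coeff (synth a) n) UNIV"
    unfolding 1 by (intro has_sum_integral_fourier_sum a continuous_intros)
  then have 3: "((\<lambda>k. a k * (if k = n then 1 else 0)) has_sum fourier_coeff (synth a) n) UNIV"
    unfolding 2 .
  have "((\<lambda>k. a k * (if k = n then 1 else 0)) has_sum a n) UNIV"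
    by (rule has_sum_finite_neutralI[of "{n}"]) auto
  with 3 show "fourier_coeff (synth a) n = a n" by (rule has_sum_unique)
qed

lemma square_integrable_continuous:
  assumes "continuous_on UNIV p" "periodic1 p" shows "square_integrable (abs_circle_fun p)"
  unfolding square_integrable.abs_eq[OF circle_eq_continuous[OF assms]]
  by (intro borel_integrable_atLeastAtMost' continuous_intros continuous_on_subset[OF assms(1)]) auto

lemma square_integrable_synth: "l1_coeffs a \<Longrightarrow> square_integrable (synth a)"
  unfolding synth_def
  by (intro square_integrable_continuous continuous_on_Re_fourier_sum periodic1_Re_fourier_sum)

lemma hermitian_fourier_coeff: "hermitian (fourier_coeff f)"
  unfolding hermitian_def
proof
  fix n show "fourier_coeff f (- n) = cnj (fourier_coeff f n)"
  proof (transfer fixing: n)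
    fix f :: "real \<Rightarrow> real"
    have "indicat_real {0..1} x *\<^sub>R (complex_of_real (f x) * cis (- (2 * pi * of_int (- n) * x))) =
        cnj (indicat_real {0..1} x *\<^sub>R (complex_of_real (f x) * cis (- (2 * pi * of_int n * x))))" for x
      by (simp add: cis_cnj)
    then show "(LBINT x:{0..1}. complex_of_real (f x) * cis (- (2 * pi * of_int (- n) * x))) =
        cnj (LBINT x:{0..1}. complex_of_real (f x) * cis (- (2 * pi * of_int n * x)))"
      unfolding set_lebesgue_integral_def by (simp only: Bochner_Integration.integral_cnj)
  qed
qed

lemma fourier_coeff_eqI:
  assumes "square_integrable f" "square_integrable g" "\<And>n. fourier_coeff f n = fourier_coeff g n"
  shows "f = g"
  using fourier_coeff_eq_0_imp_eq_0[OF square_integrable_diff[OF assms(1,2)]] assms by (simp add: fourier_coeff_diff)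

lemma synth_fourier_coeff:
  assumes "square_integrable f" "l1_coeffs (fourier_coeff f)" shows "synth (fourier_coeff f) = f"
  by (rule fourier_coeff_eqI) (simp_all add: square_integrable_synth fourier_coeff_synth hermitian_fourier_coeff assms)

text \<open>Both factors are continuous sums of their series. Expanding g termwise under the
  integral leaves the coefficient of f at n - k.\<close>

lemma fourier_coeff_mult:
  assumes "square_integrable f" "l1_coeffs (fourier_coeff f)" "square_integrable g" "l1_coeffs (fourier_coeff g)"
  shows "square_integrable (f * g)" "fourier_coeff (f * g) = conv (fourier_coeff f) (fourier_coeff g)"
proof -
  define a b where "a = fourier_coeff f" and "b = fourier_coeff g"
  have ab: "l1_coeffs a" "l1_coeffs b" "hermitian a" "hermitian b"
    using assms by (auto simp: a_def b_def hermitian_fourier_coeff)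
  have fg: "f = synth a" "g = synth b" using assms by (simp_all add: a_def b_def synth_fourier_coeff)
  define p where "p x = Re (fourier_sum a x) * Re (fourier_sum b x)" for x
  have p: "continuous_on UNIV p" "periodic1 p"
    unfolding p_def by (intro continuous_on_mult continuous_on_Re_fourier_sum ab) (simp add: periodic1_def fourier_sum_periodic)
  have fgp: "f * g = abs_circle_fun p"
    unfolding fg synth_def p_def[abs_def] by (rule times_circle_fun.abs_eq[OF circle_eq_synth[OF ab(1)] circle_eq_synth[OF ab(2)]])
  show "square_integrable (f * g)" unfolding fgp by (rule square_integrable_continuous[OF p])
  show "fourier_coeff (f * g) = conv (fourier_coeff f) (fourier_coeff g)"
  proof
    fix n
    have "fourier_coeff (f * g) n = integral {0..1} (\<lambda>x. fourier_sum b x * (fourier_sum a x * cis (freq (- n) * x)))"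
      unfolding fgp fourier_coeff_continuous[OF p] p_def
      by (simp add: fourier_sum_real ab mult_ac)
    moreover have "((\<lambda>k. b k * integral {0..1} (\<lambda>x. cis (freq k * x) * (fourier_sum a x * cis (freq (- n) * x)))) has_sum
        integral {0..1} (\<lambda>x. fourier_sum b x * (fourier_sum a x * cis (freq (- n) * x)))) UNIV"
      by (intro has_sum_integral_fourier_sum ab continuous_intros continuous_on_fourier_sum)
    moreover have "integral {0..1} (\<lambda>x. cis (freq k * x) * (fourier_sum a x * cis (freq (- n) * x))) = a (n - k)" for k
    proof -
      have "fourier_coeff (synth a) (n - k) = integral {0..1} (\<lambda>x. fourier_sum a x * cis (freq (- (n - k)) * x))"
        unfolding synth_def
        by (subst fourier_coeff_continuous)
          (simp_all add: fourier_sum_real[OF ab(3)] periodic1_Re_fourier_sum continuous_on_Re_fourier_sum ab)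
      moreover have "cis (freq k * x) * (fourier_sum a x * cis (freq (- n) * x)) = fourier_sum a x * cis (freq (- (n - k)) * x)" for x
      proof -
        have "cis (freq (- (n - k)) * x) = cis (freq k * x) * cis (freq (- n) * x)"
          by (simp add: cis_mult freq_diff algebra_simps)
        then show ?thesis by (simp only: mult_ac)
      qed
      ultimately show ?thesis unfolding fourier_coeff_synth[OF ab(1,3)] by (simp only:)
    qed
    ultimately have "((\<lambda>k. b k * a (n - k)) has_sum fourier_coeff (f * g) n) UNIV" by simp
    then show "fourier_coeff (f * g) n = conv (fourier_coeff f) (fourier_coeff g) n"
      unfolding conv_def a_def[symmetric] b_def[symmetric] by (simp add: infsumI mult.commute)
  qed
qed

lemma square_integrable_0 [simp]: "square_integrable 0"
  using square_integrable_continuous[of "\<lambda>_. 0"] by (simp add: periodic1_def zero_circle_fun_def)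

lemma square_integrable_uminus: "square_integrable f \<Longrightarrow> square_integrable (- f)"
  using square_integrable_diff[of 0 f] by simp

lemma square_integrable_add: "square_integrable f \<Longrightarrow> square_integrable g \<Longrightarrow> square_integrable (f + g)"
  using square_integrable_diff[of f "- g"] square_integrable_uminus by simp

lemma fourier_coeff_add:
  "square_integrable f \<Longrightarrow> square_integrable g \<Longrightarrow> fourier_coeff (f + g) n = fourier_coeff f n + fourier_coeff g n"
  using fourier_coeff_diff[of f "- g" n] by (simp add: square_integrable_uminus fourier_coeff_uminus)

lemma square_integrable_scaleR: "square_integrable f \<Longrightarrow> square_integrable (c *\<^sub>R f)"
  by transfer (simp add: power_mult_distrib set_integrable_mult_right)

lemma fourier_coeff_scaleR: "fourier_coeff (c *\<^sub>R f) n = of_real c * fourier_coeff f n"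
proof (transfer fixing: c n)
  fix f :: "real \<Rightarrow> real"
  have "(LBINT x:{0..1}. of_real c * (complex_of_real (f x) * cis (- (2 * pi * of_int n * x)))) =
    of_real c * (LBINT x:{0..1}. complex_of_real (f x) * cis (- (2 * pi * of_int n * x)))"
    by (rule set_integral_mult_right)
  then show "(LBINT x:{0..1}. complex_of_real (c * f x) * cis (- (2 * pi * of_int n * x))) =
    of_real c * (LBINT x:{0..1}. complex_of_real (f x) * cis (- (2 * pi * of_int n * x)))"
    by (simp add: mult.assoc)
qed

section \<open>Weak derivatives on the Fourier side\<close>

lemma test_function_props:
  assumes "test_function \<phi>"
  shows "continuous_on UNIV \<phi>" "continuous_on UNIV (deriv \<phi>)" "(\<phi> has_real_derivative deriv \<phi> x) (at x)" "\<phi> 1 = \<phi> 0"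
proof -
  have d: "(deriv ^^ k) \<phi> differentiable (at x)" for k x using assms by (simp add: test_function_def)
  have d0: "\<phi> differentiable (at x)" and d1: "deriv \<phi> differentiable (at x)" for x
    using d[of 0 x] d[of 1 x] by simp_all
  show "continuous_on UNIV \<phi>" "continuous_on UNIV (deriv \<phi>)"
    using d0 d1 by (auto intro!: continuous_at_imp_continuous_on differentiable_imp_continuous_within)
  show "(\<phi> has_real_derivative deriv \<phi> x) (at x)"
    using d0 by (metis DERIV_deriv_iff_real_differentiable)
  show "\<phi> 1 = \<phi> 0" using assms unfolding test_function_def periodic1_def by (metis add_0)
qed

text \<open>Integration by parts; the boundary terms cancel by periodicity.\<close>

lemma integral_cis_deriv:
  assumes "test_function \<phi>"
  shows "integral {0..1} (\<lambda>x. cis (freq n * x) * of_real (deriv \<phi> x)) = - (\<i> * freq n) * integral {0..1} (\<lambda>x. cis (freq n * x) * of_real (\<phi> x))"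
proof -
  note tp = test_function_props[OF assms]
  have i1: "(\<lambda>x. cis (freq n * x) * of_real (deriv \<phi> x)) integrable_on {0..1}"
    by (intro integrable_continuous_real continuous_intros continuous_on_subset[OF tp(2)]) auto
  have i2: "(\<lambda>x. cis (freq n * x) * of_real (\<phi> x)) integrable_on {0..1}"
    by (intro integrable_continuous_real continuous_intros continuous_on_subset[OF tp(1)]) auto
  have "((\<lambda>x. (\<i> * freq n) * (cis (freq n * x) * of_real (\<phi> x)) + cis (freq n * x) * of_real (deriv \<phi> x)) has_integral
     (cis (freq n * 1) * of_real (\<phi> 1) - cis (freq n * 0) * of_real (\<phi> 0))) {0..1}"
  proof (rule fundamental_theorem_of_calculus)
    fix x :: real
    have 1: "((\<lambda>x. cis (freq n * x)) has_vector_derivative (freq n * (\<i> * cis (freq n * x)))) (at x within {0..1})"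
      by (rule cis_has_vector_derivative)
    have "(\<phi> has_vector_derivative deriv \<phi> x) (at x within {0..1})"
      using tp(3) has_real_derivative_iff_has_vector_derivative has_vector_derivative_at_within by blast
    then have 2: "((\<lambda>x. complex_of_real (\<phi> x)) has_vector_derivative of_real (deriv \<phi> x)) (at x within {0..1})"
      by (rule bounded_linear.has_vector_derivative[OF bounded_linear_of_real])
    show "((\<lambda>x. cis (freq n * x) * of_real (\<phi> x)) has_vector_derivative
       (\<i> * freq n) * (cis (freq n * x) * of_real (\<phi> x)) + cis (freq n * x) * of_real (deriv \<phi> x)) (at x within {0..1})"
      using has_vector_derivative_mult[OF 1 2] by (simp add: algebra_simps)
  qed simp
  moreover have "cis (freq n * 1) = cis (freq n * 0)" using cis_freq_periodic[of n 0] by simp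
  ultimately have "((\<lambda>x. (\<i> * freq n) * (cis (freq n * x) * of_real (\<phi> x)) + cis (freq n * x) * of_real (deriv \<phi> x)) has_integral 0) {0..1}"
    using tp(4) by simp
  then have "integral {0..1} (\<lambda>x. (\<i> * freq n) * (cis (freq n * x) * of_real (\<phi> x)) + cis (freq n * x) * of_real (deriv \<phi> x)) = 0"
    by (rule integral_unique)
  moreover have "integral {0..1} (\<lambda>x. (\<i> * freq n) * (cis (freq n * x) * of_real (\<phi> x)) + cis (freq n * x) * of_real (deriv \<phi> x)) =
    (\<i> * freq n) * integral {0..1} (\<lambda>x. cis (freq n * x) * of_real (\<phi> x)) + integral {0..1} (\<lambda>x. cis (freq n * x) * of_real (deriv \<phi> x))"
    by (subst Henstock_Kurzweil_Integration.integral_add) (auto intro!: i1 integrable_on_mult_right i2)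
  ultimately show ?thesis by (simp add: add_eq_0_iff)
qed

lemma integral_complex_of_real_HK:
  assumes "f integrable_on S" shows "integral S (\<lambda>x. complex_of_real (f x)) = of_real (integral S f)"
  using integral_linear[OF assms bounded_linear_of_real] by (simp add: o_def)

text \<open>Expanded termwise, the integral against the derivative of a test function moves that
  derivative onto the coefficients.\<close>

lemma hermitian_synth_weak_derivative:
  assumes a: "l1_coeffs a" "hermitian a" and d: "l1_coeffs (dx a)"
  shows "has_weak_derivative (synth a) (synth (dx a))"
proof -
  define p q where "p x = Re (fourier_sum a x)" and "q x = Re (fourier_sum (dx a) x)" for x
  have pc: "continuous_on S p" and qc: "continuous_on S q" for S
    unfolding p_def q_def by (intro continuous_intros continuous_on_fourier_sum a d)+
  have hd: "hermitian (dx a)" by (rule hermitian_dx[OF a(2)])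
  have "(LBINT x:{0..1}. p x * deriv \<phi> x) = - (LBINT x:{0..1}. q x * \<phi> x)" if \<phi>: "test_function \<phi>" for \<phi>
  proof -
    note tp = test_function_props[OF \<phi>]
    have c0: "continuous_on {0..1} \<phi>" "continuous_on {0..1} (deriv \<phi>)"
      by (auto intro: continuous_on_subset[OF tp(1)] continuous_on_subset[OF tp(2)])
    have c1: "continuous_on {0..1} (\<lambda>x. p x * deriv \<phi> x)" and c2: "continuous_on {0..1} (\<lambda>x. q x * \<phi> x)"
      by (intro continuous_intros pc qc c0)+
    have "((\<lambda>n. a n * integral {0..1} (\<lambda>x. cis (freq n * x) * of_real (deriv \<phi> x))) has_sum
       integral {0..1} (\<lambda>x. fourier_sum a x * of_real (deriv \<phi> x))) UNIV"
      by (intro has_sum_integral_fourier_sum a continuous_intros c0)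
    moreover have "((\<lambda>n. - (dx a n * integral {0..1} (\<lambda>x. cis (freq n * x) * of_real (\<phi> x)))) has_sum
       - integral {0..1} (\<lambda>x. fourier_sum (dx a) x * of_real (\<phi> x))) UNIV"
      by (intro has_sum_uminusI has_sum_integral_fourier_sum d continuous_intros c0)
    moreover have "a n * integral {0..1} (\<lambda>x. cis (freq n * x) * of_real (deriv \<phi> x)) =
       - (dx a n * integral {0..1} (\<lambda>x. cis (freq n * x) * of_real (\<phi> x)))" for n
      unfolding integral_cis_deriv[OF \<phi>] dx_def by simp
    ultimately have "integral {0..1} (\<lambda>x. fourier_sum a x * of_real (deriv \<phi> x)) = - integral {0..1} (\<lambda>x. fourier_sum (dx a) x * of_real (\<phi> x))"
      using has_sum_unique by fastforce
    moreover have "fourier_sum a x = of_real (p x)" "fourier_sum (dx a) x = of_real (q x)" for x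
      by (simp_all add: p_def q_def fourier_sum_real a hd)
    ultimately have "integral {0..1} (\<lambda>x. complex_of_real (p x * deriv \<phi> x)) = - integral {0..1} (\<lambda>x. complex_of_real (q x * \<phi> x))"
      by simp
    then have "complex_of_real (integral {0..1} (\<lambda>x. p x * deriv \<phi> x)) = - complex_of_real (integral {0..1} (\<lambda>x. q x * \<phi> x))"
      by (simp only: integral_complex_of_real_HK[OF integrable_continuous_real[OF c1]] integral_complex_of_real_HK[OF integrable_continuous_real[OF c2]])
    then have "integral {0..1} (\<lambda>x. p x * deriv \<phi> x) = - integral {0..1} (\<lambda>x. q x * \<phi> x)"
      by (metis of_real_eq_iff of_real_minus)
    then show ?thesis by (simp add: LBINT_eq_integral c1 c2)
  qed
  moreover have "set_integrable lborel {0..1} p" "set_integrable lborel {0..1} q"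
    by (intro borel_integrable_atLeastAtMost' pc qc)+
  ultimately show ?thesis
    unfolding synth_def has_weak_derivative.abs_eq[OF circle_eq_synth[OF a(1)] circle_eq_synth[OF d]]
    by (simp add: p_def[abs_def] q_def[abs_def])
qed

section \<open>Sobolev spaces on the Fourier side\<close>

lemma sobolev_weight_times_square: "sobolev_weight r n * (cmod c)\<^sup>2 = (jb n powr r * cmod c)\<^sup>2"
  by (simp add: sobolev_weight_jb power_mult_distrib)

lemma sobolev_iff:
  "f \<in> sobolev r \<longleftrightarrow> square_integrable f \<and> (\<exists>A. l2_le (\<lambda>n. jb n powr r * cmod (fourier_coeff f n)) A)"
proof -
  let ?g = "\<lambda>n. (jb n powr r * cmod (fourier_coeff f n))\<^sup>2"
  have "?g summable_on UNIV \<longleftrightarrow> (\<exists>A. l2_le (\<lambda>n. jb n powr r * cmod (fourier_coeff f n)) A)"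
  proof
    assume s: "?g summable_on UNIV"
    have "l2_le (\<lambda>n. jb n powr r * cmod (fourier_coeff f n)) (sqrt (infsum ?g UNIV))"
      unfolding l2_le_def L2_set_def
      by (intro allI impI real_sqrt_le_mono finite_sum_le_infsum s) auto
    then show "\<exists>A. l2_le (\<lambda>n. jb n powr r * cmod (fourier_coeff f n)) A" by blast
  next
    assume "\<exists>A. l2_le (\<lambda>n. jb n powr r * cmod (fourier_coeff f n)) A"
    then obtain A where A: "l2_le (\<lambda>n. jb n powr r * cmod (fourier_coeff f n)) A" ..
    show "?g summable_on UNIV"
    proof (rule nonneg_bdd_above_summable_on[OF _ bdd_aboveI2[where M = "A\<^sup>2"]])
      fix F :: "int set" assume "F \<in> {F. F \<subseteq> UNIV \<and> finite F}"
      then have "L2_set (\<lambda>n. jb n powr r * cmod (fourier_coeff f n)) F \<le> A" using l2_leD[OF A] by blast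
      then have "(L2_set (\<lambda>n. jb n powr r * cmod (fourier_coeff f n)) F)\<^sup>2 \<le> A\<^sup>2"
        by (intro power_mono L2_set_nonneg)
      then show "sum ?g F \<le> A\<^sup>2" by (simp add: L2_set_def sum_nonneg)
    qed simp
  qed
  then show ?thesis by (simp add: sobolev_def sobolev_weight_times_square)
qed

lemma sobolevI: "square_integrable f \<Longrightarrow> l2_le (\<lambda>n. jb n powr r * cmod (fourier_coeff f n)) A \<Longrightarrow> f \<in> sobolev r"
  by (auto simp: sobolev_iff)

lemma sobolev_square_integrable: "f \<in> sobolev r \<Longrightarrow> square_integrable f"
  by (simp add: sobolev_iff)

lemma sobolev_mono:
  assumes "f \<in> sobolev r" "r' \<le> r" shows "f \<in> sobolev r'"
proof -
  obtain A where A: "square_integrable f" "l2_le (\<lambda>n. jb n powr r * cmod (fourier_coeff f n)) A"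
    using assms by (auto simp: sobolev_iff)
  have "jb n powr r' * cmod (fourier_coeff f n) \<le> jb n powr r * cmod (fourier_coeff f n)" for n
    using assms(2) by (intro mult_right_mono powr_mono) auto
  then have "l2_le (\<lambda>n. jb n powr r' * cmod (fourier_coeff f n)) A"
    by (intro l2_le_mono[OF A(2)]) auto
  then show ?thesis using A by (intro sobolevI)
qed

lemma sobolev_l1_le:
  assumes "l2_le (\<lambda>n. jb n powr r * cmod (a n)) A" "1/2 < r"
  shows "l1_le (\<lambda>n. cmod (a n)) (bracket_const r * A)"
proof -
  have e: "jb n powr (- r) * (jb n powr r * x) = x" for n x
    by (simp add: mult.assoc[symmetric] powr_add[symmetric])
  have "l1_le (\<lambda>n. jb n powr (- r) * (jb n powr r * cmod (a n))) (bracket_const r * A)"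
    by (rule l1_l2_product[OF bracket_const[OF assms(2)] assms(1)]) auto
  then show ?thesis unfolding e .
qed

lemma sobolev_l1_coeffs: "f \<in> sobolev r \<Longrightarrow> 1/2 < r \<Longrightarrow> l1_coeffs (fourier_coeff f)"
  unfolding sobolev_iff using sobolev_l1_le l1_coeffsI by blast

lemma synth_sobolev:
  assumes "hermitian a" "l2_le (\<lambda>n. jb n powr r * cmod (a n)) A" "1/2 < r"
  shows "synth a \<in> sobolev r" "fourier_coeff (synth a) = a"
proof -
  have a: "l1_coeffs a" using sobolev_l1_le[OF assms(2,3)] by (rule l1_coeffsI)
  show "fourier_coeff (synth a) = a" by (rule fourier_coeff_synth[OF a assms(1)])
  then show "synth a \<in> sobolev r" using square_integrable_synth[OF a] assms(2) by (intro sobolevI) auto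
qed

lemma sobolev_eqI:
  "f \<in> sobolev r \<Longrightarrow> g \<in> sobolev r' \<Longrightarrow> (\<And>n. fourier_coeff f n = fourier_coeff g n) \<Longrightarrow> f = g"
  by (rule fourier_coeff_eqI) (auto dest: sobolev_square_integrable)

lemma sobolev_fourier_coeff_add:
  "f \<in> sobolev r \<Longrightarrow> g \<in> sobolev r' \<Longrightarrow> fourier_coeff (f + g) n = fourier_coeff f n + fourier_coeff g n"
  by (rule fourier_coeff_add) (auto dest: sobolev_square_integrable)

lemma sobolev_fourier_coeff_diff:
  "f \<in> sobolev r \<Longrightarrow> g \<in> sobolev r' \<Longrightarrow> fourier_coeff (f - g) n = fourier_coeff f n - fourier_coeff g n"
  by (rule fourier_coeff_diff) (auto dest: sobolev_square_integrable)

lemma sobolev_scaleR: "f \<in> sobolev r \<Longrightarrow> c *\<^sub>R f \<in> sobolev r"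
proof -
  assume "f \<in> sobolev r"
  then obtain A where A: "square_integrable f" "l2_le (\<lambda>n. jb n powr r * cmod (fourier_coeff f n)) A"
    by (auto simp: sobolev_iff)
  have "l2_le (\<lambda>n. \<bar>c\<bar> * (jb n powr r * cmod (fourier_coeff f n))) (\<bar>c\<bar> * A)" by (rule l2_le_mult[OF A(2)]) simp
  then show ?thesis
    using A by (intro sobolevI[where A = "\<bar>c\<bar> * A"]) (auto simp: square_integrable_scaleR fourier_coeff_scaleR norm_mult mult_ac)
qed

lemma sobolev_add: "f \<in> sobolev r \<Longrightarrow> g \<in> sobolev r \<Longrightarrow> f + g \<in> sobolev r"
proof -
  assume fg: "f \<in> sobolev r" "g \<in> sobolev r"
  then obtain A B where A: "square_integrable f" "l2_le (\<lambda>n. jb n powr r * cmod (fourier_coeff f n)) A"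
    and B: "square_integrable g" "l2_le (\<lambda>n. jb n powr r * cmod (fourier_coeff g n)) B"
    by (auto simp: sobolev_iff)
  have "jb n powr r * cmod (fourier_coeff (f + g) n) \<le> jb n powr r * cmod (fourier_coeff f n) + jb n powr r * cmod (fourier_coeff g n)" for n
    unfolding fourier_coeff_add[OF A(1) B(1)] distrib_left[symmetric]
    by (intro mult_left_mono norm_triangle_ineq) auto
  then have "l2_le (\<lambda>n. jb n powr r * cmod (fourier_coeff (f + g) n)) (A + B)"
    by (intro l2_le_mono[OF l2_le_add[OF A(2) B(2)]]) auto
  then show ?thesis using square_integrable_add A B by (intro sobolevI)
qed

lemma sobolev_uminus: "f \<in> sobolev r \<Longrightarrow> - f \<in> sobolev r"
  using sobolev_scaleR[of f r "-1"] by simp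

lemma sobolev_diff: "f \<in> sobolev r \<Longrightarrow> g \<in> sobolev r \<Longrightarrow> f - g \<in> sobolev r"
  using sobolev_add[of f r "- g"] sobolev_uminus by simp

lemma sobolev_mult:
  assumes f: "f \<in> sobolev r" and g: "g \<in> sobolev r" and r: "1/2 < r"
  shows "f * g \<in> sobolev r" "fourier_coeff (f * g) = conv (fourier_coeff f) (fourier_coeff g)"
proof -
  obtain A B where A: "square_integrable f" "l2_le (\<lambda>n. jb n powr r * cmod (fourier_coeff f n)) A"
    and B: "square_integrable g" "l2_le (\<lambda>n. jb n powr r * cmod (fourier_coeff g n)) B"
    using f g by (auto simp: sobolev_iff)
  note m = fourier_coeff_mult[OF A(1) sobolev_l1_coeffs[OF f r] B(1) sobolev_l1_coeffs[OF g r]]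
  show "fourier_coeff (f * g) = conv (fourier_coeff f) (fourier_coeff g)" by (rule m(2))
  have "l2_le (\<lambda>n. jb n powr r * cmod (conv (fourier_coeff f) (fourier_coeff g) n))
      (2 powr r * (bracket_const r * A * B + A * (bracket_const r * B)))"
    using r by (intro conv_algebra sobolev_l1_le A B) auto
  then show "f * g \<in> sobolev r" using m by (intro sobolevI) auto
qed

section \<open>Uniqueness of weak derivatives\<close>

lemma deriv_trig:
  "deriv (\<lambda>x. a * cos (c * x) + b * sin (c * x)) = (\<lambda>x. (c * b) * cos (c * x) + (- c * a) * sin (c * x))" for a b c :: real
  by (rule ext, rule DERIV_imp_deriv) (auto intro!: derivative_eq_intros simp: algebra_simps)

text \<open>The combinations of \<open>cos\<close> and \<open>sin\<close> at one frequency are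
  closed under \<open>deriv\<close>, so all iterated derivatives exist. They are the test functions
  that detect Fourier coefficients.\<close>

lemma test_function_trig: "test_function (\<lambda>x. a * cos (freq n * x) + b * sin (freq n * x))"
proof -
  have "\<exists>a' b'. (deriv ^^ k) (\<lambda>x. a * cos (freq n * x) + b * sin (freq n * x)) = (\<lambda>x. a' * cos (freq n * x) + b' * sin (freq n * x))" for k
  proof (induction k)
    case (Suc k)
    then obtain a' b' where "(deriv ^^ k) (\<lambda>x. a * cos (freq n * x) + b * sin (freq n * x)) = (\<lambda>x. a' * cos (freq n * x) + b' * sin (freq n * x))"
      by blast
    then have "(deriv ^^ Suc k) (\<lambda>x. a * cos (freq n * x) + b * sin (freq n * x)) =
        (\<lambda>x. (freq n * b') * cos (freq n * x) + (- freq n * a') * sin (freq n * x))"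
      using deriv_trig[of a' "freq n" b'] by simp
    then show ?case by blast
  qed auto
  moreover have "(\<lambda>x. a' * cos (freq n * x) + b' * sin (freq n * x)) differentiable (at x)" for a' b' x
    by (rule differentiableI) (auto intro!: derivative_eq_intros simp flip: has_real_derivative_iff)
  moreover have "cos (freq n * (x + 1)) = cos (freq n * x)" "sin (freq n * (x + 1)) = sin (freq n * x)" for x
    using cis_freq_periodic[of n x] by (auto simp: complex_eq_iff)
  ultimately show ?thesis unfolding test_function_def periodic1_def by metis
qed

text \<open>Testing with \<open>cos\<close> and \<open>sin\<close> shows that g and g' have equal
  Fourier coefficients. Both are merely integrable, so completeness is used in its L1 form; square
  integrability of the difference is a consequence of its vanishing almost everywhere.\<close>

lemma weak_derivative_unique:
  assumes "has_weak_derivative f g" "has_weak_derivative f g'" shows "g = g'"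
proof -
  have "square_integrable (g - g') \<and> (\<forall>n. fourier_coeff (g - g') n = 0)"
    using assms
  proof (transfer, intro conjI allI)
    fix f g g' :: "real \<Rightarrow> real"
    assume c: "circle_eq g g" "circle_eq g' g'"
      and w: "set_integrable lborel {0..1} f \<and> set_integrable lborel {0..1} g \<and>
        (\<forall>\<phi>. test_function \<phi> \<longrightarrow> (LBINT x:{0..1}. f x * deriv \<phi> x) = - (LBINT x:{0..1}. g x * \<phi> x))"
      and w': "set_integrable lborel {0..1} f \<and> set_integrable lborel {0..1} g' \<and>
        (\<forall>\<phi>. test_function \<phi> \<longrightarrow> (LBINT x:{0..1}. f x * deriv \<phi> x) = - (LBINT x:{0..1}. g' x * \<phi> x))"
    have m [measurable]: "g \<in> borel_measurable borel" "g' \<in> borel_measurable borel" using c by (auto simp: circle_eq_def)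
    have i: "set_integrable lborel {0..1} (\<lambda>x. g x - g' x)" using w w' by (intro set_integral_diff) auto
    have md: "(\<lambda>x. g x - g' x) \<in> borel_measurable borel" by measurable
    have ii: "set_integrable lborel {0..1} (\<lambda>x. h x * \<phi> x)"
      if "set_integrable lborel {0..1} h" "h \<in> borel_measurable borel" "test_function \<phi>" for h \<phi> :: "real \<Rightarrow> real"
    proof -
      have "set_integrable lborel {0..1} (\<lambda>x. complex_of_real (h x) * of_real (\<phi> x))"
        using test_function_props(1)[OF that(3)] by (intro set_integrable_times_continuous that continuous_intros)
      then have "set_integrable lborel {0..1} (\<lambda>x. Re (complex_of_real (h x) * of_real (\<phi> x)))"
        unfolding set_integrable_def by (drule_tac integrable_Re) simp
      then show ?thesis by simp
    qed
    have z: "(LBINT x:{0..1}. (g x - g' x) * \<phi> x) = 0" if \<phi>: "test_function \<phi>" for \<phi>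
    proof -
      have "(LBINT x:{0..1}. (g x - g' x) * \<phi> x) = (LBINT x:{0..1}. g x * \<phi> x) - (LBINT x:{0..1}. g' x * \<phi> x)"
        using w w' \<phi> m by (subst set_integral_diff(2)[symmetric]) (auto intro!: ii simp: left_diff_distrib)
      also have "\<dots> = 0" using w w' \<phi> by simp
      finally show ?thesis .
    qed
    have fc: "(LBINT x:{0..1}. complex_of_real (g x - g' x) * cis (- (2 * pi * of_int n * x))) = 0" for n
    proof -
      have t: "test_function (\<lambda>x. cos (freq n * x))" "test_function (\<lambda>x. sin (freq n * x))"
        using test_function_trig[of 1 n 0] test_function_trig[of 0 n 1] by simp_all
      have ic: "set_integrable lborel {0..1} (\<lambda>x. complex_of_real ((g x - g' x) * cos (freq n * x)))"
        "set_integrable lborel {0..1} (\<lambda>x. complex_of_real ((g x - g' x) * sin (freq n * x)))"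
        using ii[OF i md t(1)] ii[OF i md t(2)] unfolding set_integrable_def
        by (simp_all add: scaleR_conv_of_real flip: of_real_mult)
      have "complex_of_real (g x - g' x) * cis (- (2 * pi * of_int n * x)) =
        complex_of_real ((g x - g' x) * cos (freq n * x)) - \<i> * complex_of_real ((g x - g' x) * sin (freq n * x))" for x
        by (simp add: complex_eq_iff freq_def)
      then have "(LBINT x:{0..1}. complex_of_real (g x - g' x) * cis (- (2 * pi * of_int n * x))) =
        (LBINT x:{0..1}. complex_of_real ((g x - g' x) * cos (freq n * x))) - \<i> * (LBINT x:{0..1}. complex_of_real ((g x - g' x) * sin (freq n * x)))"
        using ic by (simp only: set_integral_diff(2)[OF ic(1) set_integrable_mult_right[OF ic(2)]] set_integral_mult_right)
      also have "\<dots> = 0" unfolding set_integral_complex_of_real using z[OF t(1)] z[OF t(2)] by simp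
      finally show ?thesis .
    qed
    then show "(LBINT x:{0..1}. complex_of_real (g x - g' x) * cis (- (2 * pi * of_int n * x))) = 0" for n .
    have "AE x in lborel. x \<in> {0..1} \<longrightarrow> g x - g' x = 0"
      by (rule fourier_coeffs_eq_0_imp_AE_eq_0[OF i md fc])
    then have ae: "AE x in lborel. indicat_real {0..1} x *\<^sub>R (g x - g' x)\<^sup>2 = 0"
      by eventually_elim (auto simp: indicator_def)
    show "set_integrable lborel {0..1} (\<lambda>x. (g x - g' x)\<^sup>2)"
      unfolding set_integrable_def
    proof (rule integrable_cong_AE_imp[of lborel "\<lambda>_. 0"])
      show "AE x in lborel. 0 = indicat_real {0..1} x *\<^sub>R (g x - g' x)\<^sup>2"
        using ae by eventually_elim simp
    qed measurable
  qed
  then have "g - g' = 0" using fourier_coeff_eq_0_imp_eq_0 by blast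
  then show ?thesis by simp
qed

section \<open>\<open>Dx\<close>, \<open>A_op\<close> and \<open>A_inv\<close> as Fourier
  multipliers\<close>

lemma l2_le_dx:
  assumes "l2_le (\<lambda>n. jb n powr r * cmod (a n)) A"
  shows "l2_le (\<lambda>n. jb n powr (r - 1) * cmod (dx a n)) A"
proof (rule l2_le_mono[OF assms])
  fix n
  have "jb n powr (r - 1) * cmod (dx a n) \<le> jb n powr (r - 1) * (jb n * cmod (a n))"
    by (intro mult_left_mono cmod_dx) auto
  then show "jb n powr (r - 1) * cmod (dx a n) \<le> jb n powr r * cmod (a n)" by (simp add: powr_diff)
qed auto

text \<open>With r - 1 > 1/2 the differentiated coefficients are still absolutely summable, so the
  derivative can be synthesised as a continuous function and is the weak derivative by
  uniqueness.\<close>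

lemma Dx_sobolev:
  assumes f: "f \<in> sobolev r" and r: "3/2 < r"
  shows "Dx f \<in> sobolev (r - 1)" "fourier_coeff (Dx f) = dx (fourier_coeff f)"
proof -
  define a where "a = fourier_coeff f"
  obtain A where A: "square_integrable f" "l2_le (\<lambda>n. jb n powr r * cmod (a n)) A"
    using f by (auto simp: sobolev_iff a_def)
  have h: "hermitian a" by (simp add: a_def hermitian_fourier_coeff)
  have a: "l1_coeffs a" using sobolev_l1_coeffs[OF f] r by (simp add: a_def)
  note da = l2_le_dx[OF A(2)]
  have d: "l1_coeffs (dx a)" using sobolev_l1_le[OF da] r by (intro l1_coeffsI) auto
  have fa: "f = synth a" using synth_fourier_coeff[OF A(1)] a by (simp add: a_def)
  have "has_weak_derivative f (synth (dx a))" unfolding fa by (rule hermitian_synth_weak_derivative[OF a h d])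
  then have Dx: "Dx f = synth (dx a)"
    unfolding Dx_def using weak_derivative_unique by (intro the_equality) auto
  show "Dx f \<in> sobolev (r - 1)" "fourier_coeff (Dx f) = dx (fourier_coeff f)"
    unfolding Dx a_def[symmetric] using r by (intro synth_sobolev[OF hermitian_dx[OF h] da]; simp)+
qed

lemma A_op_sobolev:
  assumes f: "f \<in> sobolev s" and s: "5/2 < s"
  shows "A_op f \<in> sobolev (s - 2)" "fourier_coeff (A_op f) n = of_real ((jb n)\<^sup>2) * fourier_coeff f n"
proof -
  have 1: "Dx f \<in> sobolev (s - 1)" "fourier_coeff (Dx f) = dx (fourier_coeff f)"
    using Dx_sobolev[OF f] s by auto
  have 2: "Dx (Dx f) \<in> sobolev (s - 2)" "fourier_coeff (Dx (Dx f)) = dx (fourier_coeff (Dx f))"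
    using Dx_sobolev[OF 1(1)] s by auto
  have f2: "f \<in> sobolev (s - 2)" using sobolev_mono[OF f] by simp
  show "A_op f \<in> sobolev (s - 2)" unfolding A_op_def by (rule sobolev_diff[OF f2 2(1)])
  have "fourier_coeff (A_op f) n = fourier_coeff f n - \<i> * of_real (freq n) * (\<i> * of_real (freq n) * fourier_coeff f n)"
    unfolding A_op_def sobolev_fourier_coeff_diff[OF f2 2(1)] 2(2) 1(2) dx_def ..
  also have "\<dots> = of_real (1 + (freq n)\<^sup>2) * fourier_coeff f n"
    by (simp add: algebra_simps power2_eq_square)
  finally show "fourier_coeff (A_op f) n = of_real ((jb n)\<^sup>2) * fourier_coeff f n"
    by (simp add: jb_square)
qed

text \<open>A preimage is synthesised by dividing the coefficients by the symbol of
  \<open>A\<close>; since the symbol has no zero, \<open>A_op\<close> is injective and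
  \<open>the_inv_into\<close> returns that preimage.\<close>

lemma A_inv_sobolev:
  assumes g: "g \<in> sobolev (s - 2)" and s: "5/2 < s"
  shows "A_inv s g \<in> sobolev s" "fourier_coeff (A_inv s g) n = of_real (1 / (jb n)\<^sup>2) * fourier_coeff g n"
proof -
  obtain A where A: "l2_le (\<lambda>n. jb n powr (s - 2) * cmod (fourier_coeff g n)) A"
    using g by (auto simp: sobolev_iff)
  define b where "b n = of_real (1 / (jb n)\<^sup>2) * fourier_coeff g n" for n
  have "hermitian b" using hermitian_fourier_coeff[of g] by (simp add: hermitian_def b_def)
  moreover have "jb n powr s * cmod (b n) = jb n powr (s - 2) * cmod (fourier_coeff g n)" for n
  proof -
    have "jb n powr s = jb n powr (s - 2) * (jb n)\<^sup>2" by (simp add: powr_diff)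
    then show ?thesis by (simp add: b_def norm_mult norm_divide norm_power)
  qed
  then have "l2_le (\<lambda>n. jb n powr s * cmod (b n)) A" using A by simp
  ultimately have b: "synth b \<in> sobolev s" "fourier_coeff (synth b) = b" using synth_sobolev[of b s A] s by auto
  have eq: "A_op (synth b) = g"
    by (rule sobolev_eqI[OF A_op_sobolev(1)[OF b(1) s] g]) (simp add: A_op_sobolev(2)[OF b(1) s] b(2) b_def)
  have "inj_on A_op (sobolev s)"
  proof (rule inj_onI)
    fix x y assume x: "x \<in> sobolev s" and y: "y \<in> sobolev s" and "A_op x = A_op y"
    then have "of_real ((jb n)\<^sup>2) * fourier_coeff x n = of_real ((jb n)\<^sup>2) * fourier_coeff y n" for n
      using A_op_sobolev(2)[OF x s, of n] A_op_sobolev(2)[OF y s, of n] by simp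
    then show "x = y" using sobolev_eqI[OF x y] by simp
  qed
  from the_inv_into_f_f[OF this b(1)] have "A_inv s g = synth b" by (simp add: A_inv_def eq)
  then show "A_inv s g \<in> sobolev s" "fourier_coeff (A_inv s g) n = of_real (1 / (jb n)\<^sup>2) * fourier_coeff g n"
    using b by (simp_all add: b_def)
qed

section \<open>The vector field of the Cauchy problem\<close>

definition field_u :: "real \<Rightarrow> circle_fun \<Rightarrow> circle_fun \<Rightarrow> circle_fun" where
  "field_u s u \<rho> = - A_inv s (Dx ((3/2) *\<^sub>R u\<^sup>2 - \<rho>\<^sup>2) + \<rho> * Dx u) - u * Dx u"

definition field_r :: "circle_fun \<Rightarrow> circle_fun \<Rightarrow> circle_fun" where
  "field_r u \<rho> = - 2 * \<rho> * Dx u - u * Dx \<rho>"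

lemma field_u_sobolev:
  assumes s: "5/2 < s" and u: "u \<in> sobolev s" and \<rho>: "\<rho> \<in> sobolev (s - 1)"
  shows "field_u s u \<rho> \<in> sobolev (s - 1)"
    "fourier_coeff (field_u s u \<rho>) n = Bu (fourier_coeff u) (fourier_coeff \<rho>) (fourier_coeff u) (fourier_coeff \<rho>) n"
proof -
  have u1: "u \<in> sobolev (s - 1)" using sobolev_mono[OF u] by simp
  have dxu: "Dx u \<in> sobolev (s - 1)" "fourier_coeff (Dx u) = dx (fourier_coeff u)" using Dx_sobolev[OF u] s by auto
  have s1: "1/2 < s - 1" using s by simp
  have q: "(3/2) *\<^sub>R u\<^sup>2 - \<rho>\<^sup>2 \<in> sobolev (s - 1)"
    unfolding power2_eq_square by (intro sobolev_diff sobolev_scaleR sobolev_mult u1 \<rho> s1)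
  have qc: "fourier_coeff ((3/2) *\<^sub>R u\<^sup>2 - \<rho>\<^sup>2) n = 3/2 * conv (fourier_coeff u) (fourier_coeff u) n - conv (fourier_coeff \<rho>) (fourier_coeff \<rho>) n" for n
    unfolding power2_eq_square
    by (subst sobolev_fourier_coeff_diff[OF sobolev_scaleR[OF sobolev_mult(1)[OF u1 u1 s1]] sobolev_mult(1)[OF \<rho> \<rho> s1]])
      (simp add: fourier_coeff_scaleR sobolev_mult(2)[OF u1 u1 s1] sobolev_mult(2)[OF \<rho> \<rho> s1])
  have dq: "Dx ((3/2) *\<^sub>R u\<^sup>2 - \<rho>\<^sup>2) \<in> sobolev (s - 2)" "fourier_coeff (Dx ((3/2) *\<^sub>R u\<^sup>2 - \<rho>\<^sup>2)) = dx (fourier_coeff ((3/2) *\<^sub>R u\<^sup>2 - \<rho>\<^sup>2))"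
    using Dx_sobolev[OF q] s by auto
  have r: "\<rho> * Dx u \<in> sobolev (s - 1)" "fourier_coeff (\<rho> * Dx u) = conv (fourier_coeff \<rho>) (dx (fourier_coeff u))"
    using sobolev_mult[OF \<rho> dxu(1) s1] by (simp_all add: dxu(2))
  have r2: "\<rho> * Dx u \<in> sobolev (s - 2)" using sobolev_mono[OF r(1)] by simp
  have t: "u * Dx u \<in> sobolev (s - 1)" "fourier_coeff (u * Dx u) = conv (fourier_coeff u) (dx (fourier_coeff u))"
    using sobolev_mult[OF u1 dxu(1) s1] by (simp_all add: dxu(2))
  define g where "g = Dx ((3/2) *\<^sub>R u\<^sup>2 - \<rho>\<^sup>2) + \<rho> * Dx u"
  have g: "g \<in> sobolev (s - 2)" unfolding g_def by (rule sobolev_add[OF dq(1) r2])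
  have gc: "fourier_coeff g n = dx (fourier_coeff ((3/2) *\<^sub>R u\<^sup>2 - \<rho>\<^sup>2)) n + conv (fourier_coeff \<rho>) (dx (fourier_coeff u)) n"
    unfolding g_def sobolev_fourier_coeff_add[OF dq(1) r2] dq(2) r(2) ..
  note Ag = A_inv_sobolev[OF g s]
  have Ag1: "- A_inv s g \<in> sobolev (s - 1)" using sobolev_uminus[OF sobolev_mono[OF Ag(1), of "s - 1"]] by simp
  show "field_u s u \<rho> \<in> sobolev (s - 1)"
    unfolding field_u_def g_def[symmetric] by (rule sobolev_diff[OF Ag1 t(1)])
  have "fourier_coeff (field_u s u \<rho>) n = - (of_real (1 / (jb n)\<^sup>2) * fourier_coeff g n) - conv (fourier_coeff u) (dx (fourier_coeff u)) n"
    unfolding field_u_def g_def[symmetric] sobolev_fourier_coeff_diff[OF Ag1 t(1)] fourier_coeff_uminus Ag(2) t(2) ..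
  also have "\<dots> = Bu (fourier_coeff u) (fourier_coeff \<rho>) (fourier_coeff u) (fourier_coeff \<rho>) n"
    unfolding gc Bu_def dx_def[of "fourier_coeff ((3/2) *\<^sub>R u\<^sup>2 - \<rho>\<^sup>2)"] qc by (simp add: algebra_simps)
  finally show "fourier_coeff (field_u s u \<rho>) n = Bu (fourier_coeff u) (fourier_coeff \<rho>) (fourier_coeff u) (fourier_coeff \<rho>) n" .
qed

lemma field_r_sobolev:
  assumes s: "5/2 < s" and u: "u \<in> sobolev s" and \<rho>: "\<rho> \<in> sobolev (s - 1)"
  shows "field_r u \<rho> \<in> sobolev (s - 2)"
    "fourier_coeff (field_r u \<rho>) n = Br (fourier_coeff u) (fourier_coeff \<rho>) (fourier_coeff u) (fourier_coeff \<rho>) n"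
proof -
  have dxu: "Dx u \<in> sobolev (s - 2)" "fourier_coeff (Dx u) = dx (fourier_coeff u)"
    using Dx_sobolev[OF u] s sobolev_mono[of "Dx u" "s - 1" "s - 2"] by auto
  have dxr: "Dx \<rho> \<in> sobolev (s - 2)" "fourier_coeff (Dx \<rho>) = dx (fourier_coeff \<rho>)"
    using Dx_sobolev[OF \<rho>] s by auto
  have u2: "u \<in> sobolev (s - 2)" and r2: "\<rho> \<in> sobolev (s - 2)"
    using sobolev_mono[OF u] sobolev_mono[OF \<rho>] by auto
  have s2: "1/2 < s - 2" using s by simp
  \<comment> \<open>The factor -2 of the equation is a numeral of the ring; as a scalar it can be
    pulled out of the Fourier coefficient.\<close>
  have e: "field_r u \<rho> = (- 2) *\<^sub>R (\<rho> * Dx u) - u * Dx \<rho>"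
  proof -
    have "(- 2) *\<^sub>R x = - 2 * x" for x :: circle_fun
      by (metis mult_scaleR_left mult_1 of_real_def of_real_minus of_real_numeral scaleR_conv_of_real)
    then show ?thesis by (simp add: field_r_def mult.assoc)
  qed
  have 1: "(- 2) *\<^sub>R (\<rho> * Dx u) \<in> sobolev (s - 2)" by (intro sobolev_scaleR sobolev_mult r2 dxu s2)
  have 2: "u * Dx \<rho> \<in> sobolev (s - 2)" by (intro sobolev_mult u2 dxr s2)
  show "field_r u \<rho> \<in> sobolev (s - 2)" unfolding e by (rule sobolev_diff[OF 1 2])
  show "fourier_coeff (field_r u \<rho>) n = Br (fourier_coeff u) (fourier_coeff \<rho>) (fourier_coeff u) (fourier_coeff \<rho>) n"
    unfolding e sobolev_fourier_coeff_diff[OF 1 2] fourier_coeff_scaleR sobolev_mult(2)[OF r2 dxu(1) s2] sobolev_mult(2)[OF u2 dxr(1) s2]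
    by (simp add: Br_def dxu dxr)
qed

section \<open>The metric of the state space\<close>

lemma mspace_state_space [simp]: "mspace (state_space s) = sobolev s \<times> sobolev (s - 1)"
  by (simp add: state_space_def)

lemma sobolev_norm_has_sum:
  assumes "f \<in> sobolev r"
  shows "((\<lambda>n. (jb n powr r * cmod (fourier_coeff f n))\<^sup>2) has_sum (sobolev_norm r f)\<^sup>2) UNIV"
proof -
  have s: "(\<lambda>n. (jb n powr r * cmod (fourier_coeff f n))\<^sup>2) summable_on UNIV"
    using assms by (simp add: sobolev_def sobolev_weight_times_square)
  have "(sobolev_norm r f)\<^sup>2 = (\<Sum>\<^sub>\<infinity>n. (jb n powr r * cmod (fourier_coeff f n))\<^sup>2)"
    unfolding sobolev_norm_def sobolev_weight_times_square by (intro real_sqrt_pow2 infsum_nonneg) simp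
  then show ?thesis using s by (simp add: has_sum_infsum)
qed

text \<open>\<open>prod_metric\<close> combines two distances into a Euclidean norm, so the norm of
  a state is exactly the l2 norm of \<open>pnorm\<close>, and \<open>state_le\<close> bounds
  translate without loss of constants.\<close>

lemma state_norm_le_iff:
  assumes "f \<in> sobolev s" "g \<in> sobolev (s - 1)" "0 \<le> R"
  shows "sqrt ((sobolev_norm s f)\<^sup>2 + (sobolev_norm (s - 1) g)\<^sup>2) \<le> R \<longleftrightarrow>
    state_le (\<lambda>n. jb n powr (s - 1)) (fourier_coeff f) (fourier_coeff g) R"
proof -
  define h where "h n = (pnorm (\<lambda>n. jb n powr (s - 1)) (fourier_coeff f) (fourier_coeff g) n)\<^sup>2" for n
  define X where "X = (sobolev_norm s f)\<^sup>2 + (sobolev_norm (s - 1) g)\<^sup>2"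
  have "h = (\<lambda>n. (jb n powr s * cmod (fourier_coeff f n))\<^sup>2 + (jb n powr (s - 1) * cmod (fourier_coeff g n))\<^sup>2)"
    by (simp add: fun_eq_iff h_def pnorm_def powr_diff)
  then have h: "(h has_sum X) UNIV"
    using has_sum_add[OF sobolev_norm_has_sum[OF assms(1)] sobolev_norm_has_sum[OF assms(2)]] by (simp add: X_def)
  have h0: "0 \<le> h n" for n by (simp add: h_def)
  have "X \<le> R\<^sup>2 \<longleftrightarrow> (\<forall>F. finite F \<longrightarrow> sum h F \<le> R\<^sup>2)"
  proof
    assume "X \<le> R\<^sup>2"
    then show "\<forall>F. finite F \<longrightarrow> sum h F \<le> R\<^sup>2"
      using finite_sum_le_has_sum[OF h] h0 by (meson order_trans subset_UNIV)
  next
    assume "\<forall>F. finite F \<longrightarrow> sum h F \<le> R\<^sup>2"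
    then show "X \<le> R\<^sup>2" using has_sum_le_finite_sums[OF h] by blast
  qed
  also have "\<dots> \<longleftrightarrow> state_le (\<lambda>n. jb n powr (s - 1)) (fourier_coeff f) (fourier_coeff g) R"
  proof -
    have "sum h F \<le> R\<^sup>2 \<longleftrightarrow> L2_set (pnorm (\<lambda>n. jb n powr (s - 1)) (fourier_coeff f) (fourier_coeff g)) F \<le> R" for F
      unfolding L2_set_def h_def using assms(3) by (simp add: real_sqrt_le_iff' sum_nonneg)
    then show ?thesis by (simp add: state_le_def l2_le_def)
  qed
  also have "X \<le> R\<^sup>2 \<longleftrightarrow> sqrt X \<le> R" using assms(3) by (simp add: real_sqrt_le_iff' X_def)
  finally show ?thesis by (simp add: X_def)
qed

lemma mdist_state_space_le_iff:
  assumes "z \<in> mspace (state_space s)" "y \<in> mspace (state_space s)" "0 \<le> R"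
  shows "mdist (state_space s) z y \<le> R \<longleftrightarrow>
    state_le (\<lambda>n. jb n powr (s - 1)) (\<lambda>n. fourier_coeff (fst z) n - fourier_coeff (fst y) n)
      (\<lambda>n. fourier_coeff (snd z) n - fourier_coeff (snd y) n) R"
proof -
  have m: "fst z \<in> sobolev s" "fst y \<in> sobolev s" "snd z \<in> sobolev (s - 1)" "snd y \<in> sobolev (s - 1)"
    using assms by auto
  have d: "mdist (state_space s) z y = sqrt ((sobolev_norm s (fst z - fst y))\<^sup>2 + (sobolev_norm (s - 1) (snd z - snd y))\<^sup>2)"
    by (simp add: state_space_def mdist_prod_metric prod_dist_def case_prod_beta)
  have e: "fourier_coeff (fst z - fst y) = (\<lambda>n. fourier_coeff (fst z) n - fourier_coeff (fst y) n)"
    "fourier_coeff (snd z - snd y) = (\<lambda>n. fourier_coeff (snd z) n - fourier_coeff (snd y) n)"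
    using sobolev_fourier_coeff_diff[OF m(1,2)] sobolev_fourier_coeff_diff[OF m(3,4)] by auto
  show ?thesis
    unfolding d state_norm_le_iff[OF sobolev_diff[OF m(1,2)] sobolev_diff[OF m(3,4)] assms(3)] e ..
qed

section \<open>Curves in metric spaces\<close>

lemma continuous_map_mtopology_of:
  "continuous_map X (mtopology_of m) f \<longleftrightarrow> (\<forall>x\<in>topspace X. f x \<in> mspace m) \<and>
    (\<forall>x\<in>topspace X. \<forall>\<epsilon>>0. \<exists>U. openin X U \<and> x \<in> U \<and> (\<forall>y\<in>U. mdist m (f x) (f y) < \<epsilon>))"
proof -
  interpret Metric_space "mspace m" "mdist m" by simp
  have e: "(\<forall>y\<in>U. f y \<in> mball (f x) \<epsilon>) \<longleftrightarrow> (\<forall>y\<in>U. f x \<in> mspace m \<and> f y \<in> mspace m \<and> mdist m (f x) (f y) < \<epsilon>)" for U x \<epsilon>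
    by simp
  have "continuous_map X (mtopology_of m) f \<longleftrightarrow>
    (\<forall>x\<in>topspace X. \<forall>\<epsilon>>0. \<exists>U. openin X U \<and> x \<in> U \<and> (\<forall>y\<in>U. f x \<in> mspace m \<and> f y \<in> mspace m \<and> mdist m (f x) (f y) < \<epsilon>))"
    unfolding mtopology_of_def continuous_map_to_metric e ..
  also have "\<dots> \<longleftrightarrow> (\<forall>x\<in>topspace X. f x \<in> mspace m) \<and>
    (\<forall>x\<in>topspace X. \<forall>\<epsilon>>0. \<exists>U. openin X U \<and> x \<in> U \<and> (\<forall>y\<in>U. mdist m (f x) (f y) < \<epsilon>))"
    (is "?L \<longleftrightarrow> ?A \<and> ?B")
  proof (intro iffI conjI)
    assume L: ?L
    show ?A using L by (meson zero_less_one)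
    show ?B using L by meson
  next
    assume R: "?A \<and> ?B"
    show ?L
    proof (intro ballI allI impI)
      fix x and \<epsilon> :: real assume x: "x \<in> topspace X" "\<epsilon> > 0"
      then obtain U where "openin X U" "x \<in> U" "\<forall>y\<in>U. mdist m (f x) (f y) < \<epsilon>" using R by blast
      then show "\<exists>U. openin X U \<and> x \<in> U \<and> (\<forall>y\<in>U. f x \<in> mspace m \<and> f y \<in> mspace m \<and> mdist m (f x) (f y) < \<epsilon>)"
        using R x openin_subset by (metis subsetD)
    qed
  qed
  finally show ?thesis .
qed

lemma continuous_curve_iff:
  fixes J :: "real set"
  shows "continuous_map (top_of_set J) (mtopology_of m) f \<longleftrightarrow> (\<forall>t\<in>J. f t \<in> mspace m) \<and>
    (\<forall>t\<in>J. \<forall>\<epsilon>>0. \<exists>\<delta>>0. \<forall>t'\<in>J. \<bar>t' - t\<bar> < \<delta> \<longrightarrow> mdist m (f t) (f t') < \<epsilon>)"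
proof -
  have "(\<exists>U. openin (top_of_set J) U \<and> t \<in> U \<and> (\<forall>y\<in>U. mdist m (f t) (f y) < \<epsilon>)) \<longleftrightarrow>
      (\<exists>\<delta>>0. \<forall>t'\<in>J. \<bar>t' - t\<bar> < \<delta> \<longrightarrow> mdist m (f t) (f t') < \<epsilon>)" if t: "t \<in> J" for t \<epsilon>
  proof
    assume "\<exists>U. openin (top_of_set J) U \<and> t \<in> U \<and> (\<forall>y\<in>U. mdist m (f t) (f y) < \<epsilon>)"
    then obtain U where U: "openin (top_of_set J) U" "t \<in> U" "\<forall>y\<in>U. mdist m (f t) (f y) < \<epsilon>" by blast
    then obtain \<delta> where "\<delta> > 0" "ball t \<delta> \<inter> J \<subseteq> U" unfolding openin_contains_ball by blast
    then show "\<exists>\<delta>>0. \<forall>t'\<in>J. \<bar>t' - t\<bar> < \<delta> \<longrightarrow> mdist m (f t) (f t') < \<epsilon>"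
      using U(3) by (intro exI[of _ \<delta>]) (auto simp: dist_real_def subset_iff abs_minus_commute)
  next
    assume "\<exists>\<delta>>0. \<forall>t'\<in>J. \<bar>t' - t\<bar> < \<delta> \<longrightarrow> mdist m (f t) (f t') < \<epsilon>"
    then obtain \<delta> where \<delta>: "\<delta> > 0" "\<forall>t'\<in>J. \<bar>t' - t\<bar> < \<delta> \<longrightarrow> mdist m (f t) (f t') < \<epsilon>" by blast
    have "openin (top_of_set J) (J \<inter> ball t \<delta>)" by (rule openin_open_Int) simp
    then show "\<exists>U. openin (top_of_set J) U \<and> t \<in> U \<and> (\<forall>y\<in>U. mdist m (f t) (f y) < \<epsilon>)"
      using \<delta> t by (intro exI[of _ "J \<inter> ball t \<delta>"]) (auto simp: dist_real_def abs_minus_commute)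
  qed
  then show ?thesis unfolding continuous_map_mtopology_of by simp
qed

lemma limitin_mtopology_of:
  "limitin (mtopology_of m) f l F \<longleftrightarrow> l \<in> mspace m \<and> (\<forall>\<epsilon>>0. \<forall>\<^sub>F x in F. f x \<in> mspace m \<and> mdist m (f x) l < \<epsilon>)"
  unfolding mtopology_of_def by (rule Metric_space.limitin_metric[OF Metric_space_mspace_mdist])

lemma time_deriv_eq:
  assumes "has_time_deriv m z d t" shows "time_deriv m z t = d"
  unfolding time_deriv_def
proof (rule the_equality[of "\<lambda>d. has_time_deriv m z d t", OF assms])
  fix d' assume "has_time_deriv m z d' t"
  then show "d' = d"
    using assms unfolding has_time_deriv_def mtopology_of_def
    by (intro Metric_space.limitin_metric_unique[OF Metric_space_mspace_mdist]) auto
qed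

lemma continuous_map_cfunspace_restrict:
  assumes K: "compact K" and U: "U \<subseteq> mspace m"
    and c: "\<And>z. z \<in> U \<Longrightarrow> continuous_map (top_of_set K) (mtopology_of m') (G z)"
    and e: "\<And>z \<epsilon>. z \<in> U \<Longrightarrow> 0 < \<epsilon> \<Longrightarrow> \<exists>\<delta>>0. \<forall>y\<in>U. mdist m z y < \<delta> \<longrightarrow> (\<forall>t\<in>K. mdist m' (G z t) (G y t) \<le> \<epsilon>)"
  shows "continuous_map (subtopology (mtopology_of m) U) (mtopology_of (cfunspace (top_of_set K) m')) (\<lambda>z. restrict (G z) K)"
proof -
  interpret M: Metric_space "mspace m" "mdist m" by simp
  \<comment> \<open>On a compact domain continuity supplies the boundedness that membership in
    \<open>cfunspace\<close> asks for.\<close>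
  have cK: "compactin (top_of_set K) (topspace (top_of_set K))"
    using K by (simp add: compactin_subtopology)
  have mem: "restrict (G z) K \<in> mspace (cfunspace (top_of_set K) m')" if z: "z \<in> U" for z
  proof -
    have "continuous_map (top_of_set K) (mtopology_of m') (restrict (G z) K)"
      by (rule continuous_map_eq[OF c[OF z]]) simp
    moreover have "\<forall>t\<in>K. G z t \<in> mspace m'" using c[OF z] unfolding continuous_map_mtopology_of by simp
    ultimately show ?thesis unfolding compactin_mspace_cfunspace[OF cK] by simp
  qed
  show ?thesis
    unfolding continuous_map_mtopology_of
  proof (intro conjI ballI allI impI)
    fix z assume "z \<in> topspace (subtopology (mtopology_of m) U)"
    then have z: "z \<in> U" "z \<in> mspace m" by auto
    show "restrict (G z) K \<in> mspace (cfunspace (top_of_set K) m')" by (rule mem[OF z(1)])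
    fix \<epsilon> :: real assume \<epsilon>: "\<epsilon> > 0"
    \<comment> \<open>Half of \<epsilon>, because a supremum over K preserves only weak
      inequalities.\<close>
    obtain \<delta> where \<delta>: "\<delta> > 0" "\<And>y t. y \<in> U \<Longrightarrow> mdist m z y < \<delta> \<Longrightarrow> t \<in> K \<Longrightarrow> mdist m' (G z t) (G y t) \<le> \<epsilon> / 2"
      using e[OF z(1), of "\<epsilon> / 2"] \<epsilon> by auto
    define V where "V = U \<inter> M.mball z \<delta>"
    have "openin (subtopology (mtopology_of m) U) V"
      unfolding V_def mtopology_of_def by (intro openin_subtopology_Int2 M.openin_mball)
    moreover have "z \<in> V" using z \<delta>(1) by (simp add: V_def)
    moreover have "mdist (cfunspace (top_of_set K) m') (restrict (G z) K) (restrict (G y) K) < \<epsilon>" if "y \<in> V" for y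
    proof -
      have "mdist (cfunspace (top_of_set K) m') (restrict (G z) K) (restrict (G y) K) \<le> \<epsilon> / 2"
        by (rule mdist_cfunspace_le) (use that \<delta>(2) \<epsilon> in \<open>auto simp: V_def\<close>)
      then show ?thesis using \<epsilon> by simp
    qed
    ultimately show "\<exists>V. openin (subtopology (mtopology_of m) U) V \<and> z \<in> V \<and>
        (\<forall>y\<in>V. mdist (cfunspace (top_of_set K) m') (restrict (G z) K) (restrict (G y) K) < \<epsilon>)" by blast
  qed
qed

section \<open>From solution curves to Fourier coefficients\<close>

abbreviation "cu z t \<equiv> fourier_coeff (fst (z t))"
abbreviation "cr z t \<equiv> fourier_coeff (snd (z t))"

lemma state_le_point:
  assumes "state_le (\<lambda>n. jb n powr \<sigma>) w r d" "0 \<le> \<sigma>" shows "cmod (w n) \<le> d \<and> cmod (r n) \<le> d"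
  by (rule state_le_low_bound, rule state_le_mono[OF assms(1)]) (auto simp: jb_powr_ge_1 assms(2))

text \<open>Each Fourier coefficient is a 1-Lipschitz function of the state, since the weights are
  at least 1.\<close>

lemma mdist_state_space_point:
  assumes "z \<in> mspace (state_space s)" "y \<in> mspace (state_space s)" "1 \<le> s"
  shows "cmod (fourier_coeff (fst z) n - fourier_coeff (fst y) n) \<le> mdist (state_space s) z y"
    "cmod (fourier_coeff (snd z) n - fourier_coeff (snd y) n) \<le> mdist (state_space s) z y"
proof -
  have "state_le (\<lambda>n. jb n powr (s - 1)) (\<lambda>n. fourier_coeff (fst z) n - fourier_coeff (fst y) n)
      (\<lambda>n. fourier_coeff (snd z) n - fourier_coeff (snd y) n) (mdist (state_space s) z y)"
    by (rule mdist_state_space_le_iff[THEN iffD1, OF assms(1,2) _ order_refl]) simp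
  from state_le_point[OF this] assms(3)
  show "cmod (fourier_coeff (fst z) n - fourier_coeff (fst y) n) \<le> mdist (state_space s) z y"
    "cmod (fourier_coeff (snd z) n - fourier_coeff (snd y) n) \<le> mdist (state_space s) z y" by auto
qed

lemma has_vector_derivative_complexI:
  fixes f :: "real \<Rightarrow> complex"
  assumes "((\<lambda>h. (f (t + h) - f t) / of_real h) \<longlongrightarrow> D) (at 0)" shows "(f has_vector_derivative D) (at t)"
proof -
  have "((\<lambda>h. Re ((f (t + h) - f t) / of_real h)) \<longlongrightarrow> Re D) (at 0)"
    "((\<lambda>h. Im ((f (t + h) - f t) / of_real h)) \<longlongrightarrow> Im D) (at 0)"
    by (intro tendsto_Re tendsto_Im assms)+
  then have "((\<lambda>t. Re (f t)) has_real_derivative Re D) (at t)" "((\<lambda>t. Im (f t)) has_real_derivative Im D) (at t)"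
    by (simp_all add: DERIV_def)
  then show ?thesis unfolding has_vector_derivative_complex_iff by simp
qed

text \<open>Convergence of difference quotients in the metric forces convergence of every
  coefficient, so a solution in the Sobolev sense solves the system of Fourier coefficients.\<close>

lemma has_time_deriv_coeff:
  assumes d: "has_time_deriv (state_space s) z d t" and s: "1 \<le> s" and J: "open J" "t \<in> J"
    and z: "\<And>t. t \<in> J \<Longrightarrow> z t \<in> mspace (state_space s)"
  shows "((\<lambda>t. cu z t n) has_vector_derivative fourier_coeff (fst d) n) (at t)"
    "((\<lambda>t. cr z t n) has_vector_derivative fourier_coeff (snd d) n) (at t)"
proof -
  define q where "q h = (z (t + h) - z t) /\<^sub>R h" for h
  have dm: "d \<in> mspace (state_space s)" and lim: "\<And>\<epsilon>. \<epsilon> > 0 \<Longrightarrow> \<forall>\<^sub>F h in at 0. q h \<in> mspace (state_space s) \<and> mdist (state_space s) (q h) d < \<epsilon>"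
    using d unfolding has_time_deriv_def limitin_mtopology_of q_def by auto
  \<comment> \<open>Nothing is known about the curve off J, so only those h with t + h in J are
    considered.\<close>
  have "((\<lambda>h. t + h) \<longlongrightarrow> t + 0) (at 0)" by (intro tendsto_intros)
  then have inJ: "\<forall>\<^sub>F h in at 0. t + h \<in> J" using J by (auto dest: topological_tendstoD)
  have qc: "fourier_coeff (fst (q h)) n = (cu z (t + h) n - cu z t n) / of_real h"
    "fourier_coeff (snd (q h)) n = (cr z (t + h) n - cr z t n) / of_real h" if "t + h \<in> J" for h
  proof -
    have m: "fst (z (t + h)) \<in> sobolev s" "fst (z t) \<in> sobolev s" "snd (z (t + h)) \<in> sobolev (s - 1)" "snd (z t) \<in> sobolev (s - 1)"
      using z[OF that] z[OF J(2)] by auto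
    show "fourier_coeff (fst (q h)) n = (cu z (t + h) n - cu z t n) / of_real h"
      "fourier_coeff (snd (q h)) n = (cr z (t + h) n - cr z t n) / of_real h"
      by (simp_all add: q_def fourier_coeff_scaleR sobolev_fourier_coeff_diff[OF m(1,2)] sobolev_fourier_coeff_diff[OF m(3,4)]
          divide_inverse mult.commute)
  qed
  have "((\<lambda>h. (cu z (t + h) n - cu z t n) / of_real h) \<longlongrightarrow> fourier_coeff (fst d) n) (at 0) \<and>
    ((\<lambda>h. (cr z (t + h) n - cr z t n) / of_real h) \<longlongrightarrow> fourier_coeff (snd d) n) (at 0)"
    unfolding tendsto_iff
  proof (intro conjI allI impI)
    fix \<epsilon> :: real assume "\<epsilon> > 0"
    note ev = eventually_conj[OF lim[OF this] inJ]
    show "\<forall>\<^sub>F h in at 0. dist ((cu z (t + h) n - cu z t n) / of_real h) (fourier_coeff (fst d) n) < \<epsilon>"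
      using ev
    proof eventually_elim
      case (elim h)
      then show ?case using mdist_state_space_point(1)[OF _ dm s, of "q h" n] qc(1)[of h] by (simp add: dist_norm)
    qed
    show "\<forall>\<^sub>F h in at 0. dist ((cr z (t + h) n - cr z t n) / of_real h) (fourier_coeff (snd d) n) < \<epsilon>"
      using ev
    proof eventually_elim
      case (elim h)
      then show ?case using mdist_state_space_point(2)[OF _ dm s, of "q h" n] qc(2)[of h] by (simp add: dist_norm)
    qed
  qed
  then show "((\<lambda>t. cu z t n) has_vector_derivative fourier_coeff (fst d) n) (at t)"
    "((\<lambda>t. cr z t n) has_vector_derivative fourier_coeff (snd d) n) (at t)"
    by (auto intro: has_vector_derivative_complexI)
qed

definition field :: "real \<Rightarrow> circle_fun \<times> circle_fun \<Rightarrow> circle_fun \<times> circle_fun" where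
  "field s z = (field_u s (fst z) (snd z), field_r (fst z) (snd z))"

lemma dp2_solution_iff:
  "dp2_solution s J z0 z \<longleftrightarrow> z \<in> extensional J \<and> C0_curve J (state_space s) z \<and> C1_curve J (state_space (s - 1)) z \<and>
    (\<forall>t\<in>J. time_deriv (state_space (s - 1)) z t = field s (z t)) \<and> z 0 = z0"
proof -
  have "(let (u, \<rho>) = z t; (u_t, \<rho>_t) = time_deriv (state_space (s - 1)) z t in
        u_t + u * Dx u = - A_inv s (Dx ((3/2) *\<^sub>R u\<^sup>2 - \<rho>\<^sup>2) + \<rho> * Dx u) \<and> \<rho>_t + u * Dx \<rho> = - 2 * \<rho> * Dx u)
      \<longleftrightarrow> time_deriv (state_space (s - 1)) z t = field s (z t)" for t
    by (cases "z t"; cases "time_deriv (state_space (s - 1)) z t") (auto simp: field_def field_u_def field_r_def algebra_simps)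
  then show ?thesis unfolding dp2_solution_def by simp
qed

lemma coeff_solution_mono: "coeff_solution s T R u \<rho> \<Longrightarrow> T' \<le> T \<Longrightarrow> R \<le> R' \<Longrightarrow> coeff_solution s T' R' u \<rho>"
  unfolding coeff_solution_def
proof (intro conjI allI impI; elim conjE)
  assume T: "T' \<le> T" and R: "R \<le> R'"
    and b: "\<forall>t. \<bar>t\<bar> < T \<longrightarrow> hermitian (u t) \<and> hermitian (\<rho> t) \<and> state_le (\<lambda>n. jb n powr (s - 1)) (u t) (\<rho> t) R"
  show "state_le (\<lambda>n. jb n powr (s - 1)) (u t) (\<rho> t) R'" if "\<bar>t\<bar> < T'" for t
    by (rule state_le_mono[where R = R]) (use b that T R in auto)
qed (auto intro: solves_freq_subset[OF _ order_refl])

lemma zero_state: "(0, 0) \<in> mspace (state_space s)" "fourier_coeff 0 n = 0"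
proof -
  show c: "fourier_coeff 0 n = 0" for n using fourier_coeff_diff[of 0 0 n] by simp
  have "l2_le (\<lambda>n. jb n powr r * cmod (fourier_coeff 0 n)) 0" for r
    by (simp add: c l2_le_def L2_set_def)
  then have "0 \<in> sobolev r" for r by (intro sobolevI) auto
  then show "(0, 0) \<in> mspace (state_space s)" by simp
qed

lemma state_norm_iff:
  assumes "z \<in> mspace (state_space s)" "0 \<le> R"
  shows "mdist (state_space s) z (0, 0) \<le> R \<longleftrightarrow> state_le (\<lambda>n. jb n powr (s - 1)) (fourier_coeff (fst z)) (fourier_coeff (snd z)) R"
  using mdist_state_space_le_iff[OF assms(1) zero_state(1) assms(2)] by (simp add: zero_state(2))

lemma state_space_subset:
  assumes "z \<in> mspace (state_space s)" "s' \<le> s" shows "z \<in> mspace (state_space s')"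
  using assms sobolev_mono[of "fst z" s s'] sobolev_mono[of "snd z" "s - 1" "s' - 1"] by (cases z) auto

text \<open>On the open interval the norm of a solution might be unbounded towards the ends. A
  smaller interval lies in a compact part of the domain, where continuity of the norm yields
  R.\<close>

lemma dp2_solution_coeff:
  assumes s: "5/2 < s" and z: "dp2_solution s {- T<..<T} z0 z" and T': "0 < T'" "T' < T"
  shows "\<exists>R. coeff_solution s T' R (cu z) (cr z)"
proof -
  define J where "J = {- T<..<T}"
  have z: "C0_curve J (state_space s) z" "C1_curve J (state_space (s - 1)) z"
    "\<And>t. t \<in> J \<Longrightarrow> time_deriv (state_space (s - 1)) z t = field s (z t)"
    using z by (auto simp: dp2_solution_iff J_def)
  have c: "\<And>t. t \<in> J \<Longrightarrow> z t \<in> mspace (state_space s)"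
    "\<And>t \<epsilon>. t \<in> J \<Longrightarrow> 0 < \<epsilon> \<Longrightarrow> \<exists>\<delta>>0. \<forall>t'\<in>J. \<bar>t' - t\<bar> < \<delta> \<longrightarrow> mdist (state_space s) (z t) (z t') < \<epsilon>"
    using z(1) unfolding C0_curve_def continuous_curve_iff by auto
  have c1: "z t \<in> mspace (state_space (s - 1))" if "t \<in> J" for t
    by (rule state_space_subset[OF c(1)[OF that]]) simp
  define g where "g t = mdist (state_space s) (z t) (0, 0)" for t
  have sub: "{- T'..T'} \<subseteq> J" using T' by (auto simp: J_def)
  have "continuous_on {- T'..T'} g"
    unfolding continuous_on_iff
  proof (intro ballI allI impI)
    fix t \<epsilon> :: real assume t: "t \<in> {- T'..T'}" and \<epsilon>: "0 < \<epsilon>"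
    obtain \<delta> where \<delta>: "\<delta> > 0" "\<And>t'. t' \<in> J \<Longrightarrow> \<bar>t' - t\<bar> < \<delta> \<Longrightarrow> mdist (state_space s) (z t) (z t') < \<epsilon>"
      using c(2)[of t \<epsilon>] t sub \<epsilon> by blast
    have "dist (g t') (g t) < \<epsilon>" if t': "t' \<in> {- T'..T'}" "dist t' t < \<delta>" for t'
    proof -
      interpret M: Metric_space "mspace (state_space s)" "mdist (state_space s)" by (rule Metric_space_mspace_mdist)
      have m: "z t \<in> mspace (state_space s)" "z t' \<in> mspace (state_space s)" using c(1) t t' sub by blast+
      have "mdist (state_space s) (z t) (z t') < \<epsilon>" using \<delta>(2)[of t'] t' sub by (auto simp: dist_real_def)
      moreover have "g t' \<le> mdist (state_space s) (z t') (z t) + g t" "g t \<le> mdist (state_space s) (z t) (z t') + g t'"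
        unfolding g_def using m zero_state(1) by (intro M.triangle; simp)+
      ultimately show ?thesis using M.commute[of "z t" "z t'"] by (simp add: dist_real_def)
    qed
    then show "\<exists>\<delta>>0. \<forall>t'\<in>{- T'..T'}. dist t' t < \<delta> \<longrightarrow> dist (g t') (g t) < \<epsilon>" using \<delta>(1) by blast
  qed
  then have "bounded (g ` {- T'..T'})" by (intro compact_imp_bounded compact_continuous_image) auto
  then obtain R where "\<forall>x\<in>g ` {- T'..T'}. norm x \<le> R" unfolding bounded_iff by blast
  then have R: "g t \<le> R" if "t \<in> {- T'..T'}" for t
    using imageI[OF that, of g] abs_le_D1[of "g t" R] by (auto simp del: atLeastAtMost_iff)
  have R0: "0 \<le> R" using R[of 0] T' by (simp add: g_def order_trans[OF mdist_nonneg])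
  have der: "((\<lambda>t. cu z t n) has_vector_derivative Bu (cu z t) (cr z t) (cu z t) (cr z t) n) (at t)"
    "((\<lambda>t. cr z t n) has_vector_derivative Br (cu z t) (cr z t) (cu z t) (cr z t) n) (at t)" if t: "t \<in> J" for t n
  proof -
    have "\<exists>d. has_time_deriv (state_space (s - 1)) z d t" using z(2) t by (simp add: C1_curve_def)
    then have "has_time_deriv (state_space (s - 1)) z (field s (z t)) t" using time_deriv_eq z(3)[OF t] by metis
    from has_time_deriv_coeff[OF this _ _ t c1] s
    have "((\<lambda>t. cu z t n) has_vector_derivative fourier_coeff (fst (field s (z t))) n) (at t)"
      "((\<lambda>t. cr z t n) has_vector_derivative fourier_coeff (snd (field s (z t))) n) (at t)"
      by (auto simp: J_def)
    then show "((\<lambda>t. cu z t n) has_vector_derivative Bu (cu z t) (cr z t) (cu z t) (cr z t) n) (at t)"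
      "((\<lambda>t. cr z t n) has_vector_derivative Br (cu z t) (cr z t) (cu z t) (cr z t) n) (at t)"
      using field_u_sobolev(2)[OF s, of "fst (z t)" "snd (z t)" n] field_r_sobolev(2)[OF s, of "fst (z t)" "snd (z t)" n] c(1)[OF t]
      by (auto simp: field_def)
  qed
  have "coeff_solution s T' R (cu z) (cr z)"
    unfolding coeff_solution_def solves_freq_def
  proof (intro conjI allI impI)
    fix t :: real assume "\<bar>t\<bar> < T'"
    then have t: "t \<in> {- T'..T'}" "t \<in> J" using T' by (auto simp: J_def)
    show "((\<lambda>t. cu z t n) has_vector_derivative Bu (cu z t) (cr z t) (cu z t) (cr z t) n) (at t)"
      "((\<lambda>t. cr z t n) has_vector_derivative Br (cu z t) (cr z t) (cu z t) (cr z t) n) (at t)" for n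
      by (rule der[OF t(2)])+
    show "state_le (\<lambda>n. jb n powr (s - 1)) (cu z t) (cr z t) R"
      using state_norm_iff[OF c(1)[OF t(2)] R0] R[OF t(1)] by (simp add: g_def)
  qed (rule hermitian_fourier_coeff)+
  then show ?thesis by blast
qed

lemma state_le_cmult:
  "state_le V u \<rho> R \<Longrightarrow> state_le V (\<lambda>n. c * u n) (\<lambda>n. c * \<rho> n) (cmod c * R)"
proof -
  assume a: "state_le V u \<rho> R"
  have "pnorm V (\<lambda>n. c * u n) (\<lambda>n. c * \<rho> n) = (\<lambda>n. cmod c * pnorm V u \<rho> n)"
  proof
    fix n
    have "(jb n * V n * cmod (c * u n))\<^sup>2 + (V n * cmod (c * \<rho> n))\<^sup>2 =
        (cmod c)\<^sup>2 * ((jb n * V n * cmod (u n))\<^sup>2 + (V n * cmod (\<rho> n))\<^sup>2)"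
      by (simp add: norm_mult power_mult_distrib algebra_simps)
    then show "pnorm V (\<lambda>n. c * u n) (\<lambda>n. c * \<rho> n) n = cmod c * pnorm V u \<rho> n"
      by (simp add: pnorm_def real_sqrt_mult)
  qed
  then show ?thesis using l2_le_mult[OF a[unfolded state_le_def], of "cmod c"] by (simp add: state_le_def)
qed

section \<open>Tails of the data and the field in the metric\<close>

text \<open>A finite set \<open>F0\<close> carries all of the energy up to half of
  \<open>\<epsilon>\<^sup>2\<close>. On it the tail weight is made small by the choice of K, and off
  it the tail weight is at most the full weight.\<close>

lemma data_tail:
  assumes b: "state_le (\<lambda>n. jb n powr (s - 1)) w r R" and \<epsilon>: "0 < \<epsilon>"
  shows "\<exists>K\<ge>1. state_le (tail_weight s K) w r \<epsilon>"
proof -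
  define V where "V = (\<lambda>n. jb n powr (s - 1))"
  define S where "S = (SUP F\<in>Collect finite. energy F V w r)"
  have bdd: "bdd_above ((\<lambda>F. energy F V w r) ` Collect finite)"
    using state_le_energy[OF b] by (intro bdd_aboveI2[where M = "R\<^sup>2"]) (simp add: V_def)
  have S: "energy F V w r \<le> S" if "finite F" for F
    unfolding S_def using bdd that by (intro cSUP_upper) auto
  have "\<exists>F\<in>Collect finite. S - \<epsilon>\<^sup>2 / 2 < energy F V w r"
    using less_cSUP_iff[OF _ bdd, of "S - \<epsilon>\<^sup>2 / 2"] \<epsilon> unfolding S_def[symmetric] by auto
  then obtain F0 where F0: "finite F0" "S - \<epsilon>\<^sup>2 / 2 < energy F0 V w r" by auto
  define E where "E = energy F0 (\<lambda>n. V n * jb n) w r"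
  \<comment> \<open>Beyond 1 this makes \<open>E / K\<close> at most half of
    \<open>\<epsilon>\<^sup>2\<close>, where E is the energy of the finite part with one more factor
    \<open>jb n\<close>.\<close>
  define K where "K = 1 + 2 * E / \<epsilon>\<^sup>2"
  have E0: "0 \<le> E" by (simp add: E_def energy_nonneg)
  then have K: "1 \<le> K" by (simp add: K_def)
  have mono: "energy F V1 w r \<le> energy F V2 w r" if "\<And>n. 0 \<le> V1 n" "\<And>n. V1 n \<le> V2 n" for F V1 V2
    unfolding energy_def using that
    by (intro sum_mono add_mono power_mono mult_right_mono mult_left_mono) auto
  have union: "energy (F \<union> F0) V' w r = energy F0 V' w r + energy (F - F0) V' w r" if "finite F" for F V'
  proof -
    have "F \<union> F0 = F0 \<union> (F - F0)" by blast
    then show ?thesis unfolding energy_def using that F0(1)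
      by (simp only:) (subst sum.union_disjoint; auto)
  qed
  have t0: "0 \<le> tail_weight s K n" for n using K by (simp add: tail_weight_nonneg)
  have low: "energy F0 (tail_weight s K) w r \<le> \<epsilon>\<^sup>2 / 2"
  proof -
    have "energy F0 (tail_weight s K) w r \<le> energy F0 (\<lambda>n. V n * jb n / K) w r"
    proof (rule mono[OF t0])
      fix n
      have "V n * min 1 (jb n / K) \<le> V n * (jb n / K)" by (intro mult_left_mono) (auto simp: V_def)
      then show "tail_weight s K n \<le> V n * jb n / K" by (simp add: tail_weight_def V_def)
    qed
    also have "energy F0 (\<lambda>n. V n * jb n / K) w r = E / K\<^sup>2"
      by (simp add: energy_def E_def sum_divide_distrib power_mult_distrib power_divide add_divide_distrib)
    also have "E / K\<^sup>2 \<le> E / K"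
      using K E0 by (intro divide_left_mono) (auto simp: power2_eq_square)
    also have "E / K \<le> \<epsilon>\<^sup>2 / 2"
    proof -
      have "E \<le> \<epsilon>\<^sup>2 / 2 * K" using \<epsilon> by (simp add: K_def field_simps)
      then show ?thesis using K by (simp add: field_simps)
    qed
    finally show ?thesis .
  qed
  have "state_le (tail_weight s K) w r \<epsilon>"
  proof (rule state_leI_energy)
    fix F :: "int set" assume F: "finite F"
    have "energy F (tail_weight s K) w r \<le> energy (F \<union> F0) (tail_weight s K) w r"
      unfolding energy_def using F F0(1) by (intro sum_mono2) auto
    also have "\<dots> = energy F0 (tail_weight s K) w r + energy (F - F0) (tail_weight s K) w r" by (rule union[OF F])
    also have "\<dots> \<le> \<epsilon>\<^sup>2 / 2 + energy (F - F0) V w r"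
      by (intro add_mono low mono t0) (simp add: V_def tail_weight_le)
    also have "energy (F - F0) V w r \<le> \<epsilon>\<^sup>2 / 2"
      using union[OF F, of V] S[of "F \<union> F0"] F F0 by simp
    finally show "energy F (tail_weight s K) w r \<le> \<epsilon>\<^sup>2" by simp
  qed (use \<epsilon> in simp)
  then show ?thesis using K by blast
qed

lemma mdist_state_space_state_le:
  assumes "z \<in> mspace (state_space s)" "y \<in> mspace (state_space s)" "mdist (state_space s) z y \<le> R"
  shows "state_le (\<lambda>n. jb n powr (s - 1)) (\<lambda>n. fourier_coeff (fst z) n - fourier_coeff (fst y) n)
      (\<lambda>n. fourier_coeff (snd z) n - fourier_coeff (snd y) n) R"
  using mdist_state_space_le_iff[OF assms(1,2), of R] assms(3) order_trans[OF mdist_nonneg assms(3)] by simp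

lemma mdist_state_space_leI:
  assumes "z \<in> mspace (state_space s)" "y \<in> mspace (state_space s)"
    "state_le (\<lambda>n. jb n powr (s - 1)) (\<lambda>n. fourier_coeff (fst z) n - fourier_coeff (fst y) n)
      (\<lambda>n. fourier_coeff (snd z) n - fourier_coeff (snd y) n) R"
  shows "mdist (state_space s) z y \<le> R"
  using mdist_state_space_le_iff[OF assms(1,2) state_le_nonneg[OF assms(3)]] assms(3) by simp

lemma mdist_state_space_mono:
  assumes "z \<in> mspace (state_space s)" "y \<in> mspace (state_space s)" "s' \<le> s"
  shows "mdist (state_space s') z y \<le> mdist (state_space s) z y"
  using mdist_state_space_state_le[OF assms(1,2) order_refl] assms(3)
  by (intro mdist_state_space_leI state_space_subset[OF assms(1,3)] state_space_subset[OF assms(2,3)])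
    (rule state_le_mono, auto intro!: powr_mono)

lemma field_mspace:
  assumes "5/2 < s" "z \<in> mspace (state_space s)" shows "field s z \<in> mspace (state_space (s - 1))"
  using field_u_sobolev(1)[OF assms(1), of "fst z" "snd z"] field_r_sobolev(1)[OF assms(1), of "fst z" "snd z"] assms(2)
  by (cases z) (auto simp: field_def)

lemma fourier_coeff_field:
  assumes "5/2 < s" "z \<in> mspace (state_space s)"
  shows "fourier_coeff (fst (field s z)) = Bu (fourier_coeff (fst z)) (fourier_coeff (snd z)) (fourier_coeff (fst z)) (fourier_coeff (snd z))"
    "fourier_coeff (snd (field s z)) = Br (fourier_coeff (fst z)) (fourier_coeff (snd z)) (fourier_coeff (fst z)) (fourier_coeff (snd z))"
  using field_u_sobolev(2)[OF assms(1), of "fst z" "snd z"] field_r_sobolev(2)[OF assms(1), of "fst z" "snd z"] assms(2)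
  by (auto simp: field_def fun_eq_iff)

lemma field_lipschitz:
  assumes s: "5/2 < s" and z: "z \<in> mspace (state_space s)" and y: "y \<in> mspace (state_space s)"
    and b: "state_le (\<lambda>n. jb n powr (s - 1)) (fourier_coeff (fst z)) (fourier_coeff (snd z)) R"
      "state_le (\<lambda>n. jb n powr (s - 1)) (fourier_coeff (fst y)) (fourier_coeff (snd y)) R"
  shows "mdist (state_space (s - 1)) (field s z) (field s y) \<le> 2 * bilinear_const s * R * mdist (state_space s) z y"
proof (rule mdist_state_space_leI)
  have e: "s - 1 - 1 = s - 2" by simp
  show "state_le (\<lambda>n. jb n powr (s - 1 - 1)) (\<lambda>n. fourier_coeff (fst (field s z)) n - fourier_coeff (fst (field s y)) n)
     (\<lambda>n. fourier_coeff (snd (field s z)) n - fourier_coeff (snd (field s y)) n) (2 * bilinear_const s * R * mdist (state_space s) z y)"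
    unfolding fourier_coeff_field[OF s z] fourier_coeff_field[OF s y] e
    by (rule vector_field_diff_bound[OF b _ mdist_state_space_state_le[OF z y order_refl]]) (use s in simp)
qed (rule field_mspace[OF s z] field_mspace[OF s y])+

section \<open>Solution curves\<close>

text \<open>A constructed solution together with its tail bounds. The notion of solution in the
  Cauchy problem does not record them, and they carry both continuity statements in the top norm; G
  is the common growth factor of the tails.\<close>

definition tame_curve :: "real \<Rightarrow> real \<Rightarrow> real \<Rightarrow> real \<Rightarrow> (real \<Rightarrow> circle_fun \<times> circle_fun) \<Rightarrow> bool" where
  "tame_curve s T R G z \<longleftrightarrow> z \<in> extensional {- T<..<T} \<and> (\<forall>t. \<bar>t\<bar> < T \<longrightarrow> z t \<in> mspace (state_space s)) \<and>
     coeff_solution s T R (cu z) (cr z) \<and>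
     (\<forall>K a t. 0 < K \<longrightarrow> state_le (tail_weight s K) (cu z 0) (cr z 0) a \<longrightarrow> \<bar>t\<bar> < T \<longrightarrow>
        state_le (tail_weight s K) (cu z t) (cr z t) (a * G))"

lemma tame_curveD:
  assumes "tame_curve s T R G z"
  shows "z \<in> extensional {- T<..<T}" "\<And>t. \<bar>t\<bar> < T \<Longrightarrow> z t \<in> mspace (state_space s)"
    "coeff_solution s T R (cu z) (cr z)"
    "\<And>t. \<bar>t\<bar> < T \<Longrightarrow> state_le (\<lambda>n. jb n powr (s - 1)) (cu z t) (cr z t) R"
    "\<And>t n. \<bar>t\<bar> < T \<Longrightarrow> ((\<lambda>t. cu z t n) has_vector_derivative Bu (cu z t) (cr z t) (cu z t) (cr z t) n) (at t)"
    "\<And>t n. \<bar>t\<bar> < T \<Longrightarrow> ((\<lambda>t. cr z t n) has_vector_derivative Br (cu z t) (cr z t) (cu z t) (cr z t) n) (at t)"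
    "\<And>K a t. 0 < K \<Longrightarrow> state_le (tail_weight s K) (cu z 0) (cr z 0) a \<Longrightarrow> \<bar>t\<bar> < T \<Longrightarrow>
        state_le (tail_weight s K) (cu z t) (cr z t) (a * G)"
  using assms unfolding tame_curve_def coeff_solution_def solves_freq_def by blast+

lemma tame_curve_exists:
  assumes s: "5/2 < s" and R: "0 < R" and z0: "z0 \<in> mspace (state_space s)" "mdist (state_space s) z0 (0, 0) \<le> R / 2"
  shows "\<exists>z. tame_curve s (life s R) R (exp (tail_rate s R * life s R)) z \<and> z 0 = z0"
proof -
  define T where "T = life s R"
  have T: "0 < T" using tail_rate_ge_1[OF s, of R] R by (simp add: T_def life_def)
  have b: "state_le (\<lambda>n. jb n powr (s - 1)) (fourier_coeff (fst z0)) (fourier_coeff (snd z0)) (R / 2)"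
    using state_norm_iff[OF z0(1), of "R / 2"] z0(2) R by simp
  obtain u \<rho> where i: "u 0 = fourier_coeff (fst z0)" "\<rho> 0 = fourier_coeff (snd z0)"
    and sol: "coeff_solution s T R u \<rho>"
    and tail: "\<And>K a t. 0 < K \<Longrightarrow> state_le (tail_weight s K) (u 0) (\<rho> 0) a \<Longrightarrow> \<bar>t\<bar> < T \<Longrightarrow>
       state_le (tail_weight s K) (u t) (\<rho> t) (a * exp (tail_rate s R * T))"
    using coeff_solution_exists[OF s R hermitian_fourier_coeff hermitian_fourier_coeff b] unfolding T_def by metis
  define z where "z t = (if \<bar>t\<bar> < T then (synth (u t), synth (\<rho> t)) else undefined)" for t
  have h: "hermitian (u t)" "hermitian (\<rho> t)" and bd: "state_le (\<lambda>n. jb n powr (s - 1)) (u t) (\<rho> t) R" if "\<bar>t\<bar> < T" for t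
    using sol that unfolding coeff_solution_def by auto
  have m: "fst (z t) \<in> sobolev s" "snd (z t) \<in> sobolev (s - 1)" and c: "cu z t = u t" "cr z t = \<rho> t" if t: "\<bar>t\<bar> < T" for t
  proof -
    have l: "l2_le (\<lambda>n. jb n powr s * cmod (u t n)) R" "l2_le (\<lambda>n. jb n powr (s - 1) * cmod (\<rho> t n)) R"
      using state_le_components[OF bd[OF t]] by (simp_all add: powr_diff)
    show "fst (z t) \<in> sobolev s" "cu z t = u t" using synth_sobolev[OF h(1)[OF t] l(1)] s t by (auto simp: z_def)
    show "snd (z t) \<in> sobolev (s - 1)" "cr z t = \<rho> t" using synth_sobolev[OF h(2)[OF t] l(2)] s t by (auto simp: z_def)
  qed
  have "z 0 = z0"
  proof -
    have "fst (z 0) = fst z0" using m(1)[of 0] c(1)[of 0] T z0(1) i by (intro sobolev_eqI[of _ s _ s]) auto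
    moreover have "snd (z 0) = snd z0" using m(2)[of 0] c(2)[of 0] T z0(1) i by (intro sobolev_eqI[of _ "s - 1" _ "s - 1"]) auto
    ultimately show ?thesis by (simp add: prod_eq_iff)
  qed
  moreover have "tame_curve s T R (exp (tail_rate s R * T)) z"
    unfolding tame_curve_def
  proof (intro conjI allI impI)
    show "z \<in> extensional {- T<..<T}" by (auto simp: extensional_def z_def)
    show "z t \<in> mspace (state_space s)" if "\<bar>t\<bar> < T" for t using m[OF that] by (simp add: mem_Times_iff)
    show "coeff_solution s T R (cu z) (cr z)"
      unfolding coeff_solution_def solves_freq_def
    proof (intro conjI allI impI)
      fix t :: real and n assume t: "\<bar>t\<bar> < T"
      have d: "((\<lambda>t. u t n) has_vector_derivative Bu (u t) (\<rho> t) (u t) (\<rho> t) n) (at t)"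
        "((\<lambda>t. \<rho> t n) has_vector_derivative Br (u t) (\<rho> t) (u t) (\<rho> t) n) (at t)"
        using sol t unfolding coeff_solution_def solves_freq_def by auto
      show "((\<lambda>t. cu z t n) has_vector_derivative Bu (cu z t) (cr z t) (cu z t) (cr z t) n) (at t)"
        unfolding c[OF t]
        by (rule has_vector_derivative_transform_within_open[OF d(1), of "{- T<..<T}"]) (use t c in auto)
      show "((\<lambda>t. cr z t n) has_vector_derivative Br (cu z t) (cr z t) (cu z t) (cr z t) n) (at t)"
        unfolding c[OF t]
        by (rule has_vector_derivative_transform_within_open[OF d(2), of "{- T<..<T}"]) (use t c in auto)
    qed (use c h bd in auto)
    show "state_le (tail_weight s K) (cu z t) (cr z t) (a * exp (tail_rate s R * T))"
      if "0 < K" "state_le (tail_weight s K) (cu z 0) (cr z 0) a" "\<bar>t\<bar> < T" for K a t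
      using tail[of K a t] that c[of 0] c[of t] T by simp
  qed
  ultimately show ?thesis unfolding T_def by blast
qed

text \<open>The mean value inequality with reference velocity 0: at r = 2 the field is bounded in
  the low norm.\<close>

lemma tame_curve_low_lipschitz:
  assumes s: "5/2 < s" and z: "tame_curve s T R G z" and t: "\<bar>t\<bar> < T" "\<bar>t'\<bar> < T"
  shows "state_le (\<lambda>_. 1) (\<lambda>n. cu z t n - cu z t' n) (\<lambda>n. cr z t n - cr z t' n) (\<bar>t - t'\<bar> * (bilinear_const 2 * R * R))"
proof -
  note zD = tame_curveD[OF z]
  have less: "state_le (\<lambda>_. 1) (\<lambda>n. cu z t2 n - cu z t1 n) (\<lambda>n. cr z t2 n - cr z t1 n) ((t2 - t1) * (bilinear_const 2 * R * R))"
    if t12: "t1 < t2" "\<bar>t1\<bar> < T" "\<bar>t2\<bar> < T" for t1 t2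
  proof -
    have "state_le (\<lambda>_. 1) (\<lambda>n. cu z t2 n - cu z t1 n - of_real (t2 - t1) * 0) (\<lambda>n. cr z t2 n - cr z t1 n - of_real (t2 - t1) * 0)
        ((t2 - t1) * (bilinear_const 2 * R * R))"
    proof (rule mean_value_state[OF t12(1)])
      fix \<tau> assume "t1 \<le> \<tau>" "\<tau> \<le> t2"
      then have \<tau>: "\<bar>\<tau>\<bar> < T" using t12 by auto
      show "((\<lambda>t. cu z t n) has_vector_derivative Bu (cu z \<tau>) (cr z \<tau>) (cu z \<tau>) (cr z \<tau>) n) (at \<tau>)"
        "((\<lambda>t. cr z t n) has_vector_derivative Br (cu z \<tau>) (cr z \<tau>) (cu z \<tau>) (cr z \<tau>) n) (at \<tau>)" for n
        by (rule zD(5,6)[OF \<tau>])+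
      have b: "state_le (\<lambda>n. jb n powr (2 - 1)) (cu z \<tau>) (cr z \<tau>) R"
        proof (rule state_le_mono[OF zD(4)[OF \<tau>]])
        show "jb n powr (2 - 1) \<le> jb n powr (s - 1)" for n by (rule powr_mono) (use s in auto)
      qed auto
      show "state_le (\<lambda>_. 1) (\<lambda>n. Bu (cu z \<tau>) (cr z \<tau>) (cu z \<tau>) (cr z \<tau>) n - 0) (\<lambda>n. Br (cu z \<tau>) (cr z \<tau>) (cu z \<tau>) (cr z \<tau>) n - 0)
         (bilinear_const 2 * R * R)"
        using Bu_Br_bound[OF order_refl b b] by simp
    qed
    then show ?thesis by simp
  qed
  consider "t' < t" | "t = t'" | "t < t'" by linarith
  then show ?thesis
  proof cases
    case 1 then show ?thesis using less[of t' t] t by simp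
  next
    case 2
    then show ?thesis by (auto intro!: state_leI_energy simp: energy_def)
  next
    case 3
    show ?thesis
      by (rule state_le_mono[OF less[OF 3 t]]) (use 3 in \<open>auto simp: norm_minus_commute\<close>)
  qed
qed

lemma tame_curve_tail:
  assumes z: "tame_curve s T R G z" and "0 < T" and e: "0 < e"
  shows "\<exists>K\<ge>1. \<exists>a. state_le (tail_weight s K) (cu z 0) (cr z 0) a \<and> a * G \<le> e"
proof -
  \<comment> \<open>No sign of G is assumed, hence the absolute value; adding 1 keeps the divisor
    positive.\<close>
  have e': "0 < e / (\<bar>G\<bar> + 1)" using e by (simp add: add_nonneg_pos)
  obtain K where K: "K \<ge> 1" "state_le (tail_weight s K) (cu z 0) (cr z 0) (e / (\<bar>G\<bar> + 1))"
    using data_tail[OF tame_curveD(4)[OF z, of 0] e'] assms(2) by auto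
  have "e * G \<le> e * (\<bar>G\<bar> + 1)" using e by (intro mult_left_mono) auto
  then have "e / (\<bar>G\<bar> + 1) * G \<le> e" by (simp add: field_simps add_nonneg_pos)
  then show ?thesis using K by blast
qed

lemma divide_mult_cancel4: "0 < c \<Longrightarrow> x / (4 * c) * c = x / (4 :: real)"
  by simp

text \<open>K is chosen from the tail at time 0, which bounds the tails at all times uniformly; the
  remaining low frequencies are Lipschitz in time. The two tails cost \<epsilon> / 4 each and the
  low part another \<epsilon> / 4.\<close>

lemma tame_curve_C0:
  assumes s: "5/2 < s" and z: "tame_curve s T R G z"
  shows "C0_curve {- T<..<T} (state_space s) z"
  unfolding C0_curve_def continuous_curve_iff
proof (intro conjI ballI allI impI)
  note zD = tame_curveD[OF z]
  show "z t \<in> mspace (state_space s)" if "t \<in> {- T<..<T}" for t using zD(2)[of t] that by auto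
  fix t \<epsilon> :: real assume t0: "t \<in> {- T<..<T}" and \<epsilon>: "0 < \<epsilon>"
  then have T: "0 < T" and t: "\<bar>t\<bar> < T" by auto
  obtain K a where K: "K \<ge> 1" "state_le (tail_weight s K) (cu z 0) (cr z 0) a" "a * G \<le> \<epsilon> / 4"
    using tame_curve_tail[OF z T, of "\<epsilon> / 4"] \<epsilon> by auto
  \<comment> \<open>The Lipschitz constant in time of the low norm, amplified by the cost of
    measuring frequencies up to K in the top norm.\<close>
  define M where "M = K powr (s - 1) * (bilinear_const 2 * R * R)"
  define \<delta> where "\<delta> = \<epsilon> / (4 * (\<bar>M\<bar> + 1))"
  have M: "0 < \<bar>M\<bar> + 1" by simp
  have "\<delta> > 0" using \<epsilon> M by (simp add: \<delta>_def)
  moreover have "mdist (state_space s) (z t) (z t') < \<epsilon>" if t': "t' \<in> {- T<..<T}" "\<bar>t' - t\<bar> < \<delta>" for t'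
  proof -
    have tt: "\<bar>t'\<bar> < T" using t'(1) by auto
    have "state_le (tail_weight s K) (\<lambda>n. cu z t n - cu z t' n) (\<lambda>n. cr z t n - cr z t' n) (a * G + a * G)"
      by (rule state_le_diff[OF zD(7)[OF _ K(2) t] zD(7)[OF _ K(2) tt]]) (use K(1) in \<open>auto simp: tail_weight_nonneg\<close>)
    from state_le_low_tail[OF _ K(1) tame_curve_low_lipschitz[OF s z t tt] this] s
    have "state_le (\<lambda>n. jb n powr (s - 1)) (\<lambda>n. cu z t n - cu z t' n) (\<lambda>n. cr z t n - cr z t' n)
        (K powr (s - 1) * (\<bar>t - t'\<bar> * (bilinear_const 2 * R * R)) + (a * G + a * G))" by simp
    from mdist_state_space_leI[OF zD(2)[OF t] zD(2)[OF tt] this]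
    have d: "mdist (state_space s) (z t) (z t') \<le> \<bar>t - t'\<bar> * M + (a * G + a * G)" by (simp add: M_def mult_ac)
    have "\<bar>t - t'\<bar> * M \<le> \<bar>t - t'\<bar> * (\<bar>M\<bar> + 1)" by (intro mult_left_mono) auto
    also have "\<dots> \<le> \<delta> * (\<bar>M\<bar> + 1)" using t'(2) by (intro mult_right_mono) auto
    also have "\<delta> * (\<bar>M\<bar> + 1) = \<epsilon> / 4" unfolding \<delta>_def by (rule divide_mult_cancel4[OF M])
    finally show ?thesis using d K(3) \<epsilon> by linarith
  qed
  ultimately show "\<exists>\<delta>>0. \<forall>t'\<in>{- T<..<T}. \<bar>t' - t\<bar> < \<delta> \<longrightarrow> mdist (state_space s) (z t) (z t') < \<epsilon>" by blast
qed

text \<open>The mean value inequality with the field at t as reference velocity: the quotient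
  deviates from it by at most the oscillation of the field between t and t + h, which the
  oscillation of the curve in the top norm controls.\<close>

lemma tame_curve_difference_quotient:
  assumes s: "5/2 < s" and z: "tame_curve s T R G z" and t: "\<bar>t\<bar> < T" "\<bar>t + h\<bar> < T" and h: "h \<noteq> 0"
    and b: "\<And>\<tau>. \<bar>\<tau> - t\<bar> \<le> \<bar>h\<bar> \<Longrightarrow> \<bar>\<tau>\<bar> < T \<Longrightarrow> mdist (state_space s) (z \<tau>) (z t) \<le> \<eta>"
  shows "(z (t + h) - z t) /\<^sub>R h \<in> mspace (state_space (s - 1))"
    "mdist (state_space (s - 1)) ((z (t + h) - z t) /\<^sub>R h) (field s (z t)) \<le> 2 * bilinear_const s * R * \<eta>"
proof -
  note zD = tame_curveD[OF z]
  define q where "q = (z (t + h) - z t) /\<^sub>R h"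
  define V where "V = (\<lambda>n. jb n powr (s - 2))"
  define B where "B = 2 * bilinear_const s * R * \<eta>"
  define e where "e = Bu (cu z t) (cr z t) (cu z t) (cr z t)"
  define e' where "e' = Br (cu z t) (cr z t) (cu z t) (cr z t)"
  have ms: "fst (z (t + h)) \<in> sobolev s" "fst (z t) \<in> sobolev s" "snd (z (t + h)) \<in> sobolev (s - 1)" "snd (z t) \<in> sobolev (s - 1)"
    using zD(2)[OF t(1)] zD(2)[OF t(2)] by auto
  have "q \<in> mspace (state_space s)"
    using sobolev_scaleR[OF sobolev_diff[OF ms(1,2)], of "inverse h"] sobolev_scaleR[OF sobolev_diff[OF ms(3,4)], of "inverse h"]
    by (simp add: q_def mem_Times_iff)
  then have qm: "q \<in> mspace (state_space (s - 1))" by (rule state_space_subset) simp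
  then show "(z (t + h) - z t) /\<^sub>R h \<in> mspace (state_space (s - 1))" by (simp add: q_def)
  have main: "state_le V (\<lambda>n. cu z t2 n - cu z t1 n - of_real (t2 - t1) * e n) (\<lambda>n. cr z t2 n - cr z t1 n - of_real (t2 - t1) * e' n) ((t2 - t1) * B)"
    if t12: "t1 < t2" "\<bar>t1\<bar> < T" "\<bar>t2\<bar> < T" "\<bar>t1 - t\<bar> \<le> \<bar>h\<bar>" "\<bar>t2 - t\<bar> \<le> \<bar>h\<bar>" for t1 t2
  proof (rule mean_value_state[OF t12(1)])
    fix \<tau> assume "t1 \<le> \<tau>" "\<tau> \<le> t2"
    then have \<tau>: "\<bar>\<tau>\<bar> < T" "\<bar>\<tau> - t\<bar> \<le> \<bar>h\<bar>" using t12 by (auto simp: abs_le_iff)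
    show "((\<lambda>t. cu z t n) has_vector_derivative Bu (cu z \<tau>) (cr z \<tau>) (cu z \<tau>) (cr z \<tau>) n) (at \<tau>)"
      "((\<lambda>t. cr z t n) has_vector_derivative Br (cu z \<tau>) (cr z \<tau>) (cu z \<tau>) (cr z \<tau>) n) (at \<tau>)" for n
      by (rule zD(5,6)[OF \<tau>(1)])+
    show "state_le V (\<lambda>n. Bu (cu z \<tau>) (cr z \<tau>) (cu z \<tau>) (cr z \<tau>) n - e n) (\<lambda>n. Br (cu z \<tau>) (cr z \<tau>) (cu z \<tau>) (cr z \<tau>) n - e' n) B"
      unfolding V_def e_def e'_def B_def
      by (rule vector_field_diff_bound[OF zD(4)[OF \<tau>(1)] zD(4)[OF t(1)] _
            mdist_state_space_state_le[OF zD(2)[OF \<tau>(1)] zD(2)[OF t(1)] b[OF \<tau>(2,1)]]]) (use s in simp)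
  qed
  have diff: "state_le V (\<lambda>n. cu z (t + h) n - cu z t n - of_real h * e n) (\<lambda>n. cr z (t + h) n - cr z t n - of_real h * e' n) (\<bar>h\<bar> * B)"
  proof (cases "h > 0")
    case True then show ?thesis using main[of t "t + h"] t by simp
  next
    case False
    then have "state_le V (\<lambda>n. cu z t n - cu z (t + h) n + of_real h * e n) (\<lambda>n. cr z t n - cr z (t + h) n + of_real h * e' n) (\<bar>h\<bar> * B)"
      using main[of "t + h" t] t h by simp
    from state_le_uminus[THEN iffD2, OF this] show ?thesis by (simp add: algebra_simps)
  qed
  have qc: "fourier_coeff (fst q) n - e n = (1 / of_real h) * (cu z (t + h) n - cu z t n - of_real h * e n)"
    "fourier_coeff (snd q) n - e' n = (1 / of_real h) * (cr z (t + h) n - cr z t n - of_real h * e' n)" for n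
    using h by (simp_all add: q_def fourier_coeff_scaleR sobolev_fourier_coeff_diff[OF ms(1,2)] sobolev_fourier_coeff_diff[OF ms(3,4)]
      scaleR_diff_right[symmetric] divide_inverse right_diff_distrib del: scaleR_diff_right)
  have "state_le V (\<lambda>n. fourier_coeff (fst q) n - e n) (\<lambda>n. fourier_coeff (snd q) n - e' n) (cmod (1 / of_real h) * (\<bar>h\<bar> * B))"
    unfolding qc by (rule state_le_cmult[OF diff])
  moreover have "cmod (1 / of_real h) * (\<bar>h\<bar> * B) = B" using h by (simp add: norm_divide)
  ultimately have "state_le (\<lambda>n. jb n powr (s - 1 - 1)) (\<lambda>n. fourier_coeff (fst q) n - fourier_coeff (fst (field s (z t))) n)
      (\<lambda>n. fourier_coeff (snd q) n - fourier_coeff (snd (field s (z t))) n) B"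
    unfolding fourier_coeff_field[OF s zD(2)[OF t(1)]] e_def e'_def V_def by simp
  from mdist_state_space_leI[OF qm field_mspace[OF s zD(2)[OF t(1)]] this]
  show "mdist (state_space (s - 1)) ((z (t + h) - z t) /\<^sub>R h) (field s (z t)) \<le> 2 * bilinear_const s * R * \<eta>"
    by (simp add: q_def B_def)
qed

text \<open>Continuity in the top norm makes the oscillation \<eta> small near t; since the field
  loses one derivative, the time derivative exists one level lower.\<close>

lemma tame_curve_time_deriv:
  assumes s: "5/2 < s" and z: "tame_curve s T R G z" and t: "\<bar>t\<bar> < T"
  shows "has_time_deriv (state_space (s - 1)) z (field s (z t)) t"
  unfolding has_time_deriv_def limitin_mtopology_of
proof (intro conjI allI impI)
  note zD = tame_curveD[OF z]
  show "field s (z t) \<in> mspace (state_space (s - 1))" by (rule field_mspace[OF s zD(2)[OF t]])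
  fix \<epsilon> :: real assume \<epsilon>: "0 < \<epsilon>"
  define C where "C = 2 * bilinear_const s * R"
  define \<eta> where "\<eta> = \<epsilon> / (2 * (\<bar>C\<bar> + 1))"
  have C: "0 < \<bar>C\<bar> + 1" by simp
  have \<eta>: "0 < \<eta>" using \<epsilon> C by (simp add: \<eta>_def)
  have "C * \<eta> \<le> (\<bar>C\<bar> + 1) * \<eta>" using \<eta> by (intro mult_right_mono) auto
  also have "\<dots> = \<epsilon> / 2" using C unfolding \<eta>_def by (simp add: field_simps)
  finally have C\<eta>: "C * \<eta> < \<epsilon>" using \<epsilon> by simp
  obtain \<delta> where \<delta>: "\<delta> > 0" "\<And>\<tau>. \<bar>\<tau>\<bar> < T \<Longrightarrow> \<bar>\<tau> - t\<bar> < \<delta> \<Longrightarrow> mdist (state_space s) (z t) (z \<tau>) < \<eta>"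
  proof -
    have "t \<in> {- T<..<T}" using t by auto
    with tame_curve_C0[OF s z, unfolded C0_curve_def continuous_curve_iff] \<eta>
    obtain \<delta> where "\<delta> > 0" "\<forall>\<tau>\<in>{- T<..<T}. \<bar>\<tau> - t\<bar> < \<delta> \<longrightarrow> mdist (state_space s) (z t) (z \<tau>) < \<eta>" by meson
    then show thesis by (intro that[of \<delta>]) (auto simp: Ball_def abs_less_iff)
  qed
  define d where "d = min \<delta> (T - \<bar>t\<bar>)"
  have d: "0 < d" using \<delta> t by (simp add: d_def)
  show "\<forall>\<^sub>F h in at 0. (z (t + h) - z t) /\<^sub>R h \<in> mspace (state_space (s - 1)) \<and>
      mdist (state_space (s - 1)) ((z (t + h) - z t) /\<^sub>R h) (field s (z t)) < \<epsilon>"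
    unfolding eventually_at
  proof (intro exI[of _ d] conjI ballI impI)
    fix h :: real assume "h \<noteq> 0 \<and> dist h 0 < d"
    then have h: "h \<noteq> 0" "\<bar>h\<bar> < \<delta>" "\<bar>t + h\<bar> < T" by (auto simp: d_def)
    have "mdist (state_space s) (z \<tau>) (z t) \<le> \<eta>" if "\<bar>\<tau> - t\<bar> \<le> \<bar>h\<bar>" "\<bar>\<tau>\<bar> < T" for \<tau>
      using \<delta>(2)[of \<tau>] that h(2) by (simp add: mdist_commute)
    note q = tame_curve_difference_quotient[OF s z t h(3,1) this]
    show "(z (t + h) - z t) /\<^sub>R h \<in> mspace (state_space (s - 1))" by (rule q(1))
    show "mdist (state_space (s - 1)) ((z (t + h) - z t) /\<^sub>R h) (field s (z t)) < \<epsilon>"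
      using q(2) C\<eta> by (simp add: C_def)
  qed (rule d)
qed

lemma tame_curve_solution:
  assumes s: "5/2 < s" and T: "0 < T" and z: "tame_curve s T R G z"
  shows "dp2_solution s {- T<..<T} (z 0) z"
proof -
  define J where "J = {- T<..<T}"
  note zD = tame_curveD[OF z]
  have J: "\<bar>t\<bar> < T" if "t \<in> J" for t using that by (auto simp: J_def)
  have c: "\<exists>\<delta>>0. \<forall>t'\<in>J. \<bar>t' - t\<bar> < \<delta> \<longrightarrow> mdist (state_space s) (z t) (z t') < \<epsilon>" if "t \<in> J" "0 < \<epsilon>" for t \<epsilon>
    using tame_curve_C0[OF s z, unfolded C0_curve_def continuous_curve_iff] that unfolding J_def by blast
  have td: "time_deriv (state_space (s - 1)) z t = field s (z t)" if "t \<in> J" for t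
    by (rule time_deriv_eq[OF tame_curve_time_deriv[OF s z J[OF that]]])
  \<comment> \<open>The curve and its time derivative, measured one level lower, are both Lipschitz
    functions of the curve in the top norm, so one argument gives the continuity of both.\<close>
  have lip: "C0_curve J (state_space (s - 1)) w"
    if w: "\<And>t. t \<in> J \<Longrightarrow> w t \<in> mspace (state_space (s - 1))"
      "\<And>t t'. t \<in> J \<Longrightarrow> t' \<in> J \<Longrightarrow> mdist (state_space (s - 1)) (w t) (w t') \<le> C * mdist (state_space s) (z t) (z t')" for w C
    unfolding C0_curve_def continuous_curve_iff
  proof (intro conjI ballI allI impI w(1))
    fix t \<epsilon> :: real assume t: "t \<in> J" and \<epsilon>: "0 < \<epsilon>"
    have C: "0 < \<bar>C\<bar> + 1" by simp
    obtain \<delta> where \<delta>: "\<delta> > 0" "\<And>t'. t' \<in> J \<Longrightarrow> \<bar>t' - t\<bar> < \<delta> \<Longrightarrow> mdist (state_space s) (z t) (z t') < \<epsilon> / (\<bar>C\<bar> + 1)"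
      using c[OF t, of "\<epsilon> / (\<bar>C\<bar> + 1)"] \<epsilon> C by auto
    have "mdist (state_space (s - 1)) (w t) (w t') < \<epsilon>" if t': "t' \<in> J" "\<bar>t' - t\<bar> < \<delta>" for t'
    proof -
      have "mdist (state_space (s - 1)) (w t) (w t') \<le> (\<bar>C\<bar> + 1) * mdist (state_space s) (z t) (z t')"
        by (rule order_trans[OF w(2)[OF t t'(1)]]) (intro mult_right_mono; simp)
      also have "\<dots> < (\<bar>C\<bar> + 1) * (\<epsilon> / (\<bar>C\<bar> + 1))" by (intro mult_strict_left_mono \<delta>(2)[OF t'] C)
      finally show ?thesis using C by simp
    qed
    then show "\<exists>\<delta>>0. \<forall>t'\<in>J. \<bar>t' - t\<bar> < \<delta> \<longrightarrow> mdist (state_space (s - 1)) (w t) (w t') < \<epsilon>" using \<delta>(1) by blast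
  qed
  have "C0_curve J (state_space (s - 1)) z"
    by (rule lip[of z 1]) (use zD(2) J in \<open>auto intro!: state_space_subset[of _ s "s - 1"] mdist_state_space_mono simp del: mspace_state_space\<close>)
  moreover have "C0_curve J (state_space (s - 1)) (time_deriv (state_space (s - 1)) z)"
    by (rule lip[of _ "2 * bilinear_const s * R"])
      (simp_all add: td field_mspace[OF s zD(2)] field_lipschitz[OF s zD(2) zD(2) zD(4) zD(4)] J del: mspace_state_space)
  ultimately show ?thesis
    unfolding dp2_solution_iff C1_curve_def J_def[symmetric]
  proof (intro conjI ballI)
    show "z \<in> extensional J" "C0_curve J (state_space s) z" using zD(1) tame_curve_C0[OF s z] by (simp_all add: J_def)
    show "\<exists>d. has_time_deriv (state_space (s - 1)) z d t" if "t \<in> J" for t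
      by (rule exI, rule tame_curve_time_deriv[OF s z J[OF that]])
  qed (rule td refl | assumption)+
qed

section \<open>Uniqueness and continuous dependence\<close>

text \<open>Stability in the low norm asks of the two solutions only a common bound in the top norm,
  not tail bounds; it therefore applies to arbitrary solutions.\<close>

lemma dp2_solution_unique:
  assumes s: "5/2 < s" and y: "dp2_solution s {- T<..<T} z0 y" and z: "dp2_solution s {- T<..<T} z0 z"
  shows "y = z"
proof
  fix t
  have i: "y 0 = z 0" using y z by (simp add: dp2_solution_iff)
  have m: "w t \<in> mspace (state_space s)" if "dp2_solution s {- T<..<T} z0 w" "\<bar>t\<bar> < T" for w
  proof -
    have "t \<in> {- T<..<T}" using that(2) by auto
    then show ?thesis using that(1) unfolding dp2_solution_iff C0_curve_def continuous_curve_iff by blast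
  qed
  show "y t = z t"
  proof (cases "\<bar>t\<bar> < T")
    case True
    \<comment> \<open>Strictly between \<bar>t\<bar> and T: the interval contains t, and on it both
      solutions are bounded.\<close>
    define T' where "T' = (\<bar>t\<bar> + T) / 2"
    have T': "0 < T'" "T' < T" "\<bar>t\<bar> < T'" using True by (auto simp: T'_def)
    obtain R1 R2 where "coeff_solution s T' R1 (cu y) (cr y)" "coeff_solution s T' R2 (cu z) (cr z)"
      using dp2_solution_coeff[OF s y T'(1,2)] dp2_solution_coeff[OF s z T'(1,2)] by blast
    then have c: "coeff_solution s T' (max R1 R2) (cu y) (cr y)" "coeff_solution s T' (max R1 R2) (cu z) (cr z)"
      by (auto elim!: coeff_solution_mono)
    have "state_le (\<lambda>_. 1) (\<lambda>n. cu y 0 n - cu z 0 n) (\<lambda>n. cr y 0 n - cr z 0 n) 0"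
      by (rule state_leI_energy) (simp_all add: i energy_def)
    from coeff_solution_low_stability[OF s c T'(3) this]
    have "state_le (\<lambda>_. 1) (\<lambda>n. cu y t n - cu z t n) (\<lambda>n. cr y t n - cr z t n) 0" by simp
    from state_le_low_bound[OF this] have e: "cu y t n = cu z t n" "cr y t n = cr z t n" for n by auto
    have "fst (y t) = fst (z t)" using m[OF y True] m[OF z True] e by (intro sobolev_eqI[of _ s _ s]) auto
    moreover have "snd (y t) = snd (z t)" using m[OF y True] m[OF z True] e by (intro sobolev_eqI[of _ "s - 1" _ "s - 1"]) auto
    ultimately show ?thesis by (simp add: prod_eq_iff)
  next
    case False
    then have "t \<notin> {- T<..<T}" by auto
    then show ?thesis using y z unfolding dp2_solution_iff by (auto dest!: extensional_arb)
  qed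
qed

text \<open>K comes from z alone. The tail weight is at most the top weight, so a nearby curve y
  starts with a tail of at most a + d; thus one K, and one \<delta>, serves all nearby
  curves.\<close>

lemma tame_curve_stability:
  assumes s: "5/2 < s" and T: "0 < T" and z: "tame_curve s T R G z" and \<epsilon>: "0 < \<epsilon>"
  shows "\<exists>\<delta>>0. \<forall>y. tame_curve s T R G y \<longrightarrow> mdist (state_space s) (z 0) (y 0) < \<delta> \<longrightarrow>
    (\<forall>t. \<bar>t\<bar> < T \<longrightarrow> mdist (state_space s) (z t) (y t) \<le> \<epsilon>)"
proof -
  note zD = tame_curveD[OF z]
  obtain K a where K: "K \<ge> 1" "state_le (tail_weight s K) (cu z 0) (cr z 0) a" "a * G \<le> \<epsilon> / 4"
    using tame_curve_tail[OF z T, of "\<epsilon> / 4"] \<epsilon> by auto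
  \<comment> \<open>Collects the factors of the initial distance: the low part with its growth and
    its amplification by \<open>K powr (s - 1)\<close>, and the share of the distance in the tail of
    y.\<close>
  define M where "M = K powr (s - 1) * exp (low_rate s R * T) + G"
  define \<delta> where "\<delta> = \<epsilon> / (4 * (\<bar>M\<bar> + 1))"
  have M: "0 < \<bar>M\<bar> + 1" by simp
  have \<delta>: "0 < \<delta>" using \<epsilon> M by (simp add: \<delta>_def)
  have "mdist (state_space s) (z t) (y t) \<le> \<epsilon>"
    if y: "tame_curve s T R G y" and d: "mdist (state_space s) (z 0) (y 0) < \<delta>" and t: "\<bar>t\<bar> < T" for y t
  proof -
    note yD = tame_curveD[OF y]
    define d where "d = mdist (state_space s) (z 0) (y 0)"
    have T0: "\<bar>0\<bar> < T" using T by simp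
    have i: "state_le (\<lambda>n. jb n powr (s - 1)) (\<lambda>n. cu z 0 n - cu y 0 n) (\<lambda>n. cr z 0 n - cr y 0 n) d"
      unfolding d_def by (rule mdist_state_space_state_le[OF zD(2)[OF T0] yD(2)[OF T0] order_refl])
    have i1: "state_le (\<lambda>_. 1) (\<lambda>n. cu z 0 n - cu y 0 n) (\<lambda>n. cr z 0 n - cr y 0 n) d"
      by (rule state_le_mono[OF i]) (use s in \<open>auto simp: jb_powr_ge_1\<close>)
    have iK: "state_le (tail_weight s K) (\<lambda>n. cu z 0 n - cu y 0 n) (\<lambda>n. cr z 0 n - cr y 0 n) d"
      by (rule state_le_mono[OF i]) (use K(1) in \<open>auto simp: tail_weight_nonneg tail_weight_le\<close>)
    have yK: "state_le (tail_weight s K) (cu y 0) (cr y 0) (a + d)"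
      using state_le_diff[OF K(2) iK] K(1) by (simp add: tail_weight_nonneg)
    have "state_le (tail_weight s K) (\<lambda>n. cu z t n - cu y t n) (\<lambda>n. cr z t n - cr y t n) (a * G + (a + d) * G)"
      by (rule state_le_diff[OF zD(7)[OF _ K(2) t] yD(7)[OF _ yK t]]) (use K(1) in \<open>auto simp: tail_weight_nonneg\<close>)
    from state_le_low_tail[OF _ K(1) coeff_solution_low_stability[OF s zD(3) yD(3) t i1] this] s
    have "state_le (\<lambda>n. jb n powr (s - 1)) (\<lambda>n. cu z t n - cu y t n) (\<lambda>n. cr z t n - cr y t n)
       (K powr (s - 1) * (d * exp (low_rate s R * T)) + (a * G + (a + d) * G))" by simp
    from mdist_state_space_leI[OF zD(2)[OF t] yD(2)[OF t] this]
    have "mdist (state_space s) (z t) (y t) \<le> d * M + (a * G + a * G)" by (simp add: M_def algebra_simps)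
    moreover have "d * M \<le> d * (\<bar>M\<bar> + 1)" by (intro mult_left_mono) (auto simp: d_def)
    moreover have "d * (\<bar>M\<bar> + 1) \<le> \<delta> * (\<bar>M\<bar> + 1)" using that(2) by (intro mult_right_mono) (auto simp: d_def)
    moreover have "\<delta> * (\<bar>M\<bar> + 1) = \<epsilon> / 4" unfolding \<delta>_def by (rule divide_mult_cancel4[OF M])
    ultimately show ?thesis using K(3) \<epsilon> by linarith
  qed
  then show ?thesis using \<delta> by blast
qed

text \<open>For the curves this is the stability in the top norm, uniform in time. Their time
  derivatives are values of the field, which is Lipschitz into the level below on the common bound
  R.\<close>

lemma tame_curves_continuous_dependence:
  assumes s: "5/2 < s" and T: "0 < T" and U: "U \<subseteq> mspace (state_space s)"
    and tame: "\<And>z0. z0 \<in> U \<Longrightarrow> tame_curve s T R G (\<Phi> z0)" and init: "\<And>z0. z0 \<in> U \<Longrightarrow> \<Phi> z0 0 = z0"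
  shows "continuous_data_to_solution s {- T<..<T} U \<Phi>"
  unfolding continuous_data_to_solution_def
proof (intro allI impI conjI; elim conjE)
  fix K assume K: "compact K" "K \<subseteq> {- T<..<T}"
  have KT: "\<bar>t\<bar> < T" if "t \<in> K" for t
    using subsetD[OF K(2) that] by auto
  have sub: "C0_curve {- T<..<T} m w \<Longrightarrow> continuous_map (top_of_set K) (mtopology_of m) w" for m :: "(circle_fun \<times> circle_fun) metric" and w
    unfolding C0_curve_def by (rule continuous_map_from_subtopology_mono[OF _ K(2)])
  have st: "\<exists>\<delta>>0. \<forall>y\<in>U. mdist (state_space s) z y < \<delta> \<longrightarrow> (\<forall>t\<in>K. mdist (state_space s) (\<Phi> z t) (\<Phi> y t) \<le> \<epsilon>)"
    if z: "z \<in> U" and \<epsilon>: "0 < \<epsilon>" for z \<epsilon>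
  proof -
    obtain \<delta> where \<delta>: "\<delta> > 0" "\<And>y t. tame_curve s T R G y \<Longrightarrow> mdist (state_space s) (\<Phi> z 0) (y 0) < \<delta> \<Longrightarrow> \<bar>t\<bar> < T \<Longrightarrow>
        mdist (state_space s) (\<Phi> z t) (y t) \<le> \<epsilon>"
      using tame_curve_stability[OF s T tame[OF z] \<epsilon>] by blast
    then show ?thesis using tame init z KT by (intro exI[of _ \<delta>]) auto
  qed
  show "continuous_map (subtopology (mtopology_of (state_space s)) U)
      (mtopology_of (cfunspace (top_of_set K) (state_space s))) (\<lambda>z0. restrict (\<Phi> z0) K)"
    by (rule continuous_map_cfunspace_restrict[OF K(1) U sub[OF tame_curve_C0[OF s tame]] st])
  show "continuous_map (subtopology (mtopology_of (state_space s)) U)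
      (mtopology_of (cfunspace (top_of_set K) (state_space (s - 1)))) (\<lambda>z0. restrict (time_deriv (state_space (s - 1)) (\<Phi> z0)) K)"
  proof (rule continuous_map_cfunspace_restrict[OF K(1) U sub])
    show "C0_curve {- T<..<T} (state_space (s - 1)) (time_deriv (state_space (s - 1)) (\<Phi> z))" if "z \<in> U" for z
      using tame_curve_solution[OF s T tame[OF that]] by (simp add: dp2_solution_iff C1_curve_def)
    fix z and \<epsilon> :: real assume z: "z \<in> U" and \<epsilon>: "0 < \<epsilon>"
    define C where "C = 2 * bilinear_const s * R"
    have C: "0 < \<bar>C\<bar> + 1" by simp
    have "0 < \<epsilon> / (\<bar>C\<bar> + 1)" using \<epsilon> C by simp
    from st[OF z this] obtain \<delta> where \<delta>: "\<delta> > 0" "\<And>y t. y \<in> U \<Longrightarrow> mdist (state_space s) z y < \<delta> \<Longrightarrow> t \<in> K \<Longrightarrow>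
        mdist (state_space s) (\<Phi> z t) (\<Phi> y t) \<le> \<epsilon> / (\<bar>C\<bar> + 1)" by blast
    have "mdist (state_space (s - 1)) (time_deriv (state_space (s - 1)) (\<Phi> z) t) (time_deriv (state_space (s - 1)) (\<Phi> y) t) \<le> \<epsilon>"
      if y: "y \<in> U" "mdist (state_space s) z y < \<delta>" and t: "t \<in> K" for y t
    proof -
      note zD = tame_curveD[OF tame[OF z]] and yD = tame_curveD[OF tame[OF y(1)]]
      note tT = KT[OF t]
      have "mdist (state_space (s - 1)) (field s (\<Phi> z t)) (field s (\<Phi> y t)) \<le> C * mdist (state_space s) (\<Phi> z t) (\<Phi> y t)"
        unfolding C_def by (rule field_lipschitz[OF s zD(2)[OF tT] yD(2)[OF tT] zD(4)[OF tT] yD(4)[OF tT]])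
      also have "\<dots> \<le> (\<bar>C\<bar> + 1) * (\<epsilon> / (\<bar>C\<bar> + 1))" using \<delta>(2)[OF y t] C by (intro mult_mono) auto
      also have "\<dots> = \<epsilon>" using C by simp
      finally show ?thesis
        unfolding time_deriv_eq[OF tame_curve_time_deriv[OF s tame[OF z] tT]] time_deriv_eq[OF tame_curve_time_deriv[OF s tame[OF y(1)] tT]] .
    qed
    then show "\<exists>\<delta>>0. \<forall>y\<in>U. mdist (state_space s) z y < \<delta> \<longrightarrow> (\<forall>t\<in>K. mdist (state_space (s - 1))
        (time_deriv (state_space (s - 1)) (\<Phi> z) t) (time_deriv (state_space (s - 1)) (\<Phi> y) t) \<le> \<epsilon>)"
      using \<delta>(1) by blast
  qed
qed

theorem corollary4p3:
  fixes s :: real and u0 \<rho>0 :: circle_fun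
  assumes "s > 5/2" and "u0 \<in> sobolev s" and "\<rho>0 \<in> sobolev (s - 1)"
  shows "\<exists>T>0. \<exists>U \<Phi>.
    openin (mtopology_of (state_space s)) U \<and> (u0, \<rho>0) \<in> U \<and>
    (\<forall>z0\<in>U. dp2_solution s {-T<..<T} z0 (\<Phi> z0) \<and>
            (\<forall>z. dp2_solution s {-T<..<T} z0 z \<longrightarrow> z = \<Phi> z0)) \<and>
    continuous_data_to_solution s {-T<..<T} U \<Phi>"
proof -
  interpret M: Metric_space "mspace (state_space s)" "mdist (state_space s)" by (rule Metric_space_mspace_mdist)
  note s = assms(1)
  define c where "c = (u0, \<rho>0)"
  have c: "c \<in> mspace (state_space s)" using assms by (simp add: c_def)
  \<comment> \<open>All data within distance 1 of c have norm at most R / 2, so that one lifespan T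
    and one growth factor G serve the whole ball U.\<close>
  define R where "R = 2 * (mdist (state_space s) c (0, 0) + 1)"
  define T where "T = life s R"
  define G where "G = exp (tail_rate s R * T)"
  define U where "U = M.mball c 1"
  have R: "0 < R" by (simp add: R_def add_nonneg_pos)
  have T: "0 < T" using tail_rate_ge_1[OF s, of R] R by (simp add: T_def life_def)
  have U: "U \<subseteq> mspace (state_space s)" unfolding U_def by (rule M.mball_subset_mspace)
  have "\<exists>z. tame_curve s T R G z \<and> z 0 = z0" if z0: "z0 \<in> U" for z0
    unfolding T_def G_def
  proof (rule tame_curve_exists[OF s R])
    show z0m: "z0 \<in> mspace (state_space s)" using U z0 by blast
    have "mdist (state_space s) z0 (0, 0) \<le> mdist (state_space s) z0 c + mdist (state_space s) c (0, 0)"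
      by (rule M.triangle[OF z0m c zero_state(1)])
    moreover have "mdist (state_space s) z0 c < 1"
      using z0 mdist_commute[of "state_space s" z0 c] by (simp add: U_def del: mspace_state_space)
    ultimately show "mdist (state_space s) z0 (0, 0) \<le> R / 2" by (simp add: R_def)
  qed
  then obtain \<Phi> where \<Phi>: "\<And>z0. z0 \<in> U \<Longrightarrow> tame_curve s T R G (\<Phi> z0)" "\<And>z0. z0 \<in> U \<Longrightarrow> \<Phi> z0 0 = z0" by metis
  have sol: "dp2_solution s {- T<..<T} z0 (\<Phi> z0)" if "z0 \<in> U" for z0
    using tame_curve_solution[OF s T \<Phi>(1)[OF that]] \<Phi>(2)[OF that] by simp
  show ?thesis
  proof (intro exI[of _ T] exI[of _ U] exI[of _ \<Phi>] conjI ballI allI impI)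
    show "openin (mtopology_of (state_space s)) U" unfolding U_def mtopology_of_def by (rule M.openin_mball)
    show "(u0, \<rho>0) \<in> U"
      unfolding U_def c_def[symmetric] by (rule M.centre_in_mball_iff[THEN iffD2]) (use c in simp)
    show "continuous_data_to_solution s {- T<..<T} U \<Phi>"
      by (rule tame_curves_continuous_dependence[OF s T U \<Phi>])
    show "z = \<Phi> z0" if "z0 \<in> U" "dp2_solution s {- T<..<T} z0 z" for z0 z
      by (rule dp2_solution_unique[OF s that(2) sol[OF that(1)]])
  qed (rule T sol | assumption)+
qed

end
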